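(* Let $G$ be a finite abelian group, $\mathbb F$ an algebraically closed field with $\mathrm{char}(\mathbb F)\nmid|G|$, $V$ a finite dimensional $G$-module over $\mathbb F$ with structure map $\rho\colon G\to\mathrm{GL}(V)$, and $\{x_1,\dots,x_n\}$ a basis of $V^*$ with $g\cdot x_i=\chi_i(g)x_i$, $\chi_i\in\widehat G=\mathrm{Hom}(G,\mathbb F^\bullet)$; $\widehat G_V=\{\chi_1,\dots,\chi_n\}$. Let $M\subset\mathbb F[x_1,\dots,x_n]=\mathbb F[V]$ be the multiplicative monoid of monomials, $M^G\subset M$ the submonoid of $G$-invariant monomials, and $H=(\mathbb F[V]^G\setminus\{0\})_{\mathrm{red}}$. 1. Every class of $\mathcal C(\mathbb F[V]^G)$ contains a prime divisor. 2. With the monoid homomorphisms $\theta_1\colon H\to\mathcal B(\mathcal C(H))$, $w_1\colon\mathcal B(\mathcal C(H))\to\mathcal B(\mathrm{Hom}^0(\rho(G),\mathbb F^\bullet))$, $\theta_2\colon M^G\to\mathcal B(\mathcal C(M^G)^* )$, $w_2\colon\mathcal B(\mathcal C(M^G)^* )\hookrightarrow\mathcal B(\mathrm{Hom}^0(\rho(G),\mathbb F^\bullet))$, $\psi|_{M^G}\colon M^G\to\mathcal B(\widehat G_V)$ and $\nu\colon\mathcal B(\widehat G_V)\to\mathcal B(\mathrm{Hom}^0(\rho(G),\mathbb F^\bullet))$ defined in the context, where $\theta_1,\theta_2$ are transfer homomorphisms, $w_1$ is an isomorphism and $\nu$ is a transfer homomorphism onto its image, and with the inclusion $\iota\colon M^G\hookrightarrow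 H$, the diagram formed by these maps commutes, i.e. $$w_1\circ\theta_1\circ\iota=\nu\circ\psi|_{M^G}=w_2\circ\theta_2 .$$ 3. If $\widehat G_V=\widehat G$, then every class of $\mathcal C(M^G)$ contains a prime divisor.
   Context: Monoids are commutative, cancellative with unit; $\mathsf q(\cdot)$ is the quotient group, $H_{\mathrm{red}}=\{aH^\times\colon a\in H\}$, $\mathcal F(P)$ the free abelian monoid with basis $P$. A divisor theory is a homomorphism $\varphi\colon H\to\mathcal F(P)$ such that $\varphi(a)\mid\varphi(b)$ implies $a\mid b$, and each $p\in P$ equals $\gcd(\varphi(X))$ for some finite nonempty $X\subset H$. A monoid is Krull if it has a divisor theory. If $H$ is Krull and $H_{\mathrm{red}}\hookrightarrow\mathcal F(P)$ is a divisor theory (essentially unique), then $\mathcal C(H)=\mathsf q(\mathcal F(P))/\mathsf q(H_{\mathrm{red}})$ is its class group; a class contains a prime divisor if it contains some $p\in P$; $\mathcal C(H)^*\subset\mathcal C(H)$ is the set of classes containing prime divisors. For a Krull domain $R$, $\mathcal C(R)=\mathcal C(R\setminus\{0\})$. A homomorphism $\theta\colon H\to B$ is a transfer homomorphism if $B=\theta(H)B^\times$, $\theta^{-1}(B^\times)=H^\times$, and whenever $\theta(u)=bc$ there are $v,w\in H$ with $u=vw$, $\theta(v)\in bB^\times$, $\theta(w)\in cB^\times$. For a subset $A_0$ of an abelian group $A$, $\mathcal B(A_0)\subset\mathcal F(A_0)$ is the submonoid of sequences whose product (in multiplicative notation; sum in additive notation) in $A$ is the identity. In $\mathcal F(A_0)$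 write $g^{[k]}$ for the $k$-fold product of the basis element $g$ and $\boldsymbol\cdot$ for the operation; $\mathsf v_g(S)$ is the multiplicity of $g$ in $S$. Invariants: $\mathbb F[V]^G$ and relative invariants $\mathbb F[V]^{G,\mathrm{rel}}=\bigcup_\chi\{f\colon g\cdot f=\chi(g)f\ \forall g\in G\}$ (union over $\chi\in\mathrm{Hom}(\rho(G),\mathbb F^\bullet)$, weights being regarded as characters of $\rho(G)$); $D=(\mathbb F[V]^{G,\mathrm{rel}}\setminus\{0\})_{\mathrm{red}}$, $D_0=\{\gcd_D(X)\colon X\subset H\text{ finite nonempty}\}$; $M$ is regarded as a submonoid of $D$, and $M_0=M\cap D_0$. The embeddings $H\hookrightarrow D_0$ and $M^G\hookrightarrow M_0$ are divisor theories, so $\mathcal C(\mathbb F[V]^G)=\mathcal C(H)=\mathsf q(D_0)/\mathsf q(H)$ and $\mathcal C(M^G)=\mathsf q(M_0)/\mathsf q(M^G)$. A pseudoreflection is a non-identity, non-unipotent linear transformation fixing a hyperplane pointwise; $\mathrm{Hom}^0(\rho(G),\mathbb F^\bullet)$ is the group of characters of $\rho(G)$ whose kernel contains all pseudoreflections in $\rho(G)$. Sending a relative invariant to its weight induces isomorphisms $\overline w\colon\mathsf q(D_0)/\mathsf q(H)\to\mathrm{Hom}^0(\rho(G),\mathbb F^\bullet)$ and $\overline w\colon\mathsf q(M_0)/\mathsf q(M^G)\to\mathrm{Hom}^0(\rho(G),\mathbb F^\bullet)$. The characters $\chi_i$ of $G$ factor through $\rho(G)$ and are also regarded as characters of $\rho(G)$.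 Maps: $\theta_1$ (resp. $\theta_2$) factors an element in $D_0$ (resp. $M_0$) into primes of $D_0$ (resp. $M_0$) and replaces each prime $p$ by its class $[p]$. $w_1$ is the extension to product-one sequences of the isomorphism $\overline w\colon\mathcal C(H)\to\mathrm{Hom}^0(\rho(G),\mathbb F^\bullet)$; $w_2$ is the extension to product-one sequences of the restriction to $\mathcal C(M^G)^*$ of $\overline w\colon\mathcal C(M^G)\to\mathrm{Hom}^0(\rho(G),\mathbb F^\bullet)$. $\psi\colon M\to\mathcal F(\widehat G_V)$ is the homomorphism with $\psi(x_i)=\chi_i$; it maps $M^G$ into $\mathcal B(\widehat G_V)$. To define $\nu$, let $G_2=\{\chi_i\colon\chi_i=\chi_j\text{ for some distinct }i,j\in[1,n]\}$, $G_1=\widehat G_V\setminus G_2$, and for $\chi\in\widehat G_V$ put $e(\chi)=\gcd\{\mathsf v_\chi(B)\colon B\in\mathcal B(\widehat G_V)\}$; then $$\nu(B)=\prod_{\chi\in G_1}(\chi^{e(\chi)})^{[\mathsf v_\chi(B)/e(\chi)]}\ \boldsymbol\cdot\ \prod_{\chi\in G_2}\chi^{[\mathsf v_\chi(B)]} ,$$ whose image is $\mathcal B(\{\chi^{e(\chi)}\colon\chi\in G_1\}\cup G_2)$. *)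

theory Defs
  imports
    "HOL-Library.Function_Algebras"
    "HOL-Computational_Algebra.Computational_Algebra"
    "HOL-Algebra.Algebra"
begin

section \<open>Monoids, transfer homomorphisms, divisor theories, class groups\<close>

text \<open>
  Monoids are HOL-Algebra records.  All the monoids below are commutative and cancellative,
  and sequences (elements of a free abelian monoid) are finite multisets.
\<close>

definition monoid_hom :: "('a, 'c) monoid_scheme \<Rightarrow> ('b, 'd) monoid_scheme \<Rightarrow> ('a \<Rightarrow> 'b) set" where
  "monoid_hom H B = {\<theta> \<in> hom H B. \<theta> \<one>\<^bsub>H\<^esub> = \<one>\<^bsub>B\<^esub>}"

definition transfer_hom :: "('a, 'c) monoid_scheme \<Rightarrow> ('b, 'd) monoid_scheme \<Rightarrow> ('a \<Rightarrow> 'b) set" where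
  "transfer_hom H B = {\<theta> \<in> monoid_hom H B.
     carrier B = \<theta> ` carrier H <#>\<^bsub>B\<^esub> Units B \<and>
     {u \<in> carrier H. \<theta> u \<in> Units B} = Units H \<and>
     (\<forall>u \<in> carrier H. \<forall>b \<in> carrier B. \<forall>c \<in> carrier B. \<theta> u = b \<otimes>\<^bsub>B\<^esub> c \<longrightarrow>
        (\<exists>v \<in> carrier H. \<exists>w \<in> carrier H. u = v \<otimes>\<^bsub>H\<^esub> w \<and>
           \<theta> v \<in> b <#\<^bsub>B\<^esub> Units B \<and> \<theta> w \<in> c <#\<^bsub>B\<^esub> Units B))}"

definition reduced_monoid :: "('a, 'c) monoid_scheme \<Rightarrow> 'a set monoid" where
  "reduced_monoid H =
     \<lparr>carrier = (\<lambda>a. a <#\<^bsub>H\<^esub> Units H) ` carrier H, mult = (<#>\<^bsub>H\<^esub>), one = Units H\<rparr>"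

definition free_monoid :: "'a set \<Rightarrow> 'a multiset monoid" where
  "free_monoid P = \<lparr>carrier = {S. set_mset S \<subseteq> P}, mult = (+), one = {#}\<rparr>"

definition is_gcd :: "('a, 'c) monoid_scheme \<Rightarrow> 'a set \<Rightarrow> 'a \<Rightarrow> bool" where
  "is_gcd D Y d \<longleftrightarrow> d \<in> carrier D \<and> (\<forall>a \<in> Y. d divides\<^bsub>D\<^esub> a) \<and>
     (\<forall>c \<in> carrier D. (\<forall>a \<in> Y. c divides\<^bsub>D\<^esub> a) \<longrightarrow> c divides\<^bsub>D\<^esub> d)"

definition divisor_theory :: "('a, 'c) monoid_scheme \<Rightarrow> 'b set \<Rightarrow> ('a \<Rightarrow> 'b multiset) \<Rightarrow> bool" where
  "divisor_theory H P \<phi> \<longleftrightarrow> \<phi> \<in> monoid_hom H (free_monoid P) \<and>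
     (\<forall>a \<in> carrier H. \<forall>b \<in> carrier H.
        \<phi> a divides\<^bsub>free_monoid P\<^esub> \<phi> b \<longrightarrow> a divides\<^bsub>H\<^esub> b) \<and>
     (\<forall>p \<in> P. \<exists>Y. Y \<subseteq> carrier H \<and> finite Y \<and> Y \<noteq> {} \<and> is_gcd (free_monoid P) (\<phi> ` Y) {#p#})"

definition primes :: "('a, 'c) monoid_scheme \<Rightarrow> 'a set" where
  "primes D = {p \<in> carrier D. Divisibility.prime D p}"

text \<open>The factorization into primes; meaningful when \<open>D\<close> is free abelian with basis \<open>primes D\<close>.\<close>

definition factorization :: "('a, 'c) monoid_scheme \<Rightarrow> 'a \<Rightarrow> 'a multiset" where
  "factorization D a = (THE S. set_mset S \<subseteq> primes D \<and>
     finprod D (\<lambda>p. p [^]\<^bsub>D\<^esub> count S p) (set_mset S) = a)"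

text \<open>The inclusion of \<open>H\<close> into a free abelian monoid \<open>D\<close> is a divisor theory.\<close>

definition divisor_theory_embedding :: "('a, 'c) monoid_scheme \<Rightarrow> ('a, 'd) monoid_scheme \<Rightarrow> bool" where
  "divisor_theory_embedding H D \<longleftrightarrow> (\<lambda>a. a) \<in> monoid_hom H D \<and>
     factorization D \<in> iso D (free_monoid (primes D)) \<and>
     divisor_theory H (primes D) (factorization D)"

text \<open>\<open>fraction D a b\<close> is the fraction \<open>a/b\<close>, as a class of pairs.\<close>

definition fraction :: "('a, 'c) monoid_scheme \<Rightarrow> 'a \<Rightarrow> 'a \<Rightarrow> ('a \<times> 'a) set" where
  "fraction D a b = {(c, d). c \<in> carrier D \<and> d \<in> carrier D \<and> a \<otimes>\<^bsub>D\<^esub> d = c \<otimes>\<^bsub>D\<^esub> b}"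

definition quotient_group :: "('a, 'c) monoid_scheme \<Rightarrow> ('a \<times> 'a) set monoid" where
  "quotient_group D =
     \<lparr>carrier = {fraction D a b | a b. a \<in> carrier D \<and> b \<in> carrier D},
      mult = (\<lambda>A B. \<Union>(a, b) \<in> A. \<Union>(c, d) \<in> B. fraction D (a \<otimes>\<^bsub>D\<^esub> c) (b \<otimes>\<^bsub>D\<^esub> d)),
      one = fraction D \<one>\<^bsub>D\<^esub> \<one>\<^bsub>D\<^esub>\<rparr>"

text \<open>The quotient group of a submonoid \<open>H\<close> of \<open>D\<close>, as a subgroup of that of \<open>D\<close>.\<close>

definition quotient_subgroup ::
    "('a, 'c) monoid_scheme \<Rightarrow> ('a, 'd) monoid_scheme \<Rightarrow> ('a \<times> 'a) set set" where
  "quotient_subgroup D H = {fraction D a b | a b. a \<in> carrier H \<and> b \<in> carrier H}"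

definition class_group ::
    "('a, 'c) monoid_scheme \<Rightarrow> ('a, 'd) monoid_scheme \<Rightarrow> ('a \<times> 'a) set set monoid" where
  "class_group D H = quotient_group D Mod quotient_subgroup D H"

definition divisor_class ::
    "('a, 'c) monoid_scheme \<Rightarrow> ('a, 'd) monoid_scheme \<Rightarrow> 'a \<Rightarrow> ('a \<times> 'a) set set" where
  "divisor_class D H a = quotient_subgroup D H #>\<^bsub>quotient_group D\<^esub> fraction D a \<one>\<^bsub>D\<^esub>"

definition contains_prime_divisor :: "('a, 'c) monoid_scheme \<Rightarrow> ('a \<times> 'a) set set \<Rightarrow> bool" where
  "contains_prime_divisor D c \<longleftrightarrow> (\<exists>p \<in> primes D. fraction D p \<one>\<^bsub>D\<^esub> \<in> c)"

definition prime_classes ::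
    "('a, 'c) monoid_scheme \<Rightarrow> ('a, 'd) monoid_scheme \<Rightarrow> ('a \<times> 'a) set set set" where
  "prime_classes D H = {c \<in> carrier (class_group D H). contains_prime_divisor D c}"

text \<open>
  Factor an element of \<open>D\<close> into primes and replace each prime by its class.
\<close>

definition class_sequence ::
    "('a, 'c) monoid_scheme \<Rightarrow> ('a, 'd) monoid_scheme \<Rightarrow> 'a \<Rightarrow> ('a \<times> 'a) set set multiset" where
  "class_sequence D H a = image_mset (divisor_class D H) (factorization D a)"

definition block_monoid :: "('a, 'c) monoid_scheme \<Rightarrow> 'a set \<Rightarrow> 'a multiset monoid" where
  "block_monoid A A\<^sub>0 = (free_monoid A\<^sub>0)
     \<lparr>carrier := {S \<in> carrier (free_monoid A\<^sub>0).
        finprod A (\<lambda>g. g [^]\<^bsub>A\<^esub> count S g) (set_mset S) = \<one>\<^bsub>A\<^esub>}\<rparr>"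


section \<open>Characters and pseudoreflections\<close>

definition unit_group :: "'f::field monoid" where
  "unit_group = \<lparr>carrier = UNIV - {0}, mult = (*), one = 1\<rparr>"

text \<open>Characters are taken extensional, so that equality of characters is equality on \<open>A\<close>.\<close>

definition char_group :: "('a, 'c) monoid_scheme \<Rightarrow> ('a \<Rightarrow> 'f::field) monoid" where
  "char_group A =
     \<lparr>carrier = hom A unit_group \<inter> extensional (carrier A),
      mult = (\<lambda>\<chi> \<eta>. \<lambda>a \<in> carrier A. \<chi> a * \<eta> a),
      one = (\<lambda>a \<in> carrier A. 1)\<rparr>"

definition GL :: "('f::field \<Rightarrow> 'v::ab_group_add \<Rightarrow> 'v) \<Rightarrow> ('v \<Rightarrow> 'v) monoid" where
  "GL scale = \<lparr>carrier = {t. Vector_Spaces.linear scale scale t \<and> bij t}, mult = (\<circ>), one = id\<rparr>"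

definition unipotent :: "('v::ab_group_add \<Rightarrow> 'v) \<Rightarrow> bool" where
  "unipotent t \<longleftrightarrow> (\<exists>k. ((\<lambda>v. t v - v) ^^ k) = (\<lambda>v. 0))"

definition pseudoreflection ::
    "('f::field \<Rightarrow> 'v::ab_group_add \<Rightarrow> 'v) \<Rightarrow> ('v \<Rightarrow> 'v) \<Rightarrow> bool" where
  "pseudoreflection scale t \<longleftrightarrow> Vector_Spaces.linear scale scale t \<and> t \<noteq> id \<and> \<not> unipotent t \<and>
     (\<exists>W. module.subspace scale W \<and>
        vector_space.dim scale W + 1 = vector_space.dim scale UNIV \<and> (\<forall>v \<in> W. t v = v))"

text \<open>The group \<open>\<rho>(G)\<close>.\<close>

definition image_group :: "('f::field \<Rightarrow> 'v::ab_group_add \<Rightarrow> 'v) \<Rightarrow> ('g, 'm) monoid_scheme \<Rightarrow>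
    ('g \<Rightarrow> 'v \<Rightarrow> 'v) \<Rightarrow> ('v \<Rightarrow> 'v) monoid" where
  "image_group scale G \<rho> = (GL scale)\<lparr>carrier := \<rho> ` carrier G\<rparr>"

definition Hom0 :: "('f::field \<Rightarrow> 'v::ab_group_add \<Rightarrow> 'v) \<Rightarrow> ('g, 'm) monoid_scheme \<Rightarrow>
    ('g \<Rightarrow> 'v \<Rightarrow> 'v) \<Rightarrow> (('v \<Rightarrow> 'v) \<Rightarrow> 'f) monoid" where
  "Hom0 scale G \<rho> = (char_group (image_group scale G \<rho>))
     \<lparr>carrier := {\<chi> \<in> carrier (char_group (image_group scale G \<rho>)).
        \<forall>t \<in> \<rho> ` carrier G. pseudoreflection scale t \<longrightarrow> \<chi> t = 1}\<rparr>"

text \<open>A character of \<open>G\<close> that factors through \<open>\<rho>(G)\<close>, regarded as a character of \<open>\<rho>(G)\<close>.\<close>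

definition descend :: "('g, 'm) monoid_scheme \<Rightarrow> ('g \<Rightarrow> 'v \<Rightarrow> 'v) \<Rightarrow> ('g \<Rightarrow> 'f) \<Rightarrow> ('v \<Rightarrow> 'v) \<Rightarrow> 'f" where
  "descend G \<rho> \<chi> = (\<lambda>t \<in> \<rho> ` carrier G. \<chi> (inv_into (carrier G) \<rho> t))"


section \<open>Polynomials on \<open>V\<close> and their (relative) invariants\<close>

text \<open>
  Functions on \<open>V\<close> form a ring under the pointwise operations, and a vector space under
  \<open>fun_scale\<close>.  As the field is algebraically closed, hence infinite, the polynomial ring
  \<open>F[V] = F[x\<^sub>1, \<dots>, x\<^sub>n]\<close> is the ring of polynomial functions on \<open>V\<close>, that is, the algebra of functions
  generated by the dual space.
\<close>

definition fun_scale :: "'f::field \<Rightarrow> ('v \<Rightarrow> 'f) \<Rightarrow> 'v \<Rightarrow> 'f" where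
  "fun_scale c f = (\<lambda>v. c * f v)"

definition dual_space :: "('f::field \<Rightarrow> 'v::ab_group_add \<Rightarrow> 'v) \<Rightarrow> ('v \<Rightarrow> 'f) set" where
  "dual_space scale = {f. Vector_Spaces.linear scale (*) f}"

inductive_set poly_ring :: "('f::field \<Rightarrow> 'v::ab_group_add \<Rightarrow> 'v) \<Rightarrow> ('v \<Rightarrow> 'f) set"
  for scale :: "'f \<Rightarrow> 'v \<Rightarrow> 'v" where
  const: "(\<lambda>v. c) \<in> poly_ring scale"
| dual: "f \<in> dual_space scale \<Longrightarrow> f \<in> poly_ring scale"
| add: "f \<in> poly_ring scale \<Longrightarrow> h \<in> poly_ring scale \<Longrightarrow> f + h \<in> poly_ring scale"
| mult: "f \<in> poly_ring scale \<Longrightarrow> h \<in> poly_ring scale \<Longrightarrow> f * h \<in> poly_ring scale"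

definition act :: "('g, 'm) monoid_scheme \<Rightarrow> ('g \<Rightarrow> 'v \<Rightarrow> 'v) \<Rightarrow> 'g \<Rightarrow> ('v \<Rightarrow> 'f) \<Rightarrow> 'v \<Rightarrow> 'f" where
  "act G \<rho> g f = (\<lambda>v. f (\<rho> (inv\<^bsub>G\<^esub> g) v))"

definition has_weight :: "('g, 'm) monoid_scheme \<Rightarrow> ('g \<Rightarrow> 'v \<Rightarrow> 'v) \<Rightarrow> ('v \<Rightarrow> 'f::field) \<Rightarrow>
    (('v \<Rightarrow> 'v) \<Rightarrow> 'f) \<Rightarrow> bool" where
  "has_weight G \<rho> f \<chi> \<longleftrightarrow> (\<forall>g \<in> carrier G. act G \<rho> g f = fun_scale (\<chi> (\<rho> g)) f)"

definition invariants :: "('f::field \<Rightarrow> 'v::ab_group_add \<Rightarrow> 'v) \<Rightarrow> ('g, 'm) monoid_scheme \<Rightarrow>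
    ('g \<Rightarrow> 'v \<Rightarrow> 'v) \<Rightarrow> ('v \<Rightarrow> 'f) set" where
  "invariants scale G \<rho> = {f \<in> poly_ring scale. \<forall>g \<in> carrier G. act G \<rho> g f = f}"

definition relative_invariants :: "('f::field \<Rightarrow> 'v::ab_group_add \<Rightarrow> 'v) \<Rightarrow> ('g, 'm) monoid_scheme \<Rightarrow>
    ('g \<Rightarrow> 'v \<Rightarrow> 'v) \<Rightarrow> ('v \<Rightarrow> 'f) set" where
  "relative_invariants scale G \<rho> =
     (\<Union>\<chi> \<in> carrier (char_group (image_group scale G \<rho>)). {f \<in> poly_ring scale. has_weight G \<rho> f \<chi>})"

definition fun_monoid :: "('v \<Rightarrow> 'f::field) set \<Rightarrow> ('v \<Rightarrow> 'f) monoid" where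
  "fun_monoid S = \<lparr>carrier = S, mult = (*), one = 1\<rparr>"

text \<open>
  The monoids \<open>H\<close>, \<open>D\<close> and \<open>D\<^sub>0\<close>.  The units of the monoids of nonzero invariants and of nonzero
  relative invariants are in both cases the nonzero constants, so \<open>H\<close> is literally a submonoid
  of \<open>D\<close>.
\<close>

definition H_mon :: "('f::field \<Rightarrow> 'v::ab_group_add \<Rightarrow> 'v) \<Rightarrow> ('g, 'm) monoid_scheme \<Rightarrow>
    ('g \<Rightarrow> 'v \<Rightarrow> 'v) \<Rightarrow> ('v \<Rightarrow> 'f) set monoid" where
  "H_mon scale G \<rho> = reduced_monoid (fun_monoid (invariants scale G \<rho> - {0}))"

definition D_mon :: "('f::field \<Rightarrow> 'v::ab_group_add \<Rightarrow> 'v) \<Rightarrow> ('g, 'm) monoid_scheme \<Rightarrow>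
    ('g \<Rightarrow> 'v \<Rightarrow> 'v) \<Rightarrow> ('v \<Rightarrow> 'f) set monoid" where
  "D_mon scale G \<rho> = reduced_monoid (fun_monoid (relative_invariants scale G \<rho> - {0}))"

definition D0_mon :: "('f::field \<Rightarrow> 'v::ab_group_add \<Rightarrow> 'v) \<Rightarrow> ('g, 'm) monoid_scheme \<Rightarrow>
    ('g \<Rightarrow> 'v \<Rightarrow> 'v) \<Rightarrow> ('v \<Rightarrow> 'f) set monoid" where
  "D0_mon scale G \<rho> = (D_mon scale G \<rho>)
     \<lparr>carrier := {d. \<exists>Y. Y \<subseteq> carrier (H_mon scale G \<rho>) \<and> finite Y \<and> Y \<noteq> {} \<and>
        is_gcd (D_mon scale G \<rho>) Y d}\<rparr>"

text \<open>
  Monomials.  \<open>to_H\<close> is the embedding of invariant monomials into \<open>H\<close>, and \<open>to_D\<close> the one of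
  monomials into \<open>D\<close>; they agree on invariant monomials.
\<close>

definition monomial :: "nat \<Rightarrow> (nat \<Rightarrow> 'v \<Rightarrow> 'f::field) \<Rightarrow> (nat \<Rightarrow> nat) \<Rightarrow> 'v \<Rightarrow> 'f" where
  "monomial n x a = (\<Prod>i\<in>{1..n}. x i ^ a i)"

definition M_mon :: "nat \<Rightarrow> (nat \<Rightarrow> 'v \<Rightarrow> 'f::field) \<Rightarrow> ('v \<Rightarrow> 'f) monoid" where
  "M_mon n x = fun_monoid (range (monomial n x))"

definition MG_mon :: "('f::field \<Rightarrow> 'v::ab_group_add \<Rightarrow> 'v) \<Rightarrow> ('g, 'm) monoid_scheme \<Rightarrow>
    ('g \<Rightarrow> 'v \<Rightarrow> 'v) \<Rightarrow> nat \<Rightarrow> (nat \<Rightarrow> 'v \<Rightarrow> 'f) \<Rightarrow> ('v \<Rightarrow> 'f) monoid" where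
  "MG_mon scale G \<rho> n x = fun_monoid (carrier (M_mon n x) \<inter> invariants scale G \<rho>)"

definition to_H :: "('f::field \<Rightarrow> 'v::ab_group_add \<Rightarrow> 'v) \<Rightarrow> ('g, 'm) monoid_scheme \<Rightarrow>
    ('g \<Rightarrow> 'v \<Rightarrow> 'v) \<Rightarrow> ('v \<Rightarrow> 'f) \<Rightarrow> ('v \<Rightarrow> 'f) set" where
  "to_H scale G \<rho> m = (let R = fun_monoid (invariants scale G \<rho> - {0}) in m <#\<^bsub>R\<^esub> Units R)"

definition to_D :: "('f::field \<Rightarrow> 'v::ab_group_add \<Rightarrow> 'v) \<Rightarrow> ('g, 'm) monoid_scheme \<Rightarrow>
    ('g \<Rightarrow> 'v \<Rightarrow> 'v) \<Rightarrow> ('v \<Rightarrow> 'f) \<Rightarrow> ('v \<Rightarrow> 'f) set" where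
  "to_D scale G \<rho> m = (let R = fun_monoid (relative_invariants scale G \<rho> - {0}) in m <#\<^bsub>R\<^esub> Units R)"

definition M0_mon :: "('f::field \<Rightarrow> 'v::ab_group_add \<Rightarrow> 'v) \<Rightarrow> ('g, 'm) monoid_scheme \<Rightarrow>
    ('g \<Rightarrow> 'v \<Rightarrow> 'v) \<Rightarrow> nat \<Rightarrow> (nat \<Rightarrow> 'v \<Rightarrow> 'f) \<Rightarrow> ('v \<Rightarrow> 'f) set monoid" where
  "M0_mon scale G \<rho> n x = (D_mon scale G \<rho>)
     \<lparr>carrier := to_D scale G \<rho> ` carrier (M_mon n x) \<inter> carrier (D0_mon scale G \<rho>)\<rparr>"

text \<open>The monoid \<open>M\<^sup>G\<close>, regarded as a submonoid of \<open>D\<close>.\<close>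

definition MGD_mon :: "('f::field \<Rightarrow> 'v::ab_group_add \<Rightarrow> 'v) \<Rightarrow> ('g, 'm) monoid_scheme \<Rightarrow>
    ('g \<Rightarrow> 'v \<Rightarrow> 'v) \<Rightarrow> nat \<Rightarrow> (nat \<Rightarrow> 'v \<Rightarrow> 'f) \<Rightarrow> ('v \<Rightarrow> 'f) set monoid" where
  "MGD_mon scale G \<rho> n x = (D_mon scale G \<rho>)
     \<lparr>carrier := to_D scale G \<rho> ` carrier (MG_mon scale G \<rho> n x)\<rparr>"


section \<open>The weight isomorphism and the maps of the diagram\<close>

definition weight :: "('f::field \<Rightarrow> 'v::ab_group_add \<Rightarrow> 'v) \<Rightarrow> ('g, 'm) monoid_scheme \<Rightarrow>
    ('g \<Rightarrow> 'v \<Rightarrow> 'v) \<Rightarrow> ('v \<Rightarrow> 'f) set \<Rightarrow> ('v \<Rightarrow> 'v) \<Rightarrow> 'f" where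
  "weight scale G \<rho> d = (THE \<chi>. \<chi> \<in> carrier (char_group (image_group scale G \<rho>)) \<and>
     (\<exists>f \<in> d. has_weight G \<rho> f \<chi>))"

text \<open>
  The map induced by \<open>weight\<close> on the classes of a class group \<open>class_group E S\<close>, where \<open>E\<close> is a
  submonoid of \<open>D\<close> (below \<open>D\<^sub>0\<close> or \<open>M\<^sub>0\<close>): the class of \<open>a/b\<close> goes to the quotient of the weights.
\<close>

definition weight_class :: "('f::field \<Rightarrow> 'v::ab_group_add \<Rightarrow> 'v) \<Rightarrow> ('g, 'm) monoid_scheme \<Rightarrow>
    ('g \<Rightarrow> 'v \<Rightarrow> 'v) \<Rightarrow> ('v \<Rightarrow> 'f) set monoid \<Rightarrow>
    (('v \<Rightarrow> 'f) set \<times> ('v \<Rightarrow> 'f) set) set set \<Rightarrow> ('v \<Rightarrow> 'v) \<Rightarrow> 'f" where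
  "weight_class scale G \<rho> E c =
     (let K = char_group (image_group scale G \<rho>) in
      THE \<chi>. \<exists>a \<in> carrier E. \<exists>b \<in> carrier E. fraction E a b \<in> c \<and>
        \<chi> = weight scale G \<rho> a \<otimes>\<^bsub>K\<^esub> inv\<^bsub>K\<^esub> weight scale G \<rho> b)"

definition exponents :: "nat \<Rightarrow> (nat \<Rightarrow> 'v \<Rightarrow> 'f::field) \<Rightarrow> ('v \<Rightarrow> 'f) \<Rightarrow> nat \<Rightarrow> nat" where
  "exponents n x m = (THE a. (\<forall>i. i \<notin> {1..n} \<longrightarrow> a i = 0) \<and> m = monomial n x a)"

definition psi :: "nat \<Rightarrow> (nat \<Rightarrow> 'v \<Rightarrow> 'f::field) \<Rightarrow> (nat \<Rightarrow> 'g \<Rightarrow> 'f) \<Rightarrow> ('v \<Rightarrow> 'f) \<Rightarrow> ('g \<Rightarrow> 'f) multiset" where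
  "psi n x \<chi> m = (\<Sum>i\<in>{1..n}. replicate_mset (exponents n x m i) (\<chi> i))"

definition chars2 :: "nat \<Rightarrow> (nat \<Rightarrow> 'g \<Rightarrow> 'f) \<Rightarrow> ('g \<Rightarrow> 'f) set" where
  "chars2 n \<chi> = {\<chi> i | i. i \<in> {1..n} \<and> (\<exists>j \<in> {1..n}. j \<noteq> i \<and> \<chi> i = \<chi> j)}"

definition chars1 :: "nat \<Rightarrow> (nat \<Rightarrow> 'g \<Rightarrow> 'f) \<Rightarrow> ('g \<Rightarrow> 'f) set" where
  "chars1 n \<chi> = \<chi> ` {1..n} - chars2 n \<chi>"

definition e_index :: "('g, 'm) monoid_scheme \<Rightarrow> nat \<Rightarrow> (nat \<Rightarrow> 'g \<Rightarrow> 'f::field) \<Rightarrow> ('g \<Rightarrow> 'f) \<Rightarrow> nat" where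
  "e_index G n \<chi> \<eta> = Gcd ((\<lambda>B. count B \<eta>) ` carrier (block_monoid (char_group G) (\<chi> ` {1..n})))"

definition nu :: "('g, 'm) monoid_scheme \<Rightarrow> ('g \<Rightarrow> 'v \<Rightarrow> 'v) \<Rightarrow> nat \<Rightarrow> (nat \<Rightarrow> 'g \<Rightarrow> 'f::field) \<Rightarrow>
    ('g \<Rightarrow> 'f) multiset \<Rightarrow> (('v \<Rightarrow> 'v) \<Rightarrow> 'f) multiset" where
  "nu G \<rho> n \<chi> B =
     (\<Sum>\<eta> \<in> chars1 n \<chi>. replicate_mset (count B \<eta> div e_index G n \<chi> \<eta>)
        (descend G \<rho> (\<eta> [^]\<^bsub>char_group G\<^esub> e_index G n \<chi> \<eta>))) +
     (\<Sum>\<eta> \<in> chars2 n \<chi>. replicate_mset (count B \<eta>) (descend G \<rho> \<eta>))"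

text \<open>The set \<open>{\<chi>\<^sup>e\<^sup>(\<^sup>\<chi>\<^sup>) : \<chi> \<in> G\<^sub>1} \<union> G\<^sub>2\<close>, inside the characters of \<open>\<rho>(G)\<close>.\<close>

definition nu_support :: "('g, 'm) monoid_scheme \<Rightarrow> ('g \<Rightarrow> 'v \<Rightarrow> 'v) \<Rightarrow> nat \<Rightarrow>
    (nat \<Rightarrow> 'g \<Rightarrow> 'f::field) \<Rightarrow> (('v \<Rightarrow> 'v) \<Rightarrow> 'f) set" where
  "nu_support G \<rho> n \<chi> =
     (\<lambda>\<eta>. descend G \<rho> (\<eta> [^]\<^bsub>char_group G\<^esub> e_index G n \<chi> \<eta>)) ` chars1 n \<chi> \<union>
     descend G \<rho> ` chars2 n \<chi>"

end

theory Submission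
  imports Defs
begin

text \<open>
  The ring \<open>F[V]\<close> of polynomial functions is factorial by Gauss's lemma, so relative invariants have
  greatest common divisors, and these are again relative invariants. Let \<open>R\<^sub>i\<close> be the group of all
  \<open>g\<close> acting only on the \<open>i\<close>-th coordinate; it consists of the kernel and the pseudoreflections along
  \<open>x\<^sub>i\<close>. A relative invariant not divisible by \<open>x\<^sub>i\<close> does not vanish identically on the hyperplane
  \<open>x\<^sub>i = 0\<close>, hence has a weight that is trivial on \<open>R\<^sub>i\<close>; so all greatest common divisors of
  invariants have weight in \<open>Hom\<^sup>0\<close>. Conversely, by duality of finite abelian groups a character of
  \<open>\<rho>(G)\<close> that is trivial on \<open>R\<^sub>k\<close> is the weight of a monomial not involving \<open>x\<^sub>k\<close>. Hence a relative
  invariant \<open>f\<close> with weight in \<open>Hom\<^sup>0\<close> is the greatest common divisor of the invariants \<open>f * m\<^sub>k\<close>, with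
  \<open>m\<^sub>k\<close> a monomial of inverse weight not involving \<open>x\<^sub>k\<close>. So \<open>D\<^sub>0\<close> consists exactly of the relative
  invariants with weight in \<open>Hom\<^sup>0\<close>, up to constants. It is free because it is closed under greatest
  common divisors, and \<open>M\<^sub>0\<close> is a divisor-closed submonoid whose primes are the powers
  \<open>x\<^sub>i ^ e\<^sub>i\<close>, where \<open>e\<^sub>i\<close> is the exponent of \<open>\<chi>\<^sub>i\<close> restricted to \<open>R\<^sub>i\<close>. An explicit polynomial that is
  irreducible by Eisenstein's criterion provides a prime of each given weight.
\<close>

section \<open>Products of multisets\<close>

text \<open>Statements about classes are reduced to weights. \<open>D\<^sub>0\<close> and
  \<open>M\<^sub>0\<close> are free monoids with a weight homomorphism onto
  \<open>Hom\<^sub>0\<close>, whose kernels are \<open>H\<close> and the invariant monomials. So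
  both class groups are \<open>Hom\<^sub>0\<close>, and a class contains a prime exactly when its
  character is the weight of a prime. The three transfer homomorphisms are instances of one fact:
  relabelling the letters of a free monoid sends the words whose relabelled product is one onto a
  block monoid. For nu the letters are the characters in \<open>GV\<close>, with multiplicities
  divided by e(chi). The diagram commutes because e(chi_i), defined by multiplicities in product-one
  sequences, equals e_i, defined by pseudoreflections, and x_i^(e_i) has weight chi_i^(e_i). A
  character occurring for two coordinates has e_i = 1, which is why nu leaves G_2 unchanged. Primes
  of \<open>D\<^sub>0\<close>, such as x_i^(e_i), are in general reducible in F[V]. The prime of
  prescribed weight is nevertheless chosen irreducible in F[V], where Eisenstein's criterion
  applies. The criterion uses two coordinates; in dimension one \<open>Hom\<^sub>0\<close> is
  trivial.\<close>

definition msprod :: "('a, 'c) monoid_scheme \<Rightarrow> 'a multiset \<Rightarrow> 'a" where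
  "msprod E S = finprod E (\<lambda>p. p [^]\<^bsub>E\<^esub> count S p) (set_mset S)"

context comm_monoid
begin

lemma msprod_closed [simp, intro]: "set_mset S \<subseteq> carrier G \<Longrightarrow> msprod G S \<in> carrier G"
  unfolding msprod_def by (rule finprod_closed) auto

lemma msprod_superset:
  assumes "set_mset S \<subseteq> B" "B \<subseteq> carrier G" "finite B"
  shows "msprod G S = finprod G (\<lambda>p. p [^] count S p) B"
  unfolding msprod_def
  by (rule finprod_mono_neutral_cong_left) (use assms in \<open>auto simp: not_in_iff\<close>)

lemma msprod_empty [simp]: "msprod G {#} = \<one>"
  by (simp add: msprod_def)

lemma msprod_union:
  assumes "set_mset S \<subseteq> carrier G" "set_mset T \<subseteq> carrier G"
  shows "msprod G (S + T) = msprod G S \<otimes> msprod G T"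
proof -
  let ?B = "set_mset S \<union> set_mset T"
  have "msprod G (S + T) = finprod G (\<lambda>p. p [^] count (S + T) p) ?B"
    by (rule msprod_superset) (use assms in auto)
  also have "\<dots> = finprod G (\<lambda>p. p [^] count S p \<otimes> p [^] count T p) ?B"
    by (rule finprod_cong') (use assms in \<open>auto simp: nat_pow_mult\<close>)
  also have "\<dots> = finprod G (\<lambda>p. p [^] count S p) ?B \<otimes> finprod G (\<lambda>p. p [^] count T p) ?B"
    by (rule finprod_multf) (use assms in auto)
  also have "finprod G (\<lambda>p. p [^] count S p) ?B = msprod G S"
    by (rule msprod_superset[symmetric]) (use assms in auto)
  also have "finprod G (\<lambda>p. p [^] count T p) ?B = msprod G T"
    by (rule msprod_superset[symmetric]) (use assms in auto)
  finally show ?thesis .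
qed

lemma msprod_single [simp]: "a \<in> carrier G \<Longrightarrow> msprod G {#a#} = a"
  by (simp add: msprod_def finprod_insert[of "{}" a, simplified])

lemma msprod_add_mset:
  "a \<in> carrier G \<Longrightarrow> set_mset S \<subseteq> carrier G \<Longrightarrow> msprod G (add_mset a S) = a \<otimes> msprod G S"
  using msprod_union[of "{#a#}" S] by simp

end

lemma msprod_hom:
  assumes "comm_monoid E" "comm_monoid F" "h \<in> hom E F" "h \<one>\<^bsub>E\<^esub> = \<one>\<^bsub>F\<^esub>"
    and "set_mset S \<subseteq> carrier E"
  shows "h (msprod E S) = msprod F (image_mset h S)"
  using assms(5)
proof (induction S)
  case empty
  then show ?case
    using assms(4) by (simp add: comm_monoid.msprod_empty[OF assms(1)] comm_monoid.msprod_empty[OF assms(2)])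
next
  case (add a S)
  have *: "h a \<in> carrier F" "h ` set_mset S \<subseteq> carrier F"
    using assms(3) add.prems by (auto simp: hom_def)
  then show ?case
    using add assms(3) comm_monoid.msprod_closed[OF assms(1), of S]
    by (simp add: comm_monoid.msprod_add_mset[OF assms(1)] comm_monoid.msprod_add_mset[OF assms(2)] hom_def)
qed

lemma set_free_monoid [simp]: "carrier (free_monoid P) = {S. set_mset S \<subseteq> P}"
  "mult (free_monoid P) = (+)" "one (free_monoid P) = {#}"
  by (auto simp: free_monoid_def)

lemma divides_free_monoid:
  assumes "set_mset S \<subseteq> P" "set_mset T \<subseteq> P"
  shows "S divides\<^bsub>free_monoid P\<^esub> T \<longleftrightarrow> S \<subseteq># T"
proof
  assume "S \<subseteq># T"
  then have "T = S + (T - S)" "set_mset (T - S) \<subseteq> P"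
    using assms in_diffD by (fastforce simp: subset_mset.add_diff_inverse)+
  then show "S divides\<^bsub>free_monoid P\<^esub> T"
    unfolding factor_def by auto
qed (auto simp: factor_def)

lemma carrier_block_monoid:
  "carrier (block_monoid A P) = {S. set_mset S \<subseteq> P \<and> msprod A S = \<one>\<^bsub>A\<^esub>}"
  "mult (block_monoid A P) = (+)" "one (block_monoid A P) = {#}"
  by (auto simp: block_monoid_def msprod_def)

lemma Units_block_monoid:
  assumes "comm_monoid A" shows "Units (block_monoid A P) = {{#}}"
  using comm_monoid.msprod_empty[OF assms]
  by (auto simp: Units_def carrier_block_monoid)


section \<open>Reduced factorial monoids\<close>

text \<open>With trivial units association is equality. Hence factorizations into primes are unique
  as multisets (\<open>msprod_inj\<close>), and \<open>E\<close> is the free abelian monoid on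
  \<open>primes E\<close> (\<open>factorization_iso\<close>).\<close>

locale reduced_factorial = comm_monoid_cancel E for E (structure) +
  assumes reduced: "Units E = {\<one>}"
    and factorizable: "a \<in> carrier E \<Longrightarrow> \<exists>S. set_mset S \<subseteq> primes E \<and> msprod E S = a"
begin

lemma primesD: "p \<in> primes E \<Longrightarrow> p \<in> carrier E" "p \<in> primes E \<Longrightarrow> p \<noteq> \<one>"
  "p \<in> primes E \<Longrightarrow> Divisibility.prime E p"
  using reduced by (auto simp: primes_def elim: primeE)

lemma primes_subset: "primes E \<subseteq> carrier E"
  using primesD by auto

lemma one_factors:
  assumes "a \<otimes> b = \<one>" "a \<in> carrier E" "b \<in> carrier E" shows "a = \<one>" "b = \<one>"
proof -
  have "a \<in> Units E" "b \<in> Units E"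
    using assms by (auto simp: Units_def) (metis m_comm)+
  then show "a = \<one>" "b = \<one>" using reduced by auto
qed

lemma prime_divides_prime:
  assumes "p \<in> primes E" "q \<in> primes E" "p divides q" shows "p = q"
proof -
  obtain c where c: "c \<in> carrier E" "q = p \<otimes> c" using assms(3) by auto
  have "q divides p \<or> q divides c"
    using c primesD[OF assms(1)] primesD[OF assms(2)] by (metis divides_refl m_closed prime_divides)
  then show ?thesis
  proof
    assume "q divides p"
    then obtain d where d: "d \<in> carrier E" "p = q \<otimes> d" by auto
    have "p \<otimes> (c \<otimes> d) = (p \<otimes> c) \<otimes> d"
      using c(1) d(1) primesD(1)[OF assms(1)] by (simp add: m_assoc)
    also have "\<dots> = p" unfolding c(2)[symmetric] by (rule d(2)[symmetric])
    finally have *: "p \<otimes> (c \<otimes> d) = p" .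
    have "c \<otimes> d = \<one>"
      by (rule l_cancel[of p]) (use * c(1) d(1) primesD(1)[OF assms(1)] in simp_all)
    then have "c = \<one>" using one_factors c(1) d(1) by blast
    then show ?thesis using c(2) primesD(1)[OF assms(1)] by simp
  next
    assume "q divides c"
    then obtain d where d: "d \<in> carrier E" "c = q \<otimes> d" by auto
    have "q \<otimes> (p \<otimes> d) = p \<otimes> (q \<otimes> d)"
      using d(1) primesD(1)[OF assms(1)] primesD(1)[OF assms(2)] by (simp add: m_lcomm)
    also have "\<dots> = q" unfolding d(2)[symmetric] by (rule c(2)[symmetric])
    finally have *: "q \<otimes> (p \<otimes> d) = q" .
    note pq = primesD(1)[OF assms(1)] primesD(1)[OF assms(2)]
    have "q \<otimes> (p \<otimes> d) = q \<otimes> \<one>" unfolding r_one[OF pq(2)] by (rule *)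
    then have "p \<otimes> d = \<one>"
      by (rule l_cancel[OF _ m_closed[OF pq(1) d(1)] one_closed pq(2)])
    then have "p = \<one>" using one_factors(1) pq(1) d(1) by blast
    then show ?thesis using primesD(2)[OF assms(1)] by simp
  qed
qed

lemma prime_divides_msprod:
  assumes "p \<in> primes E" "set_mset S \<subseteq> primes E" "p divides msprod E S"
  shows "p \<in># S"
  using assms(2,3)
proof (induction S)
  case empty
  then have "p divides \<one>" by simp
  then obtain c where "c \<in> carrier E" "\<one> = p \<otimes> c" by auto
  then show ?case using one_factors(1)[of p c] primesD[OF assms(1)] by auto
next
  case (add q S)
  have "q \<in> carrier E" "set_mset S \<subseteq> carrier E"
    using add.prems primes_subset by auto
  then have "p divides q \<or> p divides msprod E S"
    using add.prems primesD[OF assms(1)]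
    by (metis msprod_add_mset msprod_closed prime_divides)
  then show ?case
    using add prime_divides_prime[OF assms(1), of q] by auto
qed

lemma msprod_inj:
  assumes "set_mset S \<subseteq> primes E" "set_mset T \<subseteq> primes E" "msprod E S = msprod E T"
  shows "S = T"
  using assms
proof (induction S arbitrary: T)
  case empty
  show ?case
  proof (rule ccontr)
    assume "{#} \<noteq> T"
    then obtain p T' where T: "T = add_mset p T'" by (metis multiset_cases)
    have "p \<in> primes E" "set_mset T' \<subseteq> carrier E" using T empty primes_subset by auto
    then have "p \<otimes> msprod E T' = \<one>" using empty(3) T
      by (simp add: msprod_add_mset primesD)
    then show False using one_factors(1) \<open>p \<in> primes E\<close> \<open>set_mset T' \<subseteq> carrier E\<close> primesD
      by (metis msprod_closed)
  qed
next
  case (add p S)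
  have p: "p \<in> primes E" "p \<in> carrier E" and S: "set_mset S \<subseteq> carrier E" "set_mset S \<subseteq> primes E"
    using add.prems primes_subset by auto
  have "p divides msprod E T"
    using add.prems(3) p S by (metis dividesI msprod_add_mset msprod_closed)
  then have "p \<in># T" using prime_divides_msprod p add.prems by auto
  then obtain T' where T: "T = add_mset p T'" by (metis mset_add)
  have T': "set_mset T' \<subseteq> carrier E" "set_mset T' \<subseteq> primes E" using T add.prems primes_subset by auto
  have "p \<otimes> msprod E S = p \<otimes> msprod E T'"
    using add.prems(3) T p S T' by (simp add: msprod_add_mset)
  then have "msprod E S = msprod E T'"
    by (rule l_cancel[OF _ msprod_closed[OF S(1)] msprod_closed[OF T'(1)] p(2)])
  then show ?case using add.IH[of T'] S T' T by auto
qed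

text \<open>Turns the definite description in \<open>factorization\<close> into a usable
  equation.\<close>

lemma factorization_msprod:
  assumes "set_mset S \<subseteq> primes E" shows "factorization E (msprod E S) = S"
proof -
  have "(\<forall>T. set_mset T \<subseteq> primes E \<and> finprod E (\<lambda>p. p [^] count T p) (set_mset T) = msprod E S \<longleftrightarrow> T = S)"
    using msprod_inj[OF _ assms] assms by (auto simp: msprod_def)
  then show ?thesis unfolding factorization_def by (auto intro: the_equality)
qed

lemma factorization:
  assumes "a \<in> carrier E"
  shows "set_mset (factorization E a) \<subseteq> primes E" "msprod E (factorization E a) = a"
  using factorizable[OF assms] factorization_msprod by auto

lemma factorization_mult:
  assumes "a \<in> carrier E" "b \<in> carrier E"
  shows "factorization E (a \<otimes> b) = factorization E a + factorization E b"
proof -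
  have "msprod E (factorization E a + factorization E b) = a \<otimes> b"
    using factorization[OF assms(1)] factorization[OF assms(2)] primes_subset
    by (subst msprod_union) auto
  then show ?thesis
    using factorization_msprod[of "factorization E a + factorization E b"]
      factorization[OF assms(1)] factorization[OF assms(2)] by auto
qed

lemma factorization_one: "factorization E \<one> = {#}"
  using factorization_msprod[of "{#}"] by simp

lemma factorization_prime: "p \<in> primes E \<Longrightarrow> factorization E p = {#p#}"
  using factorization_msprod[of "{#p#}"] primesD by simp

lemma factorization_iso: "factorization E \<in> iso E (free_monoid (primes E))"
proof (rule isoI)
  show "factorization E \<in> hom E (free_monoid (primes E))"
    by (auto simp: hom_def factorization_mult dest: factorization(1))
  show "bij_betw (factorization E) (carrier E) (carrier (free_monoid (primes E)))"
  proof (rule bij_betw_byWitness[where f' = "msprod E"])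
    show "msprod E ` carrier (free_monoid (primes E)) \<subseteq> carrier E"
      using primes_subset by (auto intro!: msprod_closed)
  qed (use factorization factorization_msprod in auto)
qed

lemma divides_iff_factorization:
  assumes "a \<in> carrier E" "b \<in> carrier E"
  shows "a divides b \<longleftrightarrow> factorization E a \<subseteq># factorization E b"
proof
  assume "factorization E a \<subseteq># factorization E b"
  then obtain T where T: "factorization E b = factorization E a + T"
    by (metis subset_mset.le_iff_add)
  then have "set_mset T \<subseteq> primes E" using factorization(1)[OF assms(2)] by auto
  then have "b = a \<otimes> msprod E T"
    using factorization[OF assms(2)] factorization[OF assms(1)] T primes_subset
    by (metis (no_types, lifting) dual_order.trans msprod_union)
  then show "a divides b" using \<open>set_mset T \<subseteq> primes E\<close> primes_subset by (auto simp: factor_def)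
qed (auto simp: factorization_mult assms elim!: dividesE)

text \<open>Every element is already a product of primes, so irreducibility suffices: one prime
  splits off, and the cofactor must be the identity. The concrete primes of \<open>D\<^sub>0\<close>
  are found this way.\<close>

lemma irreducible_in_primes:
  assumes "a \<in> carrier E" "a \<noteq> \<one>"
    and "\<And>b c. b \<in> carrier E \<Longrightarrow> c \<in> carrier E \<Longrightarrow> a = b \<otimes> c \<Longrightarrow> b = \<one> \<or> c = \<one>"
  shows "a \<in> primes E"
proof -
  have "factorization E a \<noteq> {#}"
    using assms(1,2) factorization(2) by force
  then obtain p T where T: "factorization E a = add_mset p T" by (metis multiset_cases)
  then have pT: "p \<in> primes E" "set_mset T \<subseteq> primes E" using factorization(1)[OF assms(1)] by auto
  then have "a = p \<otimes> msprod E T"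
    using factorization(2)[OF assms(1)] T primes_subset by (metis msprod_add_mset subset_trans subsetD)
  then have "msprod E T = \<one>"
    using assms(3)[of p "msprod E T"] pT primesD primes_subset by auto
  then show ?thesis using pT \<open>a = p \<otimes> msprod E T\<close> primesD by auto
qed

text \<open>By \<open>sat\<close>, \<open>H\<close> is saturated in \<open>E\<close>, which turns
  divisibility in \<open>E\<close> between elements of \<open>H\<close> into divisibility in
  \<open>H\<close>. The gcd condition is carried to the free monoid by
  \<open>divides_iff_factorization\<close>.\<close>

lemma divisor_theory_embeddingI:
  fixes H :: "('a, 'd) monoid_scheme"
  assumes sub: "carrier H \<subseteq> carrier E"
    and mult: "\<And>a b. a \<in> carrier H \<Longrightarrow> b \<in> carrier H \<Longrightarrow> a \<otimes>\<^bsub>H\<^esub> b = a \<otimes> b"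
    and one: "\<one>\<^bsub>H\<^esub> = \<one>"
    and sat: "\<And>a c. a \<in> carrier H \<Longrightarrow> c \<in> carrier E \<Longrightarrow> a \<otimes> c \<in> carrier H \<Longrightarrow> c \<in> carrier H"
    and gcds: "\<And>p. p \<in> primes E \<Longrightarrow> \<exists>Y. Y \<subseteq> carrier H \<and> finite Y \<and> Y \<noteq> {} \<and> is_gcd E Y p"
  shows "divisor_theory_embedding H E"
  unfolding divisor_theory_embedding_def divisor_theory_def
proof (intro conjI ballI impI)
  show "(\<lambda>a. a) \<in> monoid_hom H E"
    using sub mult one by (simp add: monoid_hom_def hom_def Pi_def subset_iff)
  show "factorization E \<in> iso E (free_monoid (primes E))" by (rule factorization_iso)
  show "factorization E \<in> monoid_hom H (free_monoid (primes E))"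
  proof -
    have "set_mset (factorization E a) \<subseteq> primes E" if "a \<in> carrier H" for a
      using that sub factorization(1) by blast
    moreover have "factorization E (a \<otimes>\<^bsub>H\<^esub> b) = factorization E a + factorization E b"
      if "a \<in> carrier H" "b \<in> carrier H" for a b
      using that sub mult factorization_mult by (metis subsetD)
    ultimately show ?thesis
      by (simp add: monoid_hom_def hom_def factorization_one one)
  qed
next
  fix a b assume ab: "a \<in> carrier H" "b \<in> carrier H"
    "factorization E a divides\<^bsub>free_monoid (primes E)\<^esub> factorization E b"
  then have abE: "a \<in> carrier E" "b \<in> carrier E" using sub by auto
  have "a divides b"
    using ab(3) divides_iff_factorization[OF abE] abE factorization(1)
    by (simp add: divides_free_monoid)
  then obtain c where c: "c \<in> carrier E" "b = a \<otimes> c" by (rule dividesE)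
  then have "c \<in> carrier H" using sat ab by blast
  then show "a divides\<^bsub>H\<^esub> b" using c ab mult unfolding factor_def by metis
next
  fix p assume p: "p \<in> primes E"
  then obtain Y where Y: "Y \<subseteq> carrier H" "finite Y" "Y \<noteq> {}" "is_gcd E Y p" using gcds by auto
  have YE: "Y \<subseteq> carrier E" using Y(1) sub by auto
  have "is_gcd (free_monoid (primes E)) (factorization E ` Y) {#p#}"
    unfolding is_gcd_def
  proof (intro conjI ballI impI)
    show "{#p#} \<in> carrier (free_monoid (primes E))" using p by simp
  next
    fix S assume "S \<in> factorization E ` Y"
    then obtain y where y: "y \<in> Y" "S = factorization E y" by auto
    then have "p divides y" using Y(4) by (auto simp: is_gcd_def)
    then have "{#p#} \<subseteq># S"
      using divides_iff_factorization[of p y] y YE p primesD factorization_prime by auto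
    then show "{#p#} divides\<^bsub>free_monoid (primes E)\<^esub> S"
      using y YE p factorization(1) by (subst divides_free_monoid) auto
  next
    fix S assume S: "S \<in> carrier (free_monoid (primes E))"
      "\<forall>T\<in>factorization E ` Y. S divides\<^bsub>free_monoid (primes E)\<^esub> T"
    have c: "msprod E S \<in> carrier E" using S(1) primes_subset by auto
    have "msprod E S divides y" if "y \<in> Y" for y
    proof -
      have y: "y \<in> carrier E" using that YE by auto
      have "S divides\<^bsub>free_monoid (primes E)\<^esub> factorization E y" using S(2) that by blast
      then have "S \<subseteq># factorization E y"
        using divides_free_monoid[OF _ factorization(1)[OF y], of S] S(1) by simp
      then show ?thesis
        using divides_iff_factorization[OF c y] factorization_msprod[of S] S(1) by simp
    qed
    then have "msprod E S divides p" using Y(4) c by (auto simp: is_gcd_def)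
    then have "S \<subseteq># {#p#}"
      using divides_iff_factorization[OF c, of p] S(1) p primesD factorization_msprod factorization_prime by auto
    then show "S divides\<^bsub>free_monoid (primes E)\<^esub> {#p#}"
      using S(1) p by (simp add: divides_free_monoid)
  qed
  then show "\<exists>Y. Y \<subseteq> carrier H \<and> finite Y \<and> Y \<noteq> {} \<and>
      is_gcd (free_monoid (primes E)) (factorization E ` Y) {#p#}"
    using Y by auto
qed

end

text \<open>The measure \<open>l\<close> drops strictly from an element to its proper factors, so
  splitting terminates; what cannot be split is prime by \<open>irr\<close>.\<close>

lemma reduced_factorialI:
  assumes "comm_monoid_cancel E" "Units E = {\<one>\<^bsub>E\<^esub>}"
    and size: "\<And>a b. a \<in> carrier E \<Longrightarrow> b \<in> carrier E \<Longrightarrow> a \<noteq> \<one>\<^bsub>E\<^esub> \<Longrightarrow> (l b :: nat) < l (a \<otimes>\<^bsub>E\<^esub> b)"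
    and irr: "\<And>a. a \<in> carrier E \<Longrightarrow> a \<noteq> \<one>\<^bsub>E\<^esub> \<Longrightarrow>
       (\<And>b c. b \<in> carrier E \<Longrightarrow> c \<in> carrier E \<Longrightarrow> a = b \<otimes>\<^bsub>E\<^esub> c \<Longrightarrow> b = \<one>\<^bsub>E\<^esub> \<or> c = \<one>\<^bsub>E\<^esub>) \<Longrightarrow>
       Divisibility.prime E a"
  shows "reduced_factorial E"
proof -
  interpret comm_monoid_cancel E by fact
  have "\<exists>S. set_mset S \<subseteq> primes E \<and> msprod E S = a" if "a \<in> carrier E" for a
    using that
  proof (induction "l a" arbitrary: a rule: less_induct)
    case less
    show ?case
    proof (cases "a = \<one>\<^bsub>E\<^esub>")
      case True
      then show ?thesis by (intro exI[of _ "{#}"]) auto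
    next
      case a1: False
      show ?thesis
      proof (cases "\<exists>b c. b \<in> carrier E \<and> c \<in> carrier E \<and> a = b \<otimes>\<^bsub>E\<^esub> c \<and> b \<noteq> \<one>\<^bsub>E\<^esub> \<and> c \<noteq> \<one>\<^bsub>E\<^esub>")
        case True
        then obtain b c where bc: "b \<in> carrier E" "c \<in> carrier E" "a = b \<otimes>\<^bsub>E\<^esub> c" "b \<noteq> \<one>\<^bsub>E\<^esub>" "c \<noteq> \<one>\<^bsub>E\<^esub>"
          by auto
        then have "l c < l a" "l b < l a"
          using size[of b c] size[of c b] by (auto simp: m_comm)
        then obtain S T where "set_mset S \<subseteq> primes E" "msprod E S = b" "set_mset T \<subseteq> primes E" "msprod E T = c"
          using less.hyps bc by metis
        moreover have "primes E \<subseteq> carrier E" by (auto simp: primes_def)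
        ultimately show ?thesis
          using bc by (intro exI[of _ "S + T"]) (auto simp: msprod_union subset_trans)
      next
        case False
        then have "Divisibility.prime E a" by (intro irr) (use less.prems a1 in auto)
        then show ?thesis using less.prems by (intro exI[of _ "{#a#}"]) (auto simp: primes_def)
      qed
    qed
  qed
  then show ?thesis
    by unfold_locales (use assms(2) in auto)
qed


section \<open>A transfer homomorphism onto a block monoid\<close>

text \<open>Common core of all transfer statements. Through \<open>\<phi>\<close>, \<open>H\<close>
  is identified with the words over \<open>P\<close> whose relabelling by \<open>f\<close> has
  product one. As \<open>f\<close> may identify letters, the relabelled word forgets information,
  but every splitting of it lifts.\<close>

lemma image_mset_transfer_hom:
  assumes A: "comm_group A" and f: "f \<in> P \<rightarrow> carrier A"
    and \<phi>: "\<phi> \<in> monoid_hom H (free_monoid P)" "inj_on \<phi> (carrier H)"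
    and img: "\<phi> ` carrier H = {T. set_mset T \<subseteq> P \<and> msprod A (image_mset f T) = \<one>\<^bsub>A\<^esub>}"
    and H: "\<And>a b. a \<in> carrier H \<Longrightarrow> b \<in> carrier H \<Longrightarrow> a \<otimes>\<^bsub>H\<^esub> b \<in> carrier H" "\<one>\<^bsub>H\<^esub> \<in> carrier H"
      "\<And>a. a \<in> carrier H \<Longrightarrow> \<one>\<^bsub>H\<^esub> \<otimes>\<^bsub>H\<^esub> a = a"
  shows "(\<lambda>a. image_mset f (\<phi> a)) \<in> transfer_hom H (block_monoid A (f ` P))"
proof -
  interpret A: comm_group A by fact
  have \<phi>m: "\<phi> (a \<otimes>\<^bsub>H\<^esub> b) = \<phi> a + \<phi> b" if "a \<in> carrier H" "b \<in> carrier H" for a b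
    using \<phi>(1) that by (auto simp: monoid_hom_def hom_def)
  have \<phi>1: "\<phi> \<one>\<^bsub>H\<^esub> = {#}" using \<phi>(1) by (auto simp: monoid_hom_def)
  have \<phi>P: "set_mset (\<phi> a) \<subseteq> P" "msprod A (image_mset f (\<phi> a)) = \<one>\<^bsub>A\<^esub>" if "a \<in> carrier H" for a
    using img that by auto
  have \<phi>0: "a = \<one>\<^bsub>H\<^esub>" if "a \<in> carrier H" "\<phi> a = {#}" for a
    using \<phi>(2) that \<phi>1 H(2) by (auto simp: inj_on_def)
  have UB: "Units (block_monoid A (f ` P)) = {{#}}" by (rule Units_block_monoid) unfold_locales
  have UH: "Units H = {\<one>\<^bsub>H\<^esub>}"
  proof
    show "Units H \<subseteq> {\<one>\<^bsub>H\<^esub>}"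
    proof
      fix u assume "u \<in> Units H"
      then obtain v where "u \<in> carrier H" "v \<in> carrier H" "u \<otimes>\<^bsub>H\<^esub> v = \<one>\<^bsub>H\<^esub>" by (auto simp: Units_def)
      then have "\<phi> u = {#}" using \<phi>m[of u v] \<phi>1 by auto
      then show "u \<in> {\<one>\<^bsub>H\<^esub>}" using \<phi>0 \<open>u \<in> carrier H\<close> by auto
    qed
  qed (use H in \<open>auto simp: Units_def\<close>)
  have lift: "\<exists>a\<in>carrier H. \<phi> a = T" if "set_mset T \<subseteq> P" "msprod A (image_mset f T) = \<one>\<^bsub>A\<^esub>" for T
    using img that by (metis (mono_tags, lifting) imageE mem_Collect_eq)
  have surj: "\<exists>T. set_mset T \<subseteq> P \<and> image_mset f T = S" if "set_mset S \<subseteq> f ` P" for S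
    using that
  proof (induction S)
    case (add x S)
    then obtain T p where "set_mset T \<subseteq> P" "image_mset f T = S" "p \<in> P" "x = f p" by auto
    then show ?case by (intro exI[of _ "add_mset p T"]) auto
  qed auto
  have img2: "(\<lambda>a. image_mset f (\<phi> a)) ` carrier H = carrier (block_monoid A (f ` P))"
  proof
    show "carrier (block_monoid A (f ` P)) \<subseteq> (\<lambda>a. image_mset f (\<phi> a)) ` carrier H"
    proof
      fix S assume "S \<in> carrier (block_monoid A (f ` P))"
      then obtain T where "set_mset T \<subseteq> P" "image_mset f T = S" "msprod A S = \<one>\<^bsub>A\<^esub>"
        using surj by (auto simp: carrier_block_monoid)
      then show "S \<in> (\<lambda>a. image_mset f (\<phi> a)) ` carrier H" using lift[of T] by auto
    qed
  qed (use \<phi>P in \<open>fastforce simp: carrier_block_monoid\<close>)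
  show ?thesis
    unfolding transfer_hom_def UB UH
  proof (intro CollectI conjI ballI impI)
    show "(\<lambda>a. image_mset f (\<phi> a)) \<in> monoid_hom H (block_monoid A (f ` P))"
      unfolding monoid_hom_def hom_def using \<phi>m \<phi>1 img2 by (auto simp: carrier_block_monoid(2,3))
    show "carrier (block_monoid A (f ` P)) =
        (\<lambda>a. image_mset f (\<phi> a)) ` carrier H <#>\<^bsub>block_monoid A (f ` P)\<^esub> {{#}}"
      unfolding img2 set_mult_def carrier_block_monoid(2) add_0_right UN_singleton by simp
    show "{u \<in> carrier H. image_mset f (\<phi> u) \<in> {{#}}} = {\<one>\<^bsub>H\<^esub>}"
    proof
      show "{u \<in> carrier H. image_mset f (\<phi> u) \<in> {{#}}} \<subseteq> {\<one>\<^bsub>H\<^esub>}"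
        using \<phi>0 by (simp add: subset_iff)
    qed (use \<phi>1 H(2) in simp)
  next
    fix u b c
    assume u: "u \<in> carrier H" and b: "b \<in> carrier (block_monoid A (f ` P))"
      and c: "c \<in> carrier (block_monoid A (f ` P))"
      and "image_mset f (\<phi> u) = b \<otimes>\<^bsub>block_monoid A (f ` P)\<^esub> c"
    then have eq: "image_mset f (\<phi> u) = b + c" by (simp only: carrier_block_monoid(2))
    \<comment> \<open>Each part of a splitting of the relabelled word is the image of a part of the
      word itself. These parts come from \<open>H\<close>, since \<open>b\<close> and
      \<open>c\<close> have product one.\<close>
    obtain B C where BC: "\<phi> u = B + C" "image_mset f B = b" "image_mset f C = c"
      using image_mset_eq_plusD[OF eq] by blast
    then have "set_mset B \<subseteq> P" "set_mset C \<subseteq> P" using \<phi>P(1)[OF u] by auto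
    then obtain v w where vw: "v \<in> carrier H" "w \<in> carrier H" "\<phi> v = B" "\<phi> w = C"
      using lift[of B] lift[of C] BC(2,3) b c by (auto simp: carrier_block_monoid(1))
    then have "\<phi> u = \<phi> (v \<otimes>\<^bsub>H\<^esub> w)" using \<phi>m BC by auto
    then have "u = v \<otimes>\<^bsub>H\<^esub> w" using \<phi>(2) u vw H(1) by (auto simp: inj_on_def)
    then show "\<exists>v\<in>carrier H. \<exists>w\<in>carrier H. u = v \<otimes>\<^bsub>H\<^esub> w \<and>
        image_mset f (\<phi> v) \<in> b <#\<^bsub>block_monoid A (f ` P)\<^esub> {{#}} \<and>
        image_mset f (\<phi> w) \<in> c <#\<^bsub>block_monoid A (f ` P)\<^esub> {{#}}"
      using vw BC by (intro bexI[of _ v] bexI[of _ w]) (auto simp: l_coset_def carrier_block_monoid(2))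
  qed
qed

lemma image_mset_block_iso:
  assumes A: "comm_group A" and B: "comm_group B" and f: "f \<in> iso A B"
  shows "image_mset f \<in> iso (block_monoid A (carrier A)) (block_monoid B (carrier B))"
proof (rule isoI)
  interpret A: comm_group A by fact
  interpret B: comm_group B by fact
  have bij: "bij_betw f (carrier A) (carrier B)" and hom: "f \<in> hom A B"
    using f by (auto simp: iso_def)
  have f1: "f \<one>\<^bsub>A\<^esub> = \<one>\<^bsub>B\<^esub>" using hom A.is_group B.is_group by (simp add: hom_one)
  have mp: "msprod B (image_mset f S) = f (msprod A S)" if "set_mset S \<subseteq> carrier A" for S
    using msprod_hom[OF A.comm_monoid_axioms B.comm_monoid_axioms hom f1 that] by simp
  have inj: "f a = f b \<longleftrightarrow> a = b" if "a \<in> carrier A" "b \<in> carrier A" for a b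
    using bij that by (auto simp: bij_betw_def inj_on_def)
  have sub: "f ` carrier A = carrier B" using bij by (auto simp: bij_betw_def)
  let ?g = "inv_into (carrier A) f"
  have gf: "?g (f a) = a" if "a \<in> carrier A" for a
    using bij that by (auto simp: bij_betw_def)
  have fg: "f (?g b) = b" "?g b \<in> carrier A" if "b \<in> carrier B" for b
    using sub that by (auto simp: f_inv_into_f inv_into_into)
  show "image_mset f \<in> hom (block_monoid A (carrier A)) (block_monoid B (carrier B))"
    using sub by (fastforce simp: hom_def carrier_block_monoid mp f1)
  show "bij_betw (image_mset f) (carrier (block_monoid A (carrier A))) (carrier (block_monoid B (carrier B)))"
  proof (rule bij_betw_byWitness[where f' = "image_mset ?g"])
    show "\<forall>S\<in>carrier (block_monoid A (carrier A)). image_mset ?g (image_mset f S) = S"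
      using gf by (auto simp: carrier_block_monoid image_mset.compositionality subset_iff
          intro!: multiset.map_ident_strong)
    have *: "image_mset f (image_mset ?g S) = S" if "set_mset S \<subseteq> carrier B" for S
      using fg that by (auto simp: image_mset.compositionality subset_iff
          intro!: multiset.map_ident_strong)
    then show "\<forall>S\<in>carrier (block_monoid B (carrier B)). image_mset f (image_mset ?g S) = S"
      by (auto simp: carrier_block_monoid)
    show "image_mset f ` carrier (block_monoid A (carrier A)) \<subseteq> carrier (block_monoid B (carrier B))"
      using sub by (fastforce simp: carrier_block_monoid mp f1)
    show "image_mset ?g ` carrier (block_monoid B (carrier B)) \<subseteq> carrier (block_monoid A (carrier A))"
    proof
      fix T assume "T \<in> image_mset ?g ` carrier (block_monoid B (carrier B))"
      then obtain S where S: "set_mset S \<subseteq> carrier B" "msprod B S = \<one>\<^bsub>B\<^esub>" "T = image_mset ?g S"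
        by (auto simp: carrier_block_monoid)
      have T: "set_mset T \<subseteq> carrier A" using S fg by auto
      then have "f (msprod A T) = f \<one>\<^bsub>A\<^esub>" using mp[OF T] S * f1 by auto
      then show "T \<in> carrier (block_monoid A (carrier A))"
        using T inj[of "msprod A T" "\<one>\<^bsub>A\<^esub>"] by (auto simp: carrier_block_monoid)
    qed
  qed
qed

section \<open>Class groups of kernels of surjective homomorphisms\<close>

text \<open>This is \<open>weight_class\<close> with the weight map and its target group as
  parameters, which separates the theory of class groups from polynomials.
  \<open>weight_class_eq\<close> identifies the two when all weights lie in
  \<open>Hom\<^sub>0\<close>.\<close>

definition class_map :: "('b, 'e) monoid_scheme \<Rightarrow> ('a \<Rightarrow> 'b) \<Rightarrow> ('a, 'c) monoid_scheme \<Rightarrow> ('a \<times> 'a) set set \<Rightarrow> 'b" where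
  "class_map A w E c = (THE \<chi>. \<exists>a \<in> carrier E. \<exists>b \<in> carrier E. fraction E a b \<in> c \<and>
     \<chi> = w a \<otimes>\<^bsub>A\<^esub> inv\<^bsub>A\<^esub> w b)"

context comm_monoid_cancel
begin

lemma fraction_self: "a \<in> carrier G \<Longrightarrow> b \<in> carrier G \<Longrightarrow> (a, b) \<in> fraction G a b"
  by (simp add: fraction_def)

lemma fraction_eqI:
  assumes "a \<in> carrier G" "b \<in> carrier G" "c \<in> carrier G" "d \<in> carrier G" "a \<otimes> d = c \<otimes> b"
  shows "fraction G a b = fraction G c d"
proof -
  have sub: "fraction G a b \<subseteq> fraction G c d"
    if "a \<in> carrier G" "b \<in> carrier G" "c \<in> carrier G" "d \<in> carrier G" "a \<otimes> d = c \<otimes> b" for a b c d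
  proof (clarsimp simp: fraction_def)
    fix x y assume xy: "x \<in> carrier G" "y \<in> carrier G" "a \<otimes> y = x \<otimes> b"
    have "b \<otimes> (c \<otimes> y) = (c \<otimes> b) \<otimes> y" using that(1-4) xy(1,2) by (simp add: m_ac)
    also have "\<dots> = (a \<otimes> d) \<otimes> y" by (simp only: that(5))
    also have "\<dots> = (a \<otimes> y) \<otimes> d" using that(1-4) xy(1,2) by (simp add: m_ac)
    also have "\<dots> = (x \<otimes> b) \<otimes> d" by (simp only: xy(3))
    also have "\<dots> = b \<otimes> (x \<otimes> d)" using that(1-4) xy(1,2) by (simp add: m_ac)
    finally have eq: "b \<otimes> (c \<otimes> y) = b \<otimes> (x \<otimes> d)" .
    show "c \<otimes> y = x \<otimes> d"
      by (rule l_cancel[OF eq]) (use that(1-4) xy(1,2) in simp_all)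
  qed
  show ?thesis using sub[of a b c d] sub[of c d a b] assms by auto
qed

lemma fraction_eq_iff:
  assumes "a \<in> carrier G" "b \<in> carrier G" "c \<in> carrier G" "d \<in> carrier G"
  shows "fraction G a b = fraction G c d \<longleftrightarrow> a \<otimes> d = c \<otimes> b"
  using fraction_eqI[OF assms] fraction_self[OF assms(3,4)] by (auto simp: fraction_def)

text \<open>The product in \<open>quotient_group\<close> is a union over all pairs of
  representatives; each pair gives the same fraction, so the union collapses.\<close>

lemma fraction_mult:
  assumes "a \<in> carrier G" "b \<in> carrier G" "c \<in> carrier G" "d \<in> carrier G"
  shows "fraction G a b \<otimes>\<^bsub>quotient_group G\<^esub> fraction G c d = fraction G (a \<otimes> c) (b \<otimes> d)"
proof -
  have *: "fraction G (a' \<otimes> c') (b' \<otimes> d') = fraction G (a \<otimes> c) (b \<otimes> d)"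
    if "(a', b') \<in> fraction G a b" "(c', d') \<in> fraction G c d" for a' b' c' d'
  proof -
    have h: "a' \<in> carrier G" "b' \<in> carrier G" "c' \<in> carrier G" "d' \<in> carrier G"
      "a \<otimes> b' = a' \<otimes> b" "c \<otimes> d' = c' \<otimes> d"
      using that by (auto simp: fraction_def)
    have "(a' \<otimes> c') \<otimes> (b \<otimes> d) = (a' \<otimes> b) \<otimes> (c' \<otimes> d)" using h(1-4) assms by (simp add: m_ac)
    also have "\<dots> = (a \<otimes> b') \<otimes> (c \<otimes> d')" by (simp only: h(5,6))
    also have "\<dots> = (a \<otimes> c) \<otimes> (b' \<otimes> d')" using h(1-4) assms by (simp add: m_ac)
    finally show ?thesis using h(1-4) assms by (intro fraction_eqI) auto
  qed
  have "fraction G a b \<otimes>\<^bsub>quotient_group G\<^esub> fraction G c d =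
     (\<Union>p\<in>fraction G a b. \<Union>q\<in>fraction G c d. fraction G (fst p \<otimes> fst q) (snd p \<otimes> snd q))"
    by (simp add: quotient_group_def case_prod_unfold)
  also have "\<dots> = (\<Union>p\<in>fraction G a b. \<Union>q\<in>fraction G c d. fraction G (a \<otimes> c) (b \<otimes> d))"
    using * by (intro SUP_cong refl) auto
  also have "\<dots> = fraction G (a \<otimes> c) (b \<otimes> d)"
    using fraction_self[OF assms(1,2)] fraction_self[OF assms(3,4)] by auto
  finally show ?thesis .
qed

lemma carrier_quotient_group:
  "U \<in> carrier (quotient_group G) \<longleftrightarrow> (\<exists>a b. a \<in> carrier G \<and> b \<in> carrier G \<and> U = fraction G a b)"
  by (auto simp: quotient_group_def)

lemma quotient_group_comm_group: "comm_group (quotient_group G)"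
proof (rule comm_groupI)
  let ?Q = "quotient_group G"
  have one: "\<one>\<^bsub>?Q\<^esub> = fraction G \<one> \<one>" by (simp add: quotient_group_def)
  show "\<one>\<^bsub>?Q\<^esub> \<in> carrier ?Q" unfolding one carrier_quotient_group by blast
  fix U Y Z assume "U \<in> carrier ?Q" then obtain a b where U: "a \<in> carrier G" "b \<in> carrier G" "U = fraction G a b"
    by (auto simp: carrier_quotient_group)
  show "\<one>\<^bsub>?Q\<^esub> \<otimes>\<^bsub>?Q\<^esub> U = U" using U by (simp add: one fraction_mult)
  have "fraction G b a \<otimes>\<^bsub>?Q\<^esub> U = \<one>\<^bsub>?Q\<^esub>"
    using U by (simp add: one fraction_mult fraction_eq_iff m_comm)
  then show "\<exists>Y\<in>carrier ?Q. Y \<otimes>\<^bsub>?Q\<^esub> U = \<one>\<^bsub>?Q\<^esub>"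
    using U carrier_quotient_group by blast
  assume "Y \<in> carrier ?Q" then obtain c d where Y: "c \<in> carrier G" "d \<in> carrier G" "Y = fraction G c d"
    by (auto simp: carrier_quotient_group)
  show "U \<otimes>\<^bsub>?Q\<^esub> Y \<in> carrier ?Q"
    unfolding carrier_quotient_group U(3) Y(3) fraction_mult[OF U(1,2) Y(1,2)] using U(1,2) Y(1,2) by blast
  show "U \<otimes>\<^bsub>?Q\<^esub> Y = Y \<otimes>\<^bsub>?Q\<^esub> U" using U Y by (simp add: fraction_mult m_comm)
  assume "Z \<in> carrier ?Q" then obtain e f where Z: "e \<in> carrier G" "f \<in> carrier G" "Z = fraction G e f"
    by (auto simp: carrier_quotient_group)
  show "U \<otimes>\<^bsub>?Q\<^esub> Y \<otimes>\<^bsub>?Q\<^esub> Z = U \<otimes>\<^bsub>?Q\<^esub> (Y \<otimes>\<^bsub>?Q\<^esub> Z)"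
    using U Y Z by (simp add: fraction_mult m_assoc)
qed

end

lemma iso_cong:
  assumes "comm_group G" "f \<in> iso G H" "\<And>x. x \<in> carrier G \<Longrightarrow> g x = f x"
  shows "g \<in> iso G H"
proof -
  interpret comm_group G by fact
  have "bij_betw g (carrier G) (carrier H) \<longleftrightarrow> bij_betw f (carrier G) (carrier H)"
    using assms(3) by (rule bij_betw_cong)
  then show ?thesis
    using assms(2,3) by (auto simp: iso_def hom_def)
qed

text \<open>The situation of both class groups: \<open>E\<close> will be \<open>D\<^sub>0\<close> or
  \<open>M\<^sub>0\<close>, \<open>A\<close> will be \<open>Hom\<^sub>0\<close>, and
  \<open>H\<close> is the part of trivial weight. Then q(E)/q(H) is isomorphic to \<open>A\<close>,
  so classes can be handled as weights.\<close>

locale monoid_weight = E: comm_monoid_cancel E + A: comm_group A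
  for E :: "('a, 'c) monoid_scheme" (structure) and A :: "('b, 'e) monoid_scheme" +
  fixes w :: "'a \<Rightarrow> 'b" and H :: "('a, 'd) monoid_scheme"
  assumes w_hom: "w \<in> hom E A" and w_one: "w \<one> = \<one>\<^bsub>A\<^esub>" and w_surj: "w ` carrier E = carrier A"
    and carrier_H: "carrier H = {a \<in> carrier E. w a = \<one>\<^bsub>A\<^esub>}"
begin

lemma w_closed [simp]: "a \<in> carrier E \<Longrightarrow> w a \<in> carrier A"
  using w_hom by (auto simp: hom_def)

lemma w_mult: "a \<in> carrier E \<Longrightarrow> b \<in> carrier E \<Longrightarrow> w (a \<otimes> b) = w a \<otimes>\<^bsub>A\<^esub> w b"
  using w_hom by (auto simp: hom_def)

sublocale Q: comm_group "quotient_group E" by (rule E.quotient_group_comm_group)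

definition frac_weight where
  "frac_weight U = (THE \<chi>. \<exists>a \<in> carrier E. \<exists>b \<in> carrier E. U = fraction E a b \<and> \<chi> = w a \<otimes>\<^bsub>A\<^esub> inv\<^bsub>A\<^esub> w b)"

lemma weight_quotient_eq:
  assumes "a \<in> carrier E" "b \<in> carrier E" "c \<in> carrier E" "d \<in> carrier E" "a \<otimes> d = c \<otimes> b"
  shows "w a \<otimes>\<^bsub>A\<^esub> inv\<^bsub>A\<^esub> w b = w c \<otimes>\<^bsub>A\<^esub> inv\<^bsub>A\<^esub> w d"
proof -
  have eq: "w a \<otimes>\<^bsub>A\<^esub> w d = w c \<otimes>\<^bsub>A\<^esub> w b"
    using w_mult assms by metis
  note ws = assms(1-4)[THEN w_closed]
  have "w a \<otimes>\<^bsub>A\<^esub> inv\<^bsub>A\<^esub> w b = ((w a \<otimes>\<^bsub>A\<^esub> w d) \<otimes>\<^bsub>A\<^esub> inv\<^bsub>A\<^esub> w d) \<otimes>\<^bsub>A\<^esub> inv\<^bsub>A\<^esub> w b"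
    using A.m_assoc[of "w a" "w d" "inv\<^bsub>A\<^esub> w d"] ws by simp
  also have "\<dots> = ((w c \<otimes>\<^bsub>A\<^esub> w b) \<otimes>\<^bsub>A\<^esub> inv\<^bsub>A\<^esub> w b) \<otimes>\<^bsub>A\<^esub> inv\<^bsub>A\<^esub> w d"
    unfolding eq using ws by (simp add: A.m_ac)
  also have "\<dots> = w c \<otimes>\<^bsub>A\<^esub> inv\<^bsub>A\<^esub> w d"
    using A.m_assoc[of "w c" "w b" "inv\<^bsub>A\<^esub> w b"] ws by simp
  finally show ?thesis .
qed

lemma frac_weight:
  assumes "a \<in> carrier E" "b \<in> carrier E"
  shows "frac_weight (fraction E a b) = w a \<otimes>\<^bsub>A\<^esub> inv\<^bsub>A\<^esub> w b"
  unfolding frac_weight_def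
proof (rule the_equality)
  fix \<chi> assume "\<exists>c\<in>carrier E. \<exists>d\<in>carrier E. fraction E a b = fraction E c d \<and> \<chi> = w c \<otimes>\<^bsub>A\<^esub> inv\<^bsub>A\<^esub> w d"
  then show "\<chi> = w a \<otimes>\<^bsub>A\<^esub> inv\<^bsub>A\<^esub> w b"
    using weight_quotient_eq assms E.fraction_eq_iff by metis
qed (use assms in auto)

lemma frac_weight_hom: "frac_weight \<in> hom (quotient_group E) A"
proof (rule homI)
  fix U Y assume "U \<in> carrier (quotient_group E)" "Y \<in> carrier (quotient_group E)"
  then obtain a b c d where *: "a \<in> carrier E" "b \<in> carrier E" "U = fraction E a b"
    "c \<in> carrier E" "d \<in> carrier E" "Y = fraction E c d"
    by (auto simp: E.carrier_quotient_group)
  show "frac_weight U \<in> carrier A" using * by (simp add: frac_weight)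
  show "frac_weight (U \<otimes>\<^bsub>quotient_group E\<^esub> Y) = frac_weight U \<otimes>\<^bsub>A\<^esub> frac_weight Y"
    using * by (simp add: E.fraction_mult frac_weight w_mult A.inv_mult A.m_ac)
qed

lemma frac_weight_group_hom: "group_hom (quotient_group E) A frac_weight"
  unfolding group_hom_def group_hom_axioms_def
  using frac_weight_hom Q.is_group A.is_group by blast

lemma frac_weight_surj: "frac_weight ` carrier (quotient_group E) = carrier A"
proof
  show "carrier A \<subseteq> frac_weight ` carrier (quotient_group E)"
  proof
    fix \<chi> assume "\<chi> \<in> carrier A"
    then have "\<chi> \<in> w ` carrier E" by (simp only: w_surj)
    then obtain a where "a \<in> carrier E" "w a = \<chi>" by (elim imageE) simp
    then have "frac_weight (fraction E a \<one>) = \<chi>" "fraction E a \<one> \<in> carrier (quotient_group E)"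
      by (auto simp: frac_weight w_one E.carrier_quotient_group)
    then show "\<chi> \<in> frac_weight ` carrier (quotient_group E)" by blast
  qed
qed (use frac_weight_hom in \<open>auto simp: hom_def\<close>)

lemma quotient_subgroup_kernel: "quotient_subgroup E H = kernel (quotient_group E) A frac_weight"
proof
  show "quotient_subgroup E H \<subseteq> kernel (quotient_group E) A frac_weight"
    by (auto simp: quotient_subgroup_def kernel_def carrier_H frac_weight E.carrier_quotient_group)
  show "kernel (quotient_group E) A frac_weight \<subseteq> quotient_subgroup E H"
  proof
    fix U assume "U \<in> kernel (quotient_group E) A frac_weight"
    then obtain a b where ab: "a \<in> carrier E" "b \<in> carrier E" "U = fraction E a b" "frac_weight U = \<one>\<^bsub>A\<^esub>"
      by (auto simp: kernel_def E.carrier_quotient_group)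
    \<comment> \<open>Surjectivity of \<open>w\<close> provides \<open>c\<close> of weight inverse
      to that of \<open>b\<close>. Expanding the fraction by \<open>c\<close> puts numerator and
      denominator into \<open>H\<close>.\<close>
    have "inv\<^bsub>A\<^esub> w b \<in> w ` carrier E" using ab(2) by (simp only: w_surj A.inv_closed w_closed)
    then obtain c where c: "c \<in> carrier E" "w c = inv\<^bsub>A\<^esub> w b" by (elim imageE) simp
    have "U = fraction E (a \<otimes> c) (b \<otimes> c)"
      using ab c by (simp add: E.fraction_eq_iff E.m_ac)
    moreover have "a \<otimes> c \<in> carrier H" "b \<otimes> c \<in> carrier H"
      using ab c by (simp_all add: carrier_H w_mult frac_weight)
    ultimately show "U \<in> quotient_subgroup E H" by (auto simp: quotient_subgroup_def)
  qed
qed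

lemma class_group_eq: "class_group E H = quotient_group E Mod kernel (quotient_group E) A frac_weight"
  by (simp add: class_group_def quotient_subgroup_kernel)

lemma comm_group_class_group: "comm_group (class_group E H)"
  unfolding class_group_eq
  by (rule Q.abelian_FactGroup) (rule normal_imp_subgroup[OF group_hom.normal_kernel[OF frac_weight_group_hom]])

lemma class_group_carrier_cosets:
  assumes "c \<in> carrier (class_group E H)"
  obtains U where "U \<in> carrier (quotient_group E)"
    "c = kernel (quotient_group E) A frac_weight #>\<^bsub>quotient_group E\<^esub> U"
  using assms by (auto simp: class_group_eq FactGroup_def RCOSETS_def)

lemma frac_weight_mult_inv:
  assumes "U \<in> carrier (quotient_group E)" "V \<in> carrier (quotient_group E)"
  shows "frac_weight (V \<otimes>\<^bsub>quotient_group E\<^esub> inv\<^bsub>quotient_group E\<^esub> U) = frac_weight V \<otimes>\<^bsub>A\<^esub> inv\<^bsub>A\<^esub> frac_weight U"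
    "frac_weight (V \<otimes>\<^bsub>quotient_group E\<^esub> U) = frac_weight V \<otimes>\<^bsub>A\<^esub> frac_weight U" "frac_weight U \<in> carrier A"
  using group_hom.hom_mult[OF frac_weight_group_hom] group_hom.hom_inv[OF frac_weight_group_hom]
    group_hom.hom_closed[OF frac_weight_group_hom] assms by auto

lemma coset_elem:
  assumes "U \<in> carrier (quotient_group E)"
  shows "Y \<in> kernel (quotient_group E) A frac_weight #>\<^bsub>quotient_group E\<^esub> U \<longleftrightarrow>
     Y \<in> carrier (quotient_group E) \<and> frac_weight Y = frac_weight U"
proof
  assume "Y \<in> carrier (quotient_group E) \<and> frac_weight Y = frac_weight U"
  then have "Y \<otimes>\<^bsub>quotient_group E\<^esub> inv\<^bsub>quotient_group E\<^esub> U \<in> kernel (quotient_group E) A frac_weight"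
    "Y = (Y \<otimes>\<^bsub>quotient_group E\<^esub> inv\<^bsub>quotient_group E\<^esub> U) \<otimes>\<^bsub>quotient_group E\<^esub> U"
    using assms frac_weight_mult_inv(1)[of U Y] frac_weight_mult_inv(3)[of U]
    by (auto simp: kernel_def Q.m_assoc simp del: Q.inv_closed)
  then show "Y \<in> kernel (quotient_group E) A frac_weight #>\<^bsub>quotient_group E\<^esub> U"
    by (auto simp: r_coset_def)
qed (use assms in \<open>auto simp: r_coset_def kernel_def frac_weight_mult_inv\<close>)

lemma class_map_coset:
  assumes "U \<in> carrier (quotient_group E)"
  shows "class_map A w E (kernel (quotient_group E) A frac_weight #>\<^bsub>quotient_group E\<^esub> U) = frac_weight U"
proof -
  obtain a b where ab: "a \<in> carrier E" "b \<in> carrier E" "U = fraction E a b"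
    using assms by (auto simp: E.carrier_quotient_group)
  show ?thesis
    unfolding class_map_def coset_elem[OF assms]
  proof (rule the_equality)
    show "\<exists>a\<in>carrier E. \<exists>b\<in>carrier E.
       (fraction E a b \<in> carrier (quotient_group E) \<and> frac_weight (fraction E a b) = frac_weight U) \<and>
       frac_weight U = w a \<otimes>\<^bsub>A\<^esub> inv\<^bsub>A\<^esub> w b"
      using ab assms frac_weight by blast
  qed (use frac_weight in fastforce)
qed

text \<open>First isomorphism theorem for \<open>frac_weight\<close>, whose kernel is q(H); on a
  coset \<open>class_map\<close> picks the common weight of its elements.\<close>

lemma class_map_iso: "class_map A w E \<in> iso (class_group E H) A"
proof -
  let ?K = "kernel (quotient_group E) A frac_weight"
  have "(\<lambda>U. the_elem (frac_weight ` U)) \<in> iso (class_group E H) A"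
    unfolding class_group_eq by (rule group_hom.FactGroup_iso_set[OF frac_weight_group_hom frac_weight_surj])
  moreover have "class_map A w E c = the_elem (frac_weight ` c)" if c: "c \<in> carrier (class_group E H)" for c
  proof -
    obtain U where U: "U \<in> carrier (quotient_group E)" "c = ?K #>\<^bsub>quotient_group E\<^esub> U"
      by (rule class_group_carrier_cosets[OF c])
    have "frac_weight ` c = {frac_weight U}"
      using coset_elem[OF U(1)] U by blast
    then show ?thesis using class_map_coset U by simp
  qed
  ultimately show ?thesis
    using iso_cong[OF comm_group_class_group] by blast
qed

lemma divisor_class:
  assumes "a \<in> carrier E"
  shows "divisor_class E H a \<in> carrier (class_group E H)" "class_map A w E (divisor_class E H a) = w a"
proof -
  have f: "fraction E a \<one> \<in> carrier (quotient_group E)"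
    using assms by (auto simp: E.carrier_quotient_group)
  show "divisor_class E H a \<in> carrier (class_group E H)"
    using f by (auto simp: divisor_class_def class_group_eq quotient_subgroup_kernel FactGroup_def RCOSETS_def)
  show "class_map A w E (divisor_class E H a) = w a"
    using class_map_coset[OF f] assms by (simp add: divisor_class_def quotient_subgroup_kernel frac_weight w_one)
qed

lemma contains_prime_divisor_iff:
  assumes "c \<in> carrier (class_group E H)"
  shows "contains_prime_divisor E c \<longleftrightarrow> (\<exists>p\<in>primes E. w p = class_map A w E c)"
proof -
  obtain U where U: "U \<in> carrier (quotient_group E)"
    "c = kernel (quotient_group E) A frac_weight #>\<^bsub>quotient_group E\<^esub> U"
    by (rule class_group_carrier_cosets[OF assms])
  have "fraction E p \<one> \<in> c \<longleftrightarrow> w p = class_map A w E c" if "p \<in> primes E" for p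
  proof -
    have "p \<in> carrier E" using that by (simp add: primes_def)
    then show ?thesis
      using U coset_elem[OF U(1), of "fraction E p \<one>"] class_map_coset[OF U(1)]
      by (auto simp: frac_weight w_one E.carrier_quotient_group)
  qed
  then show ?thesis by (auto simp: contains_prime_divisor_def)
qed

text \<open>A class is determined by its weight, so it contains the prime \<open>p\<close> exactly
  when it is the class of \<open>p\<close>.\<close>

lemma prime_classes_eq: "prime_classes E H = divisor_class E H ` primes E"
proof -
  have inj: "inj_on (class_map A w E) (carrier (class_group E H))"
    using class_map_iso by (auto simp: iso_def bij_betw_def)
  have "p \<in> carrier E" if "p \<in> primes E" for p using that by (simp add: primes_def)
  then have "c \<in> prime_classes E H \<longleftrightarrow> c \<in> divisor_class E H ` primes E" for c
    using divisor_class contains_prime_divisor_iff[of c] inj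
    unfolding prime_classes_def inj_on_def by (smt (verit) image_iff mem_Collect_eq)
  then show ?thesis by blast
qed

text \<open>Both sides say that the weight of the product is trivial. This connects product-one
  sequences of classes with elements of \<open>H\<close>.\<close>

lemma divisor_class_msprod:
  assumes "set_mset S \<subseteq> carrier E"
  shows "msprod (class_group E H) (image_mset (divisor_class E H) S) = \<one>\<^bsub>class_group E H\<^esub> \<longleftrightarrow> msprod E S \<in> carrier H"
proof -
  let ?C = "class_group E H"
  interpret C: comm_group ?C by (rule comm_group_class_group)
  have cm: "class_map A w E \<in> hom ?C A" "inj_on (class_map A w E) (carrier ?C)"
    using class_map_iso by (auto simp: iso_def bij_betw_def)
  have cm1: "class_map A w E \<one>\<^bsub>?C\<^esub> = \<one>\<^bsub>A\<^esub>"
    using cm C.is_group A.is_group by (simp add: hom_one)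
  have sub: "set_mset (image_mset (divisor_class E H) S) \<subseteq> carrier ?C"
    using assms divisor_class by auto
  have "class_map A w E (msprod ?C (image_mset (divisor_class E H) S)) =
      msprod A (image_mset (class_map A w E) (image_mset (divisor_class E H) S))"
    by (rule msprod_hom[OF C.comm_monoid_axioms A.comm_monoid_axioms cm(1) cm1 sub])
  also have "image_mset (class_map A w E) (image_mset (divisor_class E H) S) = image_mset w S"
    using assms divisor_class by (auto simp: image_mset.compositionality subset_iff intro!: image_mset_cong)
  also have "msprod A (image_mset w S) = w (msprod E S)"
    by (rule msprod_hom[OF E.comm_monoid_axioms A.comm_monoid_axioms w_hom w_one assms, symmetric])
  finally have *: "class_map A w E (msprod ?C (image_mset (divisor_class E H) S)) = w (msprod E S)" .
  have "msprod ?C (image_mset (divisor_class E H) S) = \<one>\<^bsub>?C\<^esub> \<longleftrightarrow> w (msprod E S) = \<one>\<^bsub>A\<^esub>"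
    using inj_on_eq_iff[OF cm(2) C.msprod_closed[OF sub] C.one_closed] unfolding * cm1 by simp
  then show ?thesis
    using E.msprod_closed[OF assms] by (simp add: carrier_H)
qed

end

locale factorial_weight = reduced_factorial E + monoid_weight E A w H
  for E :: "('a, 'c) monoid_scheme" (structure) and A :: "('b, 'e) monoid_scheme" and w and H :: "('a, 'd) monoid_scheme" +
  assumes mult_H: "\<And>a b. a \<in> carrier H \<Longrightarrow> b \<in> carrier H \<Longrightarrow> a \<otimes>\<^bsub>H\<^esub> b = a \<otimes> b"
    and one_H: "\<one>\<^bsub>H\<^esub> = \<one>"
begin

text \<open>Supplies the hypothesis \<open>img\<close> of \<open>image_mset_transfer_hom\<close>,
  with \<open>divisor_class E H\<close> as the relabelling of primes.\<close>

lemma factorization_image: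
  "factorization E ` carrier H = {T. set_mset T \<subseteq> primes E \<and>
     msprod (class_group E H) (image_mset (divisor_class E H) T) = \<one>\<^bsub>class_group E H\<^esub>}" (is "_ = ?R")
proof
  have HE: "a \<in> carrier E" if "a \<in> carrier H" for a using that by (simp add: carrier_H)
  show "factorization E ` carrier H \<subseteq> ?R"
  proof
    fix T assume "T \<in> factorization E ` carrier H"
    then obtain a where a: "a \<in> carrier H" "T = factorization E a" by auto
    then have "set_mset T \<subseteq> primes E" "msprod E T = a" using factorization[OF HE] by auto
    then show "T \<in> ?R" using divisor_class_msprod[of T] a primes_subset by auto
  qed
  show "?R \<subseteq> factorization E ` carrier H"
  proof
    fix T assume T: "T \<in> ?R"
    then have "msprod E T \<in> carrier H" using divisor_class_msprod[of T] primes_subset by auto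
    then show "T \<in> factorization E ` carrier H" using T factorization_msprod[of T] by (metis (no_types, lifting) imageI mem_Collect_eq)
  qed
qed

lemma class_sequence_transfer:
  "class_sequence E H \<in> transfer_hom H (block_monoid (class_group E H) (prime_classes E H))"
proof -
  have one: "\<one> \<in> carrier H" by (simp add: carrier_H w_one)
  have mult: "a \<otimes> b \<in> carrier H" if "a \<in> carrier H" "b \<in> carrier H" for a b
    using that by (simp add: carrier_H w_mult)
  have HE: "a \<in> carrier E" if "a \<in> carrier H" for a using that by (simp add: carrier_H)
  have "(\<lambda>a. image_mset (divisor_class E H) (factorization E a)) \<in>
    transfer_hom H (block_monoid (class_group E H) (divisor_class E H ` primes E))"
  proof (rule image_mset_transfer_hom[OF comm_group_class_group])
    show "divisor_class E H \<in> primes E \<rightarrow> carrier (class_group E H)"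
      using divisor_class(1) primesD(1) by auto
    show "factorization E \<in> monoid_hom H (free_monoid (primes E))"
      using HE factorization(1)
      by (auto simp: monoid_hom_def hom_def factorization_one one_H mult_H factorization_mult)
    show "inj_on (factorization E) (carrier H)"
      using HE factorization(2) by (metis inj_onI)
  qed (rule factorization_image, use one mult HE in \<open>simp_all add: mult_H one_H\<close>)
  then show ?thesis by (simp add: prime_classes_eq class_sequence_def[abs_def])
qed

end

hide_const (open) up_ring.coeff up_ring.monom Polynomials.degree Module.smult

section \<open>Unique factorization in polynomial rings over subrings\<close>

text \<open>Divisibility is taken inside a subset \<open>R\<close> because the rings of interest sit
  in the ring of all functions on \<open>V\<close>, which is not a domain and has more
  units.\<close>

definition rdvd :: "'a::comm_ring_1 set \<Rightarrow> 'a \<Rightarrow> 'a \<Rightarrow> bool" where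
  "rdvd R a b \<longleftrightarrow> (\<exists>c\<in>R. b = a * c)"

definition rprime :: "'a::comm_ring_1 set \<Rightarrow> 'a \<Rightarrow> bool" where
  "rprime R p \<longleftrightarrow> p \<in> R \<and> p \<noteq> 0 \<and> \<not> rdvd R p 1 \<and>
     (\<forall>a\<in>R. \<forall>b\<in>R. rdvd R p (a * b) \<longrightarrow> rdvd R p a \<or> rdvd R p b)"

definition prime_prod :: "'a::comm_ring_1 set \<Rightarrow> 'a \<Rightarrow> 'a list \<Rightarrow> 'a \<Rightarrow> bool" where
  "prime_prod R u ps a \<longleftrightarrow> u \<in> R \<and> rdvd R u 1 \<and> (\<forall>p\<in>set ps. rprime R p) \<and> a = u * prod_list ps"

abbreviation lcoeff :: "'a::zero poly \<Rightarrow> 'a" where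
  "lcoeff p \<equiv> coeff p (degree p)"

locale subdomain =
  fixes R :: "'a::comm_ring_1 set"
  assumes zero_in: "0 \<in> R" and one_in: "1 \<in> R" and add_in: "a \<in> R \<Longrightarrow> b \<in> R \<Longrightarrow> a + b \<in> R"
    and uminus_in: "a \<in> R \<Longrightarrow> - a \<in> R"
    and mult_in: "a \<in> R \<Longrightarrow> b \<in> R \<Longrightarrow> a * b \<in> R"
    and no_zero_div: "a \<in> R \<Longrightarrow> b \<in> R \<Longrightarrow> a * b = 0 \<Longrightarrow> a = 0 \<or> b = 0"

locale ufd = subdomain +
  assumes prime_prod_ex: "a \<in> R \<Longrightarrow> a \<noteq> 0 \<Longrightarrow> \<exists>u ps. prime_prod R u ps a"

context subdomain
begin

lemma diff_in: "a \<in> R \<Longrightarrow> b \<in> R \<Longrightarrow> a - b \<in> R"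
  using add_in[of a "- b"] uminus_in by simp

lemma sum_in: "(\<And>i. i \<in> I \<Longrightarrow> f i \<in> R) \<Longrightarrow> sum f I \<in> R"
  by (induction I rule: infinite_finite_induct) (auto simp: zero_in add_in)

lemma prod_in: "(\<And>i. i \<in> I \<Longrightarrow> f i \<in> R) \<Longrightarrow> prod f I \<in> R"
  by (induction I rule: infinite_finite_induct) (auto simp: one_in mult_in)

lemma power_in: "a \<in> R \<Longrightarrow> a ^ k \<in> R"
  by (induction k) (auto simp: one_in mult_in)

lemma prod_list_in: "set ps \<subseteq> R \<Longrightarrow> prod_list ps \<in> R"
  by (induction ps) (auto simp: one_in mult_in)

lemma cancel_left:
  assumes "a \<in> R" "b \<in> R" "c \<in> R" "a \<noteq> 0" "a * b = a * c" shows "b = c"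
proof -
  have "a * (b - c) = 0" using assms(5) by (simp add: algebra_simps)
  then show ?thesis using no_zero_div[of a "b - c"] assms diff_in by auto
qed

lemma rdvd_refl: "rdvd R a a"
  unfolding rdvd_def using one_in by force

lemma rdvd_trans: "rdvd R a b \<Longrightarrow> rdvd R b c \<Longrightarrow> rdvd R a c"
  unfolding rdvd_def using mult_in by (metis mult.assoc)

lemma rdvd_mult: "rdvd R a b \<Longrightarrow> c \<in> R \<Longrightarrow> rdvd R a (b * c)"
  unfolding rdvd_def using mult_in by (metis mult.assoc)

lemma rdvd_mult2: "rdvd R a b \<Longrightarrow> c \<in> R \<Longrightarrow> rdvd R a (c * b)"
  using rdvd_mult by (simp add: mult.commute)

lemma rdvd_mult_self: "c \<in> R \<Longrightarrow> rdvd R a (a * c)"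
  by (auto simp: rdvd_def)

lemma rdvd_add: "rdvd R a b \<Longrightarrow> rdvd R a c \<Longrightarrow> rdvd R a (b + c)"
  unfolding rdvd_def using add_in by (metis distrib_left)

lemma rdvd_diff: "rdvd R a b \<Longrightarrow> rdvd R a c \<Longrightarrow> rdvd R a (b - c)"
  unfolding rdvd_def using diff_in by (metis right_diff_distrib)

lemma rdvd_0: "rdvd R a 0"
  unfolding rdvd_def using zero_in by force

lemma rdvd_sum: "(\<And>i. i \<in> I \<Longrightarrow> rdvd R a (f i)) \<Longrightarrow> rdvd R a (sum f I)"
  by (induction I rule: infinite_finite_induct) (auto simp: rdvd_0 rdvd_add)

lemma rprimeD:
  assumes "rprime R p"
  shows "p \<in> R" "p \<noteq> 0" "\<not> rdvd R p 1"
    "a \<in> R \<Longrightarrow> b \<in> R \<Longrightarrow> rdvd R p (a * b) \<Longrightarrow> rdvd R p a \<or> rdvd R p b"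
  using assms by (auto simp: rprime_def)

lemma prime_prod_mult:
  assumes "prime_prod R u ps a" "prime_prod R v qs b"
  shows "prime_prod R (u * v) (ps @ qs) (a * b)"
proof -
  obtain u' v' where "u' \<in> R" "v' \<in> R" "1 = u * u'" "1 = v * v'"
    using assms by (auto simp: prime_prod_def rdvd_def)
  then have "rdvd R (u * v) 1"
    unfolding rdvd_def using mult_in by (intro bexI[of _ "u' * v'"]) (auto simp: mult_ac)
  then show ?thesis using assms mult_in by (auto simp: prime_prod_def mult_ac)
qed

text \<open>Primes are peeled off one at a time, each going to a factor that it divides. The
  equation for the lengths is the termination measure in \<open>primitive_part\<close> and the
  source of \<open>prime_length_less\<close>.\<close>

lemma prime_prod_split:
  assumes "prime_prod R u ps (a * b)" "a \<in> R" "b \<in> R"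
  shows "\<exists>v qs w rs. prime_prod R v qs a \<and> prime_prod R w rs b \<and> length ps = length qs + length rs"
  using assms
proof (induction ps arbitrary: a b)
  case Nil
  then obtain c where c: "c \<in> R" "a * b * c = 1" "a * b = u" by (auto simp: prime_prod_def rdvd_def)
  have "rdvd R a 1" unfolding rdvd_def
    by (rule bexI[of _ "b * c"]) (use c Nil mult_in in \<open>auto simp: mult_ac\<close>)
  moreover have "rdvd R b 1" unfolding rdvd_def
    by (rule bexI[of _ "a * c"]) (use c Nil mult_in in \<open>auto simp: mult_ac\<close>)
  ultimately have "prime_prod R a [] a" "prime_prod R b [] b" using Nil by (auto simp: prime_prod_def)
  then show ?case by force
next
  case (Cons p ps)
  have p: "rprime R p" and ps: "prod_list ps \<in> R" "u \<in> R" using Cons.prems prod_list_in[of ps] rprimeD(1)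
    by (auto simp: prime_prod_def)
  have eq: "a * b = p * (u * prod_list ps)" using Cons.prems by (simp add: prime_prod_def mult_ac)
  have *: "\<exists>v qs w rs. prime_prod R v qs a \<and> prime_prod R w rs b \<and> length (p # ps) = length qs + length rs"
    if ab: "a \<in> R" "b \<in> R" and eq: "a * b = p * (u * prod_list ps)" and pa: "rdvd R p a" for a b
  proof -
    obtain a' where a': "a' \<in> R" "a = p * a'" using pa by (auto simp: rdvd_def)
    then have "p * (a' * b) = p * (u * prod_list ps)" using eq by (simp add: mult_ac)
    then have "a' * b = u * prod_list ps"
      by (rule cancel_left[rotated 4]) (use p rprimeD a' ab ps mult_in in auto)
    then have "prime_prod R u ps (a' * b)" using Cons.prems by (simp add: prime_prod_def)
    then obtain v qs w rs where "prime_prod R v qs a'" "prime_prod R w rs b" "length ps = length qs + length rs"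
      using Cons.IH a'(1) ab(2) by blast
    moreover from this have "prime_prod R v (p # qs) a" using p a' by (auto simp: prime_prod_def mult_ac)
    ultimately show ?thesis by (intro exI[of _ v] exI[of _ "p # qs"] exI[of _ w] exI[of _ rs]) simp
  qed
  have "rdvd R p (a * b)" unfolding eq using ps mult_in by (intro rdvd_mult_self)
  then have "rdvd R p a \<or> rdvd R p b" using rprimeD(4)[OF p] Cons.prems by auto
  then show ?case
  proof
    assume "rdvd R p a"
    then show ?thesis using *[of a b] eq Cons.prems by blast
  next
    assume "rdvd R p b"
    moreover have "b * a = p * (u * prod_list ps)" using eq by (simp add: mult.commute)
    ultimately obtain v qs w rs where "prime_prod R v qs b" "prime_prod R w rs a" "length (p # ps) = length qs + length rs"
      using *[of b a] Cons.prems(2,3) by blast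
    then show ?thesis by (intro exI[of _ w] exI[of _ rs] exI[of _ v] exI[of _ qs]) auto
  qed
qed

definition polys :: "'a poly set" where
  "polys = {p. \<forall>i. coeff p i \<in> R}"

lemma coeff_in: "p \<in> polys \<Longrightarrow> coeff p i \<in> R"
  by (simp add: polys_def)

lemma polys_const [simp]: "[:a:] \<in> polys \<longleftrightarrow> a \<in> R"
  using zero_in by (auto simp: polys_def coeff_pCons split: nat.splits)

lemma polys_monom: "a \<in> R \<Longrightarrow> monom a k \<in> polys"
  using zero_in by (auto simp: polys_def)

lemma polys_smult: "a \<in> R \<Longrightarrow> p \<in> polys \<Longrightarrow> smult a p \<in> polys"
  using mult_in by (auto simp: polys_def)

lemma polys_add: "p \<in> polys \<Longrightarrow> q \<in> polys \<Longrightarrow> p + q \<in> polys"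
  using add_in by (auto simp: polys_def)

lemma polys_mult: "p \<in> polys \<Longrightarrow> q \<in> polys \<Longrightarrow> p * q \<in> polys"
  using mult_in by (auto simp: polys_def coeff_mult intro!: sum_in)

lemma lcoeff_mult:
  assumes "p \<in> polys" "q \<in> polys" "p \<noteq> 0" "q \<noteq> 0"
  shows "p * q \<noteq> 0" "degree (p * q) = degree p + degree q" "lcoeff (p * q) = lcoeff p * lcoeff q"
proof -
  have "coeff (p * q) (degree p + degree q) = lcoeff p * lcoeff q"
    by (rule coeff_mult_degree_sum)
  moreover have "lcoeff p * lcoeff q \<noteq> 0"
    using no_zero_div[of "lcoeff p" "lcoeff q"] assms coeff_in by auto
  ultimately show "p * q \<noteq> 0" "degree (p * q) = degree p + degree q"
    using degree_mult_le[of p q] le_degree[of "p * q" "degree p + degree q"] by auto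
  then show "lcoeff (p * q) = lcoeff p * lcoeff q"
    using coeff_mult_degree_sum[of p q] by simp
qed

lemma subdomain_polys: "subdomain polys"
proof
  show "p = 0 \<or> q = 0" if "p \<in> polys" "q \<in> polys" "p * q = 0" for p q
    using lcoeff_mult(1) that by blast
qed (use zero_in one_in uminus_in polys_add polys_mult in \<open>auto simp: polys_def coeff_pCons one_pCons split: nat.splits\<close>)

interpretation P: subdomain polys by (rule subdomain_polys)

text \<open>Division with remainder over a domain: the leading coefficient of \<open>f\<close>
  cannot be inverted, so \<open>g\<close> is multiplied by it at each step, and \<open>c\<close>
  collects these factors.\<close>

lemma pseudo_division:
  assumes "f \<in> polys" "f \<noteq> 0" "g \<in> polys"
  shows "\<exists>c q r. c \<in> R \<and> c \<noteq> 0 \<and> q \<in> polys \<and> r \<in> polys \<and> smult c g = q * f + r \<and> (r = 0 \<or> degree r < degree f)"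
  using assms(3)
proof (induction "degree g" arbitrary: g rule: less_induct)
  case less
  let ?l = "lcoeff f"
  have l: "?l \<in> R" "?l \<noteq> 0" using assms coeff_in by auto
  show ?case
  proof (cases "degree g < degree f")
    case True
    then show ?thesis using less.prems one_in P.zero_in
      by (intro exI[of _ 1] exI[of _ 0] exI[of _ g]) (auto simp: assms)
  next
    case False
    define m where "m = monom (lcoeff g) (degree g - degree f)"
    define g' where "g' = smult ?l g - m * f"
    have m: "m \<in> polys" unfolding m_def using less.prems by (intro polys_monom coeff_in)
    have g': "g' \<in> polys" unfolding g'_def using l m assms less.prems P.diff_in polys_smult polys_mult by blast
    show ?thesis
    proof (cases "degree g = 0 \<or> g' = 0")
      \<comment> \<open>In degree zero the degree of \<open>g'\<close> cannot drop any further; but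
        then \<open>f\<close> and \<open>g\<close> are constants and \<open>g'\<close>
        vanishes.\<close>
      case True
      have "g' = 0"
      proof (rule ccontr)
        assume "g' \<noteq> 0"
        then have d0: "degree g = 0" "degree f = 0" using True False by auto
        then have "g = [:lcoeff g:]" "f = [:?l:]" by (metis degree_0_id)+
        then show False using \<open>g' \<noteq> 0\<close> d0 unfolding g'_def m_def
          by (metis (no_types, lifting) cancel_comm_monoid_add_class.diff_cancel diff_zero monom_0 mult.commute smult_pCons mult_pCons_left mult_zero_left smult_0_right add.right_neutral pCons_0_0)
      qed
      then show ?thesis using l m P.zero_in
        by (intro exI[of _ ?l] exI[of _ m] exI[of _ 0]) (auto simp: g'_def)
    next
      case F2: False
      have "degree g' \<le> degree g"
      proof -
        have "degree (m * f) \<le> degree g"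
          using degree_mult_le[of m f] degree_monom_le[of "lcoeff g" "degree g - degree f"] False
          unfolding m_def by linarith
        then show ?thesis unfolding g'_def by (intro degree_diff_le degree_smult_le)
      qed
      moreover have "coeff g' (degree g) = 0"
      proof -
        have "coeff (m * f) (degree g) = lcoeff g * ?l"
          using False by (simp add: m_def coeff_monom_mult)
        then show ?thesis by (simp add: g'_def mult.commute)
      qed
      ultimately have "degree g' < degree g"
        using F2 by (metis leading_coeff_0_iff order_le_imp_less_or_eq)
      then obtain c q r where cqr: "c \<in> R" "c \<noteq> 0" "q \<in> polys" "r \<in> polys" "smult c g' = q * f + r"
        "r = 0 \<or> degree r < degree f"
        using less.hyps g' by blast
      have "smult (c * ?l) g = smult c g' + smult c m * f"
        by (simp add: g'_def smult_diff_right)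
      also have "\<dots> = (q + smult c m) * f + r" by (simp add: cqr(5) algebra_simps)
      finally show ?thesis
        using cqr l m no_zero_div[of c ?l] mult_in polys_add polys_smult
        by (intro exI[of _ "c * ?l"] exI[of _ "q + smult c m"] exI[of _ r]) auto
    qed
  qed
qed

lemma const_rdvd_iff:
  assumes "a \<in> R" "f \<in> polys"
  shows "rdvd polys [:a:] f \<longleftrightarrow> (\<forall>i. rdvd R a (coeff f i))"
proof
  assume "\<forall>i. rdvd R a (coeff f i)"
  then obtain c where c: "\<And>i. c i \<in> R" "\<And>i. coeff f i = a * c i" unfolding rdvd_def by metis
  have "f = [:a:] * (\<Sum>i\<le>degree f. monom (c i) i)"
  proof (rule poly_eqI)
    fix n
    have "coeff (\<Sum>i\<le>degree f. monom (c i) i) n = (if n \<le> degree f then c n else 0)"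
      by (simp add: coeff_sum)
    then show "coeff f n = coeff ([:a:] * (\<Sum>i\<le>degree f. monom (c i) i)) n"
      using c(2)[of n] by (auto simp: coeff_eq_0)
  qed
  moreover have "(\<Sum>i\<le>degree f. monom (c i) i) \<in> polys" using c by (intro P.sum_in polys_monom)
  ultimately show "rdvd polys [:a:] f" unfolding rdvd_def by blast
qed (auto simp: rdvd_def coeff_in)

text \<open>Gauss's lemma. If \<open>p\<close> divides neither polynomial, take in each the first
  coefficient not divisible by \<open>p\<close>, at \<open>i0\<close> and \<open>j0\<close>; the
  coefficient of the product at \<open>i0 + j0\<close> then has exactly one summand outside the
  multiples of \<open>p\<close>.\<close>

lemma rprime_const:
  assumes p: "rprime R p"
  shows "rprime polys [:p:]"
proof -
  note pD = rprimeD[OF p]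
  have "\<not> rdvd polys [:p:] 1"
    using const_rdvd_iff[of p 1] pD P.one_in by (auto intro: exI[of _ 0])
  moreover have "rdvd polys [:p:] f \<or> rdvd polys [:p:] g"
    if fg: "f \<in> polys" "g \<in> polys" "rdvd polys [:p:] (f * g)" for f g
  proof (rule ccontr)
    assume "\<not> ?thesis"
    then obtain i j where ij: "\<not> rdvd R p (coeff f i)" "\<not> rdvd R p (coeff g j)"
      using const_rdvd_iff pD fg by auto
    define i0 where "i0 = (LEAST i. \<not> rdvd R p (coeff f i))"
    define j0 where "j0 = (LEAST j. \<not> rdvd R p (coeff g j))"
    have i0: "\<not> rdvd R p (coeff f i0)" "\<And>i. i < i0 \<Longrightarrow> rdvd R p (coeff f i)"
      using LeastI[of "\<lambda>i. \<not> rdvd R p (coeff f i)", OF ij(1)] not_less_Least unfolding i0_def by blast+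
    have j0: "\<not> rdvd R p (coeff g j0)" "\<And>j. j < j0 \<Longrightarrow> rdvd R p (coeff g j)"
      using LeastI[of "\<lambda>i. \<not> rdvd R p (coeff g i)", OF ij(2)] not_less_Least unfolding j0_def by blast+
    let ?t = "\<lambda>i. coeff f i * coeff g (i0 + j0 - i)"
    have "coeff (f * g) (i0 + j0) = ?t i0 + sum ?t ({..i0 + j0} - {i0})"
      unfolding coeff_mult by (rule sum.remove) auto
    moreover have "rdvd R p (sum ?t ({..i0 + j0} - {i0}))"
    proof (rule rdvd_sum)
      fix i assume i: "i \<in> {..i0 + j0} - {i0}"
      show "rdvd R p (?t i)"
      proof (cases "i < i0")
        case True
        then show ?thesis using i0(2) fg by (intro rdvd_mult coeff_in) auto
      next
        case False
        then have "i0 + j0 - i < j0" using i by auto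
        then show ?thesis using j0(2) fg by (intro rdvd_mult2 coeff_in) auto
      qed
    qed
    moreover have "rdvd R p (coeff (f * g) (i0 + j0))"
      using const_rdvd_iff pD(1) fg polys_mult by blast
    ultimately have "rdvd R p (?t i0)"
      using rdvd_diff[of p "coeff (f * g) (i0 + j0)" "sum ?t ({..i0 + j0} - {i0})"] by simp
    then have "rdvd R p (coeff f i0) \<or> rdvd R p (coeff g j0)"
      using pD(4)[OF coeff_in[OF fg(1)] coeff_in[OF fg(2)]] by simp
    then show False using i0(1) j0(1) by blast
  qed
  ultimately show ?thesis using pD by (auto simp: rprime_def)
qed

lemma prime_prod_const:
  assumes "prime_prod R u ps a"
  shows "prime_prod polys [:u:] (map (\<lambda>p. [:p:]) ps) [:a:]"
proof -
  have "prod_list (map (\<lambda>p. [:p:]) ps) = [:prod_list ps:]"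
    by (induction ps) (auto simp: one_pCons)
  moreover obtain v where "v \<in> R" "1 = u * v" using assms by (auto simp: prime_prod_def rdvd_def)
  then have "rdvd polys [:u:] 1" unfolding rdvd_def
    by (intro bexI[of _ "[:v:]"]) (auto simp: one_pCons mult.commute)
  ultimately show ?thesis
    using assms by (auto simp: prime_prod_def rprime_const)
qed

end

section \<open>Polynomial rings over factorial rings\<close>

context ufd
begin

interpretation P: subdomain polys by (rule subdomain_polys)

text \<open>A prime constant taken out of \<open>f\<close> is also taken out of its leading
  coefficient, whose number of prime factors therefore bounds the process.\<close>

lemma primitive_part:
  assumes "f \<in> polys" "f \<noteq> 0"
  shows "\<exists>c f'. c \<in> R \<and> c \<noteq> 0 \<and> f' \<in> polys \<and> f = smult c f' \<and> (\<forall>p. rprime R p \<longrightarrow> \<not> rdvd polys [:p:] f')"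
proof -
  obtain u ps where "prime_prod R u ps (lcoeff f)"
    using prime_prod_ex assms coeff_in by fastforce
  then show ?thesis using assms
  proof (induction "length ps" arbitrary: u ps f rule: less_induct)
    case less
    show ?case
    proof (cases "\<forall>p. rprime R p \<longrightarrow> \<not> rdvd polys [:p:] f")
      case True
      then show ?thesis using less.prems one_in by (intro exI[of _ 1] exI[of _ f]) auto
    next
      case False
      then obtain p g where p: "rprime R p" and g: "g \<in> polys" "f = smult p g" by (auto simp: rdvd_def)
      have g0: "g \<noteq> 0" using g less.prems by auto
      have "f = [:p:] * g" using g by simp
      then have "lcoeff f = p * lcoeff g"
        using lcoeff_mult(3)[of "[:p:]" g] rprimeD[OF p] g g0 by simp
      then obtain v qs w rs where vw: "prime_prod R v qs p" "prime_prod R w rs (lcoeff g)"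
        "length ps = length qs + length rs"
        using prime_prod_split[of u ps p "lcoeff g"] less.prems rprimeD[OF p] coeff_in[OF g(1)] by auto
      have "qs \<noteq> []" using vw(1) rprimeD(3)[OF p] by (auto simp: prime_prod_def)
      then have "length rs < length ps" using vw(3) by simp
      from less.hyps[OF this vw(2) g(1) g0] obtain c f' where "c \<in> R" "c \<noteq> 0" "f' \<in> polys" "g = smult c f'"
        "\<forall>p. rprime R p \<longrightarrow> \<not> rdvd polys [:p:] f'" by blast
      then show ?thesis
        using g rprimeD[OF p] mult_in no_zero_div[of p c] by (intro exI[of _ "p * c"] exI[of _ f']) auto
    qed
  qed
qed

text \<open>The primes of \<open>c\<close> are removed one by one, each from a factor that it
  divides by \<open>rprime_const\<close>. A primitive \<open>g\<close> is never touched; this is the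
  last conjunct, and it allows cancelling constants against \<open>g\<close>.\<close>

lemma smult_split:
  assumes "c \<in> R" "c \<noteq> 0" "f \<in> polys" "q \<in> polys" "g \<in> polys" "smult c f = q * g"
  shows "\<exists>q' g' d. q' \<in> polys \<and> g' \<in> polys \<and> d \<in> R \<and> d \<noteq> 0 \<and> f = q' * g' \<and> degree q' = degree q \<and> g = smult d g'
     \<and> ((\<forall>p. rprime R p \<longrightarrow> \<not> rdvd polys [:p:] g) \<longrightarrow> g' = g)"
proof -
  obtain u ps where "prime_prod R u ps c" using prime_prod_ex assms by blast
  then show ?thesis using assms
  proof (induction ps arbitrary: c q g)
    case Nil
    then obtain v where v: "v \<in> R" "1 = c * v" by (auto simp: prime_prod_def rdvd_def)
    then have v0: "v \<noteq> 0" by auto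
    have "f = smult (v * c) f" using v by (simp add: mult.commute)
    also have "\<dots> = smult v q * g" using Nil.prems(7) by (metis mult_smult_left smult_smult)
    finally have f: "f = smult v q * g" .
    have "degree (smult v q) = degree q"
    proof (cases "q = 0")
      case False
      then show ?thesis using lcoeff_mult(2)[of "[:v:]" q] v v0 Nil.prems by simp
    qed simp
    then show ?case using f v Nil.prems polys_smult one_in
      by (intro exI[of _ "smult v q"] exI[of _ g] exI[of _ 1]) auto
  next
    case (Cons p ps)
    have p: "rprime R p" using Cons.prems by (auto simp: prime_prod_def)
    have ps: "set ps \<subseteq> R" "u \<in> R" using Cons.prems(1) rprimeD(1) by (auto simp: prime_prod_def)
    define c' where "c' = u * prod_list ps"
    have c': "c' \<in> R" "prime_prod R u ps c'" "c = p * c'"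
      using Cons.prems ps prod_list_in mult_in by (auto simp: c'_def prime_prod_def mult_ac)
    then have c'0: "c' \<noteq> 0" using Cons.prems by auto
    have eq: "[:p:] * smult c' f = q * g" using Cons.prems c' by (simp add: mult.commute)
    have canc: "smult c' f = h" if "[:p:] * smult c' f = [:p:] * h" "h \<in> polys" for h
      using P.cancel_left[of "[:p:]" "smult c' f" h] that rprimeD[OF p] Cons.prems c' polys_smult by auto
    have "rdvd polys [:p:] (q * g)" unfolding eq[symmetric] using Cons.prems c' polys_smult P.rdvd_mult_self by blast
    then have "rdvd polys [:p:] q \<or> rdvd polys [:p:] g"
      using P.rprimeD(4)[OF rprime_const[OF p]] Cons.prems by blast
    then show ?case
    proof
      assume "rdvd polys [:p:] q"
      then obtain q1 where q1: "q1 \<in> polys" "q = [:p:] * q1" by (auto simp: rdvd_def)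
      have eq1: "smult c' f = q1 * g" using eq q1 Cons.prems polys_mult by (intro canc) (simp_all add: mult.assoc)
      have "degree q = degree q1"
        using q1 lcoeff_mult(2)[of "[:p:]" q1] rprimeD[OF p] by (cases "q1 = 0") auto
      then show ?thesis
        using Cons.IH[OF c'(2,1) c'0 Cons.prems(4) q1(1) Cons.prems(6) eq1] by simp
    next
      assume dg: "rdvd polys [:p:] g"
      then obtain g1 where g1: "g1 \<in> polys" "g = [:p:] * g1" by (auto simp: rdvd_def)
      have "[:p:] * smult c' f = [:p:] * (q * g1)" unfolding eq g1(2) by (simp only: mult_ac)
      then have eq1: "smult c' f = q * g1" using g1 Cons.prems polys_mult by (intro canc)
      obtain q' g' d where "q' \<in> polys" "g' \<in> polys" "d \<in> R" "d \<noteq> 0" "f = q' * g'" "degree q' = degree q" "g1 = smult d g'"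
        using Cons.IH[OF c'(2,1) c'0 Cons.prems(4,5) g1(1) eq1] by blast
      then have "q' \<in> polys \<and> g' \<in> polys \<and> p * d \<in> R \<and> p * d \<noteq> 0 \<and> f = q' * g' \<and> degree q' = degree q \<and> g = smult (p * d) g'"
        using g1 rprimeD(1,2)[OF p] mult_in no_zero_div[of p d] by (auto simp: mult.commute[of d p])
      then show ?thesis using p dg by blast
    qed
  qed
qed

text \<open>A counterexample \<open>g\<close> to primality of least degree has smaller degree than \<open>f\<close>, then divides \<open>f\<close>
  up to a constant, and hence is constant.\<close>

lemma rprime_primitive:
  assumes f: "f \<in> polys" "degree f > 0"
    and prim: "\<And>p. rprime R p \<Longrightarrow> \<not> rdvd polys [:p:] f"
    and irr: "\<And>g h. g \<in> polys \<Longrightarrow> h \<in> polys \<Longrightarrow> f = g * h \<Longrightarrow> degree g < degree f \<Longrightarrow> degree h < degree f \<Longrightarrow> False"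
  shows "rprime polys f"
proof -
  have f0: "f \<noteq> 0" using f by auto
  have deg_dvd: "degree f \<le> degree r" if r: "r \<in> polys" "r \<noteq> 0" and d: "rdvd polys f r" for r
  proof -
    obtain s where s: "s \<in> polys" "r = f * s" using d by (auto simp: rdvd_def)
    then have "s \<noteq> 0" using r by auto
    then show ?thesis using s f0 f lcoeff_mult(2)[of f s] by simp
  qed
  \<comment> \<open>\<open>f\<close> is primitive, so \<open>smult_split\<close> keeps it as a
    factor and removes the constant \<open>c\<close> from its cofactor.\<close>
  have dvd_cancel: "rdvd polys f h" if ch: "c \<in> R" "c \<noteq> 0" "h \<in> polys" and d: "rdvd polys f (smult c h)" for c h
  proof -
    obtain w where w: "w \<in> polys" "smult c h = w * f" using d unfolding rdvd_def by (metis mult.commute)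
    then show ?thesis using smult_split[OF ch w(1) f(1) w(2)] prim unfolding rdvd_def by (metis mult.commute)
  qed
  define bad where "bad g \<longleftrightarrow> g \<in> polys \<and> \<not> rdvd polys f g \<and> (\<exists>h\<in>polys. \<not> rdvd polys f h \<and> rdvd polys f (g * h))" for g
  have "\<not> bad g" for g
  proof
    assume "bad g"
    then obtain g where g: "bad g" "\<And>g'. bad g' \<Longrightarrow> degree g \<le> degree g'"
      using exists_least_lemma by (metis (no_types, lifting) arg_min_natI arg_min_nat_le)
    obtain h where h: "h \<in> polys" "\<not> rdvd polys f h" "rdvd polys f (g * h)" and gp: "g \<in> polys" "\<not> rdvd polys f g"
      using g(1) by (auto simp: bad_def)
    have g0: "g \<noteq> 0" using gp P.rdvd_0 by auto
    have badr: "bad r" if "r \<in> polys" "r \<noteq> 0" "degree r < degree f" "rdvd polys f (r * h)" for r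
      using that deg_dvd[of r] h unfolding bad_def by force
    \<comment> \<open>Reduction modulo \<open>f\<close> turns a counterexample into one of degree
      below that of \<open>f\<close>. It does not reduce to zero, since then \<open>f\<close> would
      divide a constant multiple of \<open>g\<close>, hence \<open>g\<close>.\<close>
    have step1: "degree g < degree f"
    proof -
      obtain c q r where r: "c \<in> R" "c \<noteq> 0" "q \<in> polys" "r \<in> polys" "smult c g = q * f + r" "r = 0 \<or> degree r < degree f"
        using pseudo_division[OF f(1) f0 gp(1)] by blast
      have "r \<noteq> 0"
      proof
        assume "r = 0"
        then have "smult c g = f * q" using r by (simp add: mult.commute)
        then have "rdvd polys f (smult c g)" using P.rdvd_mult_self[OF r(3), of f] by simp
        then show False using dvd_cancel r gp by blast
      qed
      moreover have "r * h = smult c (g * h) - f * (q * h)"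
        using r(5) by (simp add: algebra_simps mult_smult_left[symmetric] del: mult_smult_left)
      moreover have "rdvd polys f (smult c (g * h) - f * (q * h))"
        using P.rdvd_mult2[OF h(3), of "[:c:]"] r h polys_mult
        by (intro P.rdvd_diff P.rdvd_mult_self) auto
      ultimately have "bad r" using r badr by auto
      then show ?thesis using g(2) r \<open>r \<noteq> 0\<close> by fastforce
    qed
    obtain c q r where r: "c \<in> R" "c \<noteq> 0" "q \<in> polys" "r \<in> polys" "smult c f = q * g + r" "r = 0 \<or> degree r < degree g"
      using pseudo_division[OF gp(1) g0 f(1)] by blast
    have "r = 0"
    proof (rule ccontr)
      assume "r \<noteq> 0"
      moreover have "r * h = f * smult c h - q * (g * h)"
        using r(5) by (simp add: algebra_simps mult_smult_left[symmetric] del: mult_smult_left)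
      moreover have "rdvd polys f (f * smult c h - q * (g * h))"
        by (rule P.rdvd_diff[OF P.rdvd_mult_self[OF polys_smult[OF r(1) h(1)]] P.rdvd_mult2[OF h(3) r(3)]])
      ultimately have "bad r" using r badr step1 by auto
      then show False using g(2) r \<open>r \<noteq> 0\<close> by fastforce
    qed
    then have "smult c f = q * g" using r by simp
    then obtain q' g' d where q': "q' \<in> polys" "g' \<in> polys" "d \<in> R" "d \<noteq> 0" "f = q' * g'" "degree q' = degree q" "g = smult d g'"
      using smult_split[OF r(1,2) f(1) r(3) gp(1)] by blast
    have nz: "q' \<noteq> 0" "g' \<noteq> 0" using q'(5) f0 by auto
    have "degree g = degree g'" using q' nz lcoeff_mult(2)[of "[:d:]" g'] by simp
    then have "degree g' < degree f" using step1 by simp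
    \<comment> \<open>\<open>irr\<close> excludes that both factors have smaller degree than
      \<open>f\<close>, so \<open>q'\<close> takes up the whole degree and \<open>g'\<close>, hence
      \<open>g\<close>, is constant.\<close>
    then have "\<not> degree q' < degree f" using irr q' by blast
    then have "degree g' = 0" using lcoeff_mult(2)[OF q'(1,2) nz] q'(5) by simp
    then have "degree g = 0" using \<open>degree g = degree g'\<close> by simp
    then obtain b where b: "g = [:b:]" by (metis degree_0_id)
    then have "rdvd polys f (smult b h)" "b \<in> R" "b \<noteq> 0" using h gp g0 by auto
    then show False using dvd_cancel h by blast
  qed
  then have "\<forall>a\<in>polys. \<forall>b\<in>polys. rdvd polys f (a * b) \<longrightarrow> rdvd polys f a \<or> rdvd polys f b"
    unfolding bad_def by blast
  moreover have "\<not> rdvd polys f 1" using deg_dvd[of 1] f P.one_in by auto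
  ultimately show ?thesis using f f0 by (auto simp: rprime_def)
qed

text \<open>Gauss's theorem, by induction on the degree: after splitting off a constant, the
  primitive part either factors into polynomials of smaller degree or is prime by
  \<open>rprime_primitive\<close>.\<close>

theorem ufd_polys: "ufd polys"
proof
  fix f assume "f \<in> polys" "f \<noteq> 0"
  then show "\<exists>u ps. prime_prod polys u ps f"
  proof (induction "degree f" arbitrary: f rule: less_induct)
    case less
    show ?case
    proof (cases "degree f = 0")
      case True
      then obtain a where a: "f = [:a:]" by (metis degree_0_id)
      then obtain u ps where "prime_prod R u ps a" using prime_prod_ex[of a] less.prems by auto
      then show ?thesis using prime_prod_const a by blast
    next
      case False
      obtain c f' where c: "c \<in> R" "c \<noteq> 0" and f': "f' \<in> polys" "f = smult c f'"
        and prim: "\<And>p. rprime R p \<Longrightarrow> \<not> rdvd polys [:p:] f'"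
        using primitive_part[OF less.prems] by blast
      obtain u ps where "prime_prod R u ps c" using prime_prod_ex c by blast
      then have c': "prime_prod polys [:u:] (map (\<lambda>p. [:p:]) ps) [:c:]" by (rule prime_prod_const)
      have f'0: "f' \<noteq> 0" using f' less.prems by auto
      have deg: "degree f' = degree f" using lcoeff_mult(2)[of "[:c:]" f'] c f' f'0 by simp
      have "\<exists>v qs. prime_prod polys v qs f'"
      proof (cases "\<exists>g h. g \<in> polys \<and> h \<in> polys \<and> f' = g * h \<and> degree g < degree f' \<and> degree h < degree f'")
        case True
        then obtain g h where gh: "g \<in> polys" "h \<in> polys" "f' = g * h" "degree g < degree f" "degree h < degree f"
          using deg by auto
        then have "g \<noteq> 0" "h \<noteq> 0" using f'0 by auto
        then show ?thesis using less.hyps[of g] less.hyps[of h] gh P.prime_prod_mult by metis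
      next
        case F2: False
        have "rprime polys f'"
        proof (rule rprime_primitive)
          show "f' \<in> polys" "degree f' > 0" using f' deg False by auto
          show "False" if "g \<in> polys" "h \<in> polys" "f' = g * h" "degree g < degree f'" "degree h < degree f'" for g h
            using F2 that by blast
        qed (rule prim)
        then have "prime_prod polys 1 [f'] f'" using P.one_in P.rdvd_refl by (auto simp: prime_prod_def)
        then show ?thesis by blast
      qed
      then obtain v qs where "prime_prod polys v qs f'" by blast
      from P.prime_prod_mult[OF c' this] have "prime_prod polys ([:u:] * v) (map (\<lambda>p. [:p:]) ps @ qs) f"
        using f' by simp
      then show ?thesis by blast
    qed
  qed
qed

end

section \<open>Transcendental extensions and greatest common divisors\<close>

context ufd
begin

interpretation P: ufd polys by (rule ufd_polys)

text \<open>By \<open>inj\<close>, evaluation at \<open>t\<close> is an isomorphism from the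
  polynomial ring onto its image, which transports factoriality. That no new units arise follows
  from degrees; it later identifies the units of F[V] with the nonzero constants.\<close>

lemma ufd_adjoin:
  assumes inj: "\<And>p. p \<in> polys \<Longrightarrow> poly p t = 0 \<Longrightarrow> p = 0"
  shows "ufd ((\<lambda>p. poly p t) ` polys)"
    and "\<And>a. a \<in> (\<lambda>p. poly p t) ` polys \<Longrightarrow> rdvd ((\<lambda>p. poly p t) ` polys) a 1 \<Longrightarrow> a \<in> R \<and> rdvd R a 1"
proof -
  let ?R = "(\<lambda>p. poly p t) ` polys"
  have eqD: "p = q" if "p \<in> polys" "q \<in> polys" "poly p t = poly q t" for p q
    using inj[of "p - q"] that P.diff_in by simp
  have inR: "poly p t \<in> ?R" if "p \<in> polys" for p using that by blast
  have dvd: "rdvd ?R (poly p t) (poly q t) \<longleftrightarrow> rdvd polys p q" if pq: "p \<in> polys" "q \<in> polys" for p q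
  proof
    assume "rdvd ?R (poly p t) (poly q t)"
    then obtain c where "c \<in> polys" "poly q t = poly (p * c) t" by (auto simp: rdvd_def)
    then have "q = p * c" using eqD pq P.mult_in by blast
    then show "rdvd polys p q" using \<open>c \<in> polys\<close> by (auto simp: rdvd_def)
  qed (auto simp: rdvd_def)
  have sub: "subdomain ?R"
  proof
    show "0 \<in> ?R" "1 \<in> ?R" using inR[OF P.zero_in] inR[OF P.one_in] by simp_all
    fix a b assume "a \<in> ?R" "b \<in> ?R"
    then obtain p q where pq: "p \<in> polys" "q \<in> polys" "a = poly p t" "b = poly q t" by blast
    show "a + b \<in> ?R" using inR[OF P.add_in[OF pq(1,2)]] pq by simp
    show "- a \<in> ?R" using inR[OF P.uminus_in[OF pq(1)]] pq by simp
    show "a * b \<in> ?R" using inR[OF P.mult_in[OF pq(1,2)]] pq by simp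
    show "a = 0 \<or> b = 0" if "a * b = 0"
      using inj[OF P.mult_in[OF pq(1,2)]] that pq P.no_zero_div[OF pq(1,2)] by auto
  qed
  have prime: "rprime ?R (poly p t)" if p: "rprime polys p" for p
    unfolding rprime_def
  proof (intro conjI ballI impI)
    note pD = P.rprimeD[OF p]
    show "poly p t \<in> ?R" using pD by blast
    show "poly p t \<noteq> 0" using pD inj by blast
    show "\<not> rdvd ?R (poly p t) 1" using dvd[OF pD(1) P.one_in] pD by simp
    fix a b assume "a \<in> ?R" "b \<in> ?R" and d: "rdvd ?R (poly p t) (a * b)"
    then obtain q r where qr: "q \<in> polys" "r \<in> polys" "a = poly q t" "b = poly r t" by blast
    then have "rdvd polys p (q * r)" using d dvd[OF pD(1) P.mult_in[OF qr(1,2)]] by simp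
    then show "rdvd ?R (poly p t) a \<or> rdvd ?R (poly p t) b" using pD(4) qr dvd[OF pD(1)] by blast
  qed
  show "ufd ?R"
    unfolding ufd_def ufd_axioms_def
  proof (intro conjI allI impI sub)
    fix a assume "a \<in> ?R" "a \<noteq> 0"
    then obtain p where p: "p \<in> polys" "a = poly p t" by blast
    then have "p \<noteq> 0" using \<open>a \<noteq> 0\<close> by auto
    with p obtain u ps where up: "prime_prod polys u ps p" using P.prime_prod_ex by blast
    have "poly (prod_list ps) t = prod_list (map (\<lambda>p. poly p t) ps)" by (induction ps) auto
    then have "prime_prod ?R (poly u t) (map (\<lambda>p. poly p t) ps) a"
      using up p dvd[of u 1] P.one_in prime by (auto simp: prime_prod_def)
    then show "\<exists>u ps. prime_prod ?R u ps a" by blast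
  qed
  show "a \<in> R \<and> rdvd R a 1" if a: "a \<in> ?R" "rdvd ?R a 1" for a
  proof -
    obtain p where p: "p \<in> polys" "a = poly p t" using a by blast
    then have "rdvd polys p 1" using dvd[OF p(1) P.one_in] a by simp
    then obtain q where q: "q \<in> polys" "1 = p * q" by (auto simp: rdvd_def)
    then have nz: "p \<noteq> 0" "q \<noteq> 0" by auto
    have "degree p + degree q = 0" using lcoeff_mult(2)[OF p(1) q(1) nz] q(2) by (metis degree_1)
    then obtain b c where bc: "p = [:b:]" "q = [:c:]" by (metis add_is_0 degree_0_id)
    then have "b * c = 1" using q(2) by (simp add: one_pCons mult.commute[of c b])
    then show ?thesis using p q bc by (auto simp: rdvd_def intro!: bexI[of _ c])
  qed
qed

definition rgcd :: "'a set \<Rightarrow> 'a \<Rightarrow> bool" where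
  "rgcd Y d \<longleftrightarrow> d \<in> R \<and> (\<forall>y\<in>Y. rdvd R d y) \<and> (\<forall>c\<in>R. (\<forall>y\<in>Y. rdvd R c y) \<longrightarrow> rdvd R c d)"

lemma coprime_prime_cancel:
  assumes p: "rprime R p" and "c \<in> R" "a \<in> R" "\<not> rdvd R p c" "rdvd R c (p * a)"
  shows "rdvd R c a"
proof -
  obtain e where e: "e \<in> R" "p * a = c * e" using assms by (auto simp: rdvd_def)
  have "rdvd R p (c * e)" unfolding e(2)[symmetric] using assms by (intro rdvd_mult_self)
  then obtain e' where e': "e' \<in> R" "e = p * e'" using rprimeD(4)[OF p] assms e by (auto simp: rdvd_def)
  then have "p * a = p * (c * e')" using e by (simp add: mult_ac)
  then have "a = c * e'" using cancel_left[of p a "c * e'"] rprimeD[OF p] assms e' mult_in by auto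
  then show ?thesis using e' by (auto simp: rdvd_def)
qed

lemma rdvd_cancel: "rprime R p \<Longrightarrow> a \<in> R \<Longrightarrow> b \<in> R \<Longrightarrow> rdvd R (p * a) (p * b) \<longleftrightarrow> rdvd R a b"
  unfolding rdvd_def using cancel_left[of p] rprimeD mult_in by (metis mult.assoc)

text \<open>Induction on the prime factors of \<open>a\<close>: a prime that divides
  \<open>b\<close> is moved into the gcd, a prime that does not is discarded.\<close>

lemma rgcd_pair_ex:
  assumes "a \<in> R" "a \<noteq> 0" "b \<in> R"
  shows "\<exists>d. rgcd {a, b} d"
proof -
  obtain u ps where "prime_prod R u ps a" using prime_prod_ex assms by blast
  then show ?thesis using assms
  proof (induction ps arbitrary: a b)
    case Nil
    have "rdvd R a 1" using Nil.prems by (simp add: prime_prod_def)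
    then have "rdvd R c 1" if "rdvd R c a" for c using that rdvd_trans by blast
    moreover have "rdvd R 1 y" if "y \<in> R" for y using that by (auto simp: rdvd_def)
    ultimately have "rgcd {a, b} 1" using Nil.prems one_in by (auto simp: rgcd_def)
    then show ?case by blast
  next
    case (Cons p ps)
    have p: "rprime R p" and ps: "set ps \<subseteq> R" "u \<in> R" using Cons.prems(1) rprimeD(1) by (auto simp: prime_prod_def)
    define a' where "a' = u * prod_list ps"
    have a': "a' \<in> R" "prime_prod R u ps a'" "a = p * a'"
      using Cons.prems ps prod_list_in mult_in by (auto simp: a'_def prime_prod_def mult_ac)
    then have a'0: "a' \<noteq> 0" using Cons.prems by auto
    note pD = rprimeD(1,2)[OF p]
    show ?case
    proof (cases "rdvd R p b")
      case True
      then obtain b' where b': "b' \<in> R" "b = p * b'" by (auto simp: rdvd_def)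
      obtain d where d: "rgcd {a', b'} d" using Cons.IH[OF a'(2,1) a'0 b'(1)] by blast
      then have dR: "d \<in> R" by (simp add: rgcd_def)
      have "rgcd {a, b} (p * d)"
        unfolding rgcd_def
      proof (intro conjI ballI impI)
        show "p * d \<in> R" using pD dR mult_in by blast
        show "rdvd R (p * d) y" if "y \<in> {a, b}" for y
          using that d rdvd_cancel[OF p dR] a' b' by (auto simp: rgcd_def)
        fix c assume c: "c \<in> R" "\<forall>y\<in>{a, b}. rdvd R c y"
        show "rdvd R c (p * d)"
        proof (cases "rdvd R p c")
          case True
          then obtain c' where c': "c' \<in> R" "c = p * c'" by (auto simp: rdvd_def)
          then have "rdvd R c' a'" "rdvd R c' b'" using c rdvd_cancel[OF p c'(1)] a' b' by auto
          then show ?thesis using d c' rdvd_cancel[OF p c'(1) dR] by (auto simp: rgcd_def)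
        next
          case False
          then have "rdvd R c a'" "rdvd R c b'" using c coprime_prime_cancel[OF p c(1)] a' b' by auto
          then have "rdvd R c d" using d c by (auto simp: rgcd_def)
          then show ?thesis using rdvd_mult2 pD by blast
        qed
      qed
      then show ?thesis by blast
    next
      case False
      obtain d where d: "rgcd {a', b} d" using Cons.IH[OF a'(2,1) a'0 Cons.prems(4)] by blast
      have "rgcd {a, b} d"
        unfolding rgcd_def
      proof (intro conjI ballI impI)
        show "d \<in> R" using d by (simp add: rgcd_def)
        show "rdvd R d y" if "y \<in> {a, b}" for y
          using that d a' rdvd_mult2 pD by (auto simp: rgcd_def)
        fix c assume c: "c \<in> R" "\<forall>y\<in>{a, b}. rdvd R c y"
        then have "\<not> rdvd R p c" using False rdvd_trans by blast
        then have "rdvd R c a'" using c coprime_prime_cancel[OF p c(1) a'(1)] a' by auto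
        then show "rdvd R c d" using d c by (auto simp: rgcd_def)
      qed
      then show ?thesis by blast
    qed
  qed
qed

lemma rgcd_ex:
  assumes "finite Y" "Y \<subseteq> R" "y \<in> Y" "y \<noteq> 0"
  shows "\<exists>d. rgcd Y d"
proof -
  \<comment> \<open>The nonzero element \<open>y\<close> is kept in the set throughout, so that the
    gcd \<open>d\<close> passed to \<open>rgcd_pair_ex\<close> is never zero.\<close>
  have "\<exists>d. rgcd (insert y Z) d" if "finite Z" "Z \<subseteq> R" for Z
    using that
  proof (induction Z)
    case empty
    have "rgcd {y} y" using assms rdvd_refl by (auto simp: rgcd_def)
    then show ?case by auto
  next
    case (insert z Z)
    then obtain d where d: "rgcd (insert y Z) d" by auto
    then have "d \<in> R" "d \<noteq> 0" using assms(4) by (auto simp: rgcd_def rdvd_def)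
    then obtain e where e: "rgcd {d, z} e" using rgcd_pair_ex[of d z] insert.prems by auto
    have "rgcd (insert y (insert z Z)) e"
      unfolding rgcd_def
    proof (intro conjI ballI impI)
      show "e \<in> R" using e by (simp add: rgcd_def)
      show "rdvd R e x" if "x \<in> insert y (insert z Z)" for x
        using that d e rdvd_trans[of e d x] by (auto simp: rgcd_def)
      show "rdvd R c e" if "c \<in> R" "\<forall>x\<in>insert y (insert z Z). rdvd R c x" for c
        using that d e by (auto simp: rgcd_def)
    qed
    then show ?case by blast
  qed
  from this[of Y] assms show ?thesis by (simp add: insert_absorb)
qed

text \<open>The gcd of \<open>a * c\<close> and \<open>b * c\<close> is \<open>c\<close> up to a
  unit, and \<open>a\<close> divides both of these elements.\<close>

lemma coprime_rdvd:
  assumes "a \<in> R" "a \<noteq> 0" "b \<in> R" "c \<in> R" "c \<noteq> 0" "rgcd {a, b} d" "rdvd R d 1" "rdvd R a (b * c)"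
  shows "rdvd R a c"
proof -
  have ac: "a * c \<noteq> 0" using no_zero_div assms by blast
  then obtain g where g: "rgcd {a * c, b * c} g" using rgcd_pair_ex[of "a * c" "b * c"] assms mult_in by blast
  have "rdvd R a g" using g assms rdvd_mult_self by (auto simp: rgcd_def)
  have "rdvd R c g" using g assms rdvd_mult_self[of _ c] by (auto simp: rgcd_def mult.commute)
  then obtain h where h: "h \<in> R" "g = c * h" by (auto simp: rdvd_def)
  have canc: "rdvd R h x" if x: "x \<in> R" and d: "rdvd R g (x * c)" for x
  proof -
    obtain k where k: "k \<in> R" "x * c = c * h * k" using d h by (auto simp: rdvd_def)
    then have "c * x = c * (h * k)" by (simp add: mult_ac)
    then have "x = h * k" using cancel_left[of c x "h * k"] assms x h k mult_in by auto
    then show ?thesis using k by (auto simp: rdvd_def)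
  qed
  have "rdvd R h a" "rdvd R h b" using canc g assms by (auto simp: rgcd_def)
  then have "rdvd R h 1" using assms(6,7) h rdvd_trans[of h d 1] by (auto simp: rgcd_def)
  then obtain k where k: "k \<in> R" "h * k = 1" by (auto simp: rdvd_def)
  then have "c = g * k" using h by (simp add: mult.assoc)
  then have "rdvd R g c" using k by (auto simp: rdvd_def)
  then show ?thesis using \<open>rdvd R a g\<close> rdvd_trans by blast
qed

text \<open>The minimum over all factorizations singles out one number; its growth under
  multiplication by a nonunit comes from \<open>prime_prod_split\<close>.\<close>

definition prime_length :: "'a \<Rightarrow> nat" where
  "prime_length a = (LEAST k. \<exists>u ps. prime_prod R u ps a \<and> length ps = k)"

lemma prime_length_less:
  assumes "a \<in> R" "b \<in> R" "a \<noteq> 0" "b \<noteq> 0" "\<not> rdvd R a 1"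
  shows "prime_length b < prime_length (a * b)"
proof -
  have "a * b \<in> R" "a * b \<noteq> 0" using assms mult_in no_zero_div by blast+
  then have "\<exists>k u ps. prime_prod R u ps (a * b) \<and> length ps = k" using prime_prod_ex by blast
  then have "\<exists>u ps. prime_prod R u ps (a * b) \<and> length ps = prime_length (a * b)"
    unfolding prime_length_def by (rule LeastI_ex)
  then obtain u ps where ps: "prime_prod R u ps (a * b)" "length ps = prime_length (a * b)" by blast
  then obtain v qs w rs where *: "prime_prod R v qs a" "prime_prod R w rs b" "length ps = length qs + length rs"
    using prime_prod_split assms by blast
  have "qs \<noteq> []" using *(1) assms(5) by (auto simp: prime_prod_def)
  moreover have "prime_length b \<le> length rs"
    unfolding prime_length_def by (rule Least_le) (use * in blast)
  ultimately show ?thesis using *(3) ps(2) by (cases qs) auto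
qed

lemma nonunit_prime_divisor:
  assumes "a \<in> R" "a \<noteq> 0" "\<not> rdvd R a 1"
  obtains p where "rprime R p" "rdvd R p a"
proof -
  obtain u ps where ps: "prime_prod R u ps a" using prime_prod_ex assms by blast
  then obtain p qs where p: "ps = p # qs" using assms(3) by (cases ps) (auto simp: prime_prod_def)
  have "a = p * (u * prod_list qs)" "rprime R p" "u * prod_list qs \<in> R"
    using ps p prod_list_in[of qs] mult_in rprimeD(1) by (auto simp: prime_prod_def mult_ac)
  then show ?thesis using that rdvd_mult_self by metis
qed

end

text \<open>Over a ring that is not a field the criterion only excludes two factors of positive
  degree. That a factor of degree zero is a unit is a separate matter, depending on the common
  divisors of the coefficients.\<close>

lemma (in subdomain) eisenstein:
  assumes q: "rprime R q" and gh: "g \<in> polys" "h \<in> polys" "g \<noteq> 0" "h \<noteq> 0"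
    and dvd: "\<And>i. i < degree (g * h) \<Longrightarrow> rdvd R q (coeff (g * h) i)"
    and lead: "\<not> rdvd R q (lcoeff (g * h))"
    and const: "\<not> rdvd R (q * q) (coeff (g * h) 0)"
  shows "degree g = 0 \<or> degree h = 0"
proof -
  note deg = lcoeff_mult[OF gh]
  \<comment> \<open>If \<open>q\<close> divides the constant coefficient of \<open>g\<close> but not
    that of \<open>h\<close>, the first coefficient of \<open>g\<close> not divisible by
    \<open>q\<close> yields such a coefficient of \<open>f\<close> in the same degree. This can only
    be the leading one, so \<open>g\<close> has the full degree.\<close>
  have *: "degree h = 0"
    if gh: "g \<in> polys" "h \<in> polys" "g \<noteq> 0" "h \<noteq> 0" and dgh: "degree f = degree g + degree h" and f: "f = g * h" "lcoeff f = lcoeff g * lcoeff h"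
      and dvd: "\<And>i. i < degree f \<Longrightarrow> rdvd R q (coeff f i)"
      and lead: "\<not> rdvd R q (lcoeff f)" and g0: "rdvd R q (coeff g 0)" and h0: "\<not> rdvd R q (coeff h 0)" for f g h
  proof -
    have "\<not> rdvd R q (lcoeff g)" using lead f(2) rdvd_mult coeff_in gh by metis
    then have ex: "\<exists>s. \<not> rdvd R q (coeff g s)" by blast
    define s where "s = (LEAST s. \<not> rdvd R q (coeff g s))"
    have s: "\<not> rdvd R q (coeff g s)" "\<And>i. i < s \<Longrightarrow> rdvd R q (coeff g i)"
      using LeastI_ex[OF ex] not_less_Least unfolding s_def by blast+
    let ?t = "\<lambda>i. coeff g i * coeff h (s - i)"
    have "coeff f s = ?t s + sum ?t ({..s} - {s})"
      unfolding f coeff_mult by (rule sum.remove) auto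
    moreover have "rdvd R q (sum ?t ({..s} - {s}))"
      using s(2) gh by (intro rdvd_sum rdvd_mult coeff_in) auto
    moreover have "\<not> rdvd R q (?t s)"
      using rprimeD(4)[OF q coeff_in[OF gh(1)] coeff_in[OF gh(2)], of s 0] s(1) h0 by auto
    ultimately have "\<not> rdvd R q (coeff f s)" using rdvd_diff[of q "coeff f s" "sum ?t ({..s} - {s})"] by auto
    then have "\<not> s < degree f" using dvd[of s] by blast
    then have "degree f \<le> s" by simp
    moreover have "s \<le> degree g" using s(1) rdvd_0 by (metis le_degree)
    ultimately show ?thesis using dgh by simp
  qed
  show ?thesis
  proof (cases "degree (g * h) = 0")
    case True
    then show ?thesis using deg by simp
  next
    case False
    have c0: "coeff (g * h) 0 = coeff g 0 * coeff h 0" by (simp add: coeff_mult)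
    have "rdvd R q (coeff (g * h) 0)" using dvd False by blast
    then have or: "rdvd R q (coeff g 0) \<or> rdvd R q (coeff h 0)"
      using rprimeD(4)[OF q] coeff_in gh unfolding c0 by blast
    have nand: "\<not> (rdvd R q (coeff g 0) \<and> rdvd R q (coeff h 0))"
    proof
      assume "rdvd R q (coeff g 0) \<and> rdvd R q (coeff h 0)"
      then obtain c d where "c \<in> R" "d \<in> R" "coeff g 0 = q * c" "coeff h 0 = q * d" by (auto simp: rdvd_def)
      then have "coeff (g * h) 0 = (q * q) * (c * d)" "c * d \<in> R" using mult_in by (auto simp: c0 mult_ac)
      then show False using const by (auto simp: rdvd_def)
    qed
    have deg': "degree (g * h) = degree h + degree g" "g * h = h * g" "lcoeff (g * h) = lcoeff h * lcoeff g"
      using deg(2,3) by (simp_all only: add.commute mult.commute)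
    from or show ?thesis
    proof
      assume "rdvd R q (coeff g 0)"
      moreover from this have "\<not> rdvd R q (coeff h 0)" using nand by blast
      ultimately show ?thesis using *[OF gh deg(2) refl deg(3) dvd lead] by simp
    next
      assume "rdvd R q (coeff h 0)"
      moreover from this have "\<not> rdvd R q (coeff g 0)" using nand by blast
      ultimately show ?thesis using *[OF gh(2,1,4,3) deg' dvd lead] by simp
    qed
  qed
qed


section \<open>Duality for finite abelian groups\<close>

text \<open>Let \<open>L\<close> be the group generated by the characters \<open>\<psi> i\<close>. If \<open>\<chi> \<notin> L\<close>, then \<open>\<chi>\<close> is orthogonal to
  the linear span of \<open>L\<close>, which is closed under products and hence contains the indicator function of the
  common kernel up to a constant.\<close>

lemma character_in_span:
  fixes G :: "('g, 'm) monoid_scheme" (structure) and \<psi> :: "'i \<Rightarrow> 'g \<Rightarrow> 'f::field"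
  assumes G: "comm_group G" "finite (carrier G)" and char: "of_nat (order G) \<noteq> (0::'f)"
    and \<psi>: "\<And>i. i \<in> I \<Longrightarrow> \<psi> i \<in> hom G unit_group" and I: "finite I"
    and \<chi>: "\<chi> \<in> hom G unit_group"
    and ker: "\<And>g. g \<in> carrier G \<Longrightarrow> (\<And>i. i \<in> I \<Longrightarrow> \<psi> i g = 1) \<Longrightarrow> \<chi> g = 1"
  shows "\<exists>a :: 'i \<Rightarrow> nat. \<forall>g\<in>carrier G. \<chi> g = (\<Prod>i\<in>I. \<psi> i g ^ a i)"
proof (rule ccontr)
  assume neg: "\<not> ?thesis"
  interpret comm_group G by fact
  have hom1: "\<eta> \<one> = 1" and homm: "\<And>g h. g \<in> carrier G \<Longrightarrow> h \<in> carrier G \<Longrightarrow> \<eta> (g \<otimes> h) = \<eta> g * \<eta> h"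
    and homn: "\<And>g. g \<in> carrier G \<Longrightarrow> \<eta> g \<noteq> 0" if "\<eta> \<in> hom G unit_group" for \<eta> :: "'g \<Rightarrow> 'f"
  proof -
    show m: "\<And>g h. g \<in> carrier G \<Longrightarrow> h \<in> carrier G \<Longrightarrow> \<eta> (g \<otimes> h) = \<eta> g * \<eta> h"
      and n: "\<And>g. g \<in> carrier G \<Longrightarrow> \<eta> g \<noteq> 0"
      using that by (auto simp: hom_def unit_group_def)
    show "\<eta> \<one> = 1" using m[of \<one> \<one>] n[of \<one>] by simp
  qed
  define L where "L a g = (\<Prod>i\<in>I. \<psi> i g ^ a i)" for a g
  have Lhom: "L a (g \<otimes> h) = L a g * L a h" "L a g \<noteq> 0" if "g \<in> carrier G" "h \<in> carrier G" for a g h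
    using that homm[OF \<psi>] homn[OF \<psi>] I by (auto simp: L_def power_mult_distrib prod.distrib)
  define S where "S f \<longleftrightarrow> (\<forall>a. (\<Sum>g\<in>carrier G. inverse (\<chi> g) * L a g * f g) = 0)" for f :: "'g \<Rightarrow> 'f"
  have S1: "S (\<lambda>_. 1)"
    unfolding S_def
  proof
    fix a
    \<comment> \<open>Translation by an element \<open>h\<close> at which the two characters differ
      multiplies the sum by a factor other than one.\<close>
    obtain h where h: "h \<in> carrier G" "\<chi> h \<noteq> L a h" using neg by (auto simp: L_def)
    let ?f = "\<lambda>g. inverse (\<chi> g) * L a g"
    have "(\<Sum>g\<in>carrier G. ?f g) = (\<Sum>g\<in>carrier G. ?f (h \<otimes> g))"
      by (rule sum.reindex_bij_witness[of _ "\<lambda>g. h \<otimes> g" "\<lambda>g. inv h \<otimes> g"])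
        (use h in \<open>auto simp: m_assoc[symmetric]\<close>)
    also have "\<dots> = (\<Sum>g\<in>carrier G. ?f h * ?f g)"
      by (rule sum.cong) (use h homm[OF \<chi>] Lhom in \<open>auto simp: mult_ac\<close>)
    also have "\<dots> = ?f h * (\<Sum>g\<in>carrier G. ?f g)" by (simp add: sum_distrib_left)
    finally have "(1 - ?f h) * (\<Sum>g\<in>carrier G. ?f g) = 0" by (simp add: algebra_simps)
    moreover have "?f h \<noteq> 1" using h homn[OF \<chi>, of h] by (auto simp: field_simps)
    ultimately show "(\<Sum>g\<in>carrier G. inverse (\<chi> g) * L a g * 1) = 0" by simp
  qed
  have Sstep: "S (\<lambda>g. (\<psi> i g - c) * f g)" if "S f" "i \<in> I" for f i c
    unfolding S_def
  proof
    fix a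
    have L: "L (a(i := Suc (a i))) g = \<psi> i g * L a g" for g
    proof -
      have "(\<Prod>j\<in>I - {i}. \<psi> j g ^ (a(i := Suc (a i))) j) = (\<Prod>j\<in>I - {i}. \<psi> j g ^ a j)"
        by (rule prod.cong) auto
      then show ?thesis using I that by (simp add: L_def prod.remove[of I i])
    qed
    have "(\<Sum>g\<in>carrier G. inverse (\<chi> g) * L a g * ((\<psi> i g - c) * f g)) =
      (\<Sum>g\<in>carrier G. inverse (\<chi> g) * L (a(i := Suc (a i))) g * f g) - c * (\<Sum>g\<in>carrier G. inverse (\<chi> g) * L a g * f g)"
      by (simp add: L sum_distrib_left sum_subtractf[symmetric] algebra_simps)
    then show "(\<Sum>g\<in>carrier G. inverse (\<chi> g) * L a g * ((\<psi> i g - c) * f g)) = 0"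
      using that by (simp add: S_def)
  qed
  define B where "B = {g \<in> carrier G. \<forall>i\<in>I. \<psi> i g = 1}"
  define C where "C = carrier G - B"
  \<comment> \<open>For \<open>b\<close> outside the common kernel, \<open>\<psi> (k b)\<close> is a
    character that is nontrivial at \<open>b\<close>. The product over these \<open>b\<close> of the
    functions \<open>\<psi> (k b) g - \<psi> (k b) b\<close> vanishes off the kernel and is a
    nonzero constant on it.\<close>
  define k where "k b = (SOME i. i \<in> I \<and> \<psi> i b \<noteq> 1)" for b
  have k: "k b \<in> I" "\<psi> (k b) b \<noteq> 1" if "b \<in> C" for b
  proof -
    have "\<exists>i. i \<in> I \<and> \<psi> i b \<noteq> 1" using that by (auto simp: B_def C_def)
    from someI_ex[OF this] show "k b \<in> I" "\<psi> (k b) b \<noteq> 1" by (auto simp: k_def)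
  qed
  have "S (\<lambda>g. \<Prod>b\<in>C'. (\<psi> (k b) g - \<psi> (k b) b))" if "finite C'" "C' \<subseteq> C" for C'
    using that
  proof (induction C')
    case (insert b C')
    then have "S (\<lambda>g. (\<psi> (k b) g - \<psi> (k b) b) * (\<Prod>b\<in>C'. (\<psi> (k b) g - \<psi> (k b) b)))"
      using k by (intro Sstep) auto
    then show ?case using insert by simp
  qed (use S1 in simp)
  moreover have "finite C" using G by (simp add: C_def)
  ultimately have "S (\<lambda>g. \<Prod>b\<in>C. (\<psi> (k b) g - \<psi> (k b) b))" by blast
  then have "(\<Sum>g\<in>carrier G. inverse (\<chi> g) * L (\<lambda>_. 0) g * (\<Prod>b\<in>C. (\<psi> (k b) g - \<psi> (k b) b))) = 0"
    unfolding S_def by blast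
  moreover have "(\<Sum>g\<in>carrier G. inverse (\<chi> g) * L (\<lambda>_. 0) g * (\<Prod>b\<in>C. (\<psi> (k b) g - \<psi> (k b) b))) =
      (\<Sum>g\<in>B. (\<Prod>b\<in>C. (1 - \<psi> (k b) b)))"
  proof (rule sum.mono_neutral_cong_right)
    show "\<forall>g\<in>carrier G - B. inverse (\<chi> g) * L (\<lambda>_. 0) g * (\<Prod>b\<in>C. (\<psi> (k b) g - \<psi> (k b) b)) = 0"
      using \<open>finite C\<close> by (auto simp: C_def)
    show "inverse (\<chi> g) * L (\<lambda>_. 0) g * (\<Prod>b\<in>C. (\<psi> (k b) g - \<psi> (k b) b)) = (\<Prod>b\<in>C. (1 - \<psi> (k b) b))"
      if "g \<in> B" for g
    proof -
      have "\<chi> g = 1" using that ker by (auto simp: B_def)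
      moreover have "(\<Prod>b\<in>C. (\<psi> (k b) g - \<psi> (k b) b)) = (\<Prod>b\<in>C. (1 - \<psi> (k b) b))"
        using that k by (intro prod.cong) (auto simp: B_def)
      ultimately show ?thesis by (simp add: L_def)
    qed
  qed (use G in \<open>auto simp: B_def\<close>)
  \<comment> \<open>On the kernel \<open>B\<close> the character \<open>\<chi>\<close> is one, so
    orthogonality forces the order of \<open>B\<close> to be zero in the field, although it divides
    the order of \<open>G\<close>.\<close>
  ultimately have "of_nat (card B) * (\<Prod>b\<in>C. (1 - \<psi> (k b) b)) = 0" by simp
  moreover have "(\<Prod>b\<in>C. (1 - \<psi> (k b) b)) \<noteq> 0"
    using k \<open>finite C\<close> by auto
  ultimately have cB: "of_nat (card B) = (0::'f)" by simp
  have "subgroup B G"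
  proof (rule subgroupI)
    show "B \<noteq> {}" using hom1[OF \<psi>] by (auto simp: B_def)
    show "inv a \<in> B" if "a \<in> B" for a
    proof -
      have "\<psi> i (inv a) = 1" if "i \<in> I" for i
        using homm[OF \<psi>[OF that], of a "inv a"] hom1[OF \<psi>[OF that]] \<open>a \<in> B\<close> that by (auto simp: B_def)
      then show ?thesis using that by (auto simp: B_def)
    qed
  qed (use homm[OF \<psi>] in \<open>auto simp: B_def\<close>)
  then have "card B dvd order G" using lagrange by (metis dvd_triv_right)
  then show False using cB char by (auto elim!: dvdE)
qed

section \<open>Polynomial functions on a diagonal representation\<close>

text \<open>Over a finite field, one plus the product of all linear factors X - a has no
  root.\<close>

lemma infinite_alg_closed_field: "infinite (UNIV :: 'f::alg_closed_field set)"
proof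
  assume fin: "finite (UNIV :: 'f set)"
  define p :: "'f poly" where "p = (\<Prod>a\<in>UNIV. [:- a, 1:])"
  have "degree p = card (UNIV :: 'f set)"
    unfolding p_def by (subst degree_prod_eq_sum_degree) auto
  then have "degree p > 0" using fin by (simp add: card_gt_0_iff)
  then have "degree (p + 1) > 0" by (simp add: degree_add_eq_left)
  then obtain z where "poly (p + 1) z = 0" using alg_closed_imp_poly_has_root by blast
  moreover have "poly p z = 0" using fin by (auto simp: p_def poly_prod)
  ultimately show False by simp
qed

lemma poly_fun_apply: "poly (p :: ('v \<Rightarrow> 'f::comm_ring_1) poly) t v = poly (map_poly (\<lambda>f. f v) p) (t v)"
  by (induction p) (auto simp: map_poly_pCons)

lemma vector_space_fun_scale: "vector_space (fun_scale :: 'f::field \<Rightarrow> ('v \<Rightarrow> 'f) \<Rightarrow> 'v \<Rightarrow> 'f)"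
  by unfold_locales (auto simp: fun_scale_def algebra_simps)

text \<open>Induction on the functionals. If some vector is killed by all earlier functionals but
  not by \<open>x k\<close>, a suitable multiple of \<open>x k\<close> can be subtracted from
  \<open>f\<close> so that the condition at \<open>k\<close> may be dropped; otherwise that
  condition is implied by the others.\<close>

lemma (in vector_space) functional_in_span:
  assumes "finite I" "\<And>i. i \<in> I \<Longrightarrow> Vector_Spaces.linear scale (*) (x i)" "Vector_Spaces.linear scale (*) f"
    and "\<And>v. (\<And>i. i \<in> I \<Longrightarrow> x i v = 0) \<Longrightarrow> f v = 0"
  shows "f \<in> module.span fun_scale (x ` I)"
  using assms
proof (induction I arbitrary: f)
  case empty
  interpret FS: vector_space "fun_scale :: 'a \<Rightarrow> ('b \<Rightarrow> 'a) \<Rightarrow> 'b \<Rightarrow> 'a" by (rule vector_space_fun_scale)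
  have "f = 0" using empty by (auto simp: fun_eq_iff)
  then show ?case by (metis FS.span_zero)
next
  case (insert k I)
  interpret FS: vector_space "fun_scale :: 'a \<Rightarrow> ('b \<Rightarrow> 'a) \<Rightarrow> 'b \<Rightarrow> 'a" by (rule vector_space_fun_scale)
  have lin: "x k (u + w) = x k u + x k w" "f (u + w) = f u + f w" "x k (scale c u) = c * x k u" "f (scale c u) = c * f u"
    "i \<in> I \<Longrightarrow> x i (u + w) = x i u + x i w" "i \<in> I \<Longrightarrow> x i (scale c u) = c * x i u" for u w c i
    using insert.prems(1)[of k] insert.prems(1)[of i] insert.prems(2)
    by (simp_all add: Vector_Spaces.linear_iff)
  show ?case
  proof (cases "\<forall>v. (\<forall>i\<in>I. x i v = 0) \<longrightarrow> x k v = 0")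
    case True
    have "f \<in> FS.span (x ` I)"
    proof (rule insert.IH)
      show "f v = 0" if "\<And>i. i \<in> I \<Longrightarrow> x i v = 0" for v
        using insert.prems(3)[of v] True that by blast
    qed (use insert.prems in auto)
    then show ?thesis using FS.span_mono[of "x ` I" "x ` insert k I"] by auto
  next
    case False
    then obtain w0 where w0: "\<forall>i\<in>I. x i w0 = 0" "x k w0 \<noteq> 0" by blast
    define w where "w = scale (inverse (x k w0)) w0"
    have w: "i \<in> I \<Longrightarrow> x i w = 0" "x k w = 1" for i using w0 lin by (auto simp: w_def)
    define h where "h = f - fun_scale (f w) (x k)"
    have "h \<in> FS.span (x ` I)"
    proof (rule insert.IH)
      show "Vector_Spaces.linear scale (*) (x i)" if "i \<in> I" for i using insert.prems that by auto
      show "Vector_Spaces.linear scale (*) h"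
        using insert.prems(2) lin by (auto simp: Vector_Spaces.linear_iff h_def fun_scale_def algebra_simps)
      fix v assume v: "\<And>i. i \<in> I \<Longrightarrow> x i v = 0"
      define v' where "v' = v + scale (- x k v) w"
      have "x k v' = x k v + (- x k v) * x k w" unfolding v'_def by (simp only: lin)
      moreover have "x i v' = x i v + (- x k v) * x i w" if "i \<in> I" for i
        unfolding v'_def using that by (simp only: lin)
      ultimately have "x i v' = 0" if "i \<in> insert k I" for i
        using that v w by auto
      then have "f v' = 0" using insert.prems(3) by blast
      moreover have "f v' = f v + (- x k v) * f w" unfolding v'_def by (simp only: lin)
      ultimately show "h v = 0"
        by (simp add: h_def fun_scale_def algebra_simps)
    qed
    then have "h \<in> FS.span (x ` insert k I)" using FS.span_mono[of "x ` I" "x ` insert k I"] by auto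
    moreover have "fun_scale (f w) (x k) \<in> FS.span (x ` insert k I)"
      by (intro FS.span_scale FS.span_base) auto
    ultimately have "h + fun_scale (f w) (x k) \<in> FS.span (x ` insert k I)" by (rule FS.span_add)
    then show ?thesis by (simp add: h_def)
  qed
qed

locale diagonal_rep =
  fixes G :: "('g, 'm) monoid_scheme"
    and scale :: "'f::alg_closed_field \<Rightarrow> 'v::ab_group_add \<Rightarrow> 'v"
    and \<rho> :: "'g \<Rightarrow> 'v \<Rightarrow> 'v"
    and n :: nat
    and x :: "nat \<Rightarrow> 'v \<Rightarrow> 'f"
    and \<chi> :: "nat \<Rightarrow> 'g \<Rightarrow> 'f"
  assumes G: "comm_group G" "finite (carrier G)"
    and char: "\<not> CHAR('f) dvd order G"
    and V: "vector_space scale" "\<exists>B. finite B \<and> module.span scale B = UNIV"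
    and \<rho>: "\<rho> \<in> hom G (GL scale)"
    and n: "n \<ge> 1"
    and basis: "inj_on x {1..n}" "\<not> module.dependent fun_scale (x ` {1..n})"
      "module.span fun_scale (x ` {1..n}) = dual_space scale"
    and \<chi>: "\<And>i. i \<in> {1..n} \<Longrightarrow> \<chi> i \<in> carrier (char_group G)"
    and weights: "\<And>i g. i \<in> {1..n} \<Longrightarrow> g \<in> carrier G \<Longrightarrow> act G \<rho> g (x i) = fun_scale (\<chi> i g) (x i)"
begin

sublocale V: vector_space scale by (rule V(1))
sublocale FS: vector_space "fun_scale :: 'f \<Rightarrow> ('v \<Rightarrow> 'f) \<Rightarrow> 'v \<Rightarrow> 'f" by (rule vector_space_fun_scale)
sublocale G: comm_group G by (rule G(1))

definition I where "I = {1..n}"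

lemma finite_I [simp, intro]: "finite I" and card_I: "card I = n"
  by (simp_all add: I_def)

lemmas basis_I = basis[folded I_def] and weights_I = weights[folded I_def] and \<chi>_I = \<chi>[folded I_def]

lemma x_dual: "i \<in> I \<Longrightarrow> x i \<in> dual_space scale"
  unfolding basis_I(3)[symmetric] by (intro FS.span_base imageI)

lemma dual_linear:
  assumes "f \<in> dual_space scale"
  shows "f (u + w) = f u + f w" "f (scale c u) = c * f u" "f 0 = 0" "f (u - w) = f u - f w" "f (sum h J) = (\<Sum>j\<in>J. f (h j))"
proof -
  have l: "Vector_Spaces.linear scale (*) f" using assms by (simp add: dual_space_def)
  then interpret l: Vector_Spaces.linear scale "(*)" f .
  show "f (u + w) = f u + f w" "f (scale c u) = c * f u" "f 0 = 0" "f (u - w) = f u - f w" "f (sum h J) = (\<Sum>j\<in>J. f (h j))"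
    by (simp_all add: l.add l.scale l.zero l.diff l.sum)
qed

lemmas x_linear = dual_linear[OF x_dual]

text \<open>Without such a vector, \<open>x i\<close> would vanish on the common kernel of the other
  coordinates and hence lie in their span, against linear independence.\<close>

lemma dual_basis_ex:
  assumes i: "i \<in> I"
  shows "\<exists>v. x i v = 1 \<and> (\<forall>j\<in>I - {i}. x j v = 0)"
proof (rule ccontr)
  assume neg: "\<not> ?thesis"
  have "x i \<in> FS.span (x ` (I - {i}))"
  proof (rule V.functional_in_span)
    show "Vector_Spaces.linear scale (*) (x j)" if "j \<in> I - {i}" for j
      using x_dual that by (auto simp: dual_space_def)
    show "Vector_Spaces.linear scale (*) (x i)" using x_dual i by (auto simp: dual_space_def)
    fix v assume v: "\<And>j. j \<in> I - {i} \<Longrightarrow> x j v = 0"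
    show "x i v = 0"
    proof (rule ccontr)
      assume "x i v \<noteq> 0"
      then have "x i (scale (inverse (x i v)) v) = 1 \<and> (\<forall>j\<in>I - {i}. x j (scale (inverse (x i v)) v) = 0)"
        using i v by (auto simp: x_linear)
      then show False using neg by blast
    qed
  qed simp
  moreover have "x ` (I - {i}) = x ` I - {x i}"
    using inj_on_image_set_diff[OF basis_I(1), of I "{i}"] i by simp
  ultimately have "FS.dependent (x ` I)"
    unfolding FS.dependent_def using i by (metis imageI)
  then show False using basis_I(2) by blast
qed

text \<open>The basis of \<open>V\<close> dual to the coordinates.\<close>

definition e :: "nat \<Rightarrow> 'v" where
  "e i = (SOME v. x i v = 1 \<and> (\<forall>j\<in>I - {i}. x j v = 0))"

lemma x_e: "i \<in> I \<Longrightarrow> j \<in> I \<Longrightarrow> x j (e i) = (if j = i then 1 else 0)"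
  using someI_ex[OF dual_basis_ex[of i]] by (auto simp: e_def)

text \<open>A nonzero difference \<open>u - w\<close> is detected by some linear functional, and all
  functionals are combinations of the \<open>x i\<close>.\<close>

lemma vec_eqI:
  assumes "\<And>i. i \<in> I \<Longrightarrow> x i u = x i w"
  shows "u = w"
proof (rule ccontr)
  assume "u \<noteq> w"
  then have "V.independent {u - w}" by simp
  interpret VP: vector_space_pair scale "(*) :: 'f \<Rightarrow> 'f \<Rightarrow> 'f"
    by unfold_locales (auto simp: algebra_simps)
  obtain f where f: "Vector_Spaces.linear scale (*) f" "f (u - w) = 1"
    using VP.linear_independent_extend[OF \<open>V.independent {u - w}\<close>, of "\<lambda>_. 1"] by auto
  have "f \<in> FS.span (x ` I)" using f basis_I(3) by (simp add: dual_space_def)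
  then have "f (u - w) = 0"
  proof (induction rule: FS.span_induct_alt)
    case (step c y h)
    then show ?case using assms x_linear(4) by (auto simp: fun_scale_def)
  qed simp
  then show False using f by simp
qed

definition vec :: "(nat \<Rightarrow> 'f) \<Rightarrow> 'v" where
  "vec a = (\<Sum>i\<in>I. scale (a i) (e i))"

lemma x_vec: "i \<in> I \<Longrightarrow> x i (vec a) = a i"
  by (simp add: vec_def x_linear x_e if_distrib cong: if_cong)

lemma vec_x: "vec (\<lambda>i. x i v) = v"
  by (rule vec_eqI) (simp add: x_vec)

lemma dual_expand: "f \<in> dual_space scale \<Longrightarrow> f v = (\<Sum>i\<in>I. f (e i) * x i v)"
proof -
  assume f: "f \<in> dual_space scale"
  have "f (vec (\<lambda>i. x i v)) = (\<Sum>i\<in>I. f (e i) * x i v)"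
    by (simp add: vec_def dual_linear[OF f] mult.commute)
  then show ?thesis by (simp add: vec_x)
qed

lemma e_inj: "inj_on e I"
  using x_e by (intro inj_onI) (metis zero_neq_one)

lemma e_independent:
  assumes "J \<subseteq> I" shows "V.independent (e ` J)"
proof (rule V.independent_if_scalars_zero)
  show "finite (e ` J)" using finite_subset[OF assms finite_I] by auto
  fix f y assume s: "(\<Sum>y\<in>e ` J. scale (f y) y) = 0" and "y \<in> e ` J"
  then obtain j where j: "j \<in> J" "y = e j" by blast
  have "inj_on e J" using e_inj assms inj_on_subset by blast
  then have "(\<Sum>i\<in>J. scale (f (e i)) (e i)) = 0" using s by (simp add: sum.reindex)
  then have "x j (\<Sum>i\<in>J. scale (f (e i)) (e i)) = 0" using j assms x_linear(3)[of j] by auto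
  moreover have "x j (\<Sum>i\<in>J. scale (f (e i)) (e i)) = (\<Sum>i\<in>J. if i = j then f (e i) else 0)"
  proof -
    have jI: "j \<in> I" using j assms by blast
    have "x j (scale (f (e i)) (e i)) = (if i = j then f (e i) else 0)" if "i \<in> J" for i
    proof -
      have "i \<in> I" using that assms by blast
      then show ?thesis using x_linear(2)[OF jI] x_e[OF _ jI] by simp
    qed
    then show ?thesis unfolding x_linear(5)[OF jI] by (intro sum.cong refl)
  qed
  ultimately show "f y = 0" using j assms finite_subset[OF assms finite_I] by simp
qed

lemma dim_span_e: "J \<subseteq> I \<Longrightarrow> V.dim (V.span (e ` J)) = card J"
  using V.dim_span_eq_card_independent[OF e_independent] card_image[OF inj_on_subset[OF e_inj]] by simp

lemma span_e:
  assumes "J \<subseteq> I" shows "v \<in> V.span (e ` J) \<longleftrightarrow> (\<forall>i\<in>I - J. x i v = 0)"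
proof
  assume "v \<in> V.span (e ` J)"
  then show "\<forall>i\<in>I - J. x i v = 0"
  proof (induction rule: V.span_induct_alt)
    case base
    then show ?case using x_linear(3) by auto
  next
    case (step c y z)
    then show ?case using assms by (auto simp: x_linear x_e)
  qed
next
  assume *: "\<forall>i\<in>I - J. x i v = 0"
  have "v = (\<Sum>i\<in>J. scale (x i v) (e i))"
  proof (rule vec_eqI)
    fix i assume "i \<in> I"
    then show "x i v = x i (\<Sum>i\<in>J. scale (x i v) (e i))"
    proof -
      have "x i (scale (x j v) (e j)) = (if j = i then x i v else 0)" if "j \<in> J" for j
      proof -
        have "j \<in> I" using that assms by blast
        then show ?thesis using x_linear(2)[OF \<open>i \<in> I\<close>] x_e[OF _ \<open>i \<in> I\<close>] by simp
      qed
      then have "x i (\<Sum>j\<in>J. scale (x j v) (e j)) = (\<Sum>j\<in>J. if j = i then x i v else 0)"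
        unfolding x_linear(5)[OF \<open>i \<in> I\<close>] by (intro sum.cong refl)
      then show ?thesis using * \<open>i \<in> I\<close> finite_subset[OF assms finite_I] by simp
    qed
  qed
  also have "\<dots> \<in> V.span (e ` J)"
    by (intro V.span_sum V.span_scale V.span_base imageI)
  finally show "v \<in> V.span (e ` J)" .
qed

lemma span_e_UNIV: "V.span (e ` I) = UNIV"
  using span_e[of I] by auto

lemma dim_UNIV: "V.dim UNIV = n"
  using dim_span_e[of I] span_e_UNIV by (simp add: card_I)


subsection \<open>The action\<close>

lemma \<chi>_hom: "i \<in> I \<Longrightarrow> \<chi> i \<in> hom G unit_group"
  using \<chi>_I by (auto simp: char_group_def)

lemma \<chi>_mult: "i \<in> I \<Longrightarrow> g \<in> carrier G \<Longrightarrow> h \<in> carrier G \<Longrightarrow> \<chi> i (g \<otimes>\<^bsub>G\<^esub> h) = \<chi> i g * \<chi> i h"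
  using \<chi>_hom by (auto simp: hom_def unit_group_def)

lemma \<chi>_nonzero: "i \<in> I \<Longrightarrow> g \<in> carrier G \<Longrightarrow> \<chi> i g \<noteq> 0"
  using \<chi>_hom[of i] by (auto simp: hom_def unit_group_def)

lemma \<chi>_one: "i \<in> I \<Longrightarrow> \<chi> i \<one>\<^bsub>G\<^esub> = 1"
  using \<chi>_mult[of i "\<one>\<^bsub>G\<^esub>" "\<one>\<^bsub>G\<^esub>"] \<chi>_nonzero[of i "\<one>\<^bsub>G\<^esub>"] by simp

lemma x_act: "i \<in> I \<Longrightarrow> g \<in> carrier G \<Longrightarrow> x i (\<rho> (inv\<^bsub>G\<^esub> g) v) = \<chi> i g * x i v"
  using weights_I[of i g] by (auto simp: act_def fun_scale_def fun_eq_iff)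

text \<open>The action on functions goes through the inverse, so \<open>\<rho> g\<close> multiplies
  the coordinate \<open>x i\<close> by the inverse of \<open>\<chi> i g\<close>.\<close>

lemma x_act': "i \<in> I \<Longrightarrow> g \<in> carrier G \<Longrightarrow> \<chi> i g * x i (\<rho> g v) = x i v"
  using x_act[of i "inv\<^bsub>G\<^esub> g" v] \<chi>_mult[of i g "inv\<^bsub>G\<^esub> g"] \<chi>_one
  by (simp flip: mult.assoc)

lemma \<rho>_eq_iff:
  assumes "g \<in> carrier G" "h \<in> carrier G"
  shows "\<rho> g = \<rho> h \<longleftrightarrow> (\<forall>i\<in>I. \<chi> i g = \<chi> i h)"
proof
  assume eq: "\<rho> g = \<rho> h"
  show "\<forall>i\<in>I. \<chi> i g = \<chi> i h"
  proof
    fix i assume i: "i \<in> I"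
    let ?v = "\<rho> g (e i)"
    have "\<chi> i g * x i ?v = 1" using x_act'[OF i assms(1), of "e i"] x_e[OF i i] by simp
    moreover have "\<chi> i h * x i ?v = 1" using x_act'[OF i assms(2), of "e i"] x_e[OF i i] eq by simp
    ultimately show "\<chi> i g = \<chi> i h" by (metis mult_cancel_right mult_zero_right zero_neq_one)
  qed
next
  assume *: "\<forall>i\<in>I. \<chi> i g = \<chi> i h"
  show "\<rho> g = \<rho> h"
  proof (rule ext, rule vec_eqI)
    fix v i assume i: "i \<in> I"
    show "x i (\<rho> g v) = x i (\<rho> h v)"
      using x_act'[OF i assms(1), of v] x_act'[OF i assms(2), of v] * i \<chi>_nonzero[OF i assms(1)]
      by (metis mult_cancel_left)
  qed
qed

lemma \<rho>_mult: "g \<in> carrier G \<Longrightarrow> h \<in> carrier G \<Longrightarrow> \<rho> (g \<otimes>\<^bsub>G\<^esub> h) = \<rho> g \<circ> \<rho> h"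
  using \<rho> by (auto simp: hom_def GL_def)

lemma \<rho>_one: "\<rho> \<one>\<^bsub>G\<^esub> = id"
proof (rule ext, rule vec_eqI)
  fix v i assume i: "i \<in> I"
  show "x i (\<rho> \<one>\<^bsub>G\<^esub> v) = x i (id v)"
    using x_act'[OF i G.one_closed, of v] \<chi>_one[OF i] by simp
qed

lemma \<rho>_linear: "g \<in> carrier G \<Longrightarrow> Vector_Spaces.linear scale scale (\<rho> g)"
  using \<rho> by (auto simp: hom_def GL_def)

text \<open>The subgroup of elements of \<open>G\<close> that act only on the \<open>i\<close>-th coordinate: the pseudoreflections along it,
  and the kernel of the representation.\<close>

definition refl_group :: "nat \<Rightarrow> 'g set" where
  "refl_group i = {g \<in> carrier G. \<forall>j\<in>I - {i}. \<chi> j g = 1}"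

text \<open>\<open>\<rho> g\<close> is diagonal, so its fixed space is spanned by the
  \<open>e i\<close> with \<open>\<chi> i g = 1\<close>. It contains a hyperplane exactly when at
  most one coordinate is moved.\<close>

lemma pseudoreflection_iff:
  assumes g: "g \<in> carrier G"
  shows "pseudoreflection scale (\<rho> g) \<longleftrightarrow> (\<exists>i\<in>I. \<chi> i g \<noteq> 1 \<and> g \<in> refl_group i)"
proof
  assume "\<exists>i\<in>I. \<chi> i g \<noteq> 1 \<and> g \<in> refl_group i"
  then obtain i where i: "i \<in> I" "\<chi> i g \<noteq> 1" "\<And>j. j \<in> I \<Longrightarrow> j \<noteq> i \<Longrightarrow> \<chi> j g = 1"
    by (auto simp: refl_group_def)
  have "\<rho> g \<noteq> id"
    using \<rho>_eq_iff[OF g G.one_closed] \<rho>_one \<chi>_one i by auto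
  moreover have "\<not> unipotent (\<rho> g)"
  proof
    assume "unipotent (\<rho> g)"
    then obtain k where k: "((\<lambda>v. \<rho> g v - v) ^^ k) = (\<lambda>v. 0)" by (auto simp: unipotent_def)
    \<comment> \<open>The eigenvalue of \<open>\<rho> g - id\<close> on \<open>e i\<close>. It is
      nonzero, so no power of that map vanishes.\<close>
    define c where "c = inverse (\<chi> i g) - 1"
    have "c \<noteq> 0" using i(2) by (auto simp: c_def field_simps)
    have step: "x i (\<rho> g v - v) = c * x i v" for v
      using x_act'[OF i(1) g, of v] \<chi>_nonzero[OF i(1) g] i(1) by (auto simp: x_linear c_def field_simps)
    have "x i (((\<lambda>v. \<rho> g v - v) ^^ k) (e i)) = c ^ k" for k
      by (induction k) (use step x_e[OF i(1) i(1)] in auto)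
    then have "c ^ k = x i 0" using k by (metis)
    then show False using \<open>c \<noteq> 0\<close> x_linear(3)[OF i(1)] by simp
  qed
  moreover have "\<rho> g v = v" if "v \<in> V.span (e ` (I - {i}))" for v
  proof (rule vec_eqI)
    fix j assume j: "j \<in> I"
    show "x j (\<rho> g v) = x j v"
    proof (cases "j = i")
      case True
      then have "x j v = 0" using that span_e[of "I - {i}"] i(1) by auto
      then show ?thesis using x_act'[OF j g, of v] \<chi>_nonzero[OF j g] by auto
    next
      case False
      then show ?thesis using x_act'[OF j g, of v] i(3)[OF j] by simp
    qed
  qed
  moreover have "V.dim (V.span (e ` (I - {i}))) + 1 = V.dim UNIV"
    using dim_span_e[of "I - {i}"] i(1) n by (simp add: dim_UNIV card_I)
  ultimately show "pseudoreflection scale (\<rho> g)"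
    unfolding pseudoreflection_def using \<rho>_linear[OF g] V.subspace_span by blast
next
  assume "pseudoreflection scale (\<rho> g)"
  then obtain W where W: "\<rho> g \<noteq> id" "V.dim W + 1 = n" "\<And>v. v \<in> W \<Longrightarrow> \<rho> g v = v"
    by (auto simp: pseudoreflection_def dim_UNIV)
  define J where "J = {j \<in> I. \<chi> j g = 1}"
  have J: "J \<subseteq> I" "finite J" by (auto simp: J_def)
  have "W \<subseteq> V.span (e ` J)"
  proof
    fix v assume v: "v \<in> W"
    have "x i v = 0" if "i \<in> I - J" for i
    proof -
      have "\<chi> i g * x i v = x i v" using x_act'[of i g v] W(3)[OF v] g that by auto
      moreover have "\<chi> i g \<noteq> 1" using that by (auto simp: J_def)
      ultimately show ?thesis by auto
    qed
    then show "v \<in> V.span (e ` J)" using span_e[OF J(1)] by auto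
  qed
  then have "V.dim W \<le> card (e ` J)" using V.dim_le_card J by blast
  also have "\<dots> \<le> card J" by (rule card_image_le[OF J(2)])
  finally have "card (I - J) \<le> 1" using W(2) card_Diff_subset[OF J(2,1)] card_I by simp
  moreover obtain i where i: "i \<in> I" "\<chi> i g \<noteq> 1"
    using \<rho>_eq_iff[OF g G.one_closed] \<rho>_one \<chi>_one W(1) by auto
  ultimately have "j = i" if "j \<in> I" "\<chi> j g \<noteq> 1" for j
    using that card_le_Suc0_iff_eq[of "I - J"] by (auto simp: J_def)
  then show "\<exists>i\<in>I. \<chi> i g \<noteq> 1 \<and> g \<in> refl_group i" using i g by (auto simp: refl_group_def)
qed


subsection \<open>The ring of polynomial functions\<close>

abbreviation R where "R \<equiv> poly_ring scale"

lemma R_x: "i \<in> I \<Longrightarrow> x i \<in> R"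
  using x_dual poly_ring.dual by blast

lemma R_0: "0 \<in> R" and R_1: "1 \<in> R"
  using poly_ring.const[of 0 scale] poly_ring.const[of 1 scale] by (simp_all add: zero_fun_def one_fun_def)

lemma R_sum: "(\<And>j. j \<in> J \<Longrightarrow> f j \<in> R) \<Longrightarrow> (\<Sum>j\<in>J. f j) \<in> R"
  by (induction J rule: infinite_finite_induct) (auto intro: poly_ring.add R_0)

lemma sum_fun_apply: "(\<Sum>j\<in>J. f j) v = (\<Sum>j\<in>J. f j v)" for f :: "'j \<Rightarrow> 'v \<Rightarrow> 'f"
  by (induction J rule: infinite_finite_induct) auto

lemma prod_fun_apply: "(\<Prod>j\<in>J. f j) v = (\<Prod>j\<in>J. f j v)" for f :: "'j \<Rightarrow> 'v \<Rightarrow> 'f"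
  by (induction J rule: infinite_finite_induct) auto

lemma power_fun_apply: "(f ^ k) v = f v ^ k" for f :: "'v \<Rightarrow> 'f"
  by (induction k) auto

lemma R_uminus: "f \<in> R \<Longrightarrow> - f \<in> R"
proof -
  assume "f \<in> R"
  then have "(\<lambda>v. -1) * f \<in> R" by (intro poly_ring.mult poly_ring.const)
  moreover have "(\<lambda>v. -1) * f = - f" by (rule ext) simp
  ultimately show "- f \<in> R" by simp
qed

lemma R_compose:
  assumes L: "\<And>i. i \<in> I \<Longrightarrow> (\<lambda>v. x i (L v)) \<in> R" and f: "f \<in> R"
  shows "(\<lambda>v. f (L v)) \<in> R"
  using f
proof induction
  case (dual f)
  have "(\<lambda>v. f (L v)) = (\<Sum>i\<in>I. (\<lambda>_. f (e i)) * (\<lambda>v. x i (L v)))"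
    by (rule ext, unfold sum_fun_apply times_fun_apply, rule dual_expand[OF dual])
  then show ?case using L by (auto intro!: R_sum poly_ring.mult poly_ring.const)
next
  case (add f h)
  then show ?case using poly_ring.add[OF add.IH] by (simp add: plus_fun_def)
next
  case (mult f h)
  then show ?case using poly_ring.mult[OF mult.IH] by (simp add: times_fun_def)
qed (rule poly_ring.const)

text \<open>The polynomial ring in the coordinates with index in \<open>A\<close>, described through
  dependence on these coordinates: \<open>P {}\<close> consists of the constants and
  \<open>P I\<close> is F[V]. Factoriality is proved by adding one coordinate at a time.\<close>

definition P :: "nat set \<Rightarrow> ('v \<Rightarrow> 'f) set" where
  "P A = {f \<in> R. \<forall>v w. (\<forall>i\<in>A. x i v = x i w) \<longrightarrow> f v = f w}"

lemma P_I: "P I = R"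
proof -
  have "u = w" if "\<forall>i\<in>I. x i u = x i w" for u w using that vec_eqI by blast
  then show ?thesis unfolding P_def by blast
qed

lemma P_mono: "A \<subseteq> B \<Longrightarrow> P A \<subseteq> P B"
  unfolding P_def by blast

lemma P_x: "i \<in> A \<Longrightarrow> A \<subseteq> I \<Longrightarrow> x i \<in> P A"
  using R_x by (auto simp: P_def)

lemma P_const: "(\<lambda>v. c) \<in> P A"
  by (auto simp: P_def poly_ring.const)

lemma P_ring: "f \<in> P A \<Longrightarrow> h \<in> P A \<Longrightarrow> f + h \<in> P A" "f \<in> P A \<Longrightarrow> h \<in> P A \<Longrightarrow> f * h \<in> P A"
  "f \<in> P A \<Longrightarrow> - f \<in> P A" "0 \<in> P A" "1 \<in> P A"
  using R_0 R_1 R_uminus poly_ring.add[of f scale h] poly_ring.mult[of f scale h]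
  unfolding P_def by (auto simp: fun_Compl_def) metis+

definition upd :: "nat \<Rightarrow> 'f \<Rightarrow> 'v \<Rightarrow> 'v" where
  "upd i c v = vec ((\<lambda>j. x j v)(i := c))"

lemma x_upd: "j \<in> I \<Longrightarrow> x j (upd i c v) = (if j = i then c else x j v)"
  by (simp add: upd_def x_vec)

lemma upd_same: "upd i (x i v) v = v"
  by (rule vec_eqI) (simp add: x_upd)

text \<open>Composition with \<open>proj A\<close> retracts F[V] onto \<open>P A\<close>.\<close>

definition proj :: "nat set \<Rightarrow> 'v \<Rightarrow> 'v" where
  "proj A v = vec (\<lambda>i. if i \<in> A then x i v else 0)"

lemma x_proj: "j \<in> I \<Longrightarrow> x j (proj A v) = (if j \<in> A then x j v else 0)"
  by (simp add: proj_def x_vec)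

lemma R_upd: "f \<in> R \<Longrightarrow> (\<lambda>v. f (upd i c v)) \<in> R"
proof (rule R_compose)
  show "(\<lambda>v. x j (upd i c v)) \<in> R" if "j \<in> I" for j
    using that by (cases "j = i") (simp_all add: x_upd poly_ring.const R_x)
qed

lemma R_proj: "f \<in> R \<Longrightarrow> (\<lambda>v. f (proj A v)) \<in> R"
proof (rule R_compose)
  show "(\<lambda>v. x j (proj A v)) \<in> R" if "j \<in> I" for j
    using that by (cases "j \<in> A") (simp_all add: x_proj poly_ring.const R_x)
qed

lemma P_proj: "f \<in> R \<Longrightarrow> (\<lambda>v. f (proj A v)) \<in> P A"
proof -
  assume f: "f \<in> R"
  have "proj A v = proj A w" if "\<forall>i\<in>A. x i v = x i w" for v w
    by (rule vec_eqI) (use that in \<open>auto simp: x_proj\<close>)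
  then have "\<forall>v w. (\<forall>i\<in>A. x i v = x i w) \<longrightarrow> f (proj A v) = f (proj A w)" by metis
  then show ?thesis using R_proj[OF f, of A] unfolding P_def mem_Collect_eq by blast
qed

lemma P_proj_same: "f \<in> P A \<Longrightarrow> A \<subseteq> I \<Longrightarrow> f (proj A v) = f v"
  by (auto simp: P_def x_proj subset_iff)

text \<open>At a fixed point the coefficients do not change when the \<open>i\<close>-th coordinate
  varies. This gives a polynomial over the field that vanishes at every element of it, and the field
  is infinite.\<close>

lemma poly_fun_transcendental:
  assumes p: "\<And>j. coeff p j \<in> P A" and i: "i \<notin> A" "i \<in> I" "A \<subseteq> I" and zero: "poly p (x i) = 0"
  shows "p = 0"
proof (rule poly_eqI)
  fix j
  have "coeff p j v = 0" for v
  proof -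
    define q where "q = map_poly (\<lambda>f. f v) p"
    have "poly q c = 0" for c
    proof -
      let ?w = "upd i c v"
      have "coeff p k ?w = coeff p k v" for k
        using p[of k] i unfolding P_def by (auto simp: x_upd subset_iff)
      then have "map_poly (\<lambda>f. f ?w) p = q"
        unfolding q_def by (intro poly_eqI) (simp add: coeff_map_poly)
      then show ?thesis using poly_fun_apply[of p "x i" ?w] zero i(2) by (simp add: x_upd)
    qed
    then have "q = 0" using poly_roots_finite[of q] infinite_alg_closed_field by auto
    then show ?thesis unfolding q_def by (metis (no_types) coeff_map_poly coeff_0 zero_fun_apply)
  qed
  then show "coeff p j = coeff 0 j" by (auto simp: fun_eq_iff)
qed

lemma P_insert:
  assumes "subdomain (P A)" and i: "i \<notin> A" "i \<in> I" "A \<subseteq> I"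
  shows "P (insert i A) = (\<lambda>p. poly p (x i)) ` subdomain.polys (P A)"
proof
  interpret S: subdomain "P A" by fact
  interpret PS: subdomain S.polys by (rule S.subdomain_polys)
  let ?Q = "(\<lambda>p. poly p (x i)) ` S.polys"
  show "?Q \<subseteq> P (insert i A)"
  proof
    fix f assume "f \<in> ?Q"
    then obtain p where p: "p \<in> S.polys" "f = poly p (x i)" by blast
    have "poly p (x i) \<in> P (insert i A)"
      unfolding poly_altdef
    proof -
      have xP: "x i \<in> P (insert i A)" using P_x i by simp
      have "x i ^ k \<in> P (insert i A)" for k
      proof (induction k)
        case 0
        show ?case unfolding power_0 by (rule P_ring(5))
      next
        case (Suc k)
        show ?case unfolding power_Suc by (rule P_ring(2)[OF xP Suc])
      qed
      then have "coeff p k * x i ^ k \<in> P (insert i A)" for k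
        using S.coeff_in[OF p(1)] P_mono[of A "insert i A"] P_ring(2) by blast
      then have "(\<Sum>k\<in>K. coeff p k * x i ^ k) \<in> P (insert i A)" for K
        by (induction K rule: infinite_finite_induct) (auto intro: P_ring)
      then show "(\<Sum>k\<le>degree p. coeff p k * x i ^ k) \<in> P (insert i A)" .
    qed
    then show "f \<in> P (insert i A)" using p by simp
  qed
  \<comment> \<open>A function in \<open>P (insert i A)\<close> may be built from functions outside
    of that ring, so the induction runs over all of \<open>R\<close>, with the remaining coordinates
    set to zero.\<close>
  have *: "(\<lambda>v. f (proj (insert i A) v)) \<in> ?Q" if "f \<in> R" for f
    using that
  proof induction
    case (const c)
    have "(\<lambda>v. c) = poly [:\<lambda>v. c:] (x i)" by simp
    then show ?case using P_const S.polys_const by blast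
  next
    case (dual f)
    let ?p = "[:\<Sum>j\<in>A. (\<lambda>_. f (e j)) * x j, \<lambda>_. f (e i):]"
    have "coeff ?p k \<in> P A" for k
      using P_const P_x[OF _ i(3)] P_ring(4) by (auto simp: coeff_pCons split: nat.splits intro!: S.sum_in P_ring(2))
    then have "?p \<in> S.polys" by (simp add: S.polys_def)
    moreover have "f (proj (insert i A) v) = poly ?p (x i) v" for v
    proof -
      have "f (proj (insert i A) v) = (\<Sum>j\<in>I. f (e j) * (if j \<in> insert i A then x j v else 0))"
        by (subst dual_expand[OF dual]) (simp add: x_proj)
      also have "\<dots> = (\<Sum>j\<in>insert i A. f (e j) * x j v)"
        using i by (intro sum.mono_neutral_cong_right) auto
      also have "\<dots> = f (e i) * x i v + (\<Sum>j\<in>A. f (e j) * x j v)"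
        using i finite_subset[OF i(3) finite_I] by simp
      finally show ?thesis by (simp add: sum_fun_apply)
    qed
    ultimately have "(\<lambda>v. f (proj (insert i A) v)) = poly ?p (x i)" "?p \<in> S.polys" by (auto intro: ext)
    then show ?case by (rule image_eqI)
  next
    case (add f h)
    then obtain p q where "p \<in> S.polys" "q \<in> S.polys" "(\<lambda>v. f (proj (insert i A) v)) = poly p (x i)"
      "(\<lambda>v. h (proj (insert i A) v)) = poly q (x i)" by blast
    then have "(\<lambda>v. (f + h) (proj (insert i A) v)) = poly (p + q) (x i)" "p + q \<in> S.polys"
      using S.polys_add by (auto simp: fun_eq_iff)
    then show ?case by blast
  next
    case (mult f h)
    then obtain p q where "p \<in> S.polys" "q \<in> S.polys" "(\<lambda>v. f (proj (insert i A) v)) = poly p (x i)"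
      "(\<lambda>v. h (proj (insert i A) v)) = poly q (x i)" by blast
    then have "(\<lambda>v. (f * h) (proj (insert i A) v)) = poly (p * q) (x i)" "p * q \<in> S.polys"
      using S.polys_mult by (auto simp: fun_eq_iff)
    then show ?case by blast
  qed
  show "P (insert i A) \<subseteq> ?Q"
  proof
    fix f assume f: "f \<in> P (insert i A)"
    then have "f \<in> R" by (simp add: P_def)
    moreover have "(\<lambda>v. f (proj (insert i A) v)) = f" using P_proj_same[OF f] i by auto
    ultimately show "f \<in> ?Q" using *[of f] by simp
  qed
qed

lemma P_empty: "f \<in> P {} \<longleftrightarrow> (\<exists>c. f = (\<lambda>_. c))"
proof
  assume "f \<in> P {}"
  then have "f v = f 0" for v by (simp add: P_def)
  then show "\<exists>c. f = (\<lambda>_. c)" by blast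
qed (use P_const in blast)

text \<open>Iterates \<open>ufd_adjoin\<close>; the description of the units is carried through the
  same induction.\<close>

lemma ufd_P: "A \<subseteq> I \<Longrightarrow> ufd (P A) \<and> (\<forall>f. f \<in> P A \<longrightarrow> rdvd (P A) f 1 \<longrightarrow> f \<in> P {})"
proof -
  assume "A \<subseteq> I"
  then have "finite A" using finite_subset finite_I by blast
  then show ?thesis using \<open>A \<subseteq> I\<close>
  proof (induction A)
    case empty
    have "ufd (P {})"
    proof
      fix f h assume "f \<in> P {}" "h \<in> P {}"
      then show "f * h = 0 \<Longrightarrow> f = 0 \<or> h = 0" by (auto simp: P_empty fun_eq_iff)
    next
      fix f assume f: "f \<in> P {}" "f \<noteq> 0"
      then obtain c where c: "f = (\<lambda>_. c)" "c \<noteq> 0" by (auto simp: P_empty fun_eq_iff)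
      then have "1 = f * (\<lambda>_. inverse c)" by (auto simp: fun_eq_iff)
      then have "prime_prod (P {}) f [] f"
        using f P_const by (auto simp: prime_prod_def rdvd_def)
      then show "\<exists>u ps. prime_prod (P {}) u ps f" by blast
    qed (auto intro: P_ring)
    then show ?case by auto
  next
    case (insert i A)
    then have i: "i \<in> I" "A \<subseteq> I" by auto
    then have ufd: "ufd (P A)" and un: "\<And>f. f \<in> P A \<Longrightarrow> rdvd (P A) f 1 \<Longrightarrow> f \<in> P {}"
      using insert.IH by blast+
    have sub: "subdomain (P A)" using ufd by (simp add: ufd_def)
    have inj: "p = 0" if "p \<in> subdomain.polys (P A)" "poly p (x i) = 0" for p
      using poly_fun_transcendental[of p A i] that insert.hyps i subdomain.coeff_in[OF sub] by blast
    show ?case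
      unfolding P_insert[OF sub insert.hyps(2) i]
      using ufd.ufd_adjoin[OF ufd inj] un by blast
  qed
qed

sublocale R: ufd R
  using ufd_P[of I] by (simp add: P_I)

lemma R_unit: "f \<in> R \<Longrightarrow> rdvd R f 1 \<longleftrightarrow> (\<exists>c. c \<noteq> 0 \<and> f = (\<lambda>_. c))"
proof
  assume "f \<in> R" "rdvd R f 1"
  then have "f \<in> P {}" using ufd_P[of I] unfolding P_I by blast
  then obtain c where c: "f = (\<lambda>_. c)" unfolding P_empty by blast
  obtain d where "1 = f * d" using \<open>rdvd R f 1\<close> by (auto simp: rdvd_def)
  then have "(1 :: 'v \<Rightarrow> 'f) 0 = (f * d) 0" by (rule arg_cong)
  then have "c \<noteq> 0" unfolding c by auto
  with c show "\<exists>c. c \<noteq> 0 \<and> f = (\<lambda>_. c)" by blast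
next
  assume "\<exists>c. c \<noteq> 0 \<and> f = (\<lambda>_. c)"
  then obtain c where "c \<noteq> 0" "f = (\<lambda>_. c)" by blast
  then have "1 = f * (\<lambda>_. inverse c)" by (auto simp: fun_eq_iff)
  then show "rdvd R f 1" using poly_ring.const by (auto simp: rdvd_def)
qed

lemma subdomain_P: "A \<subseteq> I \<Longrightarrow> subdomain (P A)"
  using ufd_P by (auto simp: ufd_def)

text \<open>Division by \<open>x i - c\<close> with remainder, the remainder being \<open>f\<close>
  with the \<open>i\<close>-th coordinate replaced by \<open>c\<close>.\<close>

lemma diff_upd_factor:
  assumes "f \<in> R" "i \<in> I"
  shows "\<exists>h\<in>R. \<forall>v. f v - f (upd i c v) = (x i v - c) * h v"
  using assms(1)
proof induction
  case (const a)
  then show ?case using R_0 by (intro bexI[of _ 0]) auto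
next
  case (dual f)
  have "f v - f (upd i c v) = (x i v - c) * f (e i)" for v
  proof -
    have "f v - f (upd i c v) = (\<Sum>j\<in>I. f (e j) * x j v) - (\<Sum>j\<in>I. f (e j) * x j (upd i c v))"
      using dual_expand[OF dual, of v] dual_expand[OF dual, of "upd i c v"] by simp
    also have "\<dots> = (\<Sum>j\<in>I. if j = i then f (e i) * (x i v - c) else 0)"
      unfolding sum_subtractf[symmetric] by (rule sum.cong) (auto simp: x_upd algebra_simps)
    finally show ?thesis using assms(2) by simp
  qed
  then show ?case using poly_ring.const by (intro bexI[of _ "\<lambda>_. f (e i)"]) auto
next
  case (add f h)
  then obtain a b where ab: "a \<in> R" "b \<in> R" "\<And>v. f v - f (upd i c v) = (x i v - c) * a v"
    "\<And>v. h v - h (upd i c v) = (x i v - c) * b v" by blast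
  have "(f + h) v - (f + h) (upd i c v) = (x i v - c) * (a + b) v" for v
  proof -
    have "(f + h) v - (f + h) (upd i c v) = (f v - f (upd i c v)) + (h v - h (upd i c v))" by simp
    then show ?thesis by (simp add: ab algebra_simps)
  qed
  then show ?case using ab poly_ring.add by blast
next
  case (mult f h)
  then obtain a b where ab: "a \<in> R" "b \<in> R" "\<And>v. f v - f (upd i c v) = (x i v - c) * a v"
    "\<And>v. h v - h (upd i c v) = (x i v - c) * b v" by blast
  \<comment> \<open>The product rule for differences: f h - f' h' = (f - f') h + f' (h - h'), where
    f' and h' arise by substituting \<open>c\<close>.\<close>
  define k where "k = a * h + (\<lambda>v. f (upd i c v)) * b"
  have "k \<in> R" unfolding k_def using ab mult.hyps R_upd poly_ring.add poly_ring.mult by blast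
  moreover have "(f * h) v - (f * h) (upd i c v) = (x i v - c) * k v" for v
  proof -
    have "(f * h) v - (f * h) (upd i c v) = (f v - f (upd i c v)) * h v + f (upd i c v) * (h v - h (upd i c v))"
      by (simp add: algebra_simps)
    then show ?thesis by (simp add: ab k_def algebra_simps)
  qed
  ultimately show ?case by blast
qed

text \<open>The factor theorem inside \<open>P A\<close>; the cofactor from
  \<open>diff_upd_factor\<close> is brought into \<open>P A\<close> by composing it with
  \<open>proj A\<close>.\<close>

lemma linear_rdvd_iff:
  assumes A: "A \<subseteq> I" "i \<in> A" and f: "f \<in> P A"
  shows "rdvd (P A) (x i - (\<lambda>_. c)) f \<longleftrightarrow> (\<forall>v. x i v = c \<longrightarrow> f v = 0)"
proof
  assume zero: "\<forall>v. x i v = c \<longrightarrow> f v = 0"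
  have i: "i \<in> I" and fR: "f \<in> R" using A f by (auto simp: P_def)
  obtain h where h: "h \<in> R" "\<And>v. f v - f (upd i c v) = (x i v - c) * h v"
    using diff_upd_factor[OF fR i] by blast
  have "f (upd i c v) = 0" for v using zero x_upd[OF i] by simp
  then have fh: "f v = (x i v - c) * h v" for v using h(2)[of v] by simp
  have "f v = (x i v - c) * h (proj A v)" for v
    using fh[of "proj A v"] P_proj_same[OF f A(1)] A x_proj[OF i, of A v] by simp
  then have "f = (x i - (\<lambda>_. c)) * (\<lambda>v. h (proj A v))" by (auto simp: fun_eq_iff)
  then show "rdvd (P A) (x i - (\<lambda>_. c)) f" using P_proj[OF h(1)] by (auto simp: rdvd_def)
qed (auto simp: rdvd_def)

text \<open>Divisibility means vanishing on the hyperplane \<open>x i = c\<close>, and restriction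
  to it by \<open>upd i c\<close> lands in the domain \<open>R\<close>. The case
  \<open>c = 0\<close> gives the primes \<open>x i\<close>, the case \<open>c = 1\<close> the prime
  for Eisenstein's criterion.\<close>

lemma linear_rprime:
  assumes A: "A \<subseteq> I" "i \<in> A"
  shows "rprime (P A) (x i - (\<lambda>_. c))"
proof -
  interpret S: subdomain "P A" using A by (intro subdomain_P)
  have i: "i \<in> I" using A by auto
  have "x i (upd i (c + 1) 0) = c + 1" using x_upd[OF i] by simp
  then have "(x i - (\<lambda>_. c)) \<noteq> 0" by (metis add_diff_cancel_left' minus_apply one_neq_zero zero_fun_apply)
  moreover have "x i - (\<lambda>_. c) \<in> P A" using P_x[OF A(2,1)] P_const S.diff_in by blast
  moreover have "\<not> rdvd (P A) (x i - (\<lambda>_. c)) 1"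
    using linear_rdvd_iff[OF A S.one_in, of c] x_upd[OF i, of i c 0] by auto
  moreover have "rdvd (P A) (x i - (\<lambda>_. c)) f \<or> rdvd (P A) (x i - (\<lambda>_. c)) h"
    if fh: "f \<in> P A" "h \<in> P A" and d: "rdvd (P A) (x i - (\<lambda>_. c)) (f * h)" for f h
  proof -
    have "f * h \<in> P A" using fh P_ring by blast
    then have z: "\<forall>v. x i v = c \<longrightarrow> (f * h) v = 0" using linear_rdvd_iff[OF A] d by blast
    have "(\<lambda>v. f (upd i c v)) * (\<lambda>v. h (upd i c v)) = 0"
      using z x_upd[OF i, of i c] by (auto simp: fun_eq_iff)
    moreover have "(\<lambda>v. f (upd i c v)) \<in> R" "(\<lambda>v. h (upd i c v)) \<in> R"
      using fh R_upd by (auto simp: P_def)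
    ultimately have "(\<lambda>v. f (upd i c v)) = 0 \<or> (\<lambda>v. h (upd i c v)) = 0" using R.no_zero_div by blast
    then have "(\<forall>v. x i v = c \<longrightarrow> f v = 0) \<or> (\<forall>v. x i v = c \<longrightarrow> h v = 0)"
      using upd_same by (metis zero_fun_apply)
    then show ?thesis using linear_rdvd_iff[OF A] fh by blast
  qed
  ultimately show ?thesis by (auto simp: rprime_def)
qed

lemma x_rprime: "i \<in> I \<Longrightarrow> rprime R (x i)"
  using linear_rprime[of I i 0] by (simp add: P_I flip: zero_fun_def)

lemma x_rdvd_iff: "i \<in> I \<Longrightarrow> f \<in> R \<Longrightarrow> rdvd R (x i) f \<longleftrightarrow> (\<forall>v. x i v = 0 \<longrightarrow> f v = 0)"
  using linear_rdvd_iff[of I i f 0] by (simp add: P_I flip: zero_fun_def)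

end

section \<open>Character groups\<close>

lemma comm_group_char_group:
  assumes "group A" shows "comm_group (char_group A :: ('a \<Rightarrow> 'f::field) monoid)"
proof (rule comm_groupI)
  interpret A: group A by fact
  let ?C = "char_group A :: ('a \<Rightarrow> 'f) monoid"
  show "\<one>\<^bsub>?C\<^esub> \<in> carrier ?C" by (auto simp: char_group_def hom_def unit_group_def)
  fix \<eta> \<theta> \<zeta> assume \<eta>: "\<eta> \<in> carrier ?C"
  have ext: "f = h" if "f \<in> extensional (carrier A)" "h \<in> extensional (carrier A)" "\<And>a. a \<in> carrier A \<Longrightarrow> f a = h a"
    for f h :: "'a \<Rightarrow> 'f" using that extensionalityI by blast
  show "\<one>\<^bsub>?C\<^esub> \<otimes>\<^bsub>?C\<^esub> \<eta> = \<eta>" using \<eta> by (intro ext) (auto simp: char_group_def)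
  have "(\<lambda>a\<in>carrier A. inverse (\<eta> a)) \<in> carrier ?C" "(\<lambda>a\<in>carrier A. inverse (\<eta> a)) \<otimes>\<^bsub>?C\<^esub> \<eta> = \<one>\<^bsub>?C\<^esub>"
    using \<eta> by (auto simp: char_group_def hom_def unit_group_def Pi_def intro!: ext)
  then show "\<exists>y\<in>carrier ?C. y \<otimes>\<^bsub>?C\<^esub> \<eta> = \<one>\<^bsub>?C\<^esub>" by blast
  assume \<theta>: "\<theta> \<in> carrier ?C"
  show "\<eta> \<otimes>\<^bsub>?C\<^esub> \<theta> \<in> carrier ?C"
    using \<eta> \<theta> by (auto simp: char_group_def hom_def unit_group_def Pi_def)
  show "\<eta> \<otimes>\<^bsub>?C\<^esub> \<theta> = \<theta> \<otimes>\<^bsub>?C\<^esub> \<eta>" by (auto simp: char_group_def mult.commute)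
  show "\<eta> \<otimes>\<^bsub>?C\<^esub> \<theta> \<otimes>\<^bsub>?C\<^esub> \<zeta> = \<eta> \<otimes>\<^bsub>?C\<^esub> (\<theta> \<otimes>\<^bsub>?C\<^esub> \<zeta>)"
    by (auto simp: char_group_def mult.assoc fun_eq_iff)
qed

lemma char_group_apply:
  "\<eta> \<in> carrier (char_group A) \<Longrightarrow> a \<in> carrier A \<Longrightarrow> \<eta> a \<noteq> 0"
  "\<eta> \<in> carrier (char_group A) \<Longrightarrow> a \<in> carrier A \<Longrightarrow> b \<in> carrier A \<Longrightarrow> \<eta> (a \<otimes>\<^bsub>A\<^esub> b) = \<eta> a * \<eta> b"
  "a \<in> carrier A \<Longrightarrow> (\<eta> \<otimes>\<^bsub>char_group A\<^esub> \<theta>) a = \<eta> a * \<theta> a"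
  "a \<in> carrier A \<Longrightarrow> \<one>\<^bsub>char_group A\<^esub> a = 1"
  by (auto simp: char_group_def hom_def unit_group_def Pi_def)

lemma char_group_eqI:
  "\<eta> \<in> carrier (char_group A) \<Longrightarrow> \<theta> \<in> carrier (char_group A) \<Longrightarrow> (\<And>a. a \<in> carrier A \<Longrightarrow> \<eta> a = \<theta> a) \<Longrightarrow> \<eta> = \<theta>"
  by (rule extensionalityI[of _ "carrier A"]) (auto simp: char_group_def)

lemma char_group_inv:
  assumes "group A" "\<eta> \<in> carrier (char_group A)" "a \<in> carrier A"
  shows "(inv\<^bsub>char_group A\<^esub> \<eta>) a = inverse (\<eta> a :: 'f::field)"
proof -
  interpret C: comm_group "char_group A :: ('a \<Rightarrow> 'f) monoid" by (rule comm_group_char_group[OF assms(1)])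
  have "(inv\<^bsub>char_group A\<^esub> \<eta> \<otimes>\<^bsub>char_group A\<^esub> \<eta>) a = 1"
    using assms by (simp add: char_group_apply(4))
  then have "(inv\<^bsub>char_group A\<^esub> \<eta>) a * \<eta> a = 1" using assms(3) by (simp add: char_group_apply(3))
  then show ?thesis by (metis inverse_unique mult.commute)
qed

lemma char_group_pow:
  assumes "group A" "\<eta> \<in> carrier (char_group A)" "a \<in> carrier A"
  shows "(\<eta> [^]\<^bsub>char_group A\<^esub> (k::nat)) a = (\<eta> a :: 'f::field) ^ k"
proof -
  interpret C: comm_group "char_group A :: ('a \<Rightarrow> 'f) monoid" by (rule comm_group_char_group[OF assms(1)])
  show ?thesis
    by (induction k) (use assms in \<open>auto simp: char_group_apply(3,4) mult.commute\<close>)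
qed


section \<open>Divisor-closed submonoids\<close>

text \<open>Made for \<open>M\<^sub>0\<close> inside \<open>D\<^sub>0\<close>. Since factors stay in
  \<open>S\<close>, elements of \<open>S\<close> have the same prime factorization in both monoids,
  which links \<open>\<theta>\<^sub>1\<close> and \<open>\<theta>\<^sub>2\<close> on
  monomials.\<close>

locale divisor_closed = reduced_factorial E for E :: "('a, 'c) monoid_scheme" (structure) +
  fixes S :: "'a set"
  assumes S_sub: "S \<subseteq> carrier E" and S_one: "\<one> \<in> S"
    and S_mult: "a \<in> S \<Longrightarrow> b \<in> S \<Longrightarrow> a \<otimes> b \<in> S"
    and S_div: "a \<in> carrier E \<Longrightarrow> b \<in> carrier E \<Longrightarrow> a \<otimes> b \<in> S \<Longrightarrow> a \<in> S"
begin

abbreviation (input) F where "F \<equiv> E\<lparr>carrier := S\<rparr>"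

lemma SE: "a \<in> S \<Longrightarrow> a \<in> carrier E"
  using S_sub by blast

lemma comm_monoid_cancel_sub: "comm_monoid_cancel F"
proof (rule comm_monoid_cancelI)
  show "Group.comm_monoid F"
    by (rule comm_monoidI) (use S_one S_mult SE m_assoc m_comm in auto)
  show "a = b" if "a \<otimes>\<^bsub>F\<^esub> c = b \<otimes>\<^bsub>F\<^esub> c" "a \<in> carrier F" "b \<in> carrier F" "c \<in> carrier F" for a b c
    using that SE r_cancel by simp
qed

lemma Units_sub: "Units F = {\<one>}"
proof
  show "Units F \<subseteq> {\<one>}"
  proof
    fix u assume "u \<in> Units F"
    then obtain v where "u \<in> S" "v \<in> S" "u \<otimes> v = \<one>" by (auto simp: Units_def)
    then show "u \<in> {\<one>}" using one_factors(1)[of u v] SE by blast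
  qed
qed (use S_one SE in \<open>auto simp: Units_def\<close>)

lemma divides_sub_iff:
  assumes "a \<in> S" "b \<in> S" shows "a divides\<^bsub>F\<^esub> b \<longleftrightarrow> a divides b"
proof
  assume "a divides b"
  then obtain c where c: "c \<in> carrier E" "b = a \<otimes> c" by (rule dividesE)
  then have "c \<otimes> a \<in> S" using assms SE m_comm by metis
  then have "c \<in> S" using S_div[of c a] c assms SE by blast
  then show "a divides\<^bsub>F\<^esub> b" using c by (auto simp: factor_def)
qed (use SE in \<open>auto simp: factor_def\<close>)

lemma msprod_sub: "set_mset T \<subseteq> S \<Longrightarrow> msprod F T = msprod E T \<and> msprod E T \<in> S"
proof (induction T)
  case empty
  interpret F: comm_monoid_cancel F by (rule comm_monoid_cancel_sub)
  show ?case using S_one F.msprod_empty by simp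
next
  case (add a T)
  interpret F: comm_monoid_cancel F by (rule comm_monoid_cancel_sub)
  have "a \<in> S" "set_mset T \<subseteq> S" "set_mset T \<subseteq> carrier E" using add.prems S_sub by auto
  then show ?case using add.IH F.msprod_add_mset[of a T] SE S_mult by (simp add: msprod_add_mset)
qed

lemma prime_sub: "p \<in> primes E \<Longrightarrow> p \<in> S \<Longrightarrow> p \<in> primes F"
proof -
  assume p: "p \<in> primes E" "p \<in> S"
  have "Divisibility.prime F p"
  proof (rule primeI)
    show "p \<notin> Units F" using primesD(2)[OF p(1)] Units_sub by simp
    fix a b assume ab: "a \<in> carrier F" "b \<in> carrier F" "p divides\<^bsub>F\<^esub> a \<otimes>\<^bsub>F\<^esub> b"
    then have "p divides a \<otimes> b" using divides_sub_iff[OF p(2), of "a \<otimes> b"] S_mult by simp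
    then have "p divides a \<or> p divides b"
      using prime_divides[OF SE SE primesD(3)[OF p(1)]] ab by simp
    then show "p divides\<^bsub>F\<^esub> a \<or> p divides\<^bsub>F\<^esub> b" using divides_sub_iff[OF p(2)] ab by simp
  qed
  then show ?thesis using p by (simp add: primes_def)
qed

lemma factors_in_sub: "a \<in> S \<Longrightarrow> set_mset (factorization E a) \<subseteq> S \<inter> primes E"
proof
  fix p assume a: "a \<in> S" and p: "p \<in># factorization E a"
  then obtain T where T: "factorization E a = add_mset p T" by (metis mset_add)
  have pT: "p \<in> primes E" "set_mset T \<subseteq> primes E" using factorization(1)[OF SE[OF a]] T by auto
  then have TE: "set_mset T \<subseteq> carrier E" using primes_subset by blast
  have "p \<otimes> msprod E T \<in> S"
    using factorization(2)[OF SE[OF a]] T a msprod_add_mset[OF primesD(1)[OF pT(1)] TE] by simp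
  then show "p \<in> S \<inter> primes E" using S_div[OF primesD(1)[OF pT(1)] msprod_closed[OF TE]] pT by blast
qed

lemma reduced_factorial_sub: "reduced_factorial F"
proof -
  interpret F: comm_monoid_cancel F by (rule comm_monoid_cancel_sub)
  show ?thesis
  proof
    show "Units F = {\<one>\<^bsub>F\<^esub>}" using Units_sub by simp
    fix a assume "a \<in> carrier F"
    then have a: "a \<in> S" by simp
    have "set_mset (factorization E a) \<subseteq> primes F" using factors_in_sub[OF a] prime_sub by blast
    moreover have "msprod F (factorization E a) = a"
      using msprod_sub[of "factorization E a"] factors_in_sub[OF a] factorization(2)[OF SE[OF a]] by simp
    ultimately show "\<exists>T. set_mset T \<subseteq> primes F \<and> msprod F T = a" by blast
  qed
qed

lemma factorization_sub: "a \<in> S \<Longrightarrow> factorization F a = factorization E a"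
proof -
  assume a: "a \<in> S"
  have "set_mset (factorization E a) \<subseteq> primes F" using factors_in_sub[OF a] prime_sub by blast
  moreover have "msprod F (factorization E a) = a"
    using msprod_sub[of "factorization E a"] factors_in_sub[OF a] factorization(2)[OF SE[OF a]] by simp
  ultimately show ?thesis using reduced_factorial.factorization_msprod[OF reduced_factorial_sub] by metis
qed

end


section \<open>Relative invariants\<close>

context diagonal_rep
begin

abbreviation IG where "IG \<equiv> image_group scale G \<rho>"
abbreviation K :: "(('v \<Rightarrow> 'v) \<Rightarrow> 'f) monoid" where "K \<equiv> char_group IG"

lemma carrier_IG [simp]: "carrier IG = \<rho> ` carrier G" "mult IG = (\<circ>)" "one IG = id"
  by (auto simp: image_group_def GL_def)

lemma comm_group_IG: "comm_group IG"
proof -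
  have "comm_group (GL scale\<lparr>carrier := \<rho> ` carrier G, one := \<rho> \<one>\<^bsub>G\<^esub>\<rparr>)"
    by (rule G.hom_imp_img_comm_group[OF \<rho>])
  moreover have "GL scale\<lparr>carrier := \<rho> ` carrier G, one := \<rho> \<one>\<^bsub>G\<^esub>\<rparr> = IG"
    by (simp add: image_group_def \<rho>_one GL_def)
  ultimately show ?thesis by simp
qed

sublocale K: comm_group K
  by (rule comm_group_char_group) (use comm_group_IG comm_group_def in blast)

lemma group_IG: "group IG"
  using comm_group_IG comm_group_def by blast

lemma K_apply:
  assumes "\<eta> \<in> carrier K" "g \<in> carrier G"
  shows "\<eta> (\<rho> g) \<noteq> 0" "h \<in> carrier G \<Longrightarrow> \<eta> (\<rho> (g \<otimes>\<^bsub>G\<^esub> h)) = \<eta> (\<rho> g) * \<eta> (\<rho> h)"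
    "(inv\<^bsub>K\<^esub> \<eta>) (\<rho> g) = inverse (\<eta> (\<rho> g))" "(\<eta> [^]\<^bsub>K\<^esub> (k::nat)) (\<rho> g) = \<eta> (\<rho> g) ^ k"
  using char_group_apply(1,2)[OF assms(1)] assms(2) char_group_inv[OF group_IG assms(1)] char_group_pow[OF group_IG assms(1)]
  by (auto simp: \<rho>_mult)

lemma K_mult: "g \<in> carrier G \<Longrightarrow> (\<eta> \<otimes>\<^bsub>K\<^esub> \<theta>) (\<rho> g) = \<eta> (\<rho> g) * \<theta> (\<rho> g)"
  and K_one: "g \<in> carrier G \<Longrightarrow> \<one>\<^bsub>K\<^esub> (\<rho> g) = 1"
  by (simp_all add: char_group_apply(3,4))

lemma K_eqI: "\<eta> \<in> carrier K \<Longrightarrow> \<theta> \<in> carrier K \<Longrightarrow> (\<And>g. g \<in> carrier G \<Longrightarrow> \<eta> (\<rho> g) = \<theta> (\<rho> g)) \<Longrightarrow> \<eta> = \<theta>"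
  by (rule char_group_eqI) auto

lemma act_apply: "act G \<rho> g f v = f (\<rho> (inv\<^bsub>G\<^esub> g) v)"
  by (simp add: act_def)

lemma act_R: "f \<in> R \<Longrightarrow> g \<in> carrier G \<Longrightarrow> act G \<rho> g f \<in> R"
  unfolding act_def
proof (rule R_compose)
  assume g: "g \<in> carrier G"
  show "(\<lambda>v. x i (\<rho> (inv\<^bsub>G\<^esub> g) v)) \<in> R" if i: "i \<in> I" for i
  proof -
    have "(\<lambda>v. x i (\<rho> (inv\<^bsub>G\<^esub> g) v)) = (\<lambda>_. \<chi> i g) * x i"
      by (rule ext) (simp add: x_act[OF i g])
    then show ?thesis using R_x[OF i] poly_ring.const poly_ring.mult by metis
  qed
qed

lemma act_mult: "act G \<rho> g (f * h) = act G \<rho> g f * act G \<rho> g h"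
  by (rule ext) (simp add: act_apply)

lemma act_act: "g \<in> carrier G \<Longrightarrow> h \<in> carrier G \<Longrightarrow> act G \<rho> g (act G \<rho> h f) = act G \<rho> (g \<otimes>\<^bsub>G\<^esub> h) f"
  by (rule ext) (simp add: act_apply G.inv_mult_group \<rho>_mult)

lemma act_one: "act G \<rho> \<one>\<^bsub>G\<^esub> f = f"
  by (rule ext) (simp add: act_apply \<rho>_one)

lemma act_scale: "act G \<rho> g (fun_scale c f) = fun_scale c (act G \<rho> g f)"
  by (rule ext) (simp add: act_apply fun_scale_def)

lemma act_inv: "g \<in> carrier G \<Longrightarrow> act G \<rho> g (act G \<rho> (inv\<^bsub>G\<^esub> g) f) = f"
  by (simp add: act_act act_one)

lemma R_scale: "f \<in> R \<Longrightarrow> fun_scale c f \<in> R"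
proof -
  assume "f \<in> R"
  moreover have "fun_scale c f = (\<lambda>_. c) * f" by (rule ext) (simp add: fun_scale_def)
  ultimately show ?thesis using poly_ring.const poly_ring.mult by metis
qed

lemma fun_scale_simps:
  "fun_scale c f * h = fun_scale c (f * h)" "f * fun_scale c h = fun_scale c (f * h)"
  "fun_scale c (fun_scale d f) = fun_scale (c * d) f" "fun_scale 1 f = f"
  for f h :: "'v \<Rightarrow> 'f"
  by (auto simp: fun_scale_def fun_eq_iff)

lemma fun_scale_eq_0: "fun_scale c f = 0 \<longleftrightarrow> c = 0 \<or> f = 0" for f :: "'v \<Rightarrow> 'f"
  by (auto simp: fun_scale_def fun_eq_iff)

lemma fun_scale_cancel: "f \<noteq> 0 \<Longrightarrow> fun_scale c f = fun_scale d f \<Longrightarrow> c = d" for f :: "'v \<Rightarrow> 'f"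
  by (auto simp: fun_scale_def fun_eq_iff)

definition Rel :: "('v \<Rightarrow> 'f) set" where
  "Rel = relative_invariants scale G \<rho> - {0}"

lemma Rel_iff: "f \<in> Rel \<longleftrightarrow> f \<in> R \<and> f \<noteq> 0 \<and> (\<exists>\<eta>\<in>carrier K. has_weight G \<rho> f \<eta>)"
  by (auto simp: Rel_def relative_invariants_def)

lemma RelR: "f \<in> Rel \<Longrightarrow> f \<in> R" and Rel0: "f \<in> Rel \<Longrightarrow> f \<noteq> 0"
  by (auto simp: Rel_iff)

definition wt :: "('v \<Rightarrow> 'f) \<Rightarrow> ('v \<Rightarrow> 'v) \<Rightarrow> 'f" where
  "wt f = (THE \<eta>. \<eta> \<in> carrier K \<and> has_weight G \<rho> f \<eta>)"

lemma weight_unique: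
  assumes "f \<noteq> 0" "\<eta> \<in> carrier K" "has_weight G \<rho> f \<eta>" "\<theta> \<in> carrier K" "has_weight G \<rho> f \<theta>"
  shows "\<eta> = \<theta>"
proof (rule K_eqI[OF assms(2,4)])
  fix g assume "g \<in> carrier G"
  then have "fun_scale (\<eta> (\<rho> g)) f = fun_scale (\<theta> (\<rho> g)) f" using assms(3,5) unfolding has_weight_def by metis
  then show "\<eta> (\<rho> g) = \<theta> (\<rho> g)" using fun_scale_cancel assms(1) by blast
qed

lemma wt_eqI: "f \<noteq> 0 \<Longrightarrow> \<eta> \<in> carrier K \<Longrightarrow> has_weight G \<rho> f \<eta> \<Longrightarrow> wt f = \<eta>"
  unfolding wt_def using weight_unique by (intro the_equality) blast+

lemma wt: "f \<in> Rel \<Longrightarrow> wt f \<in> carrier K" "f \<in> Rel \<Longrightarrow> has_weight G \<rho> f (wt f)"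
  using wt_eqI Rel_iff by metis+

lemma wt_act: "f \<in> Rel \<Longrightarrow> g \<in> carrier G \<Longrightarrow> act G \<rho> g f = fun_scale (wt f (\<rho> g)) f"
  using wt(2) by (auto simp: has_weight_def)

text \<open>The eigenvalues are multiplicative because \<open>f\<close> is nonzero, and they depend
  on \<open>\<rho> g\<close> only, since the action does. So they define a character of
  \<rho>(G).\<close>

lemma RelI:
  assumes f: "f \<in> R" "f \<noteq> 0" and eig: "\<And>g. g \<in> carrier G \<Longrightarrow> \<exists>c. act G \<rho> g f = fun_scale c f"
  shows "f \<in> Rel"
proof -
  define c where "c g = (SOME c. act G \<rho> g f = fun_scale c f)" for g
  have c: "act G \<rho> g f = fun_scale (c g) f" if "g \<in> carrier G" for g
    unfolding c_def by (rule someI_ex[OF eig[OF that]])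
  have cm: "c (g \<otimes>\<^bsub>G\<^esub> h) = c g * c h" if "g \<in> carrier G" "h \<in> carrier G" for g h
  proof -
    have "fun_scale (c (g \<otimes>\<^bsub>G\<^esub> h)) f = act G \<rho> g (act G \<rho> h f)" using that by (simp add: act_act flip: c)
    also have "\<dots> = fun_scale (c g * c h) f" using that by (simp add: c act_scale fun_scale_simps mult.commute)
    finally show ?thesis using fun_scale_cancel f by blast
  qed
  have "fun_scale (c \<one>\<^bsub>G\<^esub>) f = fun_scale 1 f" using c[of "\<one>\<^bsub>G\<^esub>"] by (simp add: act_one fun_scale_simps)
  then have c1: "c \<one>\<^bsub>G\<^esub> = 1" using fun_scale_cancel[OF f(2)] by blast
  have c0: "c g \<noteq> 0" if "g \<in> carrier G" for g
    using cm[of g "inv\<^bsub>G\<^esub> g"] c1 that by auto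
  have crho: "c g = c h" if "g \<in> carrier G" "h \<in> carrier G" "\<rho> g = \<rho> h" for g h
  proof -
    have "\<rho> (inv\<^bsub>G\<^esub> g) = \<rho> (inv\<^bsub>G\<^esub> h)"
    proof -
      have "\<chi> i (inv\<^bsub>G\<^esub> k) = inverse (\<chi> i k)" if "i \<in> I" "k \<in> carrier G" for i k
      proof -
        have "\<chi> i k * \<chi> i (inv\<^bsub>G\<^esub> k) = 1" using \<chi>_mult[of i k "inv\<^bsub>G\<^esub> k"] \<chi>_one that by simp
        then show ?thesis by (metis inverse_unique)
      qed
      then show ?thesis using that by (simp add: \<rho>_eq_iff)
    qed
    then have "act G \<rho> g f = act G \<rho> h f" by (simp add: act_def)
    then show ?thesis using c that fun_scale_cancel f by metis
  qed
  define \<eta> where "\<eta> = (\<lambda>t\<in>\<rho> ` carrier G. c (inv_into (carrier G) \<rho> t))"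
  have \<eta>c: "\<eta> (\<rho> g) = c g" if "g \<in> carrier G" for g
    unfolding \<eta>_def using that crho[of "inv_into (carrier G) \<rho> (\<rho> g)" g]
    by (simp add: inv_into_into f_inv_into_f)
  have "\<eta> \<in> carrier K"
    unfolding char_group_def
  proof (simp, intro conjI)
    show "\<eta> \<in> hom IG unit_group"
    proof (rule homI)
      show "\<eta> t \<in> carrier unit_group" if "t \<in> carrier IG" for t
        using that \<eta>c c0 by (auto simp: unit_group_def)
      show "\<eta> (s \<otimes>\<^bsub>IG\<^esub> t) = \<eta> s \<otimes>\<^bsub>unit_group\<^esub> \<eta> t" if st: "s \<in> carrier IG" "t \<in> carrier IG" for s t
      proof -
        obtain g h where gh: "g \<in> carrier G" "h \<in> carrier G" "s = \<rho> g" "t = \<rho> h" using st by auto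
        then have "s \<circ> t = \<rho> (g \<otimes>\<^bsub>G\<^esub> h)" by (simp add: \<rho>_mult)
        then show ?thesis using gh \<eta>c[of "g \<otimes>\<^bsub>G\<^esub> h"] \<eta>c[of g] \<eta>c[of h] cm by (simp add: unit_group_def)
      qed
    qed
    show "\<eta> \<in> extensional (\<rho> ` carrier G)" by (simp add: \<eta>_def)
  qed
  moreover have "has_weight G \<rho> f \<eta>" using c \<eta>c by (simp add: has_weight_def)
  ultimately show ?thesis using f by (auto simp: Rel_iff)
qed

lemma Rel_mult: "f \<in> Rel \<Longrightarrow> h \<in> Rel \<Longrightarrow> f * h \<in> Rel" "f \<in> Rel \<Longrightarrow> h \<in> Rel \<Longrightarrow> wt (f * h) = wt f \<otimes>\<^bsub>K\<^esub> wt h"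
proof -
  assume fh: "f \<in> Rel" "h \<in> Rel"
  have nz: "f * h \<noteq> 0" using fh R.no_zero_div RelR Rel0 by blast
  have "has_weight G \<rho> (f * h) (wt f \<otimes>\<^bsub>K\<^esub> wt h)"
    unfolding has_weight_def
  proof
    fix g assume g: "g \<in> carrier G"
    show "act G \<rho> g (f * h) = fun_scale ((wt f \<otimes>\<^bsub>K\<^esub> wt h) (\<rho> g)) (f * h)"
      unfolding act_mult wt_act[OF fh(1) g] wt_act[OF fh(2) g] fun_scale_simps K_mult[OF g] by (simp add: mult.commute)
  qed
  moreover have "wt f \<otimes>\<^bsub>K\<^esub> wt h \<in> carrier K" using wt fh by blast
  ultimately show "f * h \<in> Rel" "wt (f * h) = wt f \<otimes>\<^bsub>K\<^esub> wt h"
    using nz poly_ring.mult[OF RelR RelR] fh wt_eqI Rel_iff by blast+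
qed

lemma Rel_scale: "f \<in> Rel \<Longrightarrow> c \<noteq> 0 \<Longrightarrow> fun_scale c f \<in> Rel" "f \<in> Rel \<Longrightarrow> c \<noteq> 0 \<Longrightarrow> wt (fun_scale c f) = wt f"
proof -
  assume f: "f \<in> Rel" "c \<noteq> 0"
  have "has_weight G \<rho> (fun_scale c f) (wt f)"
    using wt_act[OF f(1)] by (simp add: has_weight_def act_scale fun_scale_simps mult.commute)
  moreover have "fun_scale c f \<noteq> 0" using f Rel0 fun_scale_eq_0 by blast
  ultimately show "fun_scale c f \<in> Rel" "wt (fun_scale c f) = wt f"
    using f wt R_scale[OF RelR[OF f(1)]] wt_eqI Rel_iff by blast+
qed

text \<open>Applying \<open>g\<close> to \<open>f * h\<close> and cancelling \<open>f\<close> shows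
  that \<open>h\<close> is an eigenvector too.\<close>

lemma Rel_quotient:
  assumes f: "f \<in> Rel" and h: "h \<in> R" and fh: "f * h \<in> Rel"
  shows "h \<in> Rel"
proof (rule RelI[OF h])
  show "h \<noteq> 0" using Rel0[OF fh] by auto
  fix g assume g: "g \<in> carrier G"
  let ?a = "wt f (\<rho> g)" and ?b = "wt (f * h) (\<rho> g)"
  have a: "?a \<noteq> 0" using K_apply(1) wt f g by blast
  have "fun_scale ?b (f * h) = fun_scale ?a (f * act G \<rho> g h)"
    using wt_act[OF fh g] wt_act[OF f g] by (simp add: act_mult fun_scale_simps)
  then have "fun_scale (inverse ?a) (fun_scale ?b (f * h)) = f * act G \<rho> g h"
    using a by (simp add: fun_scale_simps)
  then have "f * fun_scale (inverse ?a * ?b) h = f * act G \<rho> g h"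
    by (simp add: fun_scale_simps)
  then have "fun_scale (inverse ?a * ?b) h = act G \<rho> g h"
    using R.cancel_left[OF RelR[OF f] R_scale[OF h] act_R[OF h g] Rel0[OF f]] by blast
  then show "\<exists>c. act G \<rho> g h = fun_scale c h" by metis
qed

lemma Rel_const: "c \<noteq> 0 \<Longrightarrow> (\<lambda>_. c) \<in> Rel" "c \<noteq> 0 \<Longrightarrow> wt (\<lambda>_. c) = \<one>\<^bsub>K\<^esub>"
proof -
  assume c: "c \<noteq> 0"
  have "has_weight G \<rho> (\<lambda>_. c) \<one>\<^bsub>K\<^esub>"
    by (auto simp: has_weight_def act_def fun_scale_def K_one)
  moreover have "(\<lambda>_::'v. c) \<noteq> 0" using c by (auto simp: fun_eq_iff)
  ultimately show "(\<lambda>_. c) \<in> Rel" "wt (\<lambda>_. c) = \<one>\<^bsub>K\<^esub>"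
    using wt_eqI K.one_closed poly_ring.const Rel_iff by blast+
qed

lemma unit_const: "rdvd R u 1 \<Longrightarrow> u \<in> R \<Longrightarrow> \<exists>c. c \<noteq> 0 \<and> u = (\<lambda>_. c)"
  using R_unit by blast

lemma const_mult: "(\<lambda>_. c) * f = fun_scale c f" "f * (\<lambda>_. c) = fun_scale c f" for f :: "'v \<Rightarrow> 'f"
  by (auto simp: fun_scale_def fun_eq_iff)

lemma mutual_rdvd:
  assumes "f \<in> R" "h \<in> R" "f \<noteq> 0" "rdvd R f h" "rdvd R h f"
  shows "\<exists>c. c \<noteq> 0 \<and> h = fun_scale c f"
proof -
  obtain a b where ab: "a \<in> R" "b \<in> R" "h = f * a" "f = h * b" using assms by (auto simp: rdvd_def)
  have "f * (a * b) = f * 1" using ab by (simp only: mult.assoc[symmetric] mult_1_right)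
  then have "a * b = 1" using R.cancel_left[OF assms(1) _ R.one_in assms(3)] ab R.mult_in by blast
  then have "rdvd R a 1" using ab by (auto simp: rdvd_def)
  then obtain c where "c \<noteq> 0" "a = (\<lambda>_. c)" using unit_const ab by blast
  then show ?thesis using ab const_mult by metis
qed

text \<open>Elements of \<open>Z\<close> change only by scalars under the group, so translation
  permutes their common divisors. Hence \<open>d\<close> and each of its translates divide one
  another and differ by a constant.\<close>

lemma rgcd_Rel:
  assumes Z: "Z \<subseteq> Rel" "z \<in> Z" and d: "R.rgcd Z d"
  shows "d \<in> Rel"
proof (rule RelI)
  have dR: "d \<in> R" and dz: "\<And>z. z \<in> Z \<Longrightarrow> rdvd R d z"
    and dmax: "\<And>c. c \<in> R \<Longrightarrow> (\<And>z. z \<in> Z \<Longrightarrow> rdvd R c z) \<Longrightarrow> rdvd R c d"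
    using d by (auto simp: R.rgcd_def)
  show "d \<in> R" by fact
  show d0: "d \<noteq> 0"
  proof
    assume "d = 0"
    then have "z = 0" using dz[OF Z(2)] by (auto simp: rdvd_def)
    then show False using Z Rel0 by blast
  qed
  have inv: "rdvd R (act G \<rho> g d) d" if g: "g \<in> carrier G" for g
  proof (rule dmax)
    show "act G \<rho> g d \<in> R" using act_R dR g by blast
    fix y assume y: "y \<in> Z"
    obtain k where k: "k \<in> R" "y = d * k" using dz[OF y] by (auto simp: rdvd_def)
    have yR: "y \<in> Rel" using y Z by blast
    let ?c = "wt y (\<rho> g)"
    have "fun_scale ?c y = act G \<rho> g d * act G \<rho> g k"
      using wt_act[OF yR g] k act_mult by metis
    then have "y = act G \<rho> g d * fun_scale (inverse ?c) (act G \<rho> g k)"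
      using K_apply(1)[OF wt(1)[OF yR] g] by (simp add: fun_scale_simps flip: \<open>fun_scale ?c y = act G \<rho> g d * act G \<rho> g k\<close>)
    then show "rdvd R (act G \<rho> g d) y"
      using R_scale[OF act_R[OF k(1) g]] unfolding rdvd_def by blast
  qed
  fix g assume g: "g \<in> carrier G"
  have "rdvd R d (act G \<rho> g d)"
  proof -
    obtain k where k: "k \<in> R" "d = act G \<rho> (inv\<^bsub>G\<^esub> g) d * k" using inv[of "inv\<^bsub>G\<^esub> g"] g by (auto simp: rdvd_def)
    have "act G \<rho> g d = act G \<rho> g (act G \<rho> (inv\<^bsub>G\<^esub> g) d) * act G \<rho> g k" using k(2) act_mult by metis
    then have "act G \<rho> g d = d * act G \<rho> g k" unfolding act_inv[OF g] .
    then show ?thesis using act_R[OF k(1) g] by (auto simp: rdvd_def)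
  qed
  then show "\<exists>c. act G \<rho> g d = fun_scale c d"
    using mutual_rdvd[OF dR act_R[OF dR g] d0 _ inv[OF g]] by blast
qed

abbreviation Hom\<^sub>0 :: "(('v \<Rightarrow> 'v) \<Rightarrow> 'f) monoid" where "Hom\<^sub>0 \<equiv> Hom0 scale G \<rho>"

text \<open>By \<open>pseudoreflection_iff\<close> all pseudoreflections in \<rho>(G) come from some
  \<open>refl_group i\<close>, and the other elements of these groups act trivially.\<close>

lemma Hom0_iff: "\<eta> \<in> carrier Hom\<^sub>0 \<longleftrightarrow> \<eta> \<in> carrier K \<and> (\<forall>i\<in>I. \<forall>g\<in>refl_group i. \<eta> (\<rho> g) = 1)"
proof
  assume \<eta>: "\<eta> \<in> carrier Hom\<^sub>0"
  then have \<eta>K: "\<eta> \<in> carrier K" by (simp add: Hom0_def)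
  have "\<eta> (\<rho> g) = 1" if ig: "i \<in> I" "g \<in> refl_group i" for i g
  proof (cases "\<chi> i g = 1")
    case True
    have g: "g \<in> carrier G" using ig by (simp add: refl_group_def)
    have "\<rho> g = \<rho> \<one>\<^bsub>G\<^esub>" using \<rho>_eq_iff[OF g G.one_closed] ig True by (auto simp: refl_group_def \<chi>_one)
    moreover have "\<eta> (\<rho> \<one>\<^bsub>G\<^esub>) = 1"
      using K_apply(1,2)[OF \<eta>K G.one_closed] by (metis G.l_one G.one_closed mult_cancel_left1)
    ultimately show ?thesis by simp
  next
    case False
    have g: "g \<in> carrier G" using ig by (simp add: refl_group_def)
    then have "pseudoreflection scale (\<rho> g)" using pseudoreflection_iff ig False by blast
    then show ?thesis using \<eta> g by (auto simp: Hom0_def)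
  qed
  then show "\<eta> \<in> carrier K \<and> (\<forall>i\<in>I. \<forall>g\<in>refl_group i. \<eta> (\<rho> g) = 1)" using \<eta>K by blast
next
  assume *: "\<eta> \<in> carrier K \<and> (\<forall>i\<in>I. \<forall>g\<in>refl_group i. \<eta> (\<rho> g) = 1)"
  then show "\<eta> \<in> carrier Hom\<^sub>0" using pseudoreflection_iff by (auto simp: Hom0_def)
qed

lemma Hom0_simps [simp]: "mult Hom\<^sub>0 = mult K" "one Hom\<^sub>0 = one K"
  by (simp_all add: Hom0_def)

lemma Hom0_K: "\<eta> \<in> carrier Hom\<^sub>0 \<Longrightarrow> \<eta> \<in> carrier K"
  by (simp add: Hom0_iff)

lemma refl_groupD: "g \<in> refl_group i \<Longrightarrow> g \<in> carrier G"
  by (simp add: refl_group_def)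

lemma subgroup_Hom0: "subgroup (carrier Hom\<^sub>0) K"
proof (rule K.subgroupI)
  show "carrier Hom\<^sub>0 \<subseteq> carrier K" using Hom0_K by blast
  have "\<one>\<^bsub>K\<^esub> \<in> carrier Hom\<^sub>0" using K_one refl_groupD by (auto simp: Hom0_iff)
  then show "carrier Hom\<^sub>0 \<noteq> {}" by blast
  show "inv\<^bsub>K\<^esub> a \<in> carrier Hom\<^sub>0" if "a \<in> carrier Hom\<^sub>0" for a
    using that refl_groupD by (auto simp: Hom0_iff K_apply(3))
  show "a \<otimes>\<^bsub>K\<^esub> b \<in> carrier Hom\<^sub>0" if "a \<in> carrier Hom\<^sub>0" "b \<in> carrier Hom\<^sub>0" for a b
    using that refl_groupD by (auto simp: Hom0_iff K_mult)
qed

lemma Hom0_eq: "Hom\<^sub>0 = K\<lparr>carrier := carrier Hom\<^sub>0\<rparr>"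
  by (simp add: Hom0_def)

sublocale A: comm_group Hom\<^sub>0
proof -
  have "comm_group (K\<lparr>carrier := carrier Hom\<^sub>0\<rparr>)"
  proof (rule group.group_comm_groupI)
    show "group (K\<lparr>carrier := carrier Hom\<^sub>0\<rparr>)"
      by (rule subgroup.subgroup_is_group[OF subgroup_Hom0 K.is_group])
  qed (use Hom0_K K.m_comm in simp)
  then show "comm_group Hom\<^sub>0" using Hom0_eq by simp
qed

lemma inv_Hom0: "\<eta> \<in> carrier Hom\<^sub>0 \<Longrightarrow> inv\<^bsub>Hom\<^sub>0\<^esub> \<eta> = inv\<^bsub>K\<^esub> \<eta>"
  using K.m_inv_consistent[OF subgroup_Hom0] Hom0_eq by metis

lemma wt_refl:
  assumes f: "f \<in> Rel" and i: "i \<in> I" "\<not> rdvd R (x i) f" and g: "g \<in> refl_group i"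
  shows "wt f (\<rho> g) = 1"
proof -
  have gG: "g \<in> carrier G" using g by (rule refl_groupD)
  obtain v where v: "x i v = 0" "f v \<noteq> 0" using x_rdvd_iff[OF i(1) RelR[OF f]] i(2) by blast
  have "\<rho> (inv\<^bsub>G\<^esub> g) v = v"
  proof (rule vec_eqI)
    fix j assume j: "j \<in> I"
    show "x j (\<rho> (inv\<^bsub>G\<^esub> g) v) = x j v"
      using x_act[OF j gG, of v] g v j by (cases "j = i") (auto simp: refl_group_def)
  qed
  then have "f v = wt f (\<rho> g) * f v"
    using fun_cong[OF wt_act[OF f gG], of v] by (simp add: act_apply fun_scale_def)
  then show ?thesis using v(2) by simp
qed

text \<open>As \<open>d * x i\<close> is not a common divisor, some \<open>y = d * k\<close> in
  \<open>Z\<close> has \<open>k\<close> not divisible by \<open>x i\<close>. On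
  \<open>refl_group i\<close> both \<open>y\<close> and \<open>k\<close> have trivial weight, hence
  so has \<open>d\<close>.\<close>

lemma rgcd_Hom0:
  assumes Z: "Z \<subseteq> Rel" "z \<in> Z" "\<And>y. y \<in> Z \<Longrightarrow> wt y \<in> carrier Hom\<^sub>0" and d: "R.rgcd Z d"
  shows "wt d \<in> carrier Hom\<^sub>0"
  unfolding Hom0_iff
proof (intro conjI ballI)
  have dRel: "d \<in> Rel" by (rule rgcd_Rel[OF Z(1,2) d])
  then show "wt d \<in> carrier K" by (rule wt)
  fix i g assume ig: "i \<in> I" "g \<in> refl_group i"
  have dR: "d \<in> R" and d0: "d \<noteq> 0" using dRel RelR Rel0 by auto
  have "\<exists>y\<in>Z. \<not> rdvd R (d * x i) y"
  proof (rule ccontr)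
    assume "\<not> ?thesis"
    then have "rdvd R (d * x i) d" using d R.mult_in[OF dR R_x[OF ig(1)]] by (auto simp: R.rgcd_def)
    then obtain k where k: "k \<in> R" "d = d * x i * k" by (auto simp: rdvd_def)
    then have "d * 1 = d * (x i * k)" by (simp only: mult.assoc mult_1_right)
    then have "1 = x i * k" using R.cancel_left[OF dR R.one_in R.mult_in[OF R_x[OF ig(1)] k(1)] d0] by blast
    then show False using R.rprimeD(3)[OF x_rprime[OF ig(1)]] k by (auto simp: rdvd_def)
  qed
  then obtain y where y: "y \<in> Z" "\<not> rdvd R (d * x i) y" by blast
  obtain k where k: "k \<in> R" "y = d * k" using d y by (auto simp: R.rgcd_def rdvd_def)
  have kRel: "k \<in> Rel" using Rel_quotient[OF dRel k(1)] k y Z by auto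
  have "\<not> rdvd R (x i) k"
    using y(2) k by (auto simp: rdvd_def mult.assoc)
  then have "wt k (\<rho> g) = 1" by (rule wt_refl[OF kRel ig(1) _ ig(2)])
  moreover have "wt y (\<rho> g) = 1" using Z(3)[OF y(1)] ig by (auto simp: Hom0_iff)
  moreover have "wt y = wt d \<otimes>\<^bsub>K\<^esub> wt k" using Rel_mult(2)[OF dRel kRel] k by simp
  ultimately show "wt d (\<rho> g) = 1" using K_mult[OF refl_groupD[OF ig(2)]] by simp
qed


section \<open>Monomials\<close>

abbreviation mono where "mono \<equiv> monomial n x"

lemma mono_def: "mono a = (\<Prod>i\<in>I. x i ^ a i)"
  by (simp add: monomial_def I_def)

lemma mono_apply: "mono a v = (\<Prod>i\<in>I. x i v ^ a i)"
  by (simp add: mono_def prod_fun_apply power_fun_apply)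

lemma mono_add: "mono (\<lambda>i. a i + b i) = mono a * mono b"
  by (rule ext) (simp add: mono_apply power_add prod.distrib)

lemma mono_0: "mono (\<lambda>_. 0) = 1"
  by (rule ext) (simp add: mono_apply)

lemma mono_cong: "(\<And>i. i \<in> I \<Longrightarrow> a i = b i) \<Longrightarrow> mono a = mono b"
  by (rule ext) (simp add: mono_apply)

lemma mono_single: "i \<in> I \<Longrightarrow> mono (\<lambda>j. if j = i then k else 0) = x i ^ k"
proof (rule ext)
  fix v assume i: "i \<in> I"
  have "mono (\<lambda>j. if j = i then k else 0) v = (\<Prod>j\<in>I. if j = i then x i v ^ k else 1)"
    unfolding mono_apply by (rule prod.cong) auto
  then show "mono (\<lambda>j. if j = i then k else 0) v = (x i ^ k) v"
    using i by (simp add: power_fun_apply)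
qed

lemma mono_R: "mono a \<in> R"
  unfolding mono_def by (intro R.prod_in R.power_in R_x)

lemma mono_nonzero: "mono a \<noteq> 0"
proof
  assume "mono a = 0"
  then have "mono a (vec (\<lambda>_. 1)) = 0" by simp
  then show False by (simp add: mono_apply x_vec)
qed

lemma x_not_rdvd_mono: "k \<in> I \<Longrightarrow> a k = 0 \<Longrightarrow> \<not> rdvd R (x k) (mono a)"
proof
  assume k: "k \<in> I" "a k = 0" "rdvd R (x k) (mono a)"
  let ?v = "vec (\<lambda>i. if i = k then 0 else 1)"
  have "mono a ?v = 0" using k(3) x_rdvd_iff[OF k(1) mono_R] x_vec[OF k(1)] by simp
  moreover have "mono a ?v = 1"
    unfolding mono_apply by (rule prod.neutral) (use k x_vec in auto)
  ultimately show False by simp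
qed

lemma x_rdvd_mono: "k \<in> I \<Longrightarrow> a k > 0 \<Longrightarrow> mono a = x k * mono (a(k := a k - 1))"
proof -
  assume k: "k \<in> I" "a k > 0"
  have "mono a = mono (\<lambda>i. (if i = k then 1 else 0) + (a(k := a k - 1)) i)"
    by (rule mono_cong) (use k in auto)
  then show ?thesis using mono_add mono_single[OF k(1), of 1] by (simp add: fun_upd_def)
qed

lemma mono_eqD:
  assumes "mono a = fun_scale c (mono b)" "c \<noteq> 0" "i \<in> I"
  shows "a i = b i"
  using assms
proof (induction "a i" arbitrary: a b)
  case 0
  have "\<not> rdvd R (x i) (mono a)" by (rule x_not_rdvd_mono[of i a, OF 0(4) 0(1)[symmetric]])
  moreover have "rdvd R (x i) (mono a)" if "b i > 0"
  proof -
    have "mono a = x i * fun_scale c (mono (b(i := b i - 1)))"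
      using 0(2) unfolding x_rdvd_mono[of i b, OF 0(4) that] fun_scale_simps(2) .
    then show ?thesis using R_scale mono_R by (auto simp: rdvd_def)
  qed
  ultimately show ?case using 0 by auto
next
  case (Suc k)
  have b: "b i > 0"
  proof (rule ccontr)
    assume "\<not> b i > 0"
    then have "\<not> rdvd R (x i) (mono b)" by (intro x_not_rdvd_mono Suc.prems(3)) simp
    moreover have "mono b = x i * fun_scale (inverse c) (mono (a(i := a i - 1)))"
    proof -
      have "mono b = fun_scale (inverse c) (mono a)" using Suc by (simp add: fun_scale_simps)
      moreover have "mono a = x i * mono (a(i := a i - 1))"
        by (rule x_rdvd_mono[of i a, OF Suc.prems(3)]) (use Suc.hyps(2) in simp)
      ultimately show ?thesis by (simp only: fun_scale_simps)
    qed
    ultimately show False using R_scale mono_R by (auto simp: rdvd_def)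
  qed
  have a: "a i > 0" using Suc.hyps(2) by simp
  have "x i * mono (a(i := a i - 1)) = x i * fun_scale c (mono (b(i := b i - 1)))"
    using Suc.prems(1) unfolding x_rdvd_mono[of i a, OF Suc.prems(3) a] x_rdvd_mono[of i b, OF Suc.prems(3) b] fun_scale_simps(2) .
  then have "mono (a(i := a i - 1)) = fun_scale c (mono (b(i := b i - 1)))"
    using R.cancel_left[OF R_x mono_R R_scale[OF mono_R]] R.rprimeD(2)[OF x_rprime] Suc.prems by blast
  then have "(a(i := a i - 1)) i = (b(i := b i - 1)) i"
    using Suc.hyps(1)[of "a(i := a i - 1)" "b(i := b i - 1)"] Suc.hyps(2) Suc.prems by simp
  then show ?case using b Suc.hyps(2) by simp
qed

lemma wt_mono:
  shows "mono a \<in> Rel" "g \<in> carrier G \<Longrightarrow> wt (mono a) (\<rho> g) = (\<Prod>i\<in>I. \<chi> i g ^ a i)"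
proof -
  have *: "act G \<rho> g (mono a) = fun_scale (\<Prod>i\<in>I. \<chi> i g ^ a i) (mono a)" if "g \<in> carrier G" for g
  proof (rule ext)
    fix v
    have "mono a (\<rho> (inv\<^bsub>G\<^esub> g) v) = (\<Prod>i\<in>I. (\<chi> i g * x i v) ^ a i)"
      unfolding mono_apply using x_act that by (intro prod.cong) auto
    then show "act G \<rho> g (mono a) v = fun_scale (\<Prod>i\<in>I. \<chi> i g ^ a i) (mono a) v"
      by (simp add: act_apply fun_scale_def mono_apply power_mult_distrib prod.distrib)
  qed
  show Rel: "mono a \<in> Rel" by (rule RelI[OF mono_R mono_nonzero]) (use * in blast)
  show "wt (mono a) (\<rho> g) = (\<Prod>i\<in>I. \<chi> i g ^ a i)" if "g \<in> carrier G"
    using wt_act[OF Rel that] *[OF that] fun_scale_cancel[OF mono_nonzero] by metis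
qed

lemma char_nonzero: "of_nat (order G) \<noteq> (0 :: 'f)"
  using char by (simp add: of_nat_eq_0_iff_char_dvd)

text \<open>The common kernel of the \<open>\<chi> i\<close> with \<open>i \<noteq> k\<close> is
  \<open>refl_group k\<close>, so duality expresses \<open>\<eta>\<close> by these characters with
  natural exponents.\<close>

lemma mono_weight_ex:
  assumes \<eta>: "\<eta> \<in> carrier K" and k: "\<And>g. g \<in> refl_group k \<Longrightarrow> \<eta> (\<rho> g) = 1"
  shows "\<exists>a. a k = 0 \<and> wt (mono a) = \<eta>"
proof -
  have "\<exists>a::nat \<Rightarrow> nat. \<forall>g\<in>carrier G. \<eta> (\<rho> g) = (\<Prod>i\<in>I - {k}. \<chi> i g ^ a i)"
  proof (rule character_in_span[OF G char_nonzero])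
    show "\<chi> i \<in> hom G unit_group" if "i \<in> I - {k}" for i using \<chi>_hom that by simp
    show "(\<lambda>g. \<eta> (\<rho> g)) \<in> hom G unit_group"
      using K_apply(1,2)[OF \<eta>] by (auto simp: hom_def unit_group_def)
    show "\<eta> (\<rho> g) = 1" if "g \<in> carrier G" "\<And>i. i \<in> I - {k} \<Longrightarrow> \<chi> i g = 1" for g
      using k that by (auto simp: refl_group_def)
  qed simp
  then obtain a where a: "\<And>g. g \<in> carrier G \<Longrightarrow> \<eta> (\<rho> g) = (\<Prod>i\<in>I - {k}. \<chi> i g ^ a i)" by blast
  let ?b = "a(k := 0)"
  have "wt (mono ?b) = \<eta>"
  proof (rule K_eqI[OF wt(1)[OF wt_mono(1)] \<eta>])
    fix g assume g: "g \<in> carrier G"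
    have "(\<Prod>i\<in>I. \<chi> i g ^ ?b i) = (\<Prod>i\<in>I - {k}. \<chi> i g ^ a i)"
      by (rule prod.mono_neutral_cong_right) auto
    then show "wt (mono ?b) (\<rho> g) = \<eta> (\<rho> g)" using wt_mono(2)[OF g] a[OF g] by simp
  qed
  then show ?thesis by (intro exI[of _ ?b]) simp
qed

text \<open>A prime dividing a monomial divides some \<open>x i\<close>, and since
  \<open>x i\<close> is prime as well, the two are associated. The direction stated is the one that
  contradicts \<open>x_not_rdvd_mono\<close>.\<close>

lemma prime_rdvd_mono:
  assumes p: "rprime R p" and d: "rdvd R p (mono a)"
  shows "\<exists>i\<in>I. rdvd R (x i) p \<and> a i > 0"
proof -
  have pow: "rdvd R p (f ^ k) \<Longrightarrow> f \<in> R \<Longrightarrow> rdvd R p f \<and> k > 0" for f k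
    using R.rprimeD[OF p] R.power_in by (induction k) auto
  have "\<exists>i\<in>J. rdvd R p (x i ^ a i)" if "finite J" "J \<subseteq> I" "rdvd R p (\<Prod>i\<in>J. x i ^ a i)" for J
    using that
  proof (induction J)
    case empty
    then show ?case using R.rprimeD(3)[OF p] unfolding prod.empty by blast
  next
    case (insert j J)
    have "rdvd R p (x j ^ a j * (\<Prod>i\<in>J. x i ^ a i))" using insert.prems(2) unfolding prod.insert[OF insert.hyps] .
    moreover have "x j ^ a j \<in> R" "(\<Prod>i\<in>J. x i ^ a i) \<in> R"
      using insert R_x by (auto intro!: R.power_in R.prod_in)
    ultimately have "rdvd R p (x j ^ a j) \<or> rdvd R p (\<Prod>i\<in>J. x i ^ a i)"
      using R.rprimeD(4)[OF p] by blast
    then show ?case using insert by auto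
  qed
  from this[OF finite_I subset_refl] obtain i where i: "i \<in> I" "rdvd R p (x i ^ a i)" using d by (auto simp: mono_def)
  then have px: "rdvd R p (x i)" "a i > 0" using pow R_x by blast+
  then obtain u where u: "u \<in> R" "x i = p * u" by (auto simp: rdvd_def)
  note xp = x_rprime[OF i(1)]
  have "rdvd R (x i) p \<or> rdvd R (x i) u"
    using R.rprimeD(4)[OF xp R.rprimeD(1)[OF p] u(1)] u(2) R.rdvd_refl by metis
  moreover have "\<not> rdvd R (x i) u"
  proof
    assume "rdvd R (x i) u"
    then obtain w where w: "w \<in> R" "u = x i * w" by (auto simp: rdvd_def)
    have "x i * 1 = x i * (p * w)" using u(2) w(2) by (metis mult.left_commute mult_1_right)
    then have "1 = p * w"
      using R.cancel_left[OF R.rprimeD(1)[OF xp] R.one_in R.mult_in[OF R.rprimeD(1)[OF p] w(1)] R.rprimeD(2)[OF xp]] by blast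
    then show False using R.rprimeD(3)[OF p] w by (auto simp: rdvd_def)
  qed
  ultimately show ?thesis using i px by blast
qed

text \<open>Induction on the degree of the monomial, cancelling a prime \<open>x i\<close> from the
  factor that it divides. This makes \<open>M\<^sub>0\<close> divisor-closed in
  \<open>D\<^sub>0\<close>.\<close>

lemma mono_divisor:
  assumes "f \<in> R" "h \<in> R" "f * h = mono a"
  shows "\<exists>c b. c \<noteq> 0 \<and> f = fun_scale c (mono b)"
  using assms
proof (induction "\<Sum>i\<in>I. a i" arbitrary: f h a rule: less_induct)
  case less
  show ?case
  proof (cases "\<exists>i\<in>I. a i > 0")
    case False
    then have "mono a = 1" using mono_cong[of a "\<lambda>_. 0"] mono_0 by auto
    then have "rdvd R f 1" using less.prems by (auto simp: rdvd_def)
    then obtain c where "c \<noteq> 0" "f = (\<lambda>_. c)" using unit_const less.prems by blast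
    then have "f = fun_scale c (mono (\<lambda>_. 0))" using mono_0 by (auto simp: fun_scale_def fun_eq_iff)
    then show ?thesis using \<open>c \<noteq> 0\<close> by blast
  next
    case True
    then obtain i where i: "i \<in> I" "a i > 0" by blast
    let ?a = "a(i := a i - 1)"
    have ma: "mono a = x i * mono ?a" by (rule x_rdvd_mono[of i a, OF i])
    have "(\<Sum>j\<in>I. ?a j) < (\<Sum>j\<in>I. a j)"
      by (rule sum_strict_mono_ex1) (use i in auto)
    note IH = less.hyps[OF this]
    have xR: "x i \<in> R" "x i \<noteq> 0" using R.rprimeD[OF x_rprime[OF i(1)]] by auto
    have "rdvd R (x i) (f * h)" using ma less.prems mono_R by (auto simp: rdvd_def)
    then have "rdvd R (x i) f \<or> rdvd R (x i) h"
      using R.rprimeD(4)[OF x_rprime[OF i(1)]] less.prems by blast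
    then show ?thesis
    proof
      assume "rdvd R (x i) f"
      then obtain f' where f': "f' \<in> R" "f = x i * f'" by (auto simp: rdvd_def)
      have "x i * (f' * h) = x i * mono ?a" using f' less.prems ma by (simp only: mult.assoc)
      then have "f' * h = mono ?a" using R.cancel_left[OF xR(1) _ mono_R xR(2)] f' less.prems R.mult_in by blast
      then obtain c b where "c \<noteq> 0" "f' = fun_scale c (mono b)" using IH f' less.prems by blast
      moreover have "x i * mono b = mono (\<lambda>j. (if j = i then 1 else 0) + b j)"
        using mono_add mono_single[OF i(1), of 1] by simp
      ultimately have "f = fun_scale c (mono (\<lambda>j. (if j = i then 1 else 0) + b j))"
        using f' fun_scale_simps by metis
      then show ?thesis using \<open>c \<noteq> 0\<close> by blast
    next
      assume "rdvd R (x i) h"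
      then obtain h' where h': "h' \<in> R" "h = x i * h'" by (auto simp: rdvd_def)
      have "x i * (f * h') = x i * mono ?a" using h' less.prems ma by (simp only: mult.left_commute)
      then have "f * h' = mono ?a" using R.cancel_left[OF xR(1) _ mono_R xR(2)] h' less.prems R.mult_in by blast
      then show ?thesis using IH h' less.prems by blast
    qed
  qed
qed

text \<open>A prime common divisor would be associated to some \<open>x i\<close>, but the monomial
  with index \<open>i\<close> does not involve \<open>x i\<close>.\<close>

lemma common_divisor_monos:
  assumes "c \<in> R" "c \<noteq> 0" "\<And>k. k \<in> I \<Longrightarrow> rdvd R c (mono (m k))" "\<And>k. k \<in> I \<Longrightarrow> m k k = 0"
  shows "rdvd R c 1"
proof (rule ccontr)
  assume "\<not> rdvd R c 1"
  then obtain p where p: "rprime R p" "rdvd R p c" using R.nonunit_prime_divisor assms by blast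
  have "1 \<in> I" using n by (simp add: I_def)
  then have "rdvd R p (mono (m 1))" using p assms R.rdvd_trans by blast
  then obtain i where i: "i \<in> I" "rdvd R (x i) p" using prime_rdvd_mono p by blast
  then have "rdvd R (x i) (mono (m i))" using p assms R.rdvd_trans by blast
  then show False using x_not_rdvd_mono i assms(4) by blast
qed


section \<open>The monoids of relative invariants up to constants\<close>

text \<open>The coset of \<open>f\<close> modulo units: for invariants and for relative invariants
  the units are the nonzero constants, so \<open>to_H\<close> and \<open>to_D\<close> are both this
  map.\<close>

definition cls :: "('v \<Rightarrow> 'f) \<Rightarrow> ('v \<Rightarrow> 'f) set" where
  "cls f = {fun_scale c f | c. c \<noteq> 0}"

lemma Units_fun_monoid:
  assumes "S \<subseteq> R" "\<And>c. c \<noteq> 0 \<Longrightarrow> (\<lambda>_. c) \<in> S"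
  shows "Units (fun_monoid S) = {(\<lambda>_. c) | c. c \<noteq> 0}"
proof
  show "Units (fun_monoid S) \<subseteq> {(\<lambda>_. c) | c. c \<noteq> 0}"
  proof
    fix u assume "u \<in> Units (fun_monoid S)"
    then obtain v where "u \<in> S" "v \<in> S" "u * v = 1" by (auto simp: Units_def fun_monoid_def)
    moreover from this have "rdvd R u 1" using assms(1) by (auto simp: rdvd_def)
    ultimately show "u \<in> {(\<lambda>_. c) | c. c \<noteq> 0}" using unit_const assms(1) by blast
  qed
  show "{(\<lambda>_. c) | c. c \<noteq> 0} \<subseteq> Units (fun_monoid S)"
  proof
    fix u :: "'v \<Rightarrow> 'f" assume "u \<in> {(\<lambda>_. c) | c. c \<noteq> 0}"
    then obtain c where c: "c \<noteq> 0" "u = (\<lambda>_. c)" by blast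
    then have "u \<in> S" "(\<lambda>_. inverse c) \<in> S" using assms(2) by auto
    moreover have "u * (\<lambda>_. inverse c) = 1" "(\<lambda>_. inverse c) * u = 1" using c by (auto simp: fun_eq_iff)
    ultimately show "u \<in> Units (fun_monoid S)" by (auto simp: Units_def fun_monoid_def)
  qed
qed

lemma coset_fun_monoid:
  assumes "S \<subseteq> R" "\<And>c. c \<noteq> 0 \<Longrightarrow> (\<lambda>_. c) \<in> S"
  shows "f <#\<^bsub>fun_monoid S\<^esub> Units (fun_monoid S) = cls f"
proof -
  have "f <#\<^bsub>fun_monoid S\<^esub> Units (fun_monoid S) = (\<Union>h\<in>{(\<lambda>_. c) | c. c \<noteq> 0}. {f * h})"
  proof -
    have U: "Units (fun_monoid S) = {(\<lambda>_. c) | c. c \<noteq> 0}"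
      by (rule Units_fun_monoid) (use assms in auto)
    have m: "f \<otimes>\<^bsub>fun_monoid S\<^esub> h = f * h" for h by (simp add: fun_monoid_def)
    show ?thesis unfolding l_coset_def U m ..
  qed
  also have "\<dots> = (\<Union>c\<in>{c. c \<noteq> 0}. {f * (\<lambda>_. c)})" by blast
  also have "\<dots> = cls f" unfolding const_mult cls_def by blast
  finally show ?thesis .
qed

abbreviation Inv where "Inv \<equiv> invariants scale G \<rho> - {0}"

lemma Inv_iff: "f \<in> Inv \<longleftrightarrow> f \<in> Rel \<and> wt f = \<one>\<^bsub>K\<^esub>"
proof
  assume f: "f \<in> Inv"
  then have "has_weight G \<rho> f \<one>\<^bsub>K\<^esub>"
    by (simp add: has_weight_def invariants_def K_one fun_scale_simps)
  then show "f \<in> Rel \<and> wt f = \<one>\<^bsub>K\<^esub>"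
    using f wt_eqI[of f "\<one>\<^bsub>K\<^esub>"] Rel_iff K.one_closed by (auto simp: invariants_def)
next
  assume f: "f \<in> Rel \<and> wt f = \<one>\<^bsub>K\<^esub>"
  then have "act G \<rho> g f = f" if "g \<in> carrier G" for g
    using wt_act[of f g] that K_one by (simp add: fun_scale_simps)
  then show "f \<in> Inv" using f RelR Rel0 by (auto simp: invariants_def)
qed

lemma Inv_const: "c \<noteq> 0 \<Longrightarrow> (\<lambda>_. c) \<in> Inv"
  using Inv_iff Rel_const by blast

lemma Inv_R: "Inv \<subseteq> R"
  by (auto simp: invariants_def)

lemma to_H_eq: "to_H scale G \<rho> f = cls f"
  unfolding to_H_def Let_def by (rule coset_fun_monoid[OF Inv_R Inv_const])

lemma Rel_R: "Rel \<subseteq> R"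
  using RelR by blast

lemma to_D_eq: "to_D scale G \<rho> f = cls f"
  unfolding to_D_def Let_def Rel_def[symmetric] by (rule coset_fun_monoid[OF Rel_R Rel_const(1)])

abbreviation D where "D \<equiv> D_mon scale G \<rho>"
abbreviation H where "H \<equiv> H_mon scale G \<rho>"
abbreviation D\<^sub>0 where "D\<^sub>0 \<equiv> D0_mon scale G \<rho>"
abbreviation M\<^sub>0 where "M\<^sub>0 \<equiv> M0_mon scale G \<rho> n x"
abbreviation MG where "MG \<equiv> MG_mon scale G \<rho> n x"
abbreviation MGD where "MGD \<equiv> MGD_mon scale G \<rho> n x"

lemma cls_one: "cls 1 = {(\<lambda>_. c) | c. c \<noteq> 0}"
  by (auto simp: cls_def fun_scale_def fun_eq_iff)

lemma carrier_D: "carrier D = cls ` Rel"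
  unfolding D_mon_def Rel_def[symmetric] reduced_monoid_def
  using coset_fun_monoid[OF Rel_R Rel_const(1)] by (simp add: fun_monoid_def)

lemma carrier_H: "carrier H = cls ` Inv"
  unfolding H_mon_def reduced_monoid_def
  using coset_fun_monoid[OF Inv_R Inv_const] by (simp add: fun_monoid_def)

lemma set_mult_cls: "cls f <#>\<^bsub>fun_monoid S\<^esub> cls h = cls (f * h)"
proof
  show "cls f <#>\<^bsub>fun_monoid S\<^esub> cls h \<subseteq> cls (f * h)"
  proof
    fix k assume "k \<in> cls f <#>\<^bsub>fun_monoid S\<^esub> cls h"
    then obtain c d where "c \<noteq> 0" "d \<noteq> 0" "k = fun_scale c f * fun_scale d h"
      by (auto simp: set_mult_def cls_def fun_monoid_def)
    then have "c * d \<noteq> 0" "k = fun_scale (c * d) (f * h)" by (auto simp: fun_scale_simps mult.commute)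
    then show "k \<in> cls (f * h)" unfolding cls_def by blast
  qed
  show "cls (f * h) \<subseteq> cls f <#>\<^bsub>fun_monoid S\<^esub> cls h"
  proof
    fix k assume "k \<in> cls (f * h)"
    then obtain c where c: "c \<noteq> 0" "k = fun_scale c (f * h)" by (auto simp: cls_def)
    then have "k = fun_scale c f * fun_scale 1 h" by (simp add: fun_scale_simps)
    moreover have "fun_scale c f \<in> cls f" "fun_scale 1 h \<in> cls h" using c unfolding cls_def by fastforce+
    ultimately show "k \<in> cls f <#>\<^bsub>fun_monoid S\<^esub> cls h"
      unfolding set_mult_def fun_monoid_def by (simp del: times_fun_apply) blast
  qed
qed

lemma D_mult: "cls f \<otimes>\<^bsub>D\<^esub> cls h = cls (f * h)" and H_mult: "cls f \<otimes>\<^bsub>H\<^esub> cls h = cls (f * h)"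
  by (simp_all add: D_mon_def H_mon_def reduced_monoid_def set_mult_cls)

lemma D_one: "\<one>\<^bsub>D\<^esub> = cls 1" and H_one: "\<one>\<^bsub>H\<^esub> = cls 1"
  unfolding D_mon_def H_mon_def reduced_monoid_def Rel_def[symmetric] cls_one
  using Units_fun_monoid[OF Rel_R Rel_const(1)] Units_fun_monoid[OF Inv_R Inv_const] by simp_all

lemma cls_self: "f \<in> cls f"
  unfolding cls_def using fun_scale_simps(4)[of f] by (metis (mono_tags, lifting) mem_Collect_eq zero_neq_one)

lemma cls_eq_iff: "cls f = cls h \<longleftrightarrow> (\<exists>c. c \<noteq> 0 \<and> h = fun_scale c f)"
proof
  assume "cls f = cls h"
  then have "h \<in> cls f" using cls_self by simp
  then show "\<exists>c. c \<noteq> 0 \<and> h = fun_scale c f" by (auto simp: cls_def)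
next
  assume "\<exists>c. c \<noteq> 0 \<and> h = fun_scale c f"
  then obtain c where c: "c \<noteq> 0" "h = fun_scale c f" by blast
  show "cls f = cls h"
  proof
    show "cls h \<subseteq> cls f"
    proof
      fix k assume "k \<in> cls h"
      then obtain d where "d \<noteq> 0" "k = fun_scale (d * c) f" using c by (auto simp: cls_def fun_scale_simps)
      then show "k \<in> cls f" using c unfolding cls_def by (metis (mono_tags, lifting) mem_Collect_eq mult_eq_0_iff)
    qed
    show "cls f \<subseteq> cls h"
    proof
      fix k assume "k \<in> cls f"
      then obtain d where d: "d \<noteq> 0" "k = fun_scale d f" by (auto simp: cls_def)
      then have "k = fun_scale (d * inverse c) h" using c by (simp add: fun_scale_simps mult.assoc)
      then show "k \<in> cls h" using c d unfolding cls_def by (metis (mono_tags, lifting) mem_Collect_eq mult_eq_0_iff inverse_nonzero_iff_nonzero)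
    qed
  qed
qed

lemma Rel_one: "1 \<in> Rel" "wt 1 = \<one>\<^bsub>K\<^esub>"
  using Rel_const[of 1] by (simp_all add: one_fun_def)

lemma comm_monoid_cancel_D: "comm_monoid_cancel D"
proof (rule comm_monoid_cancelI)
  show "Group.comm_monoid D"
  proof (rule comm_monoidI)
    show "\<one>\<^bsub>D\<^esub> \<in> carrier D" using Rel_one by (auto simp: D_one carrier_D)
    fix a b c assume a: "a \<in> carrier D"
    then obtain f where f: "f \<in> Rel" "a = cls f" by (auto simp: carrier_D)
    show "\<one>\<^bsub>D\<^esub> \<otimes>\<^bsub>D\<^esub> a = a" using f by (simp add: D_one D_mult del: one_fun_apply)
    assume b: "b \<in> carrier D" then obtain h where h: "h \<in> Rel" "b = cls h" by (auto simp: carrier_D)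
    show "a \<otimes>\<^bsub>D\<^esub> b \<in> carrier D" using f h Rel_mult(1) by (auto simp: D_mult carrier_D)
    show "a \<otimes>\<^bsub>D\<^esub> b = b \<otimes>\<^bsub>D\<^esub> a" using f h by (simp only: D_mult mult.commute)
    assume "c \<in> carrier D" then obtain k where k: "k \<in> Rel" "c = cls k" by (auto simp: carrier_D)
    show "a \<otimes>\<^bsub>D\<^esub> b \<otimes>\<^bsub>D\<^esub> c = a \<otimes>\<^bsub>D\<^esub> (b \<otimes>\<^bsub>D\<^esub> c)" using f h k by (simp only: D_mult mult.assoc)
  qed
  fix a b c assume eq: "a \<otimes>\<^bsub>D\<^esub> c = b \<otimes>\<^bsub>D\<^esub> c" and abc: "a \<in> carrier D" "b \<in> carrier D" "c \<in> carrier D"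
  then obtain f h k where fhk: "f \<in> Rel" "h \<in> Rel" "k \<in> Rel" "a = cls f" "b = cls h" "c = cls k"
    by (auto simp: carrier_D)
  then obtain d where d: "d \<noteq> 0" "h * k = fun_scale d (f * k)" using eq D_mult cls_eq_iff by metis
  have "k * h = k * fun_scale d f" using d(2) by (simp only: fun_scale_simps mult.commute)
  then have "h = fun_scale d f"
    using R.cancel_left[OF RelR[OF fhk(3)] RelR[OF fhk(2)] R_scale[OF RelR[OF fhk(1)]] Rel0[OF fhk(3)]] by blast
  then show "a = b" using fhk d cls_eq_iff by blast
qed

lemma cls_divides:
  assumes "f \<in> Rel" "h \<in> Rel"
  shows "cls f divides\<^bsub>D\<^esub> cls h \<longleftrightarrow> rdvd R f h"
proof
  assume "cls f divides\<^bsub>D\<^esub> cls h"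
  then obtain k where "k \<in> Rel" "cls h = cls (f * k)" by (auto simp: factor_def carrier_D D_mult)
  then obtain c where "h = fun_scale c (f * k)" using cls_eq_iff by metis
  then have "h = f * fun_scale c k" by (simp add: fun_scale_simps)
  then show "rdvd R f h" using R_scale[OF RelR[OF \<open>k \<in> Rel\<close>]] by (auto simp: rdvd_def)
next
  assume "rdvd R f h"
  then obtain k where k: "k \<in> R" "h = f * k" by (auto simp: rdvd_def)
  then have "k \<in> Rel" using Rel_quotient assms by blast
  then show "cls f divides\<^bsub>D\<^esub> cls h" using k by (auto simp: factor_def carrier_D D_mult)
qed

lemma weight_cls: "f \<in> Rel \<Longrightarrow> weight scale G \<rho> (cls f) = wt f"
  unfolding weight_def
proof (rule the_equality)
  assume f: "f \<in> Rel"
  show "wt f \<in> carrier K \<and> (\<exists>h\<in>cls f. has_weight G \<rho> h (wt f))"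
    using wt[OF f] cls_self by blast
  fix \<eta> assume "\<eta> \<in> carrier K \<and> (\<exists>h\<in>cls f. has_weight G \<rho> h \<eta>)"
  then obtain c where c: "c \<noteq> 0" "\<eta> \<in> carrier K" "has_weight G \<rho> (fun_scale c f) \<eta>" by (auto simp: cls_def)
  then have "wt (fun_scale c f) = \<eta>" using wt_eqI Rel0[OF f] fun_scale_eq_0 by blast
  then show "\<eta> = wt f" using Rel_scale(2)[OF f c(1)] by simp
qed

end

lemma (in factorial_weight) divisor_theory_embedding:
  assumes "\<And>p. p \<in> primes E \<Longrightarrow> \<exists>Y. Y \<subseteq> carrier H \<and> finite Y \<and> Y \<noteq> {} \<and> is_gcd E Y p"
  shows "divisor_theory_embedding H E"
proof (rule divisor_theory_embeddingI[OF _ mult_H one_H _ assms])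
  show "carrier H \<subseteq> carrier E" by (auto simp: carrier_H)
  show "c \<in> carrier H" if "a \<in> carrier H" "c \<in> carrier E" "a \<otimes> c \<in> carrier H" for a c
    using that w_mult[of a c] by (simp add: carrier_H)
qed

section \<open>Relative invariants with weight in Hom^0\<close>

context diagonal_rep
begin

text \<open>The representatives of the elements of \<open>D\<^sub>0\<close>, as
  \<open>carrier_D0\<close> shows.\<close>

definition RelHom :: "('v \<Rightarrow> 'f) set" where
  "RelHom = {f \<in> Rel. wt f \<in> carrier Hom\<^sub>0}"

lemma RelHom_Rel: "f \<in> RelHom \<Longrightarrow> f \<in> Rel" and RelHom_wt: "f \<in> RelHom \<Longrightarrow> wt f \<in> carrier Hom\<^sub>0"
  by (simp_all add: RelHom_def)

lemma RelHom_one: "1 \<in> RelHom"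
  using Rel_one A.one_closed by (simp add: RelHom_def)

lemma RelHom_mult: "f \<in> RelHom \<Longrightarrow> h \<in> RelHom \<Longrightarrow> f * h \<in> RelHom"
  using Rel_mult A.m_closed by (simp add: RelHom_def)

lemma RelHom_quotient:
  assumes f: "f \<in> RelHom" and h: "h \<in> R" and fh: "f * h \<in> RelHom"
  shows "h \<in> RelHom"
proof -
  have hRel: "h \<in> Rel" using Rel_quotient RelHom_Rel assms by blast
  have "wt (f * h) = wt f \<otimes>\<^bsub>K\<^esub> wt h" using Rel_mult(2)[OF RelHom_Rel[OF f] hRel] .
  then have "wt h = inv\<^bsub>K\<^esub> wt f \<otimes>\<^bsub>K\<^esub> wt (f * h)"
    using K.inv_solve_left wt(1) hRel RelHom_Rel[OF f] RelHom_Rel[OF fh] by metis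
  moreover have "inv\<^bsub>K\<^esub> wt f \<in> carrier Hom\<^sub>0" using A.inv_closed[OF RelHom_wt[OF f]] inv_Hom0[OF RelHom_wt[OF f]] by simp
  ultimately have "wt h \<in> carrier Hom\<^sub>0" using A.m_closed RelHom_wt[OF fh] by simp
  then show ?thesis using hRel by (simp add: RelHom_def)
qed

lemma Inv_RelHom: "f \<in> Inv \<Longrightarrow> f \<in> RelHom"
  using Inv_iff A.one_closed by (simp add: RelHom_def)

text \<open>There is one monomial per coordinate, so that every coordinate is avoided by one of
  them; together they have only unit common divisors (\<open>common_divisor_monos\<close>).\<close>

lemma mono_weight_inv_ex:
  assumes f: "f \<in> RelHom"
  shows "\<exists>m. \<forall>k\<in>I. m k k = 0 \<and> f * mono (m k) \<in> Inv"
proof -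
  have "\<exists>a. a k = 0 \<and> f * mono a \<in> Inv" if k: "k \<in> I" for k
  proof -
    have i: "inv\<^bsub>K\<^esub> wt f \<in> carrier Hom\<^sub>0" using A.inv_closed[OF RelHom_wt[OF f]] inv_Hom0[OF RelHom_wt[OF f]] by simp
    then obtain a where a: "a k = 0" "wt (mono a) = inv\<^bsub>K\<^esub> wt f"
      using mono_weight_ex[of "inv\<^bsub>K\<^esub> wt f" k] k Hom0_iff by blast
    have "wt (f * mono a) = \<one>\<^bsub>K\<^esub>"
      using Rel_mult(2)[OF RelHom_Rel[OF f] wt_mono(1)] a(2) wt(1)[OF RelHom_Rel[OF f]] by simp
    then show ?thesis using a(1) Rel_mult(1)[OF RelHom_Rel[OF f] wt_mono(1)] Inv_iff by blast
  qed
  then show ?thesis by metis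
qed

lemma gcd_invariant_multiples:
  assumes f: "f \<in> RelHom" and m: "\<And>k. k \<in> I \<Longrightarrow> m k k = 0"
  shows "is_gcd D ((\<lambda>k. cls (f * mono (m k))) ` I) (cls f)"
  unfolding is_gcd_def
proof (intro conjI ballI impI)
  have fRel: "f \<in> Rel" by (rule RelHom_Rel[OF f])
  have fR: "f \<in> R" "f \<noteq> 0" using fRel RelR Rel0 by auto
  have fm: "f * mono a \<in> Rel" for a by (rule Rel_mult(1)[OF fRel wt_mono(1)])
  have oneI: "1 \<in> I" using n by (simp add: I_def)
  show "cls f \<in> carrier D" using fRel by (auto simp: carrier_D)
  show "cls f divides\<^bsub>D\<^esub> a" if "a \<in> (\<lambda>k. cls (f * mono (m k))) ` I" for a
    using that cls_divides[OF fRel fm] R.rdvd_mult_self[OF mono_R] by auto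
  fix a assume "a \<in> carrier D" and div: "\<forall>b\<in>(\<lambda>k. cls (f * mono (m k))) ` I. a divides\<^bsub>D\<^esub> b"
  then obtain c where c: "c \<in> Rel" "a = cls c" by (auto simp: carrier_D)
  have cm: "rdvd R c (f * mono (m k))" if "k \<in> I" for k
    using div that c cls_divides[OF c(1) fm] by auto
  let ?Z = "(\<lambda>k. f * mono (m k)) ` I"
  have "\<exists>d. R.rgcd ?Z d"
  proof (rule R.rgcd_ex)
    show "?Z \<subseteq> R" using RelR[OF fm] by auto
    show "f * mono (m 1) \<in> ?Z" using oneI by blast
    show "f * mono (m 1) \<noteq> 0" by (rule Rel0[OF fm])
  qed simp
  then obtain d where d: "d \<in> R" "\<And>k. k \<in> I \<Longrightarrow> rdvd R d (f * mono (m k))"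
    "\<And>c. c \<in> R \<Longrightarrow> (\<And>k. k \<in> I \<Longrightarrow> rdvd R c (f * mono (m k))) \<Longrightarrow> rdvd R c d"
    by (auto simp: R.rgcd_def)
  have "rdvd R f d" using d(3) fR R.rdvd_mult_self[OF mono_R] by blast
  then obtain s where s: "s \<in> R" "d = f * s" by (auto simp: rdvd_def)
  \<comment> \<open>The gcd in \<open>R\<close> of the multiples is \<open>d = f * s\<close>, where
    \<open>s\<close> divides every \<open>mono (m k)\<close>. So \<open>d\<close> and
    \<open>f\<close> are associated, and every common divisor divides \<open>f\<close>.\<close>
  have "rdvd R s 1"
  proof (rule common_divisor_monos)
    show "s \<in> R" by fact
    show "rdvd R s (mono (m k))" if k: "k \<in> I" for k
    proof -
      obtain t where t: "t \<in> R" "f * mono (m k) = f * s * t" using d(2)[OF k] s by (auto simp: rdvd_def)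
      then have "f * mono (m k) = f * (s * t)" by (simp only: mult.assoc)
      then have "mono (m k) = s * t"
        by (rule R.cancel_left[OF fR(1) mono_R R.mult_in[OF s(1) t(1)] fR(2)])
      then show ?thesis using t by (auto simp: rdvd_def)
    qed
    show "s \<noteq> 0"
    proof
      assume "s = 0"
      then have "d = 0" using s by simp
      then have "f * mono (m 1) = 0" using d(2)[OF oneI] by (auto simp: rdvd_def)
      then show False using Rel0[OF fm] by blast
    qed
  qed (rule m)
  then obtain u where u: "u \<in> R" "1 = s * u" by (auto simp: rdvd_def)
  have "d * u = f" unfolding s(2) by (simp only: mult.assoc u(2)[symmetric] mult_1_right)
  then have "rdvd R d f" using u(1) by (auto simp: rdvd_def)
  moreover have "rdvd R c d" using d(3) RelR[OF c(1)] cm by blast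
  ultimately show "a divides\<^bsub>D\<^esub> cls f" using R.rdvd_trans c cls_divides[OF c(1) fRel] by blast
qed

lemma carrier_D0: "carrier D\<^sub>0 = cls ` RelHom"
proof
  show "carrier D\<^sub>0 \<subseteq> cls ` RelHom"
  proof
    fix a assume "a \<in> carrier D\<^sub>0"
    then obtain Y where Y: "Y \<subseteq> cls ` Inv" "finite Y" "Y \<noteq> {}" "is_gcd D Y a"
      by (auto simp: D0_mon_def carrier_H)
    obtain Z where Z: "Z \<subseteq> Inv" "finite Z" "Y = cls ` Z" using finite_subset_image[OF Y(2,1)] by blast
    have ZR: "Z \<subseteq> Rel" using Z(1) Inv_iff by blast
    obtain z where z: "z \<in> Z" using Y(3) Z(3) by blast
    have "\<exists>d. R.rgcd Z d"
      by (rule R.rgcd_ex[OF Z(2) _ z]) (use ZR z RelR Rel0 in auto)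
    then obtain d where d: "R.rgcd Z d" by blast
    have dRel: "d \<in> Rel" by (rule rgcd_Rel[OF ZR z d])
    have "wt d \<in> carrier Hom\<^sub>0"
      by (rule rgcd_Hom0[OF ZR z _ d]) (use Z(1) Inv_RelHom RelHom_wt in blast)
    then have dRelHom: "d \<in> RelHom" using dRel by (simp add: RelHom_def)
    obtain f where f: "f \<in> Rel" "a = cls f" using Y(4) by (auto simp: is_gcd_def carrier_D)
    \<comment> \<open>The given gcd \<open>a = cls f\<close> in \<open>D\<close> and the gcd
      \<open>d\<close> taken in \<open>R\<close> divide each other, whence
      \<open>a = cls d\<close>.\<close>
    have "rdvd R f y" if "y \<in> Z" for y
      using Y(4) that Z(3) f cls_divides[OF f(1), of y] ZR by (auto simp: is_gcd_def)
    then have fd: "rdvd R f d" using d RelR[OF f(1)] by (auto simp: R.rgcd_def)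
    have "cls d divides\<^bsub>D\<^esub> b" if "b \<in> Y" for b
      using that Z(3) d cls_divides[OF dRel] ZR by (auto simp: R.rgcd_def)
    then have "cls d divides\<^bsub>D\<^esub> a" using Y(4) dRel by (auto simp: is_gcd_def carrier_D)
    then have "rdvd R d f" using f cls_divides[OF dRel f(1)] by simp
    then obtain c where "c \<noteq> 0" "d = fun_scale c f"
      using mutual_rdvd[OF RelR[OF f(1)] RelR[OF dRel] Rel0[OF f(1)] fd] by blast
    then have "a = cls d" using f cls_eq_iff by blast
    then show "a \<in> cls ` RelHom" using dRelHom by blast
  qed
  show "cls ` RelHom \<subseteq> carrier D\<^sub>0"
  proof
    fix a assume "a \<in> cls ` RelHom"
    then obtain f where f: "f \<in> RelHom" "a = cls f" by blast
    obtain m where m: "\<forall>k\<in>I. m k k = 0 \<and> f * mono (m k) \<in> Inv" using mono_weight_inv_ex[OF f(1)] by blast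
    have "is_gcd D ((\<lambda>k. cls (f * mono (m k))) ` I) (cls f)"
      by (rule gcd_invariant_multiples[OF f(1)]) (use m in blast)
    moreover have "(\<lambda>k. cls (f * mono (m k))) ` I \<subseteq> carrier H" using m by (auto simp: carrier_H)
    moreover have "(\<lambda>k. cls (f * mono (m k))) ` I \<noteq> {}" using n by (auto simp: I_def)
    ultimately show "a \<in> carrier D\<^sub>0" using f unfolding D0_mon_def by auto
  qed
qed

lemma D0_simps [simp]: "mult D\<^sub>0 = mult D" "one D\<^sub>0 = one D"
  by (simp_all add: D0_mon_def)

lemma RelHom_scale: "f \<in> RelHom \<Longrightarrow> c \<noteq> 0 \<Longrightarrow> fun_scale c f \<in> RelHom"
  using Rel_scale by (simp add: RelHom_def)

lemma D0_D: "a \<in> carrier D\<^sub>0 \<Longrightarrow> a \<in> carrier D"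
  using RelHom_Rel by (auto simp: carrier_D0 carrier_D)

lemma comm_monoid_cancel_D0: "comm_monoid_cancel D\<^sub>0"
proof -
  interpret D: comm_monoid_cancel D by (rule comm_monoid_cancel_D)
  show ?thesis
  proof (rule comm_monoid_cancelI)
    show "Group.comm_monoid D\<^sub>0"
    proof (rule comm_monoidI)
      show "\<one>\<^bsub>D\<^sub>0\<^esub> \<in> carrier D\<^sub>0" using RelHom_one by (auto simp: D_one carrier_D0)
      show "a \<otimes>\<^bsub>D\<^sub>0\<^esub> b \<in> carrier D\<^sub>0" if "a \<in> carrier D\<^sub>0" "b \<in> carrier D\<^sub>0" for a b
        using that RelHom_mult by (auto simp: D_mult carrier_D0)
    qed (use D.m_assoc D.m_comm D0_D in auto)
    show "a = b" if "a \<otimes>\<^bsub>D\<^sub>0\<^esub> c = b \<otimes>\<^bsub>D\<^sub>0\<^esub> c" "a \<in> carrier D\<^sub>0" "b \<in> carrier D\<^sub>0" "c \<in> carrier D\<^sub>0" for a b c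
      using that D.r_cancel D0_D by simp
  qed
qed

lemma cls_divides_D0:
  assumes "f \<in> RelHom" "h \<in> RelHom"
  shows "cls f divides\<^bsub>D\<^sub>0\<^esub> cls h \<longleftrightarrow> rdvd R f h"
proof
  assume "cls f divides\<^bsub>D\<^sub>0\<^esub> cls h"
  then have "cls f divides\<^bsub>D\<^esub> cls h" using D0_D by (auto simp: factor_def)
  then show "rdvd R f h" using cls_divides RelHom_Rel assms by blast
next
  assume "rdvd R f h"
  then obtain k where k: "k \<in> R" "h = f * k" by (auto simp: rdvd_def)
  then have "k \<in> RelHom" using RelHom_quotient assms by blast
  then show "cls f divides\<^bsub>D\<^sub>0\<^esub> cls h" using k by (auto simp: factor_def carrier_D0 D_mult)
qed

lemma cls_eq_one_iff: "f \<in> Rel \<Longrightarrow> cls f = \<one>\<^bsub>D\<^esub> \<longleftrightarrow> rdvd R f 1"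
proof
  assume f: "f \<in> Rel" "cls f = \<one>\<^bsub>D\<^esub>"
  then obtain c where c: "c \<noteq> 0" "1 = fun_scale c f" using cls_eq_iff D_one by metis
  then have "1 = f * fun_scale c 1" by (simp only: fun_scale_simps mult_1_right)
  then show "rdvd R f 1" using R_scale[OF R.one_in] unfolding rdvd_def by blast
next
  assume f: "f \<in> Rel" "rdvd R f 1"
  then obtain c where c: "c \<noteq> 0" "f = (\<lambda>_. c)" using unit_const RelR by blast
  have "(\<lambda>_. c) * (1 :: 'v \<Rightarrow> 'f) = fun_scale c 1" by (rule const_mult)
  then have "f = fun_scale c 1" using c(2) by (simp only: mult_1_right)
  then have "cls 1 = cls f" using c(1) cls_eq_iff by blast
  then show "cls f = \<one>\<^bsub>D\<^esub>" by (simp add: D_one)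
qed

definition cls_length :: "('v \<Rightarrow> 'f) set \<Rightarrow> nat" where
  "cls_length d = (LEAST k. \<exists>f\<in>d. k = R.prime_length f)"

lemma cls_length_less:
  assumes "f \<in> Rel" "h \<in> Rel" "\<not> rdvd R f 1"
  shows "cls_length (cls h) < cls_length (cls (f * h))"
proof -
  have "\<exists>k. \<exists>y\<in>cls (f * h). k = R.prime_length y" using cls_self by blast
  from LeastI_ex[OF this] obtain y where y: "y \<in> cls (f * h)" "cls_length (cls (f * h)) = R.prime_length y"
    by (auto simp: cls_length_def)
  then obtain c where c: "c \<noteq> 0" "y = f * fun_scale c h" by (auto simp: cls_def fun_scale_simps)
  have hc: "fun_scale c h \<in> Rel" using Rel_scale assms c by blast
  have "R.prime_length (fun_scale c h) < R.prime_length (f * fun_scale c h)"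
    using R.prime_length_less[OF RelR RelR Rel0 Rel0] assms hc by blast
  moreover have "fun_scale c h \<in> cls h" using c by (auto simp: cls_def)
  then have "cls_length (cls h) \<le> R.prime_length (fun_scale c h)"
    unfolding cls_length_def by (intro Least_le) blast
  ultimately show ?thesis using y c by simp
qed

text \<open>The gcd \<open>d\<close> of \<open>f\<close> and \<open>h\<close> in \<open>R\<close>
  again has weight in \<open>Hom\<^sub>0\<close>, so \<open>f = d * s\<close> is a factorization in
  \<open>D\<^sub>0\<close>. Either \<open>s\<close> is a unit and \<open>f\<close> divides
  \<open>h\<close>, or \<open>d\<close> is a unit and \<open>f\<close> divides \<open>k\<close> by
  \<open>coprime_rdvd\<close>.\<close>

lemma irreducible_D0_prime:
  assumes a: "a \<in> carrier D\<^sub>0" "a \<noteq> \<one>\<^bsub>D\<^sub>0\<^esub>"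
    and irr: "\<And>b c. b \<in> carrier D\<^sub>0 \<Longrightarrow> c \<in> carrier D\<^sub>0 \<Longrightarrow> a = b \<otimes>\<^bsub>D\<^sub>0\<^esub> c \<Longrightarrow> b = \<one>\<^bsub>D\<^sub>0\<^esub> \<or> c = \<one>\<^bsub>D\<^sub>0\<^esub>"
    and U: "Units D\<^sub>0 = {\<one>\<^bsub>D\<^sub>0\<^esub>}"
  shows "Divisibility.prime D\<^sub>0 a"
proof (rule primeI)
  show "a \<notin> Units D\<^sub>0" using a(2) unfolding U by blast
  fix b c assume "b \<in> carrier D\<^sub>0" "c \<in> carrier D\<^sub>0" and div: "a divides\<^bsub>D\<^sub>0\<^esub> b \<otimes>\<^bsub>D\<^sub>0\<^esub> c"
  then obtain f h k where fhk: "f \<in> RelHom" "h \<in> RelHom" "k \<in> RelHom" "a = cls f" "b = cls h" "c = cls k"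
    using a by (auto simp: carrier_D0)
  note RelF = fhk(1-3)[THEN RelHom_Rel]
  have dvd: "rdvd R f (h * k)" using div fhk cls_divides_D0[OF fhk(1) RelHom_mult[OF fhk(2,3)]] by (simp add: D_mult)
  have "\<exists>d. R.rgcd {f, h} d" by (rule R.rgcd_pair_ex) (use RelF RelR Rel0 in auto)
  then obtain d where d: "R.rgcd {f, h} d" by blast
  have sub: "{f, h} \<subseteq> Rel" "f \<in> {f, h}" using RelF by auto
  have "d \<in> Rel" by (rule rgcd_Rel[OF sub d])
  moreover have "wt d \<in> carrier Hom\<^sub>0" by (rule rgcd_Hom0[OF sub _ d]) (use fhk RelHom_wt in auto)
  ultimately have dRelHom: "d \<in> RelHom" by (simp add: RelHom_def)
  obtain s where s: "s \<in> R" "f = d * s" using d by (auto simp: R.rgcd_def rdvd_def)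
  have sRH: "s \<in> RelHom" using RelHom_quotient[OF dRelHom s(1)] s fhk(1) by simp
  have "a = cls d \<otimes>\<^bsub>D\<^sub>0\<^esub> cls s" using fhk(4) s(2) by (simp add: D_mult)
  then have "cls d = \<one>\<^bsub>D\<^esub> \<or> cls s = \<one>\<^bsub>D\<^esub>" using irr[of "cls d" "cls s"] dRelHom sRH by (auto simp: carrier_D0)
  then show "a divides\<^bsub>D\<^sub>0\<^esub> b \<or> a divides\<^bsub>D\<^sub>0\<^esub> c"
  proof
    assume "cls d = \<one>\<^bsub>D\<^esub>"
    then have "rdvd R d 1" using cls_eq_one_iff[OF RelHom_Rel[OF dRelHom]] by simp
    then have "rdvd R f k"
      using R.coprime_rdvd[OF RelR[OF RelF(1)] Rel0[OF RelF(1)] RelR[OF RelF(2)] RelR[OF RelF(3)] Rel0[OF RelF(3)] d] dvd by blast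
    then show ?thesis using fhk cls_divides_D0[OF fhk(1,3)] by simp
  next
    assume "cls s = \<one>\<^bsub>D\<^esub>"
    then have "rdvd R s 1" using cls_eq_one_iff[OF RelHom_Rel[OF sRH]] by simp
    then obtain u where u: "u \<in> R" "1 = s * u" by (auto simp: rdvd_def)
    have "f * u = d" unfolding s(2) by (simp only: mult.assoc u(2)[symmetric] mult_1_right)
    then have "rdvd R f d" using u(1) by (auto simp: rdvd_def)
    moreover have "rdvd R d h" using d by (simp add: R.rgcd_def)
    ultimately have "rdvd R f h" by (rule R.rdvd_trans)
    then show ?thesis using fhk cls_divides_D0[OF fhk(1,2)] by simp
  qed
qed

lemma Units_D0: "Units D\<^sub>0 = {\<one>\<^bsub>D\<^sub>0\<^esub>}"
proof
  show "Units D\<^sub>0 \<subseteq> {\<one>\<^bsub>D\<^sub>0\<^esub>}"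
  proof
    fix u assume "u \<in> Units D\<^sub>0"
    then obtain v where "u \<in> carrier D\<^sub>0" "v \<in> carrier D\<^sub>0" "u \<otimes>\<^bsub>D\<^sub>0\<^esub> v = \<one>\<^bsub>D\<^sub>0\<^esub>" by (auto simp: Units_def)
    then obtain f h where fh: "f \<in> RelHom" "h \<in> RelHom" "u = cls f" "cls (f * h) = \<one>\<^bsub>D\<^esub>"
      by (auto simp: carrier_D0 D_mult)
    then have "rdvd R (f * h) 1" using cls_eq_one_iff[OF Rel_mult(1)] RelHom_Rel by blast
    then have "rdvd R f 1" using R.rdvd_trans[OF R.rdvd_mult_self] RelR RelHom_Rel fh by blast
    then show "u \<in> {\<one>\<^bsub>D\<^sub>0\<^esub>}" using fh cls_eq_one_iff RelHom_Rel by simp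
  qed
  show "{\<one>\<^bsub>D\<^sub>0\<^esub>} \<subseteq> Units D\<^sub>0"
  proof -
    interpret comm_monoid_cancel D\<^sub>0 by (rule comm_monoid_cancel_D0)
    show ?thesis using Units_one_closed by blast
  qed
qed

lemma reduced_factorial_D0: "reduced_factorial D\<^sub>0"
proof (rule reduced_factorialI[OF comm_monoid_cancel_D0 Units_D0])
  show "cls_length b < cls_length (a \<otimes>\<^bsub>D\<^sub>0\<^esub> b)"
    if ab: "a \<in> carrier D\<^sub>0" "b \<in> carrier D\<^sub>0" "a \<noteq> \<one>\<^bsub>D\<^sub>0\<^esub>" for a b
  proof -
    obtain f h where fh: "f \<in> RelHom" "h \<in> RelHom" "a = cls f" "b = cls h" using ab(1,2) by (auto simp: carrier_D0)
    then have "\<not> rdvd R f 1" using ab(3) cls_eq_one_iff RelHom_Rel by simp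
    then show ?thesis using cls_length_less fh RelHom_Rel by (simp add: D_mult)
  qed
qed (rule irreducible_D0_prime[OF _ _ _ Units_D0])

abbreviation w where "w \<equiv> weight scale G \<rho>"

lemma Hom0_weight_ex: "\<eta> \<in> carrier Hom\<^sub>0 \<Longrightarrow> k \<in> I \<Longrightarrow> \<exists>a. a k = 0 \<and> wt (mono a) = \<eta>"
  using mono_weight_ex Hom0_iff by blast

lemma Hom0_mono: "\<eta> \<in> carrier Hom\<^sub>0 \<Longrightarrow> \<exists>a. mono a \<in> RelHom \<and> wt (mono a) = \<eta>"
proof -
  assume \<eta>: "\<eta> \<in> carrier Hom\<^sub>0"
  have "1 \<in> I" using n by (simp add: I_def)
  then obtain a where "wt (mono a) = \<eta>" using Hom0_weight_ex[OF \<eta>] by blast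
  then show ?thesis using \<eta> wt_mono(1) by (auto simp: RelHom_def)
qed

sublocale D0: factorial_weight D\<^sub>0 Hom\<^sub>0 w H
proof -
  interpret E: reduced_factorial D\<^sub>0 by (rule reduced_factorial_D0)
  show "factorial_weight D\<^sub>0 Hom\<^sub>0 w H"
  proof
    show "w \<in> hom D\<^sub>0 Hom\<^sub>0"
      using RelHom_Rel RelHom_wt RelHom_mult Rel_mult(2) by (auto simp: hom_def carrier_D0 weight_cls D_mult)
    show "w \<one>\<^bsub>D\<^sub>0\<^esub> = \<one>\<^bsub>Hom\<^sub>0\<^esub>" using weight_cls[OF Rel_one(1)] Rel_one(2) by (simp add: D_one)
    show "w ` carrier D\<^sub>0 = carrier Hom\<^sub>0"
    proof
      show "w ` carrier D\<^sub>0 \<subseteq> carrier Hom\<^sub>0" using RelHom_Rel RelHom_wt by (auto simp: carrier_D0 weight_cls)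
      show "carrier Hom\<^sub>0 \<subseteq> w ` carrier D\<^sub>0"
      proof
        fix \<eta> assume "\<eta> \<in> carrier Hom\<^sub>0"
        then obtain a where "mono a \<in> RelHom" "wt (mono a) = \<eta>" using Hom0_mono by blast
        then have "\<eta> = w (cls (mono a))" "cls (mono a) \<in> carrier D\<^sub>0"
          using weight_cls[OF RelHom_Rel] by (auto simp: carrier_D0)
        then show "\<eta> \<in> w ` carrier D\<^sub>0" by (rule image_eqI)
      qed
    qed
    show "carrier H = {a \<in> carrier D\<^sub>0. w a = \<one>\<^bsub>Hom\<^sub>0\<^esub>}"
    proof
      show "carrier H \<subseteq> {a \<in> carrier D\<^sub>0. w a = \<one>\<^bsub>Hom\<^sub>0\<^esub>}"
      proof
        fix a assume "a \<in> carrier H"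
        then obtain f where f: "f \<in> Inv" "a = cls f" by (auto simp: carrier_H)
        then have "f \<in> Rel" "wt f = \<one>\<^bsub>K\<^esub>" using Inv_iff by blast+
        then show "a \<in> {a \<in> carrier D\<^sub>0. w a = \<one>\<^bsub>Hom\<^sub>0\<^esub>}"
          using f Inv_RelHom[OF f(1)] by (simp add: carrier_D0 weight_cls)
      qed
      show "{a \<in> carrier D\<^sub>0. w a = \<one>\<^bsub>Hom\<^sub>0\<^esub>} \<subseteq> carrier H"
      proof
        fix a assume "a \<in> {a \<in> carrier D\<^sub>0. w a = \<one>\<^bsub>Hom\<^sub>0\<^esub>}"
        then obtain f where "f \<in> RelHom" "a = cls f" "w a = \<one>\<^bsub>K\<^esub>" by (auto simp: carrier_D0)
        then have "f \<in> Inv" using Inv_iff RelHom_Rel by (simp add: weight_cls)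
        then show "a \<in> carrier H" using \<open>a = cls f\<close> by (simp add: carrier_H)
      qed
    qed
    show "\<one>\<^bsub>H\<^esub> = \<one>\<^bsub>D\<^sub>0\<^esub>" by (simp add: H_one D_one)
    show "a \<otimes>\<^bsub>H\<^esub> b = a \<otimes>\<^bsub>D\<^sub>0\<^esub> b" if "a \<in> carrier H" "b \<in> carrier H" for a b
      using that by (auto simp: carrier_H H_mult D_mult)
  qed
qed

lemma weight_class_eq:
  assumes "\<And>a. a \<in> carrier E \<Longrightarrow> w a \<in> carrier Hom\<^sub>0"
  shows "weight_class scale G \<rho> E c = class_map Hom\<^sub>0 w E c"
proof -
  have "(\<exists>a\<in>carrier E. \<exists>b\<in>carrier E. fraction E a b \<in> c \<and> \<eta> = w a \<otimes>\<^bsub>K\<^esub> inv\<^bsub>K\<^esub> w b) \<longleftrightarrow>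
    (\<exists>a\<in>carrier E. \<exists>b\<in>carrier E. fraction E a b \<in> c \<and> \<eta> = w a \<otimes>\<^bsub>Hom\<^sub>0\<^esub> inv\<^bsub>Hom\<^sub>0\<^esub> w b)" for \<eta>
    using inv_Hom0 assms by (metis Hom0_simps(1))
  then show ?thesis unfolding weight_class_def class_map_def Let_def by simp
qed

section \<open>The monomials inside D_0\<close>

lemma carrier_M: "carrier (M_mon n x) = range mono"
  by (simp add: M_mon_def fun_monoid_def)

lemma carrier_M0: "carrier M\<^sub>0 = cls ` (range mono \<inter> RelHom)"
proof
  show "carrier M\<^sub>0 \<subseteq> cls ` (range mono \<inter> RelHom)"
  proof
    fix m assume "m \<in> carrier M\<^sub>0"
    then obtain a f where a: "m = cls (mono a)" and f: "f \<in> RelHom" "m = cls f"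
      by (auto simp: M0_mon_def carrier_M to_D_eq carrier_D0)
    then obtain c where "c \<noteq> 0" "mono a = fun_scale c f" using cls_eq_iff by metis
    then show "m \<in> cls ` (range mono \<inter> RelHom)" using RelHom_scale f a by (metis IntI imageI rangeI)
  qed
qed (auto simp: M0_mon_def carrier_M to_D_eq carrier_D0)

lemma M0_eq: "M\<^sub>0 = D\<^sub>0\<lparr>carrier := carrier M\<^sub>0\<rparr>"
  by (simp add: M0_mon_def D0_mon_def)

lemma carrier_MGD: "carrier MGD = cls ` (range mono \<inter> Inv)"
proof -
  have "range mono \<inter> invariants scale G \<rho> = range mono \<inter> Inv" using mono_nonzero by auto
  then show ?thesis by (simp add: MGD_mon_def MG_mon_def fun_monoid_def carrier_M to_D_eq image_def)
qed

sublocale DC: divisor_closed D\<^sub>0 "carrier M\<^sub>0"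
proof
  show "carrier M\<^sub>0 \<subseteq> carrier D\<^sub>0" by (auto simp: carrier_M0 carrier_D0)
  show "\<one>\<^bsub>D\<^sub>0\<^esub> \<in> carrier M\<^sub>0" 
  proof -
    have "mono (\<lambda>_. 0) \<in> RelHom" unfolding mono_0 by (rule RelHom_one)
    then have "cls (mono (\<lambda>_. 0)) \<in> carrier M\<^sub>0" unfolding carrier_M0 by blast
    then show ?thesis unfolding mono_0 D0_simps D_one .
  qed
  show "a \<otimes>\<^bsub>D\<^sub>0\<^esub> b \<in> carrier M\<^sub>0" if ab: "a \<in> carrier M\<^sub>0" "b \<in> carrier M\<^sub>0" for a b
  proof -
    obtain c d where cd: "mono c \<in> RelHom" "mono d \<in> RelHom" "a = cls (mono c)" "b = cls (mono d)"
      using ab by (auto simp: carrier_M0)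
    then have "a \<otimes>\<^bsub>D\<^sub>0\<^esub> b = cls (mono (\<lambda>i. c i + d i))" "mono (\<lambda>i. c i + d i) \<in> RelHom"
      using RelHom_mult by (simp_all only: D0_simps D_mult mono_add)
    then show ?thesis unfolding carrier_M0 by blast
  qed
  show "a \<in> carrier M\<^sub>0" if ab: "a \<in> carrier D\<^sub>0" "b \<in> carrier D\<^sub>0" "a \<otimes>\<^bsub>D\<^sub>0\<^esub> b \<in> carrier M\<^sub>0" for a b
  proof -
    obtain f h where fh: "f \<in> RelHom" "h \<in> RelHom" "a = cls f" "b = cls h" using ab(1,2) by (auto simp: carrier_D0)
    then obtain c where "cls (f * h) = cls (mono c)" using ab(3) by (auto simp: carrier_M0 D_mult)
    then obtain d where "mono c = fun_scale d (f * h)" using cls_eq_iff by metis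
    then have "f * fun_scale d h = mono c" by (simp only: fun_scale_simps)
    then obtain c b where "c \<noteq> 0" "f = fun_scale c (mono b)"
      using mono_divisor RelR[OF RelHom_Rel] fh R_scale by blast
    then have "a = cls (mono b)" "mono b \<in> RelHom"
    proof -
      show "a = cls (mono b)" using fh \<open>c \<noteq> 0\<close> \<open>f = fun_scale c (mono b)\<close> cls_eq_iff by metis
      have "mono b = fun_scale (inverse c) f" using \<open>c \<noteq> 0\<close> \<open>f = fun_scale c (mono b)\<close> by (simp add: fun_scale_simps)
      then show "mono b \<in> RelHom" using RelHom_scale fh \<open>c \<noteq> 0\<close> by simp
    qed
    then show ?thesis unfolding carrier_M0 by blast
  qed
qed

lemma M0_simps [simp]: "mult M\<^sub>0 = mult D" "one M\<^sub>0 = one D"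
  by (simp_all add: M0_mon_def)

lemma MGD_simps [simp]: "mult MGD = mult D" "one MGD = one D"
  by (simp_all add: MGD_mon_def)

lemma carrier_MGD': "carrier MGD = {a \<in> carrier M\<^sub>0. w a = \<one>\<^bsub>Hom\<^sub>0\<^esub>}"
proof
  show "carrier MGD \<subseteq> {a \<in> carrier M\<^sub>0. w a = \<one>\<^bsub>Hom\<^sub>0\<^esub>}"
  proof
    fix m assume "m \<in> carrier MGD"
    then obtain a where a: "m = cls (mono a)" "mono a \<in> Inv" unfolding carrier_MGD by blast
    then show "m \<in> {a \<in> carrier M\<^sub>0. w a = \<one>\<^bsub>Hom\<^sub>0\<^esub>}"
      using Inv_RelHom[OF a(2)] Inv_iff[of "mono a"] weight_cls[of "mono a"] unfolding carrier_M0 by auto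
  qed
  show "{a \<in> carrier M\<^sub>0. w a = \<one>\<^bsub>Hom\<^sub>0\<^esub>} \<subseteq> carrier MGD"
  proof
    fix m assume "m \<in> {a \<in> carrier M\<^sub>0. w a = \<one>\<^bsub>Hom\<^sub>0\<^esub>}"
    then obtain a where a: "m = cls (mono a)" "mono a \<in> RelHom" "w m = \<one>\<^bsub>K\<^esub>" unfolding carrier_M0 by auto
    then have "mono a \<in> Inv" using Inv_iff[of "mono a"] weight_cls[of "mono a"] RelHom_Rel by simp
    then show "m \<in> carrier MGD" unfolding carrier_MGD using a by blast
  qed
qed

sublocale M0: factorial_weight M\<^sub>0 Hom\<^sub>0 w MGD
proof -
  have "reduced_factorial M\<^sub>0" using DC.reduced_factorial_sub by (simp flip: M0_eq)
  then interpret E: reduced_factorial M\<^sub>0 .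
  show "factorial_weight M\<^sub>0 Hom\<^sub>0 w MGD"
  proof
    have sub: "carrier M\<^sub>0 \<subseteq> carrier D\<^sub>0" by (rule DC.S_sub)
    show "w \<in> hom M\<^sub>0 Hom\<^sub>0"
      using D0.w_hom sub by (auto simp: hom_def Pi_def subset_iff)
    show "w \<one>\<^bsub>M\<^sub>0\<^esub> = \<one>\<^bsub>Hom\<^sub>0\<^esub>" using D0.w_one by simp
    show "w ` carrier M\<^sub>0 = carrier Hom\<^sub>0"
    proof
      show "w ` carrier M\<^sub>0 \<subseteq> carrier Hom\<^sub>0" using sub D0.w_closed by blast
      show "carrier Hom\<^sub>0 \<subseteq> w ` carrier M\<^sub>0"
      proof
        fix \<eta> assume "\<eta> \<in> carrier Hom\<^sub>0"
        then obtain a where "mono a \<in> RelHom" "wt (mono a) = \<eta>" using Hom0_mono by blast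
        then have "\<eta> = w (cls (mono a))" "cls (mono a) \<in> carrier M\<^sub>0"
          using weight_cls[OF RelHom_Rel] by (auto simp: carrier_M0)
        then show "\<eta> \<in> w ` carrier M\<^sub>0" by (rule image_eqI)
      qed
    qed
    show "carrier MGD = {a \<in> carrier M\<^sub>0. w a = \<one>\<^bsub>Hom\<^sub>0\<^esub>}" by (rule carrier_MGD')
  qed simp_all
qed

lemma is_gcd_D0:
  assumes "p \<in> carrier D\<^sub>0" "Y \<subseteq> carrier D\<^sub>0" "is_gcd D Y p"
  shows "is_gcd D\<^sub>0 Y p"
proof -
  have iff: "a divides\<^bsub>D\<^sub>0\<^esub> b \<longleftrightarrow> a divides\<^bsub>D\<^esub> b" if ab: "a \<in> carrier D\<^sub>0" "b \<in> carrier D\<^sub>0" for a b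
    using ab cls_divides_D0 cls_divides RelHom_Rel by (auto simp: carrier_D0)
  show ?thesis using assms D0_D iff unfolding is_gcd_def by (meson subsetD)
qed

lemma divisor_theory_H: "divisor_theory_embedding H D\<^sub>0"
proof (rule D0.divisor_theory_embedding)
  fix p assume "p \<in> primes D\<^sub>0"
  then have p: "p \<in> carrier D\<^sub>0" by (simp add: primes_def)
  then obtain Y where Y: "Y \<subseteq> carrier H" "finite Y" "Y \<noteq> {}" "is_gcd D Y p"
    by (auto simp: D0_mon_def)
  moreover have "Y \<subseteq> carrier D\<^sub>0" using Y(1) D0.carrier_H by blast
  ultimately show "\<exists>Y. Y \<subseteq> carrier H \<and> finite Y \<and> Y \<noteq> {} \<and> is_gcd D\<^sub>0 Y p" using is_gcd_D0 p by blast
qed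

text \<open>When \<open>f\<close> is a monomial, so are its multiples in
  \<open>gcd_invariant_multiples\<close>. The same finite set therefore serves inside
  \<open>M\<^sub>0\<close>, where divisibility is that of \<open>D\<^sub>0\<close>.\<close>

lemma divisor_theory_MGD: "divisor_theory_embedding MGD M\<^sub>0"
proof (rule M0.divisor_theory_embedding)
  fix p assume "p \<in> primes M\<^sub>0"
  then have pM: "p \<in> carrier M\<^sub>0" by (simp add: primes_def)
  then obtain a where a: "p = cls (mono a)" "mono a \<in> RelHom" by (auto simp: carrier_M0)
  obtain m where m: "\<forall>k\<in>I. m k k = 0 \<and> mono a * mono (m k) \<in> Inv" using mono_weight_inv_ex[OF a(2)] by blast
  let ?Y = "(\<lambda>k. cls (mono a * mono (m k))) ` I"
  have g: "is_gcd D ?Y p" unfolding a(1) by (rule gcd_invariant_multiples[OF a(2)]) (use m in blast)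
  have Y: "?Y \<subseteq> carrier MGD" unfolding carrier_MGD using m by (auto simp: mono_add[symmetric])
  then have YM: "?Y \<subseteq> carrier M\<^sub>0" using M0.carrier_H by blast
  have pD: "p \<in> carrier D\<^sub>0" using pM DC.S_sub by blast
  have "is_gcd D\<^sub>0 ?Y p" by (rule is_gcd_D0[OF pD _ g]) (use YM DC.S_sub in blast)
  then have "is_gcd M\<^sub>0 ?Y p"
    unfolding is_gcd_def using pM YM DC.divides_sub_iff DC.SE unfolding M0_eq[symmetric] by (meson subsetD)
  moreover have "?Y \<noteq> {}" using n by (auto simp: I_def)
  ultimately show "\<exists>Y. Y \<subseteq> carrier MGD \<and> finite Y \<and> Y \<noteq> {} \<and> is_gcd M\<^sub>0 Y p" using Y by blast
qed


section \<open>The primes given by powers of the coordinates\<close>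

definition refl_exp :: "nat \<Rightarrow> nat" where
  "refl_exp i = (LEAST k. k > 0 \<and> (\<forall>g\<in>refl_group i. \<chi> i g ^ k = 1))"

lemma order_pos: "order G > 0"
  using G.order_gt_0_iff_finite G(2) by simp

lemma \<chi>_pow: "i \<in> I \<Longrightarrow> g \<in> carrier G \<Longrightarrow> \<chi> i (g [^]\<^bsub>G\<^esub> (k::nat)) = \<chi> i g ^ k"
  by (induction k) (auto simp: \<chi>_one \<chi>_mult)

lemma \<chi>_order: "i \<in> I \<Longrightarrow> g \<in> carrier G \<Longrightarrow> \<chi> i g ^ order G = 1"
  using \<chi>_pow[of i g "order G"] G.pow_order_eq_1[of g] \<chi>_one[of i] by simp

lemma refl_exp_props:
  assumes "i \<in> I" shows "refl_exp i > 0" "g \<in> refl_group i \<Longrightarrow> \<chi> i g ^ refl_exp i = 1"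
proof -
  have "\<exists>k. k > 0 \<and> (\<forall>g\<in>refl_group i. \<chi> i g ^ k = 1)"
    using order_pos \<chi>_order[OF assms] refl_groupD by blast
  from LeastI_ex[OF this] show "refl_exp i > 0" "g \<in> refl_group i \<Longrightarrow> \<chi> i g ^ refl_exp i = 1"
    unfolding refl_exp_def by auto
qed

lemma refl_exp_dvd_iff:
  assumes "i \<in> I" shows "(\<forall>g\<in>refl_group i. \<chi> i g ^ k = 1) \<longleftrightarrow> refl_exp i dvd k"
proof
  assume *: "\<forall>g\<in>refl_group i. \<chi> i g ^ k = 1"
  have "\<chi> i g ^ (k mod refl_exp i) = 1" if g: "g \<in> refl_group i" for g
  proof -
    have "\<chi> i g ^ k = (\<chi> i g ^ refl_exp i) ^ (k div refl_exp i) * \<chi> i g ^ (k mod refl_exp i)"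
      by (simp flip: power_mult power_add)
    then show ?thesis using * g refl_exp_props(2)[OF assms g] by simp
  qed
  then have "\<not> (k mod refl_exp i > 0)"
    using not_less_Least[of "k mod refl_exp i" "\<lambda>k. k > 0 \<and> (\<forall>g\<in>refl_group i. \<chi> i g ^ k = 1)"] refl_exp_props(1)[OF assms]
    unfolding refl_exp_def by auto
  then show "refl_exp i dvd k" by (simp add: dvd_eq_mod_eq_0)
qed (use refl_exp_props(2)[OF assms] in \<open>auto simp: power_mult elim!: dvdE\<close>)

lemma prod_refl: "i \<in> I \<Longrightarrow> g \<in> refl_group i \<Longrightarrow> (\<Prod>j\<in>I. \<chi> j g ^ a j) = \<chi> i g ^ a i"
  by (subst prod.remove[of I i]) (auto simp: refl_group_def intro!: prod.neutral)

text \<open>On \<open>refl_group i\<close> all coordinates but the \<open>i\<close>-th have trivial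
  weight, so the condition decouples into one on each exponent.\<close>

lemma mono_RelHom_iff: "mono a \<in> RelHom \<longleftrightarrow> (\<forall>i\<in>I. refl_exp i dvd a i)"
proof -
  have "mono a \<in> RelHom \<longleftrightarrow> (\<forall>i\<in>I. \<forall>g\<in>refl_group i. wt (mono a) (\<rho> g) = 1)"
    using wt_mono(1) wt(1)[OF wt_mono(1)] by (simp add: RelHom_def Hom0_iff)
  also have "\<dots> \<longleftrightarrow> (\<forall>i\<in>I. \<forall>g\<in>refl_group i. \<chi> i g ^ a i = 1)"
    using wt_mono(2) refl_groupD prod_refl by (metis (no_types, lifting))
  finally show ?thesis using refl_exp_dvd_iff by simp
qed

abbreviation single :: "nat \<Rightarrow> nat \<Rightarrow> nat \<Rightarrow> nat" where
  "single i k \<equiv> (\<lambda>j. if j = i then k else 0)"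

definition coord_prime :: "nat \<Rightarrow> ('v \<Rightarrow> 'f) set" where
  "coord_prime i = cls (mono (single i (refl_exp i)))"

lemma coord_prime_RelHom: "mono (single i (refl_exp i)) \<in> RelHom"
  by (simp add: mono_RelHom_iff)

lemma coord_prime_M0: "coord_prime i \<in> carrier M\<^sub>0"
  unfolding coord_prime_def carrier_M0 using coord_prime_RelHom by blast

text \<open>A factor of a monomial in \<open>D\<^sub>0\<close> is the class of a monomial whose
  exponents are multiples of the \<open>refl_exp j\<close>, so the exponent
  \<open>refl_exp i\<close> cannot be split properly.\<close>

lemma coord_prime_prime: "i \<in> I \<Longrightarrow> coord_prime i \<in> primes D\<^sub>0"
proof (rule D0.irreducible_in_primes)
  assume i: "i \<in> I"
  show "coord_prime i \<in> carrier D\<^sub>0" using coord_prime_M0 DC.SE by blast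
  show "coord_prime i \<noteq> \<one>\<^bsub>D\<^sub>0\<^esub>"
  proof
    assume "coord_prime i = \<one>\<^bsub>D\<^sub>0\<^esub>"
    then have "cls (mono (\<lambda>_. 0)) = cls (mono (single i (refl_exp i)))" by (simp only: coord_prime_def D0_simps D_one mono_0)
    then obtain c where "c \<noteq> 0" "mono (single i (refl_exp i)) = fun_scale c (mono (\<lambda>_. 0))" using cls_eq_iff by blast
    then have "single i (refl_exp i) i = 0" using mono_eqD i by blast
    then show False using refl_exp_props(1)[OF i] by simp
  qed
  fix b c assume bc: "b \<in> carrier D\<^sub>0" "c \<in> carrier D\<^sub>0" "coord_prime i = b \<otimes>\<^bsub>D\<^sub>0\<^esub> c"
  have bcM: "b \<otimes>\<^bsub>D\<^sub>0\<^esub> c \<in> carrier M\<^sub>0" "c \<otimes>\<^bsub>D\<^sub>0\<^esub> b \<in> carrier M\<^sub>0"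
    using bc coord_prime_M0[of i] D0.m_comm by metis+
  then have "b \<in> carrier M\<^sub>0" "c \<in> carrier M\<^sub>0" using DC.S_div bc(1,2) by blast+
  then obtain r s where rs: "b = cls (mono r)" "c = cls (mono s)" "mono r \<in> RelHom" "mono s \<in> RelHom" by (auto simp: carrier_M0)
  then have "cls (mono (single i (refl_exp i))) = cls (mono (\<lambda>j. r j + s j))"
    using bc(3) by (simp only: coord_prime_def D0_simps D_mult mono_add)
  then obtain d where d: "d \<noteq> 0" "mono (\<lambda>j. r j + s j) = fun_scale d (mono (single i (refl_exp i)))" using cls_eq_iff by blast
  have eq: "r j + s j = single i (refl_exp i) j" if "j \<in> I" for j using mono_eqD[OF d(2,1) that] .
  have "refl_exp i dvd r i" using rs(3) mono_RelHom_iff i by blast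
  moreover have "r i \<le> refl_exp i" using eq[OF i] by simp
  ultimately have "r i = 0 \<or> r i = refl_exp i" by (metis dvd_imp_le le_antisym neq0_conv)
  then show "b = \<one>\<^bsub>D\<^sub>0\<^esub> \<or> c = \<one>\<^bsub>D\<^sub>0\<^esub>"
  proof
    assume "r i = 0"
    then have "r j = 0" if "j \<in> I" for j using eq[OF that] by (cases "j = i") auto
    then have "mono r = 1" using mono_cong[of r "\<lambda>_. 0"] mono_0 by simp
    then show ?thesis using rs by (simp add: D_one)
  next
    assume "r i = refl_exp i"
    then have "s j = 0" if "j \<in> I" for j using eq[OF that] by (cases "j = i") auto
    then have "mono s = 1" using mono_cong[of s "\<lambda>_. 0"] mono_0 by simp
    then show ?thesis using rs by (simp add: D_one)
  qed
qed

lemma msprod_coord_prime: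
  assumes "finite J" "J \<subseteq> I"
  shows "msprod D\<^sub>0 (\<Sum>i\<in>J. replicate_mset (k i) (coord_prime i)) = cls (mono (\<lambda>i. if i \<in> J then refl_exp i * k i else 0))"
  using assms
proof (induction J)
  case empty
  then show ?case by (simp add: D0.msprod_empty D_one mono_0 del: one_fun_apply)
next
  case (insert j J)
  have qD: "coord_prime i \<in> carrier D\<^sub>0" for i using coord_prime_M0 DC.SE by blast
  have pow: "msprod D\<^sub>0 (replicate_mset m (coord_prime j)) = cls (mono (single j (refl_exp j * m)))" for m
  proof (induction m)
    case 0
    have "single j (refl_exp j * 0) = (\<lambda>_. 0)" by auto
    then show ?case by (simp only: replicate_mset_0 D0.msprod_empty mono_0 D0_simps D_one)
  next
    case (Suc m)
    have "msprod D\<^sub>0 (replicate_mset (Suc m) (coord_prime j)) = coord_prime j \<otimes>\<^bsub>D\<^sub>0\<^esub> msprod D\<^sub>0 (replicate_mset m (coord_prime j))"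
      using qD D0.msprod_add_mset[of "coord_prime j" "replicate_mset m (coord_prime j)"] by (simp split: if_splits)
    also have "\<dots> = cls (mono (\<lambda>i. single j (refl_exp j) i + single j (refl_exp j * m) i))"
      unfolding Suc.IH unfolding coord_prime_def mono_add by (simp only: D0_simps D_mult)
    also have "(\<lambda>i. single j (refl_exp j) i + single j (refl_exp j * m) i) = single j (refl_exp j * Suc m)" by auto
    finally show ?case .
  qed
  have sub: "set_mset (\<Sum>i\<in>J. replicate_mset (k i) (coord_prime i)) \<subseteq> carrier D\<^sub>0" "set_mset (replicate_mset (k j) (coord_prime j)) \<subseteq> carrier D\<^sub>0"
    using qD insert.hyps by (auto simp: set_mset_sum split: if_splits)
  have "msprod D\<^sub>0 (\<Sum>i\<in>insert j J. replicate_mset (k i) (coord_prime i)) =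
      msprod D\<^sub>0 (replicate_mset (k j) (coord_prime j)) \<otimes>\<^bsub>D\<^sub>0\<^esub> msprod D\<^sub>0 (\<Sum>i\<in>J. replicate_mset (k i) (coord_prime i))"
    using insert.hyps D0.msprod_union[OF sub(2,1)] by simp
  also have "\<dots> = cls (mono (\<lambda>i. single j (refl_exp j * k j) i + (if i \<in> J then refl_exp i * k i else 0)))"
    using insert unfolding pow mono_add by (simp add: D_mult)
  also have "(\<lambda>i. single j (refl_exp j * k j) i + (if i \<in> J then refl_exp i * k i else 0)) = (\<lambda>i. if i \<in> insert j J then refl_exp i * k i else 0)"
    using insert.hyps by auto
  finally show ?case .
qed

lemma factorization_mono:
  assumes "mono a \<in> RelHom"
  shows "factorization D\<^sub>0 (cls (mono a)) = (\<Sum>i\<in>I. replicate_mset (a i div refl_exp i) (coord_prime i))"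
proof -
  have "mono (\<lambda>i. if i \<in> I then refl_exp i * (a i div refl_exp i) else 0) = mono a"
    by (rule mono_cong) (use assms mono_RelHom_iff in auto)
  then have "msprod D\<^sub>0 (\<Sum>i\<in>I. replicate_mset (a i div refl_exp i) (coord_prime i)) = cls (mono a)"
    using msprod_coord_prime[OF finite_I subset_refl, of "\<lambda>i. a i div refl_exp i"] by simp
  moreover have "set_mset (\<Sum>i\<in>I. replicate_mset (a i div refl_exp i) (coord_prime i)) \<subseteq> primes D\<^sub>0"
    using coord_prime_prime by (auto simp: set_mset_sum split: if_splits)
  ultimately show ?thesis using D0.factorization_msprod by metis
qed

lemma coord_prime_prime_M0: "i \<in> I \<Longrightarrow> coord_prime i \<in> primes M\<^sub>0"
  using DC.prime_sub[OF coord_prime_prime coord_prime_M0] by (simp flip: M0_eq)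

lemma factorization_M0: "a \<in> carrier M\<^sub>0 \<Longrightarrow> factorization M\<^sub>0 a = factorization D\<^sub>0 a"
  using DC.factorization_sub[of a] by (simp flip: M0_eq)

lemma w_coord_prime: "i \<in> I \<Longrightarrow> g \<in> carrier G \<Longrightarrow> w (coord_prime i) (\<rho> g) = \<chi> i g ^ refl_exp i"
proof -
  assume i: "i \<in> I" and g: "g \<in> carrier G"
  have "w (coord_prime i) (\<rho> g) = (\<Prod>j\<in>I. \<chi> j g ^ single i (refl_exp i) j)"
    unfolding coord_prime_def using weight_cls[OF wt_mono(1)] wt_mono(2)[OF g] by simp
  also have "\<dots> = (\<Prod>j\<in>I. if j = i then \<chi> i g ^ refl_exp i else 1)" by (rule prod.cong) auto
  finally show ?thesis using i by simp
qed

lemma w_coord_prime_Hom0: "w (coord_prime i) \<in> carrier Hom\<^sub>0"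
  using coord_prime_M0 M0.w_closed by blast

text \<open>If \<open>\<eta>\<close> comes from \<open>\<chi> i\<close>, then \<open>refl_exp i = 1\<close>, so that \<open>x i\<close> itself is a prime of weight \<open>\<eta>\<close>.\<close>

lemma prime_of_weight_M0:
  assumes all: "\<chi> ` I = carrier (char_group G)" and \<eta>: "\<eta> \<in> carrier Hom\<^sub>0"
  shows "\<exists>p\<in>primes M\<^sub>0. w p = \<eta>"
proof -
  have \<eta>K: "\<eta> \<in> carrier K" using \<eta> by (rule Hom0_K)
  have "(\<lambda>g\<in>carrier G. \<eta> (\<rho> g)) \<in> carrier (char_group G)"
    using K_apply(1,2)[OF \<eta>K] by (auto simp: char_group_def hom_def unit_group_def)
  then obtain i where i: "i \<in> I" "\<chi> i = (\<lambda>g\<in>carrier G. \<eta> (\<rho> g))" using all by (metis imageE)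
  then have eq: "\<chi> i g = \<eta> (\<rho> g)" if "g \<in> carrier G" for g using that by simp
  have "\<forall>g\<in>refl_group i. \<chi> i g ^ 1 = 1" using eq refl_groupD \<eta> i(1) by (simp add: Hom0_iff)
  then have "refl_exp i = 1" using refl_exp_dvd_iff[OF i(1), of 1] by simp
  then have "w (coord_prime i) = \<eta>"
    using w_coord_prime[OF i(1)] eq by (intro K_eqI[OF Hom0_K[OF w_coord_prime_Hom0] \<eta>K]) simp
  then show ?thesis using coord_prime_prime_M0[OF i(1)] by blast
qed


section \<open>Primes of given weight\<close>

text \<open>With \<open>m k\<close> a monomial of weight \<open>\<eta>\<close> not involving \<open>x k\<close>, \<open>N = order G\<close> and \<open>E\<close> a
  multiple of \<open>N\<close> exceeding the exponents of \<open>x 1\<close> in the \<open>m k\<close>, the polynomial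
  \<open>(x 2 ^ N - 1) * (m 1 + (\<Sum>k\<ge>3. x 1 ^ (k * E) * m k)) + x 1 ^ ((n + 1) * E) * m 2\<close>
  has weight \<open>\<eta>\<close>. As a polynomial in \<open>x 1\<close> it satisfies Eisenstein's criterion at \<open>x 2 - 1\<close>, and
  its coefficients have no common divisor.\<close>

lemma prime_of_weight_D0:
  assumes \<eta>: "\<eta> \<in> carrier Hom\<^sub>0" and n2: "n \<ge> 2"
  shows "\<exists>p\<in>primes D\<^sub>0. w p = \<eta>"
proof -
  have I12: "1 \<in> I" "2 \<in> I" using n2 by (auto simp: I_def)
  define A where "A = I - {1}"
  have A: "A \<subseteq> I" "1 \<notin> A" "2 \<in> A" "insert 1 A = I" using I12 by (auto simp: A_def)
  interpret S: subdomain "P A" by (rule subdomain_P[OF A(1)])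
  interpret PS: subdomain S.polys by (rule S.subdomain_polys)
  have PR: "f \<in> R" if "f \<in> P A" for f using that by (simp add: P_def)
  have poly_R: "R = (\<lambda>p. poly p (x 1)) ` S.polys"
    using P_insert[OF S.subdomain_axioms A(2) I12(1) A(1)] A(4) P_I by simp
  have poly_inj: "p = r" if "p \<in> S.polys" "r \<in> S.polys" "poly p (x 1) = poly r (x 1)" for p r
  proof -
    have "p - r = 0"
      by (rule poly_fun_transcendental[of _ A 1])
        (use that S.coeff_in[OF PS.diff_in[OF that(1,2)]] A I12 in auto)
    then show ?thesis by simp
  qed
  have "\<exists>a. a k = 0 \<and> wt (mono a) = \<eta>" if "k \<in> I" for k using Hom0_weight_ex[OF \<eta> that] .
  then obtain m where m: "\<And>k. k \<in> I \<Longrightarrow> m k k = 0" "\<And>k. k \<in> I \<Longrightarrow> wt (mono (m k)) = \<eta>" by metis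
  define N where "N = order G"
  have N: "N > 0" "of_nat N \<noteq> (0::'f)" using order_pos char_nonzero by (auto simp: N_def)
  define E where "E = Suc (\<Sum>k\<in>I. m k 1) * N"
  have E: "m k 1 < E" if "k \<in> I" for k
  proof -
    have "m k 1 \<le> (\<Sum>k\<in>I. m k 1)" using that member_le_sum[of k I "\<lambda>k. m k 1"] by simp
    also have "\<dots> < Suc (\<Sum>k\<in>I. m k 1) * 1" by simp
    also have "\<dots> \<le> E" unfolding E_def using N(1) by (intro mult_le_mono2) simp
    finally show ?thesis .
  qed
  \<comment> \<open>Term \<open>k\<close> has degree \<open>s k\<close> in \<open>x 1\<close>. The
    term with \<open>k = 1\<close> gives the constant coefficient, the one with \<open>k = 2\<close>
    the leading one. As \<open>m k 1 < E\<close>, dividing \<open>s k\<close> by \<open>E\<close>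
    recovers \<open>\<sigma> k\<close>, so the degrees are distinct.\<close>
  define \<sigma> where "\<sigma> k = (if k = 1 then 0 else if k = 2 then n + 1 else k)" for k :: nat
  define s where "s k = \<sigma> k * E + m k 1" for k
  have s_div: "s k div E = \<sigma> k" if "k \<in> I" for k using E[OF that] by (simp add: s_def)
  have \<sigma>_inj: "k = l" if "k \<in> I" "l \<in> I" "\<sigma> k = \<sigma> l" for k l
    using that by (auto simp: \<sigma>_def I_def split: if_splits)
  have s_inj: "k = l" if "k \<in> I" "l \<in> I" "s k = s l" for k l
    using that s_div \<sigma>_inj by metis
  have s1: "s 1 = 0" using m(1)[OF I12(1)] by (simp add: s_def \<sigma>_def)
  have s2: "s k < s 2" if "k \<in> I" "k \<noteq> 2" for k
  proof -
    have "\<sigma> k < \<sigma> 2" using that by (auto simp: \<sigma>_def I_def)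
    then have "\<sigma> k * E + E \<le> \<sigma> 2 * E" by (metis add.commute mult_Suc mult_le_mono1 Suc_leI)
    then show ?thesis using E[OF that(1)] by (simp add: s_def)
  qed
  define u where "u = x 2 ^ N - 1"
  \<comment> \<open>The coefficients with respect to \<open>x 1\<close>: the power of
    \<open>x 1\<close> in \<open>m k\<close> has moved into \<open>s k\<close>, and only the leading
    coefficient lacks the factor \<open>u\<close>.\<close>
  define c where "c k = (if k = 2 then 1 else u) * mono ((m k)(1 := 0))" for k
  have x2: "x 2 \<in> P A" by (rule P_x[OF A(3,1)])
  have uP: "u \<in> P A" unfolding u_def by (intro S.diff_in S.power_in x2 S.one_in)
  have monoP: "mono ((m k)(1 := 0)) \<in> P A" for k
  proof -
    have "mono ((m k)(1 := 0)) = (\<Prod>i\<in>I. x i ^ ((m k)(1 := 0)) i)" by (rule mono_def)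
    also have "\<dots> = (\<Prod>i\<in>A. x i ^ m k i)"
      by (rule prod.mono_neutral_cong_right) (auto simp: A_def)
    finally show ?thesis using P_x A(1) by (auto intro!: S.prod_in S.power_in)
  qed
  have cP: "c k \<in> P A" for k unfolding c_def using uP monoP S.mult_in S.one_in by simp
  define p where "p = (\<Sum>k\<in>I. monom (c k) (s k))"
  have pS: "p \<in> S.polys" unfolding p_def by (intro PS.sum_in S.polys_monom cP)
  have coeff_p: "coeff p (s k) = c k" if "k \<in> I" for k
  proof -
    have "coeff p (s k) = (\<Sum>l\<in>I. if l = k then c k else 0)"
      unfolding p_def coeff_sum by (rule sum.cong) (use s_inj that in auto)
    then show ?thesis using that by simp
  qed
  have coeff_p0: "coeff p j = 0" if "j \<notin> s ` I" for j
    unfolding p_def coeff_sum using that by (auto intro!: sum.neutral)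
  \<comment> \<open>At this point every monomial is one while \<open>x 2 - 1\<close> vanishes, which
    serves to refute divisibility by \<open>x 2 - 1\<close>.\<close>
  let ?o = "vec (\<lambda>_. 1)"
  have mono_o: "mono a ?o = 1" for a by (simp add: mono_apply x_vec)
  have c2o: "c 2 ?o = 1" by (simp add: c_def mono_o)
  have deg: "degree p = s 2"
  proof (rule antisym)
    have "coeff p (s 2) \<noteq> 0" using coeff_p[OF I12(2)] c2o by auto
    then show "s 2 \<le> degree p" by (rule le_degree)
    show "degree p \<le> s 2"
    proof (rule degree_le, intro allI impI)
      fix j assume "s 2 < j"
      then have "j \<notin> s ` I" using s2 by force
      then show "coeff p j = 0" by (rule coeff_p0)
    qed
  qed
  define f where "f = poly p (x 1)"
  have fR: "f \<in> R" unfolding poly_R f_def using pS by blast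
  have f_sum: "f = (\<Sum>k\<in>I. c k * x 1 ^ s k)"
    by (simp add: f_def p_def poly_sum poly_monom)
  have s2pos: "s 2 > 0" using s2[OF I12(1)] by simp
  have f0: "f \<noteq> 0"
  proof
    assume "f = 0"
    then have "p = 0" using poly_inj[OF pS PS.zero_in] by (simp add: f_def)
    then show False using deg s2pos by simp
  qed
  have f_unit: "\<not> rdvd R f 1"
  proof
    assume "rdvd R f 1"
    then obtain b where "f = (\<lambda>_. b)" using unit_const fR by blast
    then have "poly p (x 1) = poly [:\<lambda>_. b:] (x 1)" by (simp add: f_def)
    then have "p = [:\<lambda>_. b:]" by (rule poly_inj[OF pS, rotated]) (simp add: P_const)
    then show False using deg s2pos by simp
  qed
  have f_weight: "act G \<rho> g f = fun_scale (\<eta> (\<rho> g)) f" if g: "g \<in> carrier G" for g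
  proof (rule ext)
    fix v
    let ?v = "\<rho> (inv\<^bsub>G\<^esub> g) v"
    have u_inv: "u ?v = u v"
      using x_act[OF I12(2) g, of v] \<chi>_order[OF I12(2) g] by (simp add: u_def power_fun_apply N_def power_mult_distrib)
    have tm: "(c k * x 1 ^ s k) ?v = \<eta> (\<rho> g) * (c k * x 1 ^ s k) v" if k: "k \<in> I" for k
    proof -
      have split: "mono ((m k)(1 := 0)) y * x 1 y ^ s k = x 1 y ^ (\<sigma> k * E) * mono (m k) y" for y
      proof -
        have "mono (m k) y = x 1 y ^ m k 1 * (\<Prod>i\<in>I - {1}. x i y ^ m k i)"
          unfolding mono_apply by (rule prod.remove) (use I12 in auto)
        moreover have "mono ((m k)(1 := 0)) y = (\<Prod>i\<in>I - {1}. x i y ^ m k i)"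
          unfolding mono_apply by (rule prod.mono_neutral_cong_right) auto
        ultimately show ?thesis by (simp add: s_def power_add mult_ac)
      qed
      have "x 1 ?v ^ (\<sigma> k * E) = x 1 v ^ (\<sigma> k * E)"
      proof -
        have "\<chi> 1 g ^ (\<sigma> k * E) = (\<chi> 1 g ^ N) ^ (\<sigma> k * Suc (\<Sum>k\<in>I. m k 1))"
          by (simp add: E_def power_mult[symmetric] mult_ac del: mult_Suc mult_Suc_right)
        then have "\<chi> 1 g ^ (\<sigma> k * E) = 1" using \<chi>_order[OF I12(1) g] by (simp add: N_def)
        then show ?thesis using x_act[OF I12(1) g, of v] by (simp add: power_mult_distrib)
      qed
      moreover have "mono (m k) ?v = \<eta> (\<rho> g) * mono (m k) v"
        using fun_cong[OF wt_act[OF wt_mono(1)[of "m k"] g], of v] m(2)[OF k] by (simp add: act_apply fun_scale_def)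
      ultimately have "mono ((m k)(1 := 0)) ?v * x 1 ?v ^ s k = \<eta> (\<rho> g) * (mono ((m k)(1 := 0)) v * x 1 v ^ s k)"
        unfolding split by simp
      then show ?thesis using u_inv by (cases "k = 2") (simp_all add: c_def power_fun_apply)
    qed
    have "act G \<rho> g f v = (\<Sum>k\<in>I. (c k * x 1 ^ s k) ?v)" by (simp add: act_apply f_sum sum_fun_apply)
    also have "\<dots> = (\<Sum>k\<in>I. \<eta> (\<rho> g) * (c k * x 1 ^ s k) v)" by (rule sum.cong[OF refl]) (rule tm)
    also have "\<dots> = fun_scale (\<eta> (\<rho> g)) f v" by (simp add: fun_scale_def f_sum sum_fun_apply sum_distrib_left)
    finally show "act G \<rho> g f v = fun_scale (\<eta> (\<rho> g)) f v" .
  qed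
  have fRel: "f \<in> Rel" using f_weight by (intro RelI[OF fR f0]) blast
  have wf: "wt f = \<eta>" using f_weight Hom0_K[OF \<eta>] by (intro wt_eqI[OF f0]) (auto simp: has_weight_def)
  have fRH: "f \<in> RelHom" using fRel wf \<eta> by (simp add: RelHom_def)
  let ?lin = "x 2 - (\<lambda>_. 1)"
  have lin: "rprime (P A) ?lin" by (rule linear_rprime[OF A(1,3)])
  have qu: "rdvd (P A) ?lin u"
    using linear_rdvd_iff[OF A(1,3) uP] by (simp add: u_def power_fun_apply)
  \<comment> \<open>A prime divisor of \<open>c 2\<close> is associated to some \<open>x k\<close>,
    where \<open>k \<noteq> 1\<close> because \<open>x 1\<close> was removed and
    \<open>k \<noteq> 2\<close> because \<open>m 2\<close> avoids \<open>x 2\<close>. It does not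
    divide \<open>c k\<close>, since \<open>m k\<close> avoids \<open>x k\<close> and
    \<open>u\<close> is nonzero at the origin.\<close>
  have no_common: "rdvd R h 1" if h: "h \<in> R" "\<And>k. k \<in> I \<Longrightarrow> rdvd R h (c k)" for h
  proof (rule ccontr)
    assume nu: "\<not> rdvd R h 1"
    have "h \<noteq> 0"
    proof
      assume "h = 0"
      then have "c 2 = 0" using h(2)[OF I12(2)] by (auto simp: rdvd_def)
      then show False using c2o by simp
    qed
    then obtain r where r: "rprime R r" "rdvd R r h" using R.nonunit_prime_divisor[OF h(1) _ nu] by blast
    have "rdvd R r (c 2)" using R.rdvd_trans[OF r(2) h(2)[OF I12(2)]] .
    then have "rdvd R r (mono ((m 2)(1 := 0)))" by (simp add: c_def)
    then obtain k where k: "k \<in> I" "rdvd R (x k) r" "((m 2)(1 := 0)) k > 0" using prime_rdvd_mono[OF r(1)] by blast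
    have k12: "k \<noteq> 1" "k \<noteq> 2" using k(3) m(1)[OF I12(2)] by (auto split: if_splits)
    have "rdvd R (x k) (c k)" using R.rdvd_trans[OF k(2) R.rdvd_trans[OF r(2) h(2)[OF k(1)]]] .
    then have "rdvd R (x k) (u * mono ((m k)(1 := 0)))" using k12 by (simp add: c_def)
    then have "rdvd R (x k) u \<or> rdvd R (x k) (mono ((m k)(1 := 0)))"
      using R.rprimeD(4)[OF x_rprime[OF k(1)]] PR[OF uP] mono_R by blast
    moreover have "\<not> rdvd R (x k) (mono ((m k)(1 := 0)))"
      by (rule x_not_rdvd_mono[OF k(1)]) (use k12 m(1)[OF k(1)] in simp)
    moreover have "\<not> rdvd R (x k) u"
    proof
      assume "rdvd R (x k) u"
      moreover have "x k 0 = 0" using x_linear(3)[OF k(1)] .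
      ultimately have "u 0 = 0" using x_rdvd_iff[OF k(1) PR[OF uP]] by blast
      then show False using x_linear(3)[OF I12(2)] N(1) by (simp add: u_def power_fun_apply zero_power)
    qed
    ultimately show False by blast
  qed
  \<comment> \<open>A factor of degree zero in \<open>x 1\<close> divides all coefficients
    \<open>c k\<close>, so it is a unit; Eisenstein's criterion leaves this case open.\<close>
  have factor_unit: "rdvd R h 1"
    if gh: "pg \<in> S.polys" "ph \<in> S.polys" "p = pg * ph" "degree ph = 0" and h: "h = poly ph (x 1)" for pg ph h
  proof (rule no_common)
    obtain h0 where h0: "ph = [:h0:]" using gh(4) by (metis degree_0_id)
    then have hh: "h = h0" "h0 \<in> P A" using h gh(2) by simp_all
    then show "h \<in> R" using PR by simp
    show "rdvd R h (c k)" if "k \<in> I" for k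
    proof -
      have "c k = h0 * coeff pg (s k)" using coeff_p[OF that] gh(3) h0 by simp
      then show ?thesis using hh PR[OF S.coeff_in[OF gh(1)]] by (auto simp: rdvd_def)
    qed
  qed
  \<comment> \<open>Irreducibility holds already in \<open>R\<close>, which is stronger than
    irreducibility in \<open>D\<^sub>0\<close>.\<close>
  have irr: "rdvd R g 1 \<or> rdvd R h 1" if gh: "g \<in> R" "h \<in> R" "f = g * h" for g h
  proof -
    obtain pg ph where pp: "pg \<in> S.polys" "ph \<in> S.polys" "g = poly pg (x 1)" "h = poly ph (x 1)"
      using gh(1,2) unfolding poly_R by blast
    have "poly p (x 1) = poly (pg * ph) (x 1)" using gh(3) pp by (simp add: f_def)
    then have pgh: "p = pg * ph" by (rule poly_inj[OF pS PS.mult_in[OF pp(1,2)]])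
    then have nz: "pg \<noteq> 0" "ph \<noteq> 0" using deg s2pos by auto
    have "degree pg = 0 \<or> degree ph = 0"
    proof (rule S.eisenstein[OF lin pp(1,2) nz, folded pgh])
      fix i assume i: "i < degree p"
      show "rdvd (P A) ?lin (coeff p i)"
      proof (cases "i \<in> s ` I")
        case True
        then obtain k where k: "k \<in> I" "i = s k" by blast
        then have "k \<noteq> 2" using i deg by auto
        then have "coeff p i = u * mono ((m k)(1 := 0))" using k coeff_p by (simp add: c_def)
        then show ?thesis using S.rdvd_mult[OF qu monoP] by simp
      next
        case False
        then show ?thesis using coeff_p0 S.rdvd_0 by simp
      qed
    next
      show "\<not> rdvd (P A) ?lin (lcoeff p)"
      proof
        assume "rdvd (P A) ?lin (lcoeff p)"
        then have "rdvd (P A) ?lin (c 2)" using deg coeff_p[OF I12(2)] by simp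
        then have "c 2 ?o = 0" using linear_rdvd_iff[OF A(1,3) cP] x_vec[OF I12(2)] by simp
        then show False using c2o by simp
      qed
      show "\<not> rdvd (P A) (?lin * ?lin) (coeff p 0)"
      proof
        assume "rdvd (P A) (?lin * ?lin) (coeff p 0)"
        then have "rdvd (P A) (?lin * ?lin) (c 1)" using coeff_p[OF I12(1)] s1 by simp
        then obtain t where t: "t \<in> P A" "u * mono ((m 1)(1 := 0)) = ?lin * ?lin * t"
          by (auto simp: rdvd_def c_def)
        \<comment> \<open>\<open>u\<close> is \<open>x 2 - 1\<close> times the geometric sum
          \<open>Q\<close>, and at the point \<open>?o\<close> the value of \<open>Q\<close> is
          \<open>N\<close>, nonzero in the field. So \<open>x 2 - 1\<close> divides the constant
          coefficient only once.\<close>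
        define Q where "Q = (\<Sum>j<N. x 2 ^ j)"
        have QP: "Q \<in> P A" unfolding Q_def by (intro S.sum_in S.power_in x2)
        have uQ: "u = ?lin * Q" unfolding u_def Q_def one_fun_def[symmetric] by (rule power_diff_1_eq)
        have "?lin * (Q * mono ((m 1)(1 := 0))) = ?lin * (?lin * t)" using t(2) uQ by (simp only: mult.assoc)
        then have "Q * mono ((m 1)(1 := 0)) = ?lin * t"
          by (rule S.cancel_left[rotated 4]) (use lin S.rprimeD S.mult_in QP monoP t in blast)+
        then have "(Q * mono ((m 1)(1 := 0))) ?o = (?lin * t) ?o" by simp
        then have "Q ?o = 0" using x_vec[OF I12(2)] by (simp add: mono_o)
        moreover have "Q ?o = of_nat N" using x_vec[OF I12(2)] by (simp add: Q_def sum_fun_apply power_fun_apply)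
        ultimately show False using N(2) by simp
      qed
    qed
    then show ?thesis
    proof
      assume "degree ph = 0"
      then show ?thesis using factor_unit[OF pp(1,2) pgh _ pp(4)] by blast
    next
      assume "degree pg = 0"
      moreover have "p = ph * pg" using pgh by (simp only: mult.commute)
      ultimately show ?thesis using factor_unit[OF pp(2,1) _ _ pp(3)] by blast
    qed
  qed
  have "cls f \<in> primes D\<^sub>0"
  proof (rule D0.irreducible_in_primes)
    show "cls f \<in> carrier D\<^sub>0" using fRH by (simp add: carrier_D0)
    show "cls f \<noteq> \<one>\<^bsub>D\<^sub>0\<^esub>" using cls_eq_one_iff[OF fRel] f_unit by simp
    fix a b assume ab: "a \<in> carrier D\<^sub>0" "b \<in> carrier D\<^sub>0" "cls f = a \<otimes>\<^bsub>D\<^sub>0\<^esub> b"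
    then obtain g h where gh: "g \<in> RelHom" "h \<in> RelHom" "a = cls g" "b = cls h" by (auto simp: carrier_D0)
    then have "cls (g * h) = cls f" using ab by (simp add: D_mult)
    then obtain d where d: "d \<noteq> 0" "f = fun_scale d (g * h)" using cls_eq_iff by metis
    have gR: "g \<in> Rel" "h \<in> Rel" using gh RelHom_Rel by auto
    have "f = g * fun_scale d h" using d(2) by (simp only: fun_scale_simps)
    then have "rdvd R g 1 \<or> rdvd R (fun_scale d h) 1" using irr gR RelR R_scale by blast
    then show "a = \<one>\<^bsub>D\<^sub>0\<^esub> \<or> b = \<one>\<^bsub>D\<^sub>0\<^esub>"
    proof
      assume "rdvd R g 1"
      then show ?thesis using cls_eq_one_iff[OF gR(1)] gh by simp
    next
      assume "rdvd R (fun_scale d h) 1"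
      then have "cls (fun_scale d h) = \<one>\<^bsub>D\<^esub>" using cls_eq_one_iff[OF Rel_scale(1)[OF gR(2) d(1)]] by simp
      moreover have "cls h = cls (fun_scale d h)" using d(1) cls_eq_iff by blast
      ultimately show ?thesis using gh by simp
    qed
  qed
  then show ?thesis using weight_cls[OF fRel] wf by blast
qed

lemma prime_of_weight:
  assumes \<eta>: "\<eta> \<in> carrier Hom\<^sub>0" shows "\<exists>p\<in>primes D\<^sub>0. w p = \<eta>"
proof (cases "n \<ge> 2")
  case False
  then have I: "I = {1}" using n by (auto simp: I_def)
  \<comment> \<open>With a single coordinate \<open>refl_group 1\<close> is the whole group, so
    \<open>Hom\<^sub>0\<close> is trivial and any prime has the required weight.\<close>
  have tr: "\<theta> (\<rho> g) = 1" if "\<theta> \<in> carrier Hom\<^sub>0" "g \<in> carrier G" for \<theta> g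
    using that I by (auto simp: Hom0_iff refl_group_def)
  have "w (coord_prime 1) = \<eta>"
    by (rule K_eqI[OF Hom0_K[OF w_coord_prime_Hom0] Hom0_K[OF \<eta>]]) (simp only: tr[OF w_coord_prime_Hom0] tr[OF \<eta>])
  then show ?thesis using coord_prime_prime[of 1] I by blast
qed (rule prime_of_weight_D0[OF \<eta>])

end

lemma transfer_hom_block_image:
  assumes "comm_monoid A" "\<theta> \<in> transfer_hom H (block_monoid A P)"
  shows "\<theta> ` carrier H = carrier (block_monoid A P)"
proof -
  have "carrier (block_monoid A P) = \<theta> ` carrier H <#>\<^bsub>block_monoid A P\<^esub> {{#}}"
    using assms(2) unfolding transfer_hom_def Units_block_monoid[OF assms(1)] by blast
  then show ?thesis unfolding set_mult_def carrier_block_monoid(2) by simp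
qed

lemma monoid_hom_block_mono:
  assumes "\<theta> \<in> monoid_hom H (block_monoid A P)" "P \<subseteq> Q"
  shows "\<theta> \<in> monoid_hom H (block_monoid A Q)"
proof -
  have "carrier (block_monoid A P) \<subseteq> carrier (block_monoid A Q)"
    using assms(2) by (auto simp: carrier_block_monoid)
  then show ?thesis using assms(1) by (auto simp: monoid_hom_def hom_def carrier_block_monoid(2,3) Pi_def subset_iff)
qed

lemma msprod_char_group:
  assumes "group A" "set_mset S \<subseteq> carrier (char_group A)" "a \<in> carrier A"
  shows "msprod (char_group A) S a = (\<Prod>\<eta>\<in>#S. \<eta> a :: 'f::field)"
proof -
  interpret C: comm_group "char_group A :: (_ \<Rightarrow> 'f) monoid" by (rule comm_group_char_group[OF assms(1)])
  show ?thesis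
    using assms(2)
  proof (induction S)
    case (add \<eta> S)
    then show ?case using assms(3) C.msprod_add_mset[of \<eta> S] by (simp add: char_group_apply(3))
  qed (use assms(3) in \<open>simp add: char_group_apply(4)\<close>)
qed

lemma count_sum_replicate: "finite J \<Longrightarrow> count (\<Sum>i\<in>J. replicate_mset (k i) (h i)) y = (\<Sum>i\<in>J. if h i = y then k i else 0)"
  by (auto simp: count_sum intro!: sum.cong)

lemma prod_mset_count: "finite P \<Longrightarrow> set_mset S \<subseteq> P \<Longrightarrow> (\<Prod>y\<in>#S. f y :: 'f::comm_monoid_mult) = (\<Prod>y\<in>P. f y ^ count S y)"
proof (induction S)
  case (add a S)
  have "(\<Prod>y\<in>P. f y ^ count (add_mset a S) y) = (\<Prod>y\<in>P. (if y = a then f a else 1) * f y ^ count S y)"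
    by (rule prod.cong) auto
  also have "\<dots> = f a * (\<Prod>y\<in>P. f y ^ count S y)"
    using add.prems by (simp add: prod.distrib)
  finally show ?case using add by simp
qed simp

context diagonal_rep
begin

section \<open>The maps of the diagram\<close>

abbreviation CH where "CH \<equiv> class_group D\<^sub>0 H"
abbreviation CM where "CM \<equiv> class_group M\<^sub>0 MGD"
abbreviation wH where "wH \<equiv> weight_class scale G \<rho> D\<^sub>0"
abbreviation wM where "wM \<equiv> weight_class scale G \<rho> M\<^sub>0"
abbreviation C :: "('g \<Rightarrow> 'f) monoid" where "C \<equiv> char_group G"
abbreviation GV where "GV \<equiv> \<chi> ` I"

sublocale C: comm_group C
  by (rule comm_group_char_group[OF G.is_group])

lemma wH_eq: "wH = class_map Hom\<^sub>0 w D\<^sub>0" and wM_eq: "wM = class_map Hom\<^sub>0 w M\<^sub>0"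
  using weight_class_eq D0.w_closed M0.w_closed by blast+

lemma wH_iso: "wH \<in> iso CH Hom\<^sub>0" and wM_iso: "wM \<in> iso CM Hom\<^sub>0"
  unfolding wH_eq wM_eq by (rule D0.class_map_iso M0.class_map_iso)+

lemma class_contains_prime: "c \<in> carrier CH \<Longrightarrow> contains_prime_divisor D\<^sub>0 c"
proof -
  assume c: "c \<in> carrier CH"
  then have "wH c \<in> carrier Hom\<^sub>0" using wH_iso by (auto simp: iso_def hom_def)
  then show ?thesis using D0.contains_prime_divisor_iff[OF c] prime_of_weight wH_eq by metis
qed

lemma class_contains_prime_M0: "GV = carrier C \<Longrightarrow> c \<in> carrier CM \<Longrightarrow> contains_prime_divisor M\<^sub>0 c"
proof -
  assume GV: "GV = carrier C" and c: "c \<in> carrier CM"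
  then have "wM c \<in> carrier Hom\<^sub>0" using wM_iso by (auto simp: iso_def hom_def)
  then show ?thesis using M0.contains_prime_divisor_iff[OF c] prime_of_weight_M0[OF GV] wM_eq by metis
qed

lemma prime_classes_D0: "prime_classes D\<^sub>0 H = carrier CH"
  using class_contains_prime by (auto simp: prime_classes_def)

lemma theta1_transfer: "class_sequence D\<^sub>0 H \<in> transfer_hom H (block_monoid CH (carrier CH))"
  using D0.class_sequence_transfer unfolding prime_classes_D0 .

lemma carrier_MG: "carrier MG = range mono \<inter> Inv"
  using mono_nonzero by (auto simp: MG_mon_def fun_monoid_def carrier_M)

lemma MG_simps [simp]: "mult MG = (*)" "one MG = 1"
  by (simp_all add: MG_mon_def fun_monoid_def)

lemma MG_mult: "a \<in> carrier MG \<Longrightarrow> b \<in> carrier MG \<Longrightarrow> a * b \<in> carrier MG"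
proof -
  assume "a \<in> carrier MG" "b \<in> carrier MG"
  then obtain r s where rs: "a = mono r" "b = mono s" "a \<in> Inv" "b \<in> Inv" by (auto simp: carrier_MG)
  then have ab: "a * b = mono (\<lambda>i. r i + s i)" by (simp only: mono_add)
  have "a * b \<in> Rel" "wt (a * b) = \<one>\<^bsub>K\<^esub>" using rs(3,4) Rel_mult[of a b] Inv_iff by auto
  then have "a * b \<in> Inv" using Inv_iff by blast
  then show ?thesis using ab unfolding carrier_MG by blast
qed

lemma MG_one: "1 \<in> carrier MG"
proof -
  have "1 \<in> Inv" using Inv_iff Rel_one by blast
  moreover have "1 = mono (\<lambda>_. 0)" by (simp only: mono_0)
  ultimately show ?thesis unfolding carrier_MG by blast
qed

lemma cls_MG: "cls ` carrier MG = carrier MGD"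
  by (simp add: carrier_MG carrier_MGD)

text \<open>Comparison of exponents: distinct monomials are never proportional, so nothing is lost
  when monomials are regarded as elements of \<open>D\<close>.\<close>

lemma cls_inj: "inj_on cls (range mono)"
proof (rule inj_onI)
  fix a b assume "a \<in> range mono" "b \<in> range mono" "cls a = cls b"
  then obtain r s c where "a = mono r" "b = mono s" "c \<noteq> 0" "mono s = fun_scale c (mono r)" using cls_eq_iff by blast
  then show "a = b" using mono_eqD[of s c r] mono_cong[of s r] by simp
qed

text \<open>The map starts at monomials as functions; \<open>cls\<close> identifies
  \<open>MG\<close> with \<open>MGD\<close>, injectively by \<open>cls_inj\<close>.\<close>

lemma theta2_transfer:
  "(\<lambda>m. class_sequence M\<^sub>0 MGD (to_D scale G \<rho> m)) \<in> transfer_hom MG (block_monoid CM (prime_classes M\<^sub>0 MGD))"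
proof -
  have clsM: "cls a \<in> carrier M\<^sub>0" if "a \<in> carrier MG" for a
    using that cls_MG M0.carrier_H by blast
  have "(\<lambda>m. image_mset (divisor_class M\<^sub>0 MGD) (factorization M\<^sub>0 (cls m)))
      \<in> transfer_hom MG (block_monoid CM (divisor_class M\<^sub>0 MGD ` primes M\<^sub>0))"
  proof (rule image_mset_transfer_hom[OF M0.comm_group_class_group])
    show "divisor_class M\<^sub>0 MGD \<in> primes M\<^sub>0 \<rightarrow> carrier CM"
      using M0.divisor_class(1) M0.primesD(1) by blast
    show "(\<lambda>m. factorization M\<^sub>0 (cls m)) \<in> monoid_hom MG (free_monoid (primes M\<^sub>0))"
      unfolding monoid_hom_def hom_def
    proof (intro CollectI conjI Pi_I ballI)
      show "factorization M\<^sub>0 (cls a) \<in> carrier (free_monoid (primes M\<^sub>0))" if "a \<in> carrier MG" for a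
        using M0.factorization(1)[OF clsM[OF that]] by simp
      show "factorization M\<^sub>0 (cls (a \<otimes>\<^bsub>MG\<^esub> b)) =
          factorization M\<^sub>0 (cls a) \<otimes>\<^bsub>free_monoid (primes M\<^sub>0)\<^esub> factorization M\<^sub>0 (cls b)"
        if "a \<in> carrier MG" "b \<in> carrier MG" for a b
        using M0.factorization_mult[OF clsM[OF that(1)] clsM[OF that(2)]] by (simp add: D_mult del: times_fun_apply)
      show "factorization M\<^sub>0 (cls \<one>\<^bsub>MG\<^esub>) = \<one>\<^bsub>free_monoid (primes M\<^sub>0)\<^esub>"
        using M0.factorization_one by (simp add: D_one del: one_fun_apply)
    qed
    show "inj_on (\<lambda>m. factorization M\<^sub>0 (cls m)) (carrier MG)"
    proof (rule inj_onI)
      fix a b assume ab: "a \<in> carrier MG" "b \<in> carrier MG" "factorization M\<^sub>0 (cls a) = factorization M\<^sub>0 (cls b)"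
      then have "cls a = cls b" using M0.factorization(2) clsM by metis
      then show "a = b" using cls_inj ab by (auto simp: carrier_MG inj_on_def)
    qed
    show "(\<lambda>m. factorization M\<^sub>0 (cls m)) ` carrier MG = {T. set_mset T \<subseteq> primes M\<^sub>0 \<and>
        msprod CM (image_mset (divisor_class M\<^sub>0 MGD) T) = \<one>\<^bsub>CM\<^esub>}"
      unfolding M0.factorization_image[symmetric] cls_MG[symmetric] image_image ..
  qed (use MG_mult MG_one in \<open>simp_all del: times_fun_apply one_fun_apply\<close>)
  then show ?thesis by (simp add: M0.prime_classes_eq class_sequence_def to_D_eq)
qed

lemma w2_inj:
  "image_mset wM \<in> monoid_hom (block_monoid CM (prime_classes M\<^sub>0 MGD)) (block_monoid Hom\<^sub>0 (carrier Hom\<^sub>0))"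
  "inj_on (image_mset wM) (carrier (block_monoid CM (prime_classes M\<^sub>0 MGD)))"
proof -
  have iso: "image_mset wM \<in> iso (block_monoid CM (carrier CM)) (block_monoid Hom\<^sub>0 (carrier Hom\<^sub>0))"
    by (rule image_mset_block_iso[OF M0.comm_group_class_group A.comm_group_axioms wM_iso])
  have sub: "carrier (block_monoid CM (prime_classes M\<^sub>0 MGD)) \<subseteq> carrier (block_monoid CM (carrier CM))"
    by (auto simp: carrier_block_monoid prime_classes_def)
  show "image_mset wM \<in> monoid_hom (block_monoid CM (prime_classes M\<^sub>0 MGD)) (block_monoid Hom\<^sub>0 (carrier Hom\<^sub>0))"
    using iso sub by (auto simp: monoid_hom_def iso_def hom_def Pi_def subset_iff carrier_block_monoid(2,3))
  show "inj_on (image_mset wM) (carrier (block_monoid CM (prime_classes M\<^sub>0 MGD)))"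
    using iso sub by (auto simp: iso_def bij_betw_def intro: inj_on_subset)
qed

section \<open>The maps psi and nu\<close>

lemma exponents_mono: "exponents n x (mono a) = (\<lambda>i. if i \<in> I then a i else 0)"
  unfolding exponents_def
proof (rule the_equality)
  show "(\<forall>i. i \<notin> {1..n} \<longrightarrow> (if i \<in> I then a i else 0) = 0) \<and> mono a = mono (\<lambda>i. if i \<in> I then a i else 0)"
    using mono_cong[of a "\<lambda>i. if i \<in> I then a i else 0"] by (simp add: I_def)
  fix b assume b: "(\<forall>i. i \<notin> {1..n} \<longrightarrow> b i = 0) \<and> mono a = mono b"
  then have "mono a = fun_scale 1 (mono b)" by (simp add: fun_scale_simps)
  then have "a i = b i" if "i \<in> I" for i by (rule mono_eqD) (use that in auto)
  then show "b = (\<lambda>i. if i \<in> I then a i else 0)" using b by (auto simp: I_def fun_eq_iff)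
qed

lemma psi_mono: "psi n x \<chi> (mono a) = (\<Sum>i\<in>I. replicate_mset (a i) (\<chi> i))"
  unfolding psi_def exponents_mono I_def[symmetric] by (rule sum.cong) auto

lemma psi_subset: "set_mset (psi n x \<chi> (mono a)) \<subseteq> GV"
  unfolding psi_mono by (auto simp: set_mset_sum split: if_splits)

lemma psi_mult: "psi n x \<chi> (mono a * mono b) = psi n x \<chi> (mono a) + psi n x \<chi> (mono b)"
  unfolding mono_add[symmetric] psi_mono sum.distrib[symmetric]
  by (intro sum.cong refl multiset_eqI) simp

lemma psi_one: "psi n x \<chi> 1 = {#}"
  using psi_mono[of "\<lambda>_. 0"] unfolding mono_0 by simp

lemma psi_hom: "psi n x \<chi> \<in> monoid_hom (M_mon n x) (free_monoid GV)"
proof -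
  have m: "mult (M_mon n x) = (*)" "one (M_mon n x) = 1" by (simp_all add: M_mon_def fun_monoid_def)
  show ?thesis
    unfolding monoid_hom_def hom_def m carrier_M using psi_subset psi_mult psi_one by auto
qed

lemma psi_x: "i \<in> I \<Longrightarrow> psi n x \<chi> (x i) = {#\<chi> i#}"
proof -
  assume i: "i \<in> I"
  have "psi n x \<chi> (x i) = (\<Sum>j\<in>I. if j = i then {#\<chi> i#} else {#})"
    using psi_mono[of "single i 1"] unfolding mono_single[OF i] power_one_right
    by (elim ssubst, intro sum.cong refl) auto
  then show ?thesis using i by simp
qed

lemma prod_mset_psi: "(\<Prod>\<eta>\<in>#(\<Sum>i\<in>J. replicate_mset (k i) (\<chi> i)). \<eta> g) = (\<Prod>i\<in>J. \<chi> i g ^ k i)"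
  by (induction J rule: infinite_finite_induct) auto

lemma GV_C: "GV \<subseteq> carrier C"
  using \<chi>_I by blast

lemma psi_block: "psi n x \<chi> \<in> monoid_hom MG (block_monoid C GV)"
proof -
  have "msprod C (psi n x \<chi> (mono a)) = \<one>\<^bsub>C\<^esub>" if "mono a \<in> Inv" for a
  proof (rule char_group_eqI)
    have sub: "set_mset (psi n x \<chi> (mono a)) \<subseteq> carrier C" using psi_subset GV_C by blast
    then show "msprod C (psi n x \<chi> (mono a)) \<in> carrier C" by (rule C.msprod_closed)
    fix g assume g: "g \<in> carrier G"
    have "msprod C (psi n x \<chi> (mono a)) g = (\<Prod>i\<in>I. \<chi> i g ^ a i)"
      unfolding msprod_char_group[OF G.is_group sub g] unfolding psi_mono prod_mset_psi ..
    also have "\<dots> = wt (mono a) (\<rho> g)" by (rule wt_mono(2)[OF g, symmetric])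
    also have "\<dots> = 1" using that Inv_iff K_one[OF g] by simp
    finally show "msprod C (psi n x \<chi> (mono a)) g = \<one>\<^bsub>C\<^esub> g" using g by (simp add: char_group_apply(4))
  qed (rule C.one_closed)
  then show ?thesis
    using psi_subset psi_mult psi_one
    by (auto simp: monoid_hom_def hom_def carrier_MG carrier_block_monoid simp del: times_fun_apply one_fun_apply)
qed

text \<open>Setting the index to one on \<open>chars2\<close> allows both products in
  \<open>nu\<close> to be treated as a single sum over \<open>GV\<close>
  (\<open>nu_eq\<close>).\<close>

definition nu_index :: "('g \<Rightarrow> 'f) \<Rightarrow> nat" where
  "nu_index \<eta> = (if \<eta> \<in> chars1 n \<chi> then e_index G n \<chi> \<eta> else 1)"

definition nu_char :: "('g \<Rightarrow> 'f) \<Rightarrow> ('v \<Rightarrow> 'v) \<Rightarrow> 'f" where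
  "nu_char \<eta> = descend G \<rho> (\<eta> [^]\<^bsub>C\<^esub> nu_index \<eta>)"

text \<open>\<open>nu\<close> is this division of multiplicities followed by relabelling with
  \<open>nu_char\<close>, the shape required by \<open>image_mset_transfer_hom\<close>.\<close>

definition nu_exp :: "('g \<Rightarrow> 'f) multiset \<Rightarrow> ('g \<Rightarrow> 'f) multiset" where
  "nu_exp B = (\<Sum>\<eta>\<in>GV. replicate_mset (count B \<eta> div nu_index \<eta>) \<eta>)"

lemma chars: "chars1 n \<chi> \<union> chars2 n \<chi> = GV" "chars1 n \<chi> \<inter> chars2 n \<chi> = {}"
  by (auto simp: chars1_def chars2_def I_def)

lemma block_refl_trivial:
  assumes B: "B \<in> carrier (block_monoid C GV)" and g: "g \<in> carrier G"
  shows "(\<Prod>\<eta>\<in>GV. \<eta> g ^ count B \<eta>) = 1"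
proof -
  have sub: "set_mset B \<subseteq> GV" and one: "msprod C B = \<one>\<^bsub>C\<^esub>" using B by (auto simp: carrier_block_monoid)
  have subC: "set_mset B \<subseteq> carrier C" using sub GV_C by blast
  have "(\<Prod>\<eta>\<in>GV. \<eta> g ^ count B \<eta>) = (\<Prod>\<eta>\<in>#B. \<eta> g)"
    by (rule prod_mset_count[symmetric]) (use sub in auto)
  also have "\<dots> = msprod C B g" by (rule msprod_char_group[OF G.is_group subC g, symmetric])
  finally show ?thesis using one g by (simp add: char_group_apply(4))
qed

text \<open>The combinatorial index agrees with the one defined by pseudoreflections. If another
  coordinate has the same character, that character is trivial on \<open>refl_group i\<close> and
  both indices are one; otherwise each divides the other.\<close>

lemma nu_index_eq: "i \<in> I \<Longrightarrow> nu_index (\<chi> i) = refl_exp i"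
proof (cases "\<chi> i \<in> chars1 n \<chi>")
  case False
  assume i: "i \<in> I"
  then have "\<chi> i \<in> chars2 n \<chi>" using chars(1) False by blast
  then obtain k l where "k \<in> I" "l \<in> I" "l \<noteq> k" "\<chi> i = \<chi> k" "\<chi> k = \<chi> l"
    unfolding chars2_def I_def[symmetric] by blast
  then obtain j where j: "j \<in> I" "j \<noteq> i" "\<chi> i = \<chi> j" by metis
  then have "\<forall>g\<in>refl_group i. \<chi> i g ^ 1 = 1" by (auto simp: refl_group_def)
  then show ?thesis using refl_exp_dvd_iff[OF i, of 1] False by (simp add: nu_index_def)
next
  case True
  assume i: "i \<in> I"
  have uniq: "j = i" if "j \<in> I" "\<chi> j = \<chi> i" for j
  proof (rule ccontr)
    assume "j \<noteq> i"
    then have "i \<in> I \<and> (\<exists>j\<in>I. j \<noteq> i \<and> \<chi> i = \<chi> j)"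
      using i that by (intro conjI bexI[of _ j]) simp_all
    then have "\<chi> i \<in> chars2 n \<chi>" unfolding chars2_def I_def[symmetric] by blast
    then show False using True chars(2) by blast
  qed
  let ?S = "(\<lambda>B. count B (\<chi> i)) ` carrier (block_monoid C GV)"
  have "refl_exp i dvd Gcd ?S"
  proof (rule Gcd_greatest)
    fix k assume "k \<in> ?S"
    then obtain B where B: "B \<in> carrier (block_monoid C GV)" "k = count B (\<chi> i)" by blast
    \<comment> \<open>On \<open>refl_group i\<close> all other characters in \<open>GV\<close> are
      trivial, so in a product-one sequence the power of \<open>\<chi> i\<close> has to be trivial
      there by itself.\<close>
    have "\<chi> i g ^ k = 1" if g: "g \<in> refl_group i" for g
    proof -
      have "(\<Prod>\<eta>\<in>GV. \<eta> g ^ count B \<eta>) = \<chi> i g ^ k * (\<Prod>\<eta>\<in>GV - {\<chi> i}. \<eta> g ^ count B \<eta>)"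
        unfolding B(2) by (rule prod.remove) (use i in auto)
      also have "(\<Prod>\<eta>\<in>GV - {\<chi> i}. \<eta> g ^ count B \<eta>) = 1"
      proof (rule prod.neutral, rule ballI)
        fix \<eta> assume "\<eta> \<in> GV - {\<chi> i}"
        then obtain j where j: "j \<in> I" "\<eta> = \<chi> j" "j \<noteq> i" by blast
        then have "\<eta> g = 1" using g by (simp add: refl_group_def)
        then show "\<eta> g ^ count B \<eta> = 1" by simp
      qed
      finally show ?thesis using block_refl_trivial[OF B(1) refl_groupD[OF g]] by simp
    qed
    then show "refl_exp i dvd k" using refl_exp_dvd_iff[OF i] by blast
  qed
  moreover have "Gcd ?S dvd refl_exp i"
  proof -
    \<comment> \<open>An invariant product of \<open>x i ^ refl_exp i\<close> with a monomial free
      of \<open>x i\<close> yields a product-one sequence in which \<open>\<chi> i\<close> occurs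
      exactly \<open>refl_exp i\<close> times.\<close>
    obtain b where b: "b i i = 0" "mono (single i (refl_exp i)) * mono (b i) \<in> Inv"
      using mono_weight_inv_ex[OF coord_prime_RelHom[of i]] i by blast
    let ?m = "mono (\<lambda>j. single i (refl_exp i) j + b i j)"
    have "?m \<in> Inv" unfolding mono_add by (rule b(2))
    then have "psi n x \<chi> ?m \<in> carrier (block_monoid C GV)"
      using psi_block unfolding monoid_hom_def hom_def carrier_MG by blast
    then have "count (psi n x \<chi> ?m) (\<chi> i) \<in> ?S" by blast
    moreover have "count (psi n x \<chi> ?m) (\<chi> i) = refl_exp i"
    proof -
      have "count (psi n x \<chi> ?m) (\<chi> i) = (\<Sum>j\<in>I. if j = i then refl_exp i else 0)"
        unfolding psi_mono count_sum_replicate[OF finite_I] by (rule sum.cong) (use uniq b(1) in auto)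
      then show ?thesis using i by simp
    qed
    ultimately show ?thesis by (metis Gcd_dvd)
  qed
  ultimately have "Gcd ?S = refl_exp i" by (rule dvd_antisym[rotated])
  then show ?thesis using True by (simp add: nu_index_def e_index_def I_def)
qed

lemma nu_char_eq: "i \<in> I \<Longrightarrow> nu_char (\<chi> i) = w (coord_prime i)"
proof -
  assume i: "i \<in> I"
  have pow: "(\<chi> i [^]\<^bsub>C\<^esub> nu_index (\<chi> i)) g = \<chi> i g ^ refl_exp i" if "g \<in> carrier G" for g
    using char_group_pow[OF G.is_group \<chi>_I[OF i] that] nu_index_eq[OF i] by simp
  have wK: "w (coord_prime i) \<in> carrier K" by (rule Hom0_K[OF w_coord_prime_Hom0])
  show ?thesis
  proof (rule extensionalityI[of _ "\<rho> ` carrier G"])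
    show "nu_char (\<chi> i) \<in> extensional (\<rho> ` carrier G)" by (simp add: nu_char_def descend_def)
    show "w (coord_prime i) \<in> extensional (\<rho> ` carrier G)" using wK by (simp add: char_group_def)
    fix t assume t: "t \<in> \<rho> ` carrier G"
    let ?g = "inv_into (carrier G) \<rho> t"
    have g: "?g \<in> carrier G" "\<rho> ?g = t" using t by (auto simp: inv_into_into f_inv_into_f)
    have "nu_char (\<chi> i) t = \<chi> i ?g ^ refl_exp i" using t pow[OF g(1)] by (simp add: nu_char_def descend_def)
    also have "\<dots> = w (coord_prime i) t" using w_coord_prime[OF i g(1)] g(2) by simp
    finally show "nu_char (\<chi> i) t = w (coord_prime i) t" .
  qed
qed

lemma nu_char_Hom0: "\<eta> \<in> GV \<Longrightarrow> nu_char \<eta> \<in> carrier Hom\<^sub>0"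
  using nu_char_eq w_coord_prime_Hom0 by auto

lemma nu_char_apply: "\<eta> \<in> GV \<Longrightarrow> g \<in> carrier G \<Longrightarrow> nu_char \<eta> (\<rho> g) = \<eta> g ^ nu_index \<eta>"
  using nu_char_eq w_coord_prime nu_index_eq by auto

lemma nu_eq: "nu G \<rho> n \<chi> B = image_mset nu_char (nu_exp B)"
proof -
  have fin: "finite (chars1 n \<chi>)" "finite (chars2 n \<chi>)"
    using finite_subset[of _ GV] chars(1) by auto
  have im: "image_mset nu_char (\<Sum>\<eta>\<in>Y. replicate_mset (k \<eta>) \<eta>) = (\<Sum>\<eta>\<in>Y. replicate_mset (k \<eta>) (nu_char \<eta>))" for Y k
    by (induction Y rule: infinite_finite_induct) auto
  have "nu_exp B = (\<Sum>\<eta>\<in>chars1 n \<chi>. replicate_mset (count B \<eta> div nu_index \<eta>) \<eta>) + (\<Sum>\<eta>\<in>chars2 n \<chi>. replicate_mset (count B \<eta> div nu_index \<eta>) \<eta>)"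
    unfolding nu_exp_def chars(1)[symmetric] by (rule sum.union_disjoint[OF fin chars(2)])
  moreover have "(\<Sum>\<eta>\<in>chars1 n \<chi>. replicate_mset (count B \<eta> div nu_index \<eta>) (nu_char \<eta>)) =
     (\<Sum>\<eta>\<in>chars1 n \<chi>. replicate_mset (count B \<eta> div e_index G n \<chi> \<eta>) (descend G \<rho> (\<eta> [^]\<^bsub>C\<^esub> e_index G n \<chi> \<eta>)))"
    by (rule sum.cong) (auto simp: nu_char_def nu_index_def)
  moreover have "(\<Sum>\<eta>\<in>chars2 n \<chi>. replicate_mset (count B \<eta> div nu_index \<eta>) (nu_char \<eta>)) =
     (\<Sum>\<eta>\<in>chars2 n \<chi>. replicate_mset (count B \<eta>) (descend G \<rho> \<eta>))"
  proof (rule sum.cong)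
    fix \<eta> assume \<eta>: "\<eta> \<in> chars2 n \<chi>"
    then have e1: "nu_index \<eta> = 1" using chars(2) by (auto simp: nu_index_def)
    have "\<eta> \<in> carrier C" using \<eta> chars(1) GV_C by blast
    then have "\<eta> [^]\<^bsub>C\<^esub> (1::nat) = \<eta>" by simp
    then show "replicate_mset (count B \<eta> div nu_index \<eta>) (nu_char \<eta>) = replicate_mset (count B \<eta>) (descend G \<rho> \<eta>)"
      unfolding nu_char_def e1 by simp
  qed simp
  ultimately show ?thesis by (simp add: nu_def im)
qed

lemma nu_support_eq: "nu_support G \<rho> n \<chi> = nu_char ` GV"
proof -
  have "(\<lambda>\<eta>. descend G \<rho> (\<eta> [^]\<^bsub>C\<^esub> e_index G n \<chi> \<eta>)) ` chars1 n \<chi> = nu_char ` chars1 n \<chi>"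
    by (rule image_cong) (auto simp: nu_char_def nu_index_def)
  moreover have "descend G \<rho> ` chars2 n \<chi> = nu_char ` chars2 n \<chi>"
  proof (rule image_cong)
    fix \<eta> assume \<eta>: "\<eta> \<in> chars2 n \<chi>"
    then have e1: "nu_index \<eta> = 1" using chars(2) by (auto simp: nu_index_def)
    have "\<eta> \<in> carrier C" using \<eta> chars(1) GV_C by blast
    then have "\<eta> [^]\<^bsub>C\<^esub> (1::nat) = \<eta>" by simp
    then show "descend G \<rho> \<eta> = nu_char \<eta>" unfolding nu_char_def e1 by simp
  qed simp
  ultimately show ?thesis unfolding nu_support_def chars(1)[symmetric] image_Un by simp
qed

lemma count_nu_exp: "count (nu_exp B) \<eta> = (if \<eta> \<in> GV then count B \<eta> div nu_index \<eta> else 0)"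
  unfolding nu_exp_def by (subst count_sum_replicate) auto

lemma nu_index_dvd:
  assumes "B \<in> carrier (block_monoid C GV)" "\<eta> \<in> GV" shows "nu_index \<eta> dvd count B \<eta>"
proof (cases "\<eta> \<in> chars1 n \<chi>")
  case True
  then show ?thesis using assms(1) unfolding nu_index_def e_index_def I_def[symmetric] by (auto intro: Gcd_dvd)
qed (simp add: nu_index_def)

lemma nu_index_pos: "\<eta> \<in> GV \<Longrightarrow> nu_index \<eta> > 0"
  using nu_index_eq refl_exp_props(1) by auto

lemma msprod_Hom0_apply:
  assumes "set_mset S \<subseteq> carrier Hom\<^sub>0" "g \<in> carrier G"
  shows "msprod Hom\<^sub>0 S (\<rho> g) = (\<Prod>\<theta>\<in>#S. \<theta> (\<rho> g))"
  using assms(1)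
proof (induction S)
  case empty
  then show ?case using A.msprod_empty K_one[OF assms(2)] by simp
next
  case (add a S)
  then have "msprod Hom\<^sub>0 (add_mset a S) = a \<otimes>\<^bsub>K\<^esub> msprod Hom\<^sub>0 S" using A.msprod_add_mset[of a S] by simp
  then show ?case using add K_mult[OF assms(2)] by simp
qed

lemma msprod_nu_char:
  assumes T: "set_mset T \<subseteq> GV" and g: "g \<in> carrier G"
  shows "msprod Hom\<^sub>0 (image_mset nu_char T) (\<rho> g) = (\<Prod>\<eta>\<in>GV. \<eta> g ^ (nu_index \<eta> * count T \<eta>))"
proof -
  have "msprod Hom\<^sub>0 (image_mset nu_char T) (\<rho> g) = (\<Prod>\<eta>\<in>#T. nu_char \<eta> (\<rho> g))"
    using T nu_char_Hom0 by (subst msprod_Hom0_apply[OF _ g]) (auto simp: image_mset.compositionality comp_def)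
  also have "\<dots> = (\<Prod>\<eta>\<in>GV. nu_char \<eta> (\<rho> g) ^ count T \<eta>)"
    by (rule prod_mset_count) (use T in auto)
  also have "\<dots> = (\<Prod>\<eta>\<in>GV. \<eta> g ^ (nu_index \<eta> * count T \<eta>))"
    by (rule prod.cong) (auto simp: nu_char_apply[OF _ g] power_mult)
  finally show ?thesis .
qed

lemma nu_exp_count: "B \<in> carrier (block_monoid C GV) \<Longrightarrow> \<eta> \<in> GV \<Longrightarrow> nu_index \<eta> * count (nu_exp B) \<eta> = count B \<eta>"
  using nu_index_dvd by (simp add: count_nu_exp)

text \<open>On product-one sequences the division of multiplicities by \<open>nu_index\<close> is
  exact, hence additive. Raising the characters to the same indices compensates for it, so having
  product one is preserved in both directions.\<close>

lemma nu_transfer: "nu G \<rho> n \<chi> \<in> transfer_hom (block_monoid C GV) (block_monoid Hom\<^sub>0 (nu_support G \<rho> n \<chi>))"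
proof -
  have sub: "set_mset (nu_exp B) \<subseteq> GV" for B
    unfolding nu_exp_def by (auto simp: set_mset_sum split: if_splits)
  have "(\<lambda>B. image_mset nu_char (nu_exp B)) \<in> transfer_hom (block_monoid C GV) (block_monoid Hom\<^sub>0 (nu_char ` GV))"
  proof (rule image_mset_transfer_hom[OF A.comm_group_axioms])
    show "nu_char \<in> GV \<rightarrow> carrier Hom\<^sub>0" using nu_char_Hom0 by blast
    show "nu_exp \<in> monoid_hom (block_monoid C GV) (free_monoid GV)"
    proof -
      have "nu_exp (B + B') = nu_exp B + nu_exp B'"
        if "B \<in> carrier (block_monoid C GV)" "B' \<in> carrier (block_monoid C GV)" for B B'
        by (rule multiset_eqI) (use nu_index_dvd[OF that(1)] in \<open>simp add: count_nu_exp div_plus_div_distrib_dvd_left\<close>)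
      moreover have "nu_exp {#} = {#}" by (rule multiset_eqI) (simp add: count_nu_exp)
      ultimately show ?thesis using sub by (simp add: monoid_hom_def hom_def carrier_block_monoid(2,3))
    qed
    show "inj_on nu_exp (carrier (block_monoid C GV))"
    proof (rule inj_onI, rule multiset_eqI)
      fix B B' \<eta> assume B: "B \<in> carrier (block_monoid C GV)" "B' \<in> carrier (block_monoid C GV)" "nu_exp B = nu_exp B'"
      show "count B \<eta> = count B' \<eta>"
      proof (cases "\<eta> \<in> GV")
        case True
        then show ?thesis using nu_exp_count[OF B(1)] nu_exp_count[OF B(2)] B(3) by metis
      next
        case False
        then have "\<eta> \<notin># B" "\<eta> \<notin># B'" using B by (auto simp: carrier_block_monoid)
        then show ?thesis by (simp add: not_in_iff)
      qed
    qed
    show "nu_exp ` carrier (block_monoid C GV) =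
        {T. set_mset T \<subseteq> GV \<and> msprod Hom\<^sub>0 (image_mset nu_char T) = \<one>\<^bsub>Hom\<^sub>0\<^esub>}" (is "_ = ?R")
    proof
      show "nu_exp ` carrier (block_monoid C GV) \<subseteq> ?R"
      proof
        fix T assume "T \<in> nu_exp ` carrier (block_monoid C GV)"
        then obtain B where B: "B \<in> carrier (block_monoid C GV)" "T = nu_exp B" by blast
        have T: "set_mset T \<subseteq> GV" using sub B(2) by simp
        have "msprod Hom\<^sub>0 (image_mset nu_char T) = \<one>\<^bsub>K\<^esub>"
        proof (rule K_eqI[OF Hom0_K K.one_closed])
          show "msprod Hom\<^sub>0 (image_mset nu_char T) \<in> carrier Hom\<^sub>0"
            using T nu_char_Hom0 by (intro A.msprod_closed) auto
          fix g assume g: "g \<in> carrier G"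
          have "msprod Hom\<^sub>0 (image_mset nu_char T) (\<rho> g) = (\<Prod>\<eta>\<in>GV. \<eta> g ^ count B \<eta>)"
            unfolding msprod_nu_char[OF T g] unfolding B(2) by (rule prod.cong) (use nu_exp_count[OF B(1)] in auto)
          then show "msprod Hom\<^sub>0 (image_mset nu_char T) (\<rho> g) = \<one>\<^bsub>K\<^esub> (\<rho> g)"
            using block_refl_trivial[OF B(1) g] K_one[OF g] by simp
        qed
        then show "T \<in> ?R" using T by simp
      qed
      show "?R \<subseteq> nu_exp ` carrier (block_monoid C GV)"
      proof
        fix T assume "T \<in> ?R"
        then have T: "set_mset T \<subseteq> GV" "msprod Hom\<^sub>0 (image_mset nu_char T) = \<one>\<^bsub>K\<^esub>" by auto
        \<comment> \<open>The inverse of \<open>nu_exp\<close>: every multiplicity is multiplied by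
          its index, and evaluation on \<open>G\<close> shows that the product is still
          trivial.\<close>
        define B where "B = (\<Sum>\<eta>\<in>GV. replicate_mset (nu_index \<eta> * count T \<eta>) \<eta>)"
        have cB: "count B \<eta> = (if \<eta> \<in> GV then nu_index \<eta> * count T \<eta> else 0)" for \<eta>
          unfolding B_def by (subst count_sum_replicate) auto
        have BG: "set_mset B \<subseteq> GV" unfolding B_def by (auto simp: set_mset_sum split: if_splits)
        then have BC: "set_mset B \<subseteq> carrier C" using GV_C by blast
        have "msprod C B = \<one>\<^bsub>C\<^esub>"
        proof (rule char_group_eqI[OF C.msprod_closed[OF BC] C.one_closed])
          fix g assume g: "g \<in> carrier G"
          have "msprod C B g = (\<Prod>\<eta>\<in>GV. \<eta> g ^ count B \<eta>)"
            unfolding msprod_char_group[OF G.is_group BC g] by (rule prod_mset_count) (use BG in auto)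
          also have "\<dots> = (\<Prod>\<eta>\<in>GV. \<eta> g ^ (nu_index \<eta> * count T \<eta>))" by (rule prod.cong) (auto simp: cB)
          also have "\<dots> = \<one>\<^bsub>K\<^esub> (\<rho> g)" using msprod_nu_char[OF T(1) g] T(2) by simp
          finally show "msprod C B g = \<one>\<^bsub>C\<^esub> g" using g K_one by (simp add: char_group_apply(4))
        qed
        then have "B \<in> carrier (block_monoid C GV)" using BG by (simp add: carrier_block_monoid)
        moreover have "T = nu_exp B"
        proof (rule multiset_eqI)
          fix \<eta>
          show "count T \<eta> = count (nu_exp B) \<eta>"
          proof (cases "\<eta> \<in> GV")
            case True
            then show ?thesis using nu_index_pos[OF True] by (simp add: count_nu_exp cB)
          next
            case False
            then have "\<eta> \<notin># T" using T(1) by blast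
            then show ?thesis using False by (simp add: count_nu_exp not_in_iff)
          qed
        qed
        ultimately show "T \<in> nu_exp ` carrier (block_monoid C GV)" by (rule image_eqI[rotated])
      qed
    qed
    have BC: "set_mset S \<subseteq> carrier C" if "S \<in> carrier (block_monoid C GV)" for S
      using that GV_C by (auto simp: carrier_block_monoid)
    show "S \<otimes>\<^bsub>block_monoid C GV\<^esub> T \<in> carrier (block_monoid C GV)"
      if "S \<in> carrier (block_monoid C GV)" "T \<in> carrier (block_monoid C GV)" for S T
      using that C.msprod_union[OF BC BC] by (simp add: carrier_block_monoid)
  qed (simp_all add: carrier_block_monoid C.msprod_empty)
  then show ?thesis unfolding nu_support_eq nu_eq[abs_def] .
qed

lemma nu_image: "nu G \<rho> n \<chi> ` carrier (block_monoid C GV) = carrier (block_monoid Hom\<^sub>0 (nu_support G \<rho> n \<chi>))"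
  by (rule transfer_hom_block_image[OF A.comm_monoid_axioms nu_transfer])

lemma nu_hom: "nu G \<rho> n \<chi> \<in> monoid_hom (block_monoid C GV) (block_monoid Hom\<^sub>0 (carrier Hom\<^sub>0))"
proof (rule monoid_hom_block_mono)
  show "nu G \<rho> n \<chi> \<in> monoid_hom (block_monoid C GV) (block_monoid Hom\<^sub>0 (nu_support G \<rho> n \<chi>))"
    using nu_transfer by (simp add: transfer_hom_def)
  show "nu_support G \<rho> n \<chi> \<subseteq> carrier Hom\<^sub>0" using nu_char_Hom0 unfolding nu_support_eq by blast
qed

text \<open>On both sides coordinate \<open>i\<close> contributes \<open>a i div refl_exp i\<close>
  copies of the weight of \<open>x i ^ refl_exp i\<close>. Where several coordinates share a
  character their exponents add up, and the division stays exact.\<close>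

lemma nu_psi:
  assumes "mono a \<in> RelHom"
  shows "nu G \<rho> n \<chi> (psi n x \<chi> (mono a)) = image_mset w (factorization D\<^sub>0 (cls (mono a)))"
proof -
  have "nu_exp (psi n x \<chi> (mono a)) = (\<Sum>i\<in>I. replicate_mset (a i div refl_exp i) (\<chi> i))"
  proof (rule multiset_eqI)
    fix \<eta>
    have c: "count (psi n x \<chi> (mono a)) \<eta> = (\<Sum>i\<in>I. if \<chi> i = \<eta> then a i else 0)"
      unfolding psi_mono by (rule count_sum_replicate[OF finite_I])
    have d: "count (\<Sum>i\<in>I. replicate_mset (a i div refl_exp i) (\<chi> i)) \<eta> = (\<Sum>i\<in>I. if \<chi> i = \<eta> then a i div refl_exp i else 0)"
      by (rule count_sum_replicate[OF finite_I])
    show "count (nu_exp (psi n x \<chi> (mono a))) \<eta> = count (\<Sum>i\<in>I. replicate_mset (a i div refl_exp i) (\<chi> i)) \<eta>"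
    proof (cases "\<eta> \<in> GV")
      case True
      have "(\<Sum>i\<in>I. if \<chi> i = \<eta> then a i else 0) = (\<Sum>i\<in>I. nu_index \<eta> * (if \<chi> i = \<eta> then a i div refl_exp i else 0))"
        by (rule sum.cong) (use nu_index_eq assms mono_RelHom_iff in auto)
      also have "\<dots> = nu_index \<eta> * (\<Sum>i\<in>I. if \<chi> i = \<eta> then a i div refl_exp i else 0)" by (simp add: sum_distrib_left)
      finally show ?thesis using True nu_index_pos[OF True] unfolding count_nu_exp c d by simp
    next
      case False
      then have "(\<Sum>i\<in>I. if \<chi> i = \<eta> then a i div refl_exp i else 0) = 0" by (intro sum.neutral) auto
      then show ?thesis using False unfolding count_nu_exp d by simp
    qed
  qed
  moreover have "image_mset h (\<Sum>i\<in>I. replicate_mset (k i) (y i)) = (\<Sum>i\<in>I. replicate_mset (k i) (h (y i)))" for h k y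
    using finite_I by induction auto
  ultimately have "nu G \<rho> n \<chi> (psi n x \<chi> (mono a)) = (\<Sum>i\<in>I. replicate_mset (a i div refl_exp i) (nu_char (\<chi> i)))"
    "image_mset w (factorization D\<^sub>0 (cls (mono a))) = (\<Sum>i\<in>I. replicate_mset (a i div refl_exp i) (w (coord_prime i)))"
    unfolding nu_eq factorization_mono[OF assms] by simp_all
  then show ?thesis using nu_char_eq by simp
qed

text \<open>\<open>class_map\<close> sends the class of a prime to its weight, so both outer paths
  give the weights of the prime factors. The factorizations in \<open>D\<^sub>0\<close> and
  \<open>M\<^sub>0\<close> agree by \<open>factorization_M0\<close>, and \<open>nu_psi\<close>
  computes the middle path.\<close>

lemma diagram:
  assumes m: "m \<in> carrier MG"
  shows "image_mset wH (class_sequence D\<^sub>0 H (to_H scale G \<rho> m)) = nu G \<rho> n \<chi> (psi n x \<chi> m)"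
    "nu G \<rho> n \<chi> (psi n x \<chi> m) = image_mset wM (class_sequence M\<^sub>0 MGD (to_D scale G \<rho> m))"
proof -
  obtain a where a: "m = mono a" "m \<in> Inv" using m by (auto simp: carrier_MG)
  have RelHom: "mono a \<in> RelHom" using Inv_RelHom a by simp
  have M: "cls (mono a) \<in> carrier M\<^sub>0" unfolding carrier_M0 using RelHom by blast
  have DD: "cls (mono a) \<in> carrier D\<^sub>0" using DC.SE[OF M] .
  note nu = nu_psi[OF RelHom]
  have "image_mset wH (class_sequence D\<^sub>0 H (cls (mono a))) = image_mset w (factorization D\<^sub>0 (cls (mono a)))"
    unfolding class_sequence_def image_mset.compositionality comp_def wH_eq
    by (rule image_mset_cong) (use D0.factorization(1)[OF DD] D0.divisor_class(2) D0.primesD(1) in blast)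
  then show "image_mset wH (class_sequence D\<^sub>0 H (to_H scale G \<rho> m)) = nu G \<rho> n \<chi> (psi n x \<chi> m)"
    unfolding to_H_eq a(1) nu .
  have "image_mset wM (class_sequence M\<^sub>0 MGD (cls (mono a))) = image_mset w (factorization M\<^sub>0 (cls (mono a)))"
    unfolding class_sequence_def image_mset.compositionality comp_def wM_eq
    by (rule image_mset_cong) (use M0.factorization(1)[OF M] M0.divisor_class(2) M0.primesD(1) in blast)
  then show "nu G \<rho> n \<chi> (psi n x \<chi> m) = image_mset wM (class_sequence M\<^sub>0 MGD (to_D scale G \<rho> m))"
    unfolding to_D_eq a(1) nu factorization_M0[OF M] by simp
qed

lemma iota: "to_H scale G \<rho> \<in> monoid_hom MG H" "inj_on (to_H scale G \<rho>) (carrier MG)"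
proof -
  show "to_H scale G \<rho> \<in> monoid_hom MG H"
    by (auto simp: monoid_hom_def hom_def to_H_eq carrier_H carrier_MG H_mult H_one simp del: times_fun_apply one_fun_apply)
  show "inj_on (to_H scale G \<rho>) (carrier MG)"
  proof -
    have "to_H scale G \<rho> = cls" by (rule ext) (rule to_H_eq)
    moreover have "carrier MG \<subseteq> range mono" unfolding carrier_MG by blast
    ultimately show ?thesis using inj_on_subset[OF cls_inj] by metis
  qed
qed

end

theorem proposition4p9:
  fixes G :: "('g, 'm) monoid_scheme"
    and scale :: "'f::alg_closed_field \<Rightarrow> 'v::ab_group_add \<Rightarrow> 'v"
    and \<rho> :: "'g \<Rightarrow> 'v \<Rightarrow> 'v"
    and n :: nat
    and x :: "nat \<Rightarrow> 'v \<Rightarrow> 'f"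
    and \<chi> :: "nat \<Rightarrow> 'g \<Rightarrow> 'f"
  defines "H \<equiv> H_mon scale G \<rho>"
    and "D\<^sub>0 \<equiv> D0_mon scale G \<rho>"
    and "M \<equiv> M_mon n x"
    and "MG \<equiv> MG_mon scale G \<rho> n x"
    and "M\<^sub>0 \<equiv> M0_mon scale G \<rho> n x"
    and "MGD \<equiv> MGD_mon scale G \<rho> n x"
    and "Hom\<^sub>0 \<equiv> Hom0 scale G \<rho>"
    and "GV \<equiv> \<chi> ` {1..n}"
  defines "CH \<equiv> class_group D\<^sub>0 H"
    and "CM \<equiv> class_group M\<^sub>0 MGD"
    and "CMstar \<equiv> prime_classes M\<^sub>0 MGD"
    and "wH \<equiv> weight_class scale G \<rho> D\<^sub>0"
    and "wM \<equiv> weight_class scale G \<rho> M\<^sub>0"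
  defines "\<iota> \<equiv> to_H scale G \<rho>"
    and "\<theta>\<^sub>1 \<equiv> class_sequence D\<^sub>0 H"
    and "\<theta>\<^sub>2 \<equiv> \<lambda>m. class_sequence M\<^sub>0 MGD (to_D scale G \<rho> m)"
    and "w\<^sub>1 \<equiv> image_mset wH"
    and "w\<^sub>2 \<equiv> image_mset wM"
    and "\<psi> \<equiv> psi n x \<chi>"
    and "\<nu> \<equiv> nu G \<rho> n \<chi>"
  assumes G: "comm_group G" "finite (carrier G)"
    and char: "\<not> CHAR('f) dvd order G"
    and V: "vector_space scale" "\<exists>B. finite B \<and> module.span scale B = UNIV"
    and \<rho>: "\<rho> \<in> hom G (GL scale)"
    and n: "n \<ge> 1"
    and basis: "inj_on x {1..n}" "\<not> module.dependent fun_scale (x ` {1..n})"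
      "module.span fun_scale (x ` {1..n}) = dual_space scale"
    and \<chi>: "\<And>i. i \<in> {1..n} \<Longrightarrow> \<chi> i \<in> carrier (char_group G)"
    and weights: "\<And>i g. i \<in> {1..n} \<Longrightarrow> g \<in> carrier G \<Longrightarrow> act G \<rho> g (x i) = fun_scale (\<chi> i g) (x i)"
  shows
    "(divisor_theory_embedding H D\<^sub>0 \<and> divisor_theory_embedding MGD M\<^sub>0 \<and>
      wH \<in> iso CH Hom\<^sub>0 \<and> wM \<in> iso CM Hom\<^sub>0) \<and>
     (\<forall>c \<in> carrier CH. contains_prime_divisor D\<^sub>0 c) \<and>
     (\<theta>\<^sub>1 \<in> transfer_hom H (block_monoid CH (carrier CH)) \<and>
      w\<^sub>1 \<in> iso (block_monoid CH (carrier CH)) (block_monoid Hom\<^sub>0 (carrier Hom\<^sub>0)) \<and>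
      \<theta>\<^sub>2 \<in> transfer_hom MG (block_monoid CM CMstar) \<and>
      w\<^sub>2 \<in> monoid_hom (block_monoid CM CMstar) (block_monoid Hom\<^sub>0 (carrier Hom\<^sub>0)) \<and>
      inj_on w\<^sub>2 (carrier (block_monoid CM CMstar)) \<and>
      \<psi> \<in> monoid_hom M (free_monoid GV) \<and> (\<forall>i \<in> {1..n}. \<psi> (x i) = {#\<chi> i#}) \<and>
      \<psi> \<in> monoid_hom MG (block_monoid (char_group G) GV) \<and>
      \<nu> \<in> monoid_hom (block_monoid (char_group G) GV) (block_monoid Hom\<^sub>0 (carrier Hom\<^sub>0)) \<and>
      \<nu> ` carrier (block_monoid (char_group G) GV)
        = carrier (block_monoid Hom\<^sub>0 (nu_support G \<rho> n \<chi>)) \<and>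
      \<nu> \<in> transfer_hom (block_monoid (char_group G) GV) (block_monoid Hom\<^sub>0 (nu_support G \<rho> n \<chi>)) \<and>
      \<iota> \<in> monoid_hom MG H \<and> inj_on \<iota> (carrier MG) \<and>
      (\<forall>m \<in> carrier MG. w\<^sub>1 (\<theta>\<^sub>1 (\<iota> m)) = \<nu> (\<psi> m) \<and> \<nu> (\<psi> m) = w\<^sub>2 (\<theta>\<^sub>2 m))) \<and>
     (GV = carrier (char_group G) \<longrightarrow> (\<forall>c \<in> carrier CM. contains_prime_divisor M\<^sub>0 c))"
proof -
  interpret diagonal_rep G scale \<rho> n x \<chi>
    by (rule diagonal_rep.intro[OF G char V \<rho> n basis \<chi> weights])
  have "w\<^sub>1 \<in> iso (block_monoid CH (carrier CH)) (block_monoid Hom\<^sub>0 (carrier Hom\<^sub>0))"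
    unfolding assms(1-21)
    by (rule image_mset_block_iso[OF D0.comm_group_class_group A.comm_group_axioms wH_iso])
  then show ?thesis
    unfolding assms(1-21) I_def[symmetric]
    using divisor_theory_H divisor_theory_MGD wH_iso wM_iso class_contains_prime theta1_transfer theta2_transfer
      w2_inj psi_hom psi_x psi_block nu_hom nu_image nu_transfer iota diagram class_contains_prime_M0
    by (intro conjI ballI impI) simp_all
qed

end
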